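(* Let $\Gamma=(X,\mathcal E)$ be the Biggs-Smith graph (the distance-regular graph with $102$ vertices and intersection array $\{3,2,2,2,1,1,1;1,1,1,1,1,1,3\}$). The spectrum of its adjacency matrix $A$ is $3^1\left(\frac{1+\sqrt{17}}2\right)^92^{18}(\theta_1)^{16}0^{17}(\theta_2)^{16}\left(\frac{1-\sqrt{17}}2\right)^9(\theta_3)^{16}$, where $\theta_1=2\cos(\pi/9)-1\approx0.879$, $\theta_2=2\cos(13\pi/9)-1\approx-1.347$, $\theta_3=2\cos(7\pi/9)-1\approx-2.532$ are the roots of $\theta^3+3\theta^2-3$. Let $x\in X$ and $T=T(x)$. With the vertices within each $\Gamma_i(x)$ suitably ordered (one ordering for all the vectors listed), the standard module $V=\mathbb C^X$ is an orthogonal direct sum of irreducible $T$-modules $V=W_0\oplus W_{1,a}\oplus W_{1,b}\oplus W_{2,a}\oplus W_{2,b}\oplus W_{2,c}\oplus W_{3,a}\oplus W_{3,b}\oplus W_{3,c}\oplus W_4$, where two summands are isomorphic if and only if they have the same type in the following list, and the data are as listed. Each listed basis is a pure basis of the module. For each summand other than $W_0$, the seed vector $\nu$ spans $E_r^*W$ (so $\dim E_r^*W=1$), where $r$ is the endpoint of the summand $W$, and is given by its essential part. Type I ($W_0$): endpoint 0, multiplicity 1, dimension 8, diameter 7, shape $(1,1,1,1,1,1,1,1)$; basis $e_0^*,\dots,e_7^*$; matrix representing $A$: $$\begin{pmatrix}0&3&0&0&0&0&0&0\\1&0&2&0&0&0&0&0\\0&1&0&2&0&0&0&0\\0&0&1&0&2&0&0&0\\0&0&0&1&1&1&0&0\\0&0&0&0&1&1&1&0\\0&0&0&0&0&1&1&1\\0&0&0&0&0&0&3&0\end{pmatrix},$$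 with eigenvalues $3,\frac{1+\sqrt{17}}2,2,\theta_1,0,\theta_2,\frac{1-\sqrt{17}}2,\theta_3$. Type II ($W_{1,a},W_{1,b}$): endpoint 1, multiplicity 2, dimension 9, diameter 5, shape $(1,1,1,2,2,2)$; basis $\nu,A\nu,E_3^*A^2\nu,E_4^*A^3\nu,E_4^*A^4\nu,E_5^*A^4\nu,E_5^*A^5\nu,E_6^*A^5\nu,E_6^*A^6\nu$ (with $A\nu=E_2^*A\nu$), where $\nu=[1,-1,0]$ for $W_{1,a}$ and $\nu=[1,1,-2]$ for $W_{1,b}$; matrix representing $A$: $$\begin{pmatrix}0&2&0&0&0&0&0&0&0\\1&0&2&0&0&0&0&0&0\\0&1&0&2&-1&0&0&0&0\\0&0&1&0&1&1&1&0&0\\0&0&0&1&0&0&1&0&0\\0&0&0&1&-1&1&0&1&1\\0&0&0&0&1&0&1&0&1\\0&0&0&0&0&1&-1&1&3\\0&0&0&0&0&0&1&0&-1\end{pmatrix},$$ with eigenvalues $\frac{1+\sqrt{17}}2,2,2,\theta_1,0,0,\theta_2,\frac{1-\sqrt{17}}2,\theta_3$. Type III ($W_{2,a},W_{2,b},W_{2,c}$): endpoint 2, multiplicity 3, dimension 13, diameter 5, shape $(1,2,3,3,3,1)$; basis (in this order) $\nu$, $A\nu$, $E_3^*A^4\nu$, $E_4^*A^2\nu$, $E_4^*A^3\nu$, $E_4^*A^6\nu-36E_4^*A^2\nu$, $E_5^*A^3\nu$, $E_5^*A^4\nu+E_5^*A^3\nu$, $E_5^*A^6\nu-10E_5^*A^4\nu-E_5^*A^3\nu$,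 $E_6^*A^4\nu$, $E_6^*A^5\nu$, $E_6^*A(E_5^*A^6\nu-10E_5^*A^4\nu-E_5^*A^3\nu)$, $E_7^*A^5\nu$ (with $A\nu=E_3^*A\nu$), where $\nu=[1,-1,0,0,0,0]$ for $W_{2,a}$, $\nu=[0,0,1,-1,0,0]$ for $W_{2,b}$, $\nu=[0,0,0,0,1,-1]$ for $W_{2,c}$; matrix representing $A$: $$\left(\begin{array}{ccccccccccccc}0&2&0&0&0&0&0&0&0&0&0&0&0\\1&0&0&2&0&0&0&0&0&0&0&0&0\\0&0&0&0&1&1&0&0&0&0&0&0&0\\0&1&0&0&1&0&1&0&0&0&0&0&0\\0&0&1&1&0&0&0&1&0&0&0&0&0\\0&0&1&0&0&1&0&0&1&0&0&0&0\\0&0&0&1&0&0&-1&0&0&1&0&0&0\\0&0&0&0&1&0&0&1&0&0&1&0&0\\0&0&0&0&0&1&0&0&-1&0&0&1&0\\0&0&0&0&0&0&1&0&0&1&0&0&1\\0&0&0&0&0&0&0&1&0&0&0&-1&1\\0&0&0&0&0&0&0&0&1&0&-1&0&1\\0&0&0&0&0&0&0&0&0&1&1&1&0\end{array}\right),$$ with eigenvalues $\frac{1+\sqrt{17}}2,2,2,2,\theta_1,\theta_1,0,0,\theta_2,\theta_2,\frac{1-\sqrt{17}}2,\theta_3,\theta_3$. Type IV ($W_{3,a},W_{3,b},W_{3,c}$): endpoint 3, multiplicity 3, dimension 11, diameter 4, shape $(1,3,3,3,1)$; basis $v_1,\dots,v_{11}$ where (with $A\nu=E_4^*A\nu$) $v_1=\nu$,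 $v_2=A\nu-\tfrac52E_4^*A^2\nu+\tfrac12E_4^*A^4\nu$, $v_3=\tfrac12A\nu-\tfrac74E_4^*A^2\nu+\tfrac14E_4^*A^4\nu$, $v_4=\tfrac12A\nu-\tfrac{17}4E_4^*A^2\nu+\tfrac34E_4^*A^4\nu$, $v_5=-\tfrac52E_5^*A^2\nu+\tfrac12E_5^*A^3\nu+\tfrac12E_5^*A^4\nu$, $v_6=-\tfrac{17}4E_5^*A^2\nu+\tfrac14E_5^*A^3\nu+\tfrac34E_5^*A^4\nu$, $v_7=-\tfrac{31}4E_5^*A^2\nu+\tfrac34E_5^*A^3\nu+\tfrac54E_5^*A^4\nu$, $v_8=-\tfrac18E_6^*A^3\nu+\tfrac14E_6^*A^4\nu+\tfrac18E_6^*A^5\nu$, $v_9=-\tfrac{19}{16}E_6^*A^3\nu-\tfrac18E_6^*A^4\nu+\tfrac3{16}E_6^*A^5\nu$, $v_{10}=-\tfrac{37}{16}E_6^*A^3\nu+\tfrac18E_6^*A^4\nu+\tfrac5{16}E_6^*A^5\nu$, $v_{11}=\tfrac14E_7^*A^5\nu$, and $W_{3,a}$: $\nu=[2,-2,-2,2,2,-2,-2,2,0,0,0,0]$; $W_{3,b}$: $\nu=[1,-1,1,-1,-1,1,-1,1,2,-2,0,0]$; $W_{3,c}$: $\nu=[1,-1,1,-1,1,-1,1,-1,0,0,-2,2]$; matrix representing $A$: $$\left(\begin{array}{ccccccccccc}0&1&1&0&0&0&0&0&0&0&0\\1&1&0&0&1&0&0&0&0&0&0\\1&-1&-1&0&0&1&0&0&0&0&0\\-1&-1&0&-1&0&0&1&0&0&0&0\\0&1&0&0&1&1&1&1&0&0&0\\0&0&1&0&0&-1&0&0&1&0&0\\0&0&0&1&0&0&-1&0&0&1&0\\0&0&0&0&1&0&0&0&0&1&0\\0&0&0&0&0&1&0&-1&-1&-1&0\\0&0&0&0&0&0&1&1&0&0&1\\0&0&0&0&0&0&0&2&1&3&0\end{array}\right),$$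 with eigenvalues $\frac{1+\sqrt{17}}2,2,\theta_1,\theta_1,0,0,\theta_2,\theta_2,\frac{1-\sqrt{17}}2,\theta_3,\theta_3$. Type V ($W_4$): endpoint 4, multiplicity 1, dimension 4, diameter 3, shape $(1,1,1,1)$; basis $\nu,E_5^*A\nu,E_6^*A^2\nu,E_7^*A^3\nu$, where $\nu=[1,-1,-1,1,1,-1,1,-1,-1,1,-1,1,1,-1,-1,1,1,-1,-1,1,-1,1,-1,1]$; matrix representing $A$: $\begin{pmatrix}-1&1&0&0\\1&1&1&0\\0&1&-1&3\\0&0&1&0\end{pmatrix}$, with eigenvalues $2,\theta_1,\theta_2,\theta_3$. Moreover $\dim T=8^2+9^2+13^2+11^2+4^2=451$.
   Context: Let $\Gamma=(X,\mathcal E)$ be a finite undirected connected graph without loops or multiple edges, with path-length distance $d$ and diameter $D\ge1$; put $\Gamma_i(x)=\{y\in X:d(x,y)=i\}$. $\Gamma$ is distance-regular if for all $0\le h,i,j\le D$ the number $p^h_{i,j}=|\Gamma_i(y)\cap\Gamma_j(z)|$ is the same for all $y,z\in X$ with $d(y,z)=h$. Its intersection array is $\{b_0,\dots,b_{D-1};c_1,\dots,c_D\}$ with $b_i=p^i_{1,i+1}$, $c_i=p^i_{1,i-1}$. $A\in\mathrm{Mat}_X(\mathbb C)$ is the adjacency matrix; in its spectrum, exponents denote multiplicities. The standard module $V=\mathbb C^X$ (column vectors) carries the Hermitian inner product $\langle u,v\rangle=u^t\bar v$. Fix a base vertex $x\in X$. For $0\le i\le D$, $E_i^*=E_i^*(x)$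 is the diagonal matrix with $(y,y)$-entry $1$ if $d(x,y)=i$ and $0$ otherwise, and $e_i^*\in V$ is the vector with $y$-entry $1$ if $d(x,y)=i$ and $0$ otherwise. The Terwilliger algebra $T=T(x)$ is the subalgebra of $\mathrm{Mat}_X(\mathbb C)$ generated by $A$ and $E_0^*,\dots,E_D^*$. A $T$-module is a subspace $W\subseteq V$ with $BW\subseteq W$ for all $B\in T$; it is irreducible if $W\ne0$ and it properly contains no nonzero $T$-module. Isomorphisms of $T$-modules are vector space isomorphisms commuting with every $B\in T$. The endpoint of $W$ is $r=\min\{i:E_i^*W\ne0\}$; the diameter of an irreducible $W$ is $\delta=|\{i:E_i^*W\ne0\}|-1$, and its shape is $(\dim E_r^*W,\dots,\dim E_{r+\delta}^*W)$. The multiplicity of an irreducible module is the number of summands isomorphic to it in an orthogonal decomposition of $V$ into irreducible $T$-modules. A nonzero vector is pure with support $i$ if it lies in $E_i^*V$; its essential part is the row vector of its coordinates at the vertices of $\Gamma_i(x)$, in the chosen order (all its other coordinates are $0$). A pure basis of an irreducible $T$-module is an ordered basis of pure vectors with weakly increasing supports. The matrix $B$ representing $A$ with respect to a basis $v_1,\dots,v_\ell$ is given by $Av_j=\sum_iB_{ij}v_i$. *)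

theory Defs
  imports "HOL-Analysis.Analysis" "Jordan_Normal_Form.Char_Poly"
begin

text \<open>
  The vertex set \<open>X\<close> is the universe of a finite type \<open>'n\<close>, so \<open>Mat\<^sub>X(\<complex>)\<close> is the type
  \<open>complex^'n^'n\<close> and the standard module \<open>\<complex>\<^sup>X\<close> is \<open>complex^'n\<close>, regarded as a
  complex vector space through the interpretation \<open>vec\<close> of HOL-Analysis. The
  type constructor \<open>mat\<close> of Jordan_Normal_Form is used only for the \<open>\<ell> \<times> \<ell>\<close> matrices
  representing the action on a module.
\<close>

section \<open>Distance-regular graphs\<close>

definition gdist :: "('n \<Rightarrow> 'n \<Rightarrow> bool) \<Rightarrow> 'n \<Rightarrow> 'n \<Rightarrow> nat" where
  "gdist adj y z = (LEAST n. (adj ^^ n) y z)"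

definition sphere_at :: "('n \<Rightarrow> 'n \<Rightarrow> bool) \<Rightarrow> nat \<Rightarrow> 'n \<Rightarrow> 'n set" where
  "sphere_at adj i x = {y. gdist adj x y = i}"

definition graph_diameter :: "('n::finite \<Rightarrow> 'n \<Rightarrow> bool) \<Rightarrow> nat" where
  "graph_diameter adj = Max {gdist adj y z |y z. True}"

definition connected_graph :: "('n \<Rightarrow> 'n \<Rightarrow> bool) \<Rightarrow> bool" where
  "connected_graph adj \<longleftrightarrow> symp adj \<and> irreflp adj \<and> (\<forall>y z. adj\<^sup>*\<^sup>* y z)"

definition distance_regular :: "('n::finite \<Rightarrow> 'n \<Rightarrow> bool) \<Rightarrow> bool" where
  "distance_regular adj \<longleftrightarrow>
     connected_graph adj \<and> graph_diameter adj \<ge> 1 \<and>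
     (\<forall>h \<le> graph_diameter adj. \<forall>i \<le> graph_diameter adj. \<forall>j \<le> graph_diameter adj.
        \<exists>p. \<forall>y z. gdist adj y z = h \<longrightarrow> card (sphere_at adj i y \<inter> sphere_at adj j z) = p)"

definition intersection_number ::
    "('n::finite \<Rightarrow> 'n \<Rightarrow> bool) \<Rightarrow> nat \<Rightarrow> nat \<Rightarrow> nat \<Rightarrow> nat" where
  "intersection_number adj h i j =
     (THE p. \<forall>y z. gdist adj y z = h \<longrightarrow> card (sphere_at adj i y \<inter> sphere_at adj j z) = p)"

definition intersection_array :: "('n::finite \<Rightarrow> 'n \<Rightarrow> bool) \<Rightarrow> nat list \<times> nat list" where
  "intersection_array adj =
     (map (\<lambda>i. intersection_number adj i 1 (i + 1)) [0..<graph_diameter adj],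
      map (\<lambda>i. intersection_number adj i 1 (i - 1)) [1..<graph_diameter adj + 1])"

text \<open>Existence and uniqueness up to isomorphism of this graph are classical and are not
  built into the definition.\<close>

definition is_biggs_smith :: "('n::finite \<Rightarrow> 'n \<Rightarrow> bool) \<Rightarrow> bool" where
  "is_biggs_smith adj \<longleftrightarrow> distance_regular adj \<and> CARD('n) = 102 \<and>
     intersection_array adj = ([3,2,2,2,1,1,1], [1,1,1,1,1,1,3])"

section \<open>The Terwilliger algebra\<close>

definition adj_matrix :: "('n \<Rightarrow> 'n \<Rightarrow> bool) \<Rightarrow> complex^'n^'n" where
  "adj_matrix adj = (\<chi> y z. if adj y z then 1 else 0)"

definition hermitian :: "complex^'n \<Rightarrow> complex^'n \<Rightarrow> complex" where
  "hermitian u v = (\<Sum>y\<in>UNIV. vec_nth u y * cnj (vec_nth v y))"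

definition Estar :: "('n \<Rightarrow> 'n \<Rightarrow> bool) \<Rightarrow> 'n \<Rightarrow> nat \<Rightarrow> complex^'n^'n" where
  "Estar adj x i = (\<chi> y z. if y = z \<and> gdist adj x y = i then 1 else 0)"

definition estar :: "('n \<Rightarrow> 'n \<Rightarrow> bool) \<Rightarrow> 'n \<Rightarrow> nat \<Rightarrow> complex^'n" where
  "estar adj x i = (\<chi> y. if gdist adj x y = i then 1 else 0)"

definition mat_scale :: "complex \<Rightarrow> complex^'n^'n \<Rightarrow> complex^'n^'n" where
  "mat_scale c M = map_matrix ((*) c) M"

interpretation cmat: vector_space "mat_scale :: complex \<Rightarrow> complex^'n^'n \<Rightarrow> complex^'n^'n"
  by unfold_locales (simp_all add: mat_scale_def Finite_Cartesian_Product.vec_eq_iff algebra_simps)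

text \<open>\<open>Finite_Cartesian_Product.mat 1\<close> is the identity matrix; the class constants \<open>1\<close>
  and \<open>*\<close> on \<open>complex^'n^'n\<close> are entrywise and are not used.\<close>

definition matrix_subalgebra :: "(complex^'n^'n) set \<Rightarrow> bool" where
  "matrix_subalgebra S \<longleftrightarrow> cmat.subspace S \<and> Finite_Cartesian_Product.mat 1 \<in> S \<and>
     (\<forall>M\<in>S. \<forall>N\<in>S. M ** N \<in> S)"

definition terwilliger_algebra :: "('n::finite \<Rightarrow> 'n \<Rightarrow> bool) \<Rightarrow> 'n \<Rightarrow> (complex^'n^'n) set" where
  "terwilliger_algebra adj x =
     matrix_subalgebra hull (insert (adj_matrix adj) (Estar adj x ` {..graph_diameter adj}))"

section \<open>Modules\<close>

definition T_module :: "('n::finite \<Rightarrow> 'n \<Rightarrow> bool) \<Rightarrow> 'n \<Rightarrow> (complex^'n) set \<Rightarrow> bool" where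
  "T_module adj x W \<longleftrightarrow> vec.subspace W \<and> (\<forall>M\<in>terwilliger_algebra adj x. \<forall>w\<in>W. M *v w \<in> W)"

definition irreducible_T_module ::
    "('n::finite \<Rightarrow> 'n \<Rightarrow> bool) \<Rightarrow> 'n \<Rightarrow> (complex^'n) set \<Rightarrow> bool" where
  "irreducible_T_module adj x W \<longleftrightarrow> T_module adj x W \<and> W \<noteq> {0} \<and>
     \<not> (\<exists>U. T_module adj x U \<and> U \<noteq> {0} \<and> U \<subset> W)"

definition T_isomorphic ::
    "('n::finite \<Rightarrow> 'n \<Rightarrow> bool) \<Rightarrow> 'n \<Rightarrow> (complex^'n) set \<Rightarrow> (complex^'n) set \<Rightarrow> bool" where
  "T_isomorphic adj x W W' \<longleftrightarrow>
     (\<exists>f. bij_betw f W W' \<and>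
        (\<forall>u\<in>W. \<forall>v\<in>W. f (u + v) = f u + f v) \<and>
        (\<forall>c. \<forall>v\<in>W. f (c *s v) = c *s f v) \<and>
        (\<forall>M\<in>terwilliger_algebra adj x. \<forall>v\<in>W. f (M *v v) = M *v f v))"

text \<open>Pairwise orthogonality implies that the sum is direct.\<close>

definition orthogonal_decomposition ::
    "('n::finite \<Rightarrow> 'n \<Rightarrow> bool) \<Rightarrow> 'n \<Rightarrow> (complex^'n) set list \<Rightarrow> bool" where
  "orthogonal_decomposition adj x Ws \<longleftrightarrow>
     (\<forall>W\<in>set Ws. irreducible_T_module adj x W) \<and>
     (\<forall>i<length Ws. \<forall>j<length Ws. i \<noteq> j \<longrightarrow>
        (\<forall>u\<in>Ws ! i. \<forall>v\<in>Ws ! j. hermitian u v = 0)) \<and>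
     vec.span (\<Union>(set Ws)) = UNIV"

definition T_multiplicity :: "('n::finite \<Rightarrow> 'n \<Rightarrow> bool) \<Rightarrow> 'n \<Rightarrow> (complex^'n) set \<Rightarrow> nat" where
  "T_multiplicity adj x W =
     (THE m. \<exists>Ws. orthogonal_decomposition adj x Ws \<and>
        m = length (filter (\<lambda>U. T_isomorphic adj x U W) Ws))"

definition module_supports ::
    "('n::finite \<Rightarrow> 'n \<Rightarrow> bool) \<Rightarrow> 'n \<Rightarrow> (complex^'n) set \<Rightarrow> nat set" where
  "module_supports adj x W = {i. i \<le> graph_diameter adj \<and> (*v) (Estar adj x i) ` W \<noteq> {0}}"

definition endpoint :: "('n::finite \<Rightarrow> 'n \<Rightarrow> bool) \<Rightarrow> 'n \<Rightarrow> (complex^'n) set \<Rightarrow> nat" where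
  "endpoint adj x W = Min (module_supports adj x W)"

definition module_diameter :: "('n::finite \<Rightarrow> 'n \<Rightarrow> bool) \<Rightarrow> 'n \<Rightarrow> (complex^'n) set \<Rightarrow> nat" where
  "module_diameter adj x W = card (module_supports adj x W) - 1"

definition module_shape :: "('n::finite \<Rightarrow> 'n \<Rightarrow> bool) \<Rightarrow> 'n \<Rightarrow> (complex^'n) set \<Rightarrow> nat list" where
  "module_shape adj x W =
     map (\<lambda>k. vec.dim ((*v) (Estar adj x (endpoint adj x W + k)) ` W))
       [0..<module_diameter adj x W + 1]"

definition pure_vector :: "('n::finite \<Rightarrow> 'n \<Rightarrow> bool) \<Rightarrow> 'n \<Rightarrow> nat \<Rightarrow> complex^'n \<Rightarrow> bool" where
  "pure_vector adj x i v \<longleftrightarrow> i \<le> graph_diameter adj \<and> v \<noteq> 0 \<and> v \<in> range ((*v) (Estar adj x i))"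

definition pure_basis ::
    "('n::finite \<Rightarrow> 'n \<Rightarrow> bool) \<Rightarrow> 'n \<Rightarrow> (complex^'n) set \<Rightarrow> (complex^'n) list \<Rightarrow> bool" where
  "pure_basis adj x W vs \<longleftrightarrow>
     distinct vs \<and> vec.independent (set vs) \<and> vec.span (set vs) = W \<and>
     (\<exists>supps. sorted supps \<and> list_all2 (pure_vector adj x) supps vs)"

definition represents :: "complex^'n^'n \<Rightarrow> (complex^'n) list \<Rightarrow> complex Matrix.mat \<Rightarrow> bool" where
  "represents M vs B \<longleftrightarrow> B \<in> carrier_mat (length vs) (length vs) \<and>
     (\<forall>j<length vs. M *v (vs ! j) = (\<Sum>i<length vs. B $$ (i, j) *s (vs ! i)))"

text \<open>Eigenvalues are listed with (algebraic) multiplicity.\<close>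

definition has_eigenvalues :: "complex Matrix.mat \<Rightarrow> real list \<Rightarrow> bool" where
  "has_eigenvalues B es \<longleftrightarrow> char_poly B = (\<Prod>\<theta>\<leftarrow>es. [:- complex_of_real \<theta>, 1:])"

definition has_module_data ::
    "('n::finite \<Rightarrow> 'n \<Rightarrow> bool) \<Rightarrow> 'n \<Rightarrow> (complex^'n) set \<Rightarrow>
      nat \<Rightarrow> nat \<Rightarrow> nat \<Rightarrow> nat \<Rightarrow> nat list \<Rightarrow>
      (complex^'n) list \<Rightarrow> complex list list \<Rightarrow> real list \<Rightarrow> bool" where
  "has_module_data adj x W r m n \<delta> shape vs B es \<longleftrightarrow>
     endpoint adj x W = r \<and>
     T_multiplicity adj x W = m \<and>
     vec.dim W = n \<and>
     module_diameter adj x W = \<delta> \<and>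
     module_shape adj x W = shape \<and>
     pure_basis adj x W vs \<and>
     represents (adj_matrix adj) vs (mat_of_rows_list n B) \<and>
     has_eigenvalues (mat_of_rows_list n B) es"

text \<open>\<open>ord i\<close> lists the vertices of \<open>\<Gamma>\<^sub>i(x)\<close> in the chosen order.\<close>

definition vertex_ordering ::
    "('n::finite \<Rightarrow> 'n \<Rightarrow> bool) \<Rightarrow> 'n \<Rightarrow> (nat \<Rightarrow> 'n list) \<Rightarrow> bool" where
  "vertex_ordering adj x ord \<longleftrightarrow>
     (\<forall>i \<le> graph_diameter adj. distinct (ord i) \<and> set (ord i) = sphere_at adj i x)"

definition essential_part :: "(nat \<Rightarrow> 'n list) \<Rightarrow> nat \<Rightarrow> complex^'n \<Rightarrow> complex list" where
  "essential_part ord i v = map (vec_nth v) (ord i)"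

definition is_seed ::
    "('n::finite \<Rightarrow> 'n \<Rightarrow> bool) \<Rightarrow> 'n \<Rightarrow> (nat \<Rightarrow> 'n list) \<Rightarrow> (complex^'n) set \<Rightarrow>
      complex^'n \<Rightarrow> complex list \<Rightarrow> bool" where
  "is_seed adj x ord W \<nu> coords \<longleftrightarrow>
     pure_vector adj x (endpoint adj x W) \<nu> \<and>
     vec.span {\<nu>} = (*v) (Estar adj x (endpoint adj x W)) ` W \<and>
     essential_part ord (endpoint adj x W) \<nu> = coords"

section \<open>Explicit data\<close>

definition theta1 :: real where "theta1 = 2 * cos (pi / 9) - 1"
definition theta2 :: real where "theta2 = 2 * cos (13 * pi / 9) - 1"
definition theta3 :: real where "theta3 = 2 * cos (7 * pi / 9) - 1"

text \<open>The vector \<open>E\<^sub>i\<^sup>* A\<^sup>k v\<close>; the power is iterated application of \<open>A\<close> (the class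
  operation \<open>^\<close> on \<open>complex^'n^'n\<close> is entrywise).\<close>

definition EA :: "('n::finite \<Rightarrow> 'n \<Rightarrow> bool) \<Rightarrow> 'n \<Rightarrow> nat \<Rightarrow> nat \<Rightarrow> complex^'n \<Rightarrow> complex^'n" where
  "EA adj x i k v = Estar adj x i *v (((*v) (adj_matrix adj) ^^ k) v)"

definition basis_II ::
    "('n::finite \<Rightarrow> 'n \<Rightarrow> bool) \<Rightarrow> 'n \<Rightarrow> complex^'n \<Rightarrow> (complex^'n) list" where
  "basis_II adj x \<nu> = (let A = adj_matrix adj; e = EA adj x in
     [\<nu>, A *v \<nu>, e 3 2 \<nu>, e 4 3 \<nu>, e 4 4 \<nu>, e 5 4 \<nu>, e 5 5 \<nu>, e 6 5 \<nu>, e 6 6 \<nu>])"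

definition basis_III ::
    "('n::finite \<Rightarrow> 'n \<Rightarrow> bool) \<Rightarrow> 'n \<Rightarrow> complex^'n \<Rightarrow> (complex^'n) list" where
  "basis_III adj x \<nu> = (let A = adj_matrix adj; e = EA adj x in
     [\<nu>,
      A *v \<nu>,
      e 3 4 \<nu>,
      e 4 2 \<nu>,
      e 4 3 \<nu>,
      e 4 6 \<nu> - 36 *s e 4 2 \<nu>,
      e 5 3 \<nu>,
      e 5 4 \<nu> + e 5 3 \<nu>,
      e 5 6 \<nu> - 10 *s e 5 4 \<nu> - e 5 3 \<nu>,
      e 6 4 \<nu>,
      e 6 5 \<nu>,
      Estar adj x 6 *v (A *v (e 5 6 \<nu> - 10 *s e 5 4 \<nu> - e 5 3 \<nu>)),
      e 7 5 \<nu>])"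

definition basis_IV ::
    "('n::finite \<Rightarrow> 'n \<Rightarrow> bool) \<Rightarrow> 'n \<Rightarrow> complex^'n \<Rightarrow> (complex^'n) list" where
  "basis_IV adj x \<nu> = (let A = adj_matrix adj; e = EA adj x in
     [\<nu>,
      A *v \<nu> - (5/2) *s e 4 2 \<nu> + (1/2) *s e 4 4 \<nu>,
      (1/2) *s (A *v \<nu>) - (7/4) *s e 4 2 \<nu> + (1/4) *s e 4 4 \<nu>,
      (1/2) *s (A *v \<nu>) - (17/4) *s e 4 2 \<nu> + (3/4) *s e 4 4 \<nu>,
      - (5/2) *s e 5 2 \<nu> + (1/2) *s e 5 3 \<nu> + (1/2) *s e 5 4 \<nu>,
      - (17/4) *s e 5 2 \<nu> + (1/4) *s e 5 3 \<nu> + (3/4) *s e 5 4 \<nu>,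
      - (31/4) *s e 5 2 \<nu> + (3/4) *s e 5 3 \<nu> + (5/4) *s e 5 4 \<nu>,
      - (1/8) *s e 6 3 \<nu> + (1/4) *s e 6 4 \<nu> + (1/8) *s e 6 5 \<nu>,
      - (19/16) *s e 6 3 \<nu> - (1/8) *s e 6 4 \<nu> + (3/16) *s e 6 5 \<nu>,
      - (37/16) *s e 6 3 \<nu> + (1/8) *s e 6 4 \<nu> + (5/16) *s e 6 5 \<nu>,
      (1/4) *s e 7 5 \<nu>])"

definition basis_V ::
    "('n::finite \<Rightarrow> 'n \<Rightarrow> bool) \<Rightarrow> 'n \<Rightarrow> complex^'n \<Rightarrow> (complex^'n) list" where
  "basis_V adj x \<nu> = [\<nu>, EA adj x 5 1 \<nu>, EA adj x 6 2 \<nu>, EA adj x 7 3 \<nu>]"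

definition matrix_I :: "complex list list" where
  "matrix_I =
    [[0, 3, 0, 0, 0, 0, 0, 0],
     [1, 0, 2, 0, 0, 0, 0, 0],
     [0, 1, 0, 2, 0, 0, 0, 0],
     [0, 0, 1, 0, 2, 0, 0, 0],
     [0, 0, 0, 1, 1, 1, 0, 0],
     [0, 0, 0, 0, 1, 1, 1, 0],
     [0, 0, 0, 0, 0, 1, 1, 1],
     [0, 0, 0, 0, 0, 0, 3, 0]]"

definition matrix_II :: "complex list list" where
  "matrix_II =
    [[0, 2, 0, 0, 0, 0, 0, 0, 0],
     [1, 0, 2, 0, 0, 0, 0, 0, 0],
     [0, 1, 0, 2, -1, 0, 0, 0, 0],
     [0, 0, 1, 0, 1, 1, 1, 0, 0],
     [0, 0, 0, 1, 0, 0, 1, 0, 0],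
     [0, 0, 0, 1, -1, 1, 0, 1, 1],
     [0, 0, 0, 0, 1, 0, 1, 0, 1],
     [0, 0, 0, 0, 0, 1, -1, 1, 3],
     [0, 0, 0, 0, 0, 0, 1, 0, -1]]"

definition matrix_III :: "complex list list" where
  "matrix_III =
    [[0, 2, 0, 0, 0, 0, 0, 0, 0, 0, 0, 0, 0],
     [1, 0, 0, 2, 0, 0, 0, 0, 0, 0, 0, 0, 0],
     [0, 0, 0, 0, 1, 1, 0, 0, 0, 0, 0, 0, 0],
     [0, 1, 0, 0, 1, 0, 1, 0, 0, 0, 0, 0, 0],
     [0, 0, 1, 1, 0, 0, 0, 1, 0, 0, 0, 0, 0],
     [0, 0, 1, 0, 0, 1, 0, 0, 1, 0, 0, 0, 0],
     [0, 0, 0, 1, 0, 0, -1, 0, 0, 1, 0, 0, 0],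
     [0, 0, 0, 0, 1, 0, 0, 1, 0, 0, 1, 0, 0],
     [0, 0, 0, 0, 0, 1, 0, 0, -1, 0, 0, 1, 0],
     [0, 0, 0, 0, 0, 0, 1, 0, 0, 1, 0, 0, 1],
     [0, 0, 0, 0, 0, 0, 0, 1, 0, 0, 0, -1, 1],
     [0, 0, 0, 0, 0, 0, 0, 0, 1, 0, -1, 0, 1],
     [0, 0, 0, 0, 0, 0, 0, 0, 0, 1, 1, 1, 0]]"

definition matrix_IV :: "complex list list" where
  "matrix_IV =
    [[0, 1, 1, 0, 0, 0, 0, 0, 0, 0, 0],
     [1, 1, 0, 0, 1, 0, 0, 0, 0, 0, 0],
     [1, -1, -1, 0, 0, 1, 0, 0, 0, 0, 0],
     [-1, -1, 0, -1, 0, 0, 1, 0, 0, 0, 0],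
     [0, 1, 0, 0, 1, 1, 1, 1, 0, 0, 0],
     [0, 0, 1, 0, 0, -1, 0, 0, 1, 0, 0],
     [0, 0, 0, 1, 0, 0, -1, 0, 0, 1, 0],
     [0, 0, 0, 0, 1, 0, 0, 0, 0, 1, 0],
     [0, 0, 0, 0, 0, 1, 0, -1, -1, -1, 0],
     [0, 0, 0, 0, 0, 0, 1, 1, 0, 0, 1],
     [0, 0, 0, 0, 0, 0, 0, 2, 1, 3, 0]]"

definition matrix_V :: "complex list list" where
  "matrix_V =
    [[-1, 1, 0, 0],
     [1, 1, 1, 0],
     [0, 1, -1, 3],
     [0, 0, 1, 0]]"

end

(*
  Fix a base vertex. By the intersection numbers every path of length four lies on a 9-cycle, and
  following these cycles shows that all adjacencies are forced once the vertices at distance at most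
  two have been named. So the graph is a concrete one, in which the ten modules are spanned by
  explicit integral vectors.

  In these bases the action of A and, up to scalars, the Gram matrix depend on the type only, and each
  basis is obtained from its seed by an element of T. The seeds of the types have different levels, so
  that the projections onto the spaces of seeds of one type lie in T; hence so do all matrix units. The
  modules are therefore irreducible and two of them are isomorphic exactly if they have the same type,
  and dim T is the sum of the squares of the dimensions.

  A polynomial of degree 8 with distinct roots annihilates A, since it annihilates every base vertex
  inside its 8-dimensional module. The multiplicities of the eigenvalues of A, and of the matrices that
  represent A on the modules, are determined by the traces of the powers 0, ..., 7.
*)

theory Submission
  imports Defs "Jordan_Normal_Form.Schur_Decomposition"
begin

section \<open>Levels and nine-cycles\<close>

text \<open>The hypothesis is only an intersection array, so explicit vectors become available after
  a uniqueness proof. Since a_1 = a_2 = a_3 = 0 and c_1 = ... = c_6 = 1, levels 0 to 4 form a tree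
  up to a perfect matching on level 4. Levels 5 and 6 repeat level 4 with their own matchings, and
  level 7 glues the 24 columns in threes. The freedom left is three involutions and one partition.
  Nine-cycles only yield existence statements about these; counting and the three branches at the
  base vertex turn them into equations. No matrix computation involves an irrational number. A
  Lagrange polynomial in A is a multiple of the projection onto an eigenspace, its trace is fixed by
  the traces of the powers below the number of eigenvalues, and the power sums of conjugate
  eigenvalues are integers. The listed bases of types II and IV are not orthogonal, so passing to
  adjoints mixes basis vectors, and the inverse Gram matrix is needed to separate them again.
  Multiplicity refers to arbitrary decompositions and therefore needs an invariant: the rank of the
  projection onto the seeds of one type.\<close>

lemma card_eq_3_obtain:
  assumes "card N = 3" obtains a b c where "N = {a,b,c}" "a \<noteq> b" "a \<noteq> c" "b \<noteq> c"
  using assms card_3_iff[of N] by metis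

section \<open>Distances in a connected graph\<close>

locale conn_graph =
  fixes adj :: "'n::finite \<Rightarrow> 'n \<Rightarrow> bool"
  assumes conn: "connected_graph adj"
begin

lemma adj_sym: "adj y z \<longleftrightarrow> adj z y"
  using conn by (auto simp: connected_graph_def symp_def)

lemma adj_irrefl [simp]: "\<not> adj y y"
  using conn by (auto simp: connected_graph_def irreflp_def)

lemma relpowp_gdist: "(adj ^^ gdist adj y z) y z"
proof -
  have "adj\<^sup>*\<^sup>* y z" using conn by (auto simp: connected_graph_def)
  then obtain n where "(adj ^^ n) y z" by (metis rtranclp_imp_relpowp)
  then show ?thesis unfolding gdist_def by (rule LeastI)
qed

lemma gdist_le: "(adj ^^ n) y z \<Longrightarrow> gdist adj y z \<le> n"
  unfolding gdist_def by (rule Least_le)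

lemma gdist_0 [simp]: "gdist adj y z = 0 \<longleftrightarrow> y = z"
proof
  show "gdist adj y z = 0 \<Longrightarrow> y = z" using relpowp_gdist[of y z] by simp
  show "y = z \<Longrightarrow> gdist adj y z = 0" using gdist_le[of 0 y z] by simp
qed

lemma gdist_step: "adj z w \<Longrightarrow> gdist adj y w \<le> Suc (gdist adj y z)"
  using relpowp_gdist[of y z] by (intro gdist_le) auto

lemma gdist_adj:
  assumes "adj z w"
  shows "gdist adj y w = gdist adj y z - 1 \<and> gdist adj y z > 0 \<or> gdist adj y w = gdist adj y z \<or> gdist adj
      y w = Suc (gdist adj y z)"
  using gdist_step[OF assms, of y] gdist_step[of w z y] assms adj_sym[of z w] by linarith

lemma gdist_pred:
  assumes "gdist adj y z = Suc n"
  shows "\<exists>w. adj w z \<and> gdist adj y w = n"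
proof -
  have "(adj ^^ Suc n) y z" using relpowp_gdist[of y z] assms by simp
  then obtain w where w: "(adj ^^ n) y w" "adj w z" by auto
  then have "gdist adj y w \<le> n" by (intro gdist_le)
  moreover have "Suc n \<le> Suc (gdist adj y w)" using gdist_step[OF w(2), of y] assms by simp
  ultimately show ?thesis using w by auto
qed

lemma gdist_1 [simp]: "gdist adj y z = Suc 0 \<longleftrightarrow> adj y z"
proof
  assume "gdist adj y z = Suc 0"
  from gdist_pred[OF this] show "adj y z" by auto
next
  assume a: "adj y z"
  then have "(adj ^^ 1) y z" by (metis relpowp_1)
  then have "gdist adj y z \<le> 1" by (rule gdist_le)
  moreover have "gdist adj y z \<noteq> 0" using a adj_irrefl gdist_0 by metis
  ultimately show "gdist adj y z = Suc 0" by linarith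
qed

lemma relpowp_rev: "(adj ^^ n) y z \<Longrightarrow> (adj ^^ n) z y"
proof (induction n arbitrary: z)
  case (Suc n)
  then obtain w where "(adj ^^ n) y w" "adj w z" by auto
  then have "(adj ^^ n) w y" "adj z w" using Suc.IH adj_sym by auto
  then show ?case by (meson relpowp_Suc_I2)
qed auto

lemma gdist_sym: "gdist adj y z = gdist adj z y"
  by (meson antisym gdist_le relpowp_gdist relpowp_rev)

end

section \<open>Neighbourhoods read off the intersection array\<close>

locale biggs_smith =
  fixes adj :: "'n::finite \<Rightarrow> 'n \<Rightarrow> bool"
  assumes bs: "is_biggs_smith adj"
begin

sublocale conn_graph adj
  using bs by unfold_locales (simp add: is_biggs_smith_def distance_regular_def)

lemma diam: "graph_diameter adj = 7"
proof -
  have "length (fst (intersection_array adj)) = 7" using bs by (simp add: is_biggs_smith_def)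
  then show ?thesis by (simp add: intersection_array_def)
qed

lemma gdist_le_7: "gdist adj y z \<le> 7"
proof -
  have "{gdist adj y z |y z. True} = (\<lambda>(y,z). gdist adj y z) ` UNIV" by auto
  then have "finite {gdist adj y z |y z. True}" by simp
  then have "gdist adj y z \<le> graph_diameter adj" unfolding graph_diameter_def by (intro Max_ge) auto
  then show ?thesis by (simp add: diam)
qed

lemma card_spheres:
  assumes "h \<le> 7" "i \<le> 7" "j \<le> 7" "gdist adj y z = h"
  shows "card (sphere_at adj i y \<inter> sphere_at adj j z) = intersection_number adj h i j"
proof -
  obtain p where p: "\<forall>y z. gdist adj y z = h \<longrightarrow> card (sphere_at adj i y \<inter> sphere_at adj j z) = p"
    using bs assms unfolding is_biggs_smith_def distance_regular_def diam by blast
  have "intersection_number adj h i j = p" unfolding intersection_number_def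
    using p assms(4) by (intro the_equality) auto
  then show ?thesis using p assms by auto
qed

lemma int_nums:
  "intersection_number adj 0 1 1 = 3" "intersection_number adj 1 1 2 = 2"
  "intersection_number adj 2 1 3 = 2" "intersection_number adj 3 1 4 = 2"
  "intersection_number adj 4 1 5 = 1" "intersection_number adj 5 1 6 = 1"
  "intersection_number adj 6 1 7 = 1"
  "intersection_number adj 1 1 0 = 1" "intersection_number adj 2 1 1 = 1"
  "intersection_number adj 3 1 2 = 1" "intersection_number adj 4 1 3 = 1"
  "intersection_number adj 5 1 4 = 1" "intersection_number adj 6 1 5 = 1"
  "intersection_number adj 7 1 6 = 3"
proof -
  have l: "[0..<7] = [0,1,2,3,4,5,6::nat]" "[1..<7 + 1] = [1,2,3,4,5,6,7::nat]" by code_simp+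
  show "intersection_number adj 0 1 1 = 3" "intersection_number adj 1 1 2 = 2"
    "intersection_number adj 2 1 3 = 2" "intersection_number adj 3 1 4 = 2"
    "intersection_number adj 4 1 5 = 1" "intersection_number adj 5 1 6 = 1"
    "intersection_number adj 6 1 7 = 1"
    "intersection_number adj 1 1 0 = 1" "intersection_number adj 2 1 1 = 1"
    "intersection_number adj 3 1 2 = 1" "intersection_number adj 4 1 3 = 1"
    "intersection_number adj 5 1 4 = 1" "intersection_number adj 6 1 5 = 1"
    "intersection_number adj 7 1 6 = 3"
    using bs unfolding is_biggs_smith_def intersection_array_def diam l by (simp_all del: One_nat_def, simp_all?)
qed

lemma card_nb_at:
  assumes "gdist adj y z = h" "j \<le> 7"
  shows "card {w. adj z w \<and> gdist adj y w = j} = intersection_number adj h 1 j"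
proof -
  have "sphere_at adj 1 z \<inter> sphere_at adj j y = {w. adj z w \<and> gdist adj y w = j}"
    by (auto simp: sphere_at_def)
  then show ?thesis using card_spheres[of h 1 j z y] assms gdist_le_7[of y z] gdist_sym[of y z] by simp
qed

lemma card_nb: "card {w. adj z w} = 3"
proof -
  have "{w. adj z w \<and> gdist adj z w = 1} = {w. adj z w}" by auto
  then show ?thesis using card_nb_at[of z z 0 1] int_nums(1) by simp
qed

lemma nbs_0:
  obtains a b c where "\<And>w. adj z w \<longleftrightarrow> w \<in> {a,b,c}" "a \<noteq> b" "a \<noteq> c" "b \<noteq> c"
proof -
  obtain a b c where N: "{w. adj z w} = {a,b,c}" and "a \<noteq> b" "a \<noteq> c" "b \<noteq> c"
    by (rule card_eq_3_obtain[OF card_nb[of z]])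
  moreover have "adj z w \<longleftrightarrow> w \<in> {a,b,c}" for w using N by blast
  ultimately show ?thesis using that by blast
qed

text \<open>Here c_d = 1 and b_d = 2 exhaust the valency 3, so a_d = 0: levels 1, 2, 3 have no inner
  edges, and a step that does not go back leads outwards.\<close>

lemma nbs_low:
  assumes d: "gdist adj y z = d" and "d \<in> {1,2,3}"
  obtains p a b where "\<And>w. adj z w \<longleftrightarrow> w \<in> {p,a,b}" "p \<noteq> a" "p \<noteq> b" "a \<noteq> b"
    "gdist adj y p = d - 1" "gdist adj y a = d + 1" "gdist adj y b = d + 1"
proof -
  have "card {w. adj z w \<and> gdist adj y w = d - 1} = 1" "card {w. adj z w \<and> gdist adj y w = d + 1} = 2"
    using card_nb_at[OF d, of "d - 1"] card_nb_at[OF d, of "d + 1"] assms(2) int_nums by (auto simp: eval_nat_numeral)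
  then obtain p a b where p: "{w. adj z w \<and> gdist adj y w = d - 1} = {p}"
    and ab: "{w. adj z w \<and> gdist adj y w = d + 1} = {a,b}" "a \<noteq> b"
    unfolding card_1_singleton_iff card_2_iff One_nat_def by blast
  have "gdist adj y p = d - 1" "gdist adj y a = d + 1" "gdist adj y b = d + 1" using p ab by blast+
  then have pa: "p \<noteq> a" "p \<noteq> b" by auto
  then have "card {p,a,b} = 3" using ab by auto
  moreover have sub: "{p,a,b} \<subseteq> {w. adj z w}" using p ab by blast
  ultimately have "{w. adj z w} = {p,a,b}" using card_nb[of z] card_subset_eq[of "{w. adj z w}" "{p,a,b}"] by simp
  then have "adj z w \<longleftrightarrow> w \<in> {p,a,b}" for w by blast
  moreover have "gdist adj y p = d - 1" "gdist adj y a = d + 1" "gdist adj y b = d + 1" using p ab by blast+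
  ultimately show ?thesis using pa ab(2) by (intro that[of p a b]) auto
qed

text \<open>Since c_d = b_d = 1, one of the three neighbours is left over, and it can only have the
  same distance. This is the source of the perfect matchings on levels 4, 5 and 6.\<close>

lemma nbs_high:
  assumes d: "gdist adj y z = d" and "d \<in> {4,5,6}"
  obtains p a b where "\<And>w. adj z w \<longleftrightarrow> w \<in> {p,a,b}" "p \<noteq> a" "p \<noteq> b" "a \<noteq> b"
    "gdist adj y p = d - 1" "gdist adj y a = d" "gdist adj y b = d + 1"
proof -
  have "card {w. adj z w \<and> gdist adj y w = d - 1} = 1" "card {w. adj z w \<and> gdist adj y w = d + 1} = 1"
    using card_nb_at[OF d, of "d - 1"] card_nb_at[OF d, of "d + 1"] assms(2) int_nums by (auto simp: eval_nat_numeral)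
  then obtain p b where p: "{w. adj z w \<and> gdist adj y w = d - 1} = {p}"
    and b: "{w. adj z w \<and> gdist adj y w = d + 1} = {b}"
    unfolding card_1_singleton_iff One_nat_def by blast
  have "gdist adj y p = d - 1" "gdist adj y b = d + 1" using p b by blast+
  then have pb: "p \<noteq> b" by auto
  have sub2: "{p,b} \<subseteq> {w. adj z w}" using p b by blast
  have "card {p,b} = 2" using pb by simp
  then have "{p,b} \<noteq> {w. adj z w}" using card_nb[of z] by fastforce
  then obtain a where a: "adj z a" "a \<noteq> p" "a \<noteq> b" using sub2 by blast
  have "card {p,a,b} = 3" using a pb by simp
  moreover have "{p,a,b} \<subseteq> {w. adj z w}" using sub2 a by blast
  ultimately have N: "{w. adj z w} = {p,a,b}" using card_nb[of z] card_subset_eq[of "{w. adj z w}" "{p,a,b}"] by simp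
  note za = a(1)
  have "a \<notin> {w. adj z w \<and> gdist adj y w = d - 1}" "a \<notin> {w. adj z w \<and> gdist adj y w = d + 1}"
    unfolding p b using a by simp_all
  then have da: "gdist adj y a = d" using gdist_adj[OF za, of y] za d by auto
  have "adj z w' \<longleftrightarrow> w' \<in> {p,a,b}" for w' using N by blast
  moreover have "gdist adj y p = d - 1" "gdist adj y b = d + 1" using p b by blast+
  ultimately show ?thesis using pb a(2,3) da by (intro that[of p a b]) auto
qed

text \<open>The entry c_7 = 3 is the full valency.\<close>

lemma nbs_7:
  assumes d: "gdist adj y z = 7" "adj z w" shows "gdist adj y w = 6"
proof -
  have "card {w. adj z w \<and> gdist adj y w = 6} = 3"
    using card_nb_at[OF d(1), of 6] int_nums by simp
  then have "{w. adj z w \<and> gdist adj y w = 6} = {w. adj z w}"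
    by (intro card_subset_eq) (auto simp: card_nb)
  then show ?thesis using d by blast
qed

text \<open>The ends of a non-backtracking path of length four have distance four, and a vertex at distance
  four from \<open>v0\<close> has exactly one neighbour at the same distance from \<open>v0\<close>; a geodesic from
  that neighbour back to \<open>v0\<close> closes the cycle.\<close>

lemma nine_cycle:
  assumes "adj v0 v1" "adj v1 v2" "adj v2 v3" "adj v3 v4" "v0 \<noteq> v2" "v1 \<noteq> v3" "v2 \<noteq> v4"
  obtains v5 v6 v7 v8 where "adj v4 v5" "adj v5 v6" "adj v6 v7" "adj v7 v8" "adj v8 v0"
    "v5 \<noteq> v3" "v6 \<noteq> v4" "v7 \<noteq> v5" "v8 \<noteq> v6" "v7 \<noteq> v0" "v8 \<noteq> v1"
proof -
  have step: "gdist adj y c = Suc i" if h: "gdist adj y a = i - 1" "gdist adj y b = i" "adj a b" "adj b c"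
      "a \<noteq> c" "i \<in> {1,2,3}" for a b c y i
  proof -
    obtain p u w where *: "\<And>w'. adj b w' \<longleftrightarrow> w' \<in> {p,u,w}" "p \<noteq> u" "p \<noteq> w" "u \<noteq> w"
      "gdist adj y p = i - 1" "gdist adj y u = i + 1" "gdist adj y w = i + 1"
      by (rule nbs_low[OF h(2,6)]) (rule that; assumption)
    have "a \<in> {p,u,w}" using *(1)[of a] h(3) adj_sym[of a b] by blast
    then have "a = p" using h(1) *(6,7) by auto
    moreover have "c \<in> {p,u,w}" using *(1)[of c] h(4) by blast
    ultimately show ?thesis using *(2-) h(5) by auto
  qed
  have d1: "gdist adj v0 v1 = 1" "gdist adj v1 v2 = 1" using assms by simp_all
  have d2: "gdist adj v0 v2 = 2" using step[of v0 v0 1 v1 v2] assms d1 by simp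
  have d3: "gdist adj v0 v3 = 3" using step[of v0 v1 2 v2 v3] assms d1 d2 by simp
  have d4: "gdist adj v0 v4 = 4" using step[of v0 v2 3 v3 v4] assms d2 d3 by simp
  have e2: "gdist adj v1 v3 = 2" using step[of v1 v1 1 v2 v3] assms d1 by simp
  have e3: "gdist adj v1 v4 = 3" using step[of v1 v2 2 v3 v4] assms d1 e2 by simp
  have "4 \<in> {4,5,6::nat}" by simp
  from nbs_high[OF d4 this] obtain v5 where v5: "adj v4 v5" "gdist adj v0 v5 = 4"
    by (metis insertI1 insertI2)
  obtain v6 where v6: "adj v6 v5" "gdist adj v0 v6 = 3" using gdist_pred[of v0 v5 3] v5 by auto
  obtain v7 where v7: "adj v7 v6" "gdist adj v0 v7 = 2" using gdist_pred[of v0 v6 2] v6 by auto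
  obtain v8 where v8: "adj v8 v7" "adj v0 v8" using gdist_pred[of v0 v7 1] v7 by auto
  \<comment> \<open>Otherwise \<open>v5\<close> is within distance 3 of \<open>v1\<close>. The
    vertex \<open>v4\<close> has distance 3 from \<open>v1\<close>, and of its neighbours only
    \<open>v3\<close> is that close, so \<open>v5 = v3\<close>; but these two have different
    distances from \<open>v0\<close>.\<close>
  have "v8 \<noteq> v1"
  proof
    assume "v8 = v1"
    then have "gdist adj v1 v7 = 1" using v8 by simp
    then have le: "gdist adj v1 v5 \<le> 3" using gdist_step[OF v7(1), of v1] gdist_step[OF v6(1), of v1] by linarith
    have three: "3 \<in> {1,2,3::nat}" by simp
    obtain p u w where *: "\<And>w'. adj v4 w' \<longleftrightarrow> w' \<in> {p,u,w}"
      "gdist adj v1 p = 2" "gdist adj v1 u = 4" "gdist adj v1 w = 4"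
      by (rule nbs_low[OF e3 three]) simp
    have "v3 \<in> {p,u,w}" using *(1)[of v3] assms(4) adj_sym[of v3 v4] by blast
    then have "v3 = p" using e2 * by auto
    moreover have "v5 \<in> {p,u,w}" using *(1)[of v5] v5 by blast
    ultimately have "v5 = v3" using le * by auto
    then show False using v5 d3 by simp
  qed
  moreover have "v8 \<noteq> v6" "v7 \<noteq> v0" using v6 v7 v8 gdist_1[of v0 v8] gdist_0[of v0 v0] by force+
  ultimately show ?thesis using v5 v6 v7 v8 d3 d4 d2
    by (intro that[of v5 v6 v7 v8]) (auto simp: adj_sym[of v4] adj_sym[of v5 v6] adj_sym[of v6 v7] adj_sym[of v7 v8]
        adj_sym[of v8 v0])
qed

end

section \<open>The columns over a base vertex\<close>

locale rooted_biggs_smith = biggs_smith adj for adj :: "'n::finite \<Rightarrow> 'n \<Rightarrow> bool" +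
  fixes x :: 'n
begin

text \<open>Being on level 1 has to remain a numerical statement in what follows, instead of being
  rewritten to adjacency with \<open>x\<close>.\<close>

declare gdist_1 [simp del]

abbreviation "lev \<equiv> gdist adj x"

text \<open>The choices are determined for \<open>par\<close> on levels 1 to 6 and for
  \<open>mate\<close> and \<open>up\<close> on levels 4 to 6. On levels 1 to 3 there are two outer
  neighbours, and on level 7 three inner ones.\<close>

definition par where "par v = (SOME w. adj v w \<and> lev w = lev v - 1)"
definition mate where "mate v = (SOME w. adj v w \<and> lev w = lev v)"
definition up where "up v = (SOME w. adj v w \<and> lev w = lev v + 1)"

lemma lev_self [simp]: "gdist adj y y = 0" by simp

lemma nb_high:
  assumes "lev v \<in> {4,5,6}"
  shows "adj v w \<longleftrightarrow> w = par v \<or> w = mate v \<or> w = up v"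
    and "lev (par v) = lev v - 1" "lev (mate v) = lev v" "lev (up v) = lev v + 1"
proof -
  obtain p a b where *: "\<And>w. adj v w \<longleftrightarrow> w \<in> {p,a,b}" "p \<noteq> a" "p \<noteq> b" "a \<noteq> b"
    "lev p = lev v - 1" "lev a = lev v" "lev b = lev v + 1"
    by (rule nbs_high[OF refl assms]) (rule that; assumption)
  have "lev v > 0" using assms by auto
  then have "\<And>w. adj v w \<and> lev w = lev v - 1 \<longleftrightarrow> w = p"
      "\<And>w. adj v w \<and> lev w = lev v \<longleftrightarrow> w = a"
    "\<And>w. adj v w \<and> lev w = lev v + 1 \<longleftrightarrow> w = b" using * by auto
  then have "par v = p" "mate v = a" "up v = b"
    unfolding par_def mate_def up_def by simp_all
  then show "adj v w \<longleftrightarrow> w = par v \<or> w = mate v \<or> w = up v"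
    and "lev (par v) = lev v - 1" "lev (mate v) = lev v" "lev (up v) = lev v + 1"
    using *(1,5-) by simp_all
qed

lemma nb_low:
  assumes "lev v \<in> {1,2,3}"
  shows "adj v (par v)" "lev (par v) = lev v - 1" "adj v w \<Longrightarrow> lev w = lev v - 1 \<Longrightarrow> w = par v"
    and "adj v w \<Longrightarrow> w \<noteq> par v \<Longrightarrow> lev w = lev v + 1"
proof -
  obtain p a b where *: "\<And>w. adj v w \<longleftrightarrow> w \<in> {p,a,b}" "p \<noteq> a" "p \<noteq> b" "a \<noteq> b"
    "lev p = lev v - 1" "lev a = lev v + 1" "lev b = lev v + 1"
    by (rule nbs_low[OF refl assms]) (rule that; assumption)
  have "lev v > 0" using assms by auto
  then have "\<And>w. adj v w \<and> lev w = lev v - 1 \<longleftrightarrow> w = p" using * by auto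
  then have "par v = p"
    unfolding par_def by simp
  then show "adj v (par v)" "lev (par v) = lev v - 1" "adj v w \<Longrightarrow> lev w = lev v - 1 \<Longrightarrow> w = par v"
    and "adj v w \<Longrightarrow> w \<noteq> par v \<Longrightarrow> lev w = lev v + 1"
    using * by auto
qed

lemma lev_cases:
  assumes "1 \<le> lev v" "lev v \<le> 6" shows "lev v \<in> {1,2,3} \<or> lev v \<in> {4,5,6}"
proof -
  have "lev v = 1 \<or> lev v = 2 \<or> lev v = 3 \<or> lev v = 4 \<or> lev v = 5 \<or> lev v = 6"
    using assms by linarith
  then show ?thesis by blast
qed

lemma adj_par: "1 \<le> lev v \<Longrightarrow> lev v \<le> 6 \<Longrightarrow> adj v (par v)"
  using lev_cases[of v] nb_low(1)[of v] nb_high(1)[of v "par v"] by blast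

lemma lev_par: "1 \<le> lev v \<Longrightarrow> lev v \<le> 6 \<Longrightarrow> lev (par v) = lev v - 1"
  using lev_cases[of v] nb_low(2)[of v] nb_high(2)[of v] by blast

lemma par_eq:
  assumes "adj v w" "lev v = lev w + 1" "lev v \<le> 6"
  shows "par v = w"
proof -
  have "lev v \<in> {1,2,3} \<or> lev v \<in> {4,5,6}" using assms by (intro lev_cases) auto
  then show ?thesis
  proof
    assume "lev v \<in> {1,2,3}" from nb_low(3)[OF this assms(1)] assms show ?thesis by simp
  next
    assume h: "lev v \<in> {4,5,6}"
    from nb_high[OF h] assms h show ?thesis by force
  qed
qed

lemma adj_low:
  assumes "lev v \<in> {1,2,3}"
  shows "adj v w \<longleftrightarrow> w = par v \<or> lev w = lev v + 1 \<and> par w = v"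
proof
  assume a: "adj v w"
  show "w = par v \<or> lev w = lev v + 1 \<and> par w = v"
    using nb_low(4)[OF assms a] par_eq[of w v] a adj_sym[of v w] assms by fastforce
next
  assume "w = par v \<or> lev w = lev v + 1 \<and> par w = v"
  then show "adj v w"
  proof
    assume "lev w = lev v + 1 \<and> par w = v"
    then show ?thesis using adj_par[of w] assms adj_sym[of v w] by auto
  qed (use nb_low(1)[OF assms] in simp)
qed

lemma adj_0: "adj x w \<longleftrightarrow> lev w = 1" by (simp add: gdist_1)

lemma children:
  assumes "lev v \<in> {1,2,3}"
  obtains a b where "a \<noteq> b" "\<And>w. lev w = lev v + 1 \<and> par w = v \<longleftrightarrow> w = a \<or> w = b"
proof -
  obtain p a b where *: "\<And>w. adj v w \<longleftrightarrow> w \<in> {p,a,b}" "p \<noteq> a" "p \<noteq> b" "a \<noteq> b"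
    "lev p = lev v - 1" "lev a = lev v + 1" "lev b = lev v + 1"
    by (rule nbs_low[OF refl assms]) (rule that; assumption)
  have "lev w = lev v + 1 \<and> par w = v \<longleftrightarrow> w = a \<or> w = b" for w
    using *(1)[of w] *(5,6,7) adj_low[OF assms, of w] assms nb_low(2)[OF assms] by auto
  then show ?thesis using that *(4) by blast
qed

text \<open>A vertex \<open>u\<close> of level 4 carries a column \<open>u, up u, up (up u)\<close> that ends in a
    vertex of level 7.
  Levels 4, 5 and 6 each induce a perfect matching; transported to level 4 along the columns, these
  are the involutions \<open>mate\<close>, \<open>m5\<close> and \<open>m6\<close>.\<close>

definition "m5 u = par (mate (up u))"
definition "m6 u = par (par (mate (up (up u))))"
definition "apex u = up (up (up u))"

text \<open>The parent lies on level 4 or 5, where the outer neighbour is unique.\<close>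

lemma up_par:
  assumes "lev v \<in> {5,6}" shows "up (par v) = v"
proof -
  have "adj (par v) v" "lev (par v) = lev v - 1" using assms adj_par[of v] lev_par[of v] adj_sym by auto
  then show ?thesis using assms nb_high[of "par v"] by fastforce
qed

lemma col_facts:
  assumes "lev u = 4"
  shows "lev (up u) = 5" "lev (up (up u)) = 6" "lev (apex u) = 7" "lev (mate u) = 4" "lev (par u) = 3"
    "lev (m5 u) = 4" "lev (m6 u) = 4" "lev (mate (up u)) = 5" "lev (mate (up (up u))) = 6"
    "par (up u) = u" "par (up (up u)) = up u" "up (m5 u) = mate (up u)" "up (up (m6 u)) = mate (up (up u))"
proof -
  show l: "lev (up u) = 5" "lev (mate u) = 4" "lev (par u) = 3" using nb_high(2-)[of u] assms by auto
  show l6: "lev (up (up u)) = 6" "lev (mate (up u)) = 5" using nb_high(2-)[of "up u"] l by auto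
  show l7: "lev (apex u) = 7" "lev (mate (up (up u))) = 6" unfolding apex_def using nb_high(2-)[of "up (up u)"] l6 by auto
  show "lev (m5 u) = 4" "lev (m6 u) = 4" "up (m5 u) = mate (up u)" "up (up (m6 u)) = mate (up (up u))"
    unfolding m5_def m6_def using l6 l7 by (simp_all add: lev_par up_par)
  show "par (up u) = u" "par (up (up u)) = up u"
    using par_eq[of "up u" u] par_eq[of "up (up u)" "up u"] nb_high(1)[of u] nb_high(1)[of "up u"] assms l l6 adj_sym by auto
qed

lemma mate_mate: assumes "lev v \<in> {4,5,6}" shows "mate (mate v) = v"
proof -
  have "adj (mate v) v" "lev (mate v) = lev v" using nb_high[OF assms] adj_sym by auto
  then show ?thesis using nb_high[of "mate v"] assms by fastforce
qed

lemma m_invol: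
  assumes "lev u = 4" shows "m5 (m5 u) = u" "m6 (m6 u) = u" "mate (mate u) = u"
  using col_facts[OF assms] by (simp_all add: m5_def[of "m5 u"] m6_def[of "m6 u"] mate_mate assms)

lemma adj_4: "lev u = 4 \<Longrightarrow> adj u w \<longleftrightarrow> w = par u \<or> w = mate u \<or> w = up u"
  using nb_high(1)[of u] by simp
lemma adj_5: "lev u = 4 \<Longrightarrow> adj (up u) w \<longleftrightarrow> w = u \<or> w = up (m5 u) \<or> w = up (up u)"
  using nb_high(1)[of "up u"] col_facts[of u] by simp
lemma adj_6: "lev u = 4 \<Longrightarrow> adj (up (up u)) w \<longleftrightarrow> w = up u \<or> w = up (up (m6 u))
    \<or> w = apex u"
  using nb_high(1)[of "up (up u)"] col_facts[of u] by (simp add: apex_def)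

lemma up_inj:
  assumes "lev u = 4" "lev v = 4" shows "up u = up v \<longleftrightarrow> u = v"
proof
  assume e: "up u = up v"
  have "u = par (up u)" by (rule col_facts(10)[OF assms(1), symmetric])
  also have "\<dots> = v" unfolding e by (rule col_facts(10)[OF assms(2)])
  finally show "u = v" .
qed simp

lemma upup_inj:
  assumes "lev u = 4" "lev v = 4" shows "up (up u) = up (up v) \<longleftrightarrow> u = v"
proof
  assume e: "up (up u) = up (up v)"
  have "up u = par (up (up u))" by (rule col_facts(11)[OF assms(1), symmetric])
  also have "\<dots> = up v" unfolding e by (rule col_facts(11)[OF assms(2)])
  finally show "u = v" using up_inj[OF assms] by simp
qed simp

lemma lev_gap: "adj a b \<Longrightarrow> lev a \<le> lev b + 1 \<and> lev b \<le> lev a + 1"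
  using gdist_step[of a b x] gdist_step[of b a x] adj_sym[of a b] by simp

text \<open>A table for the nine-cycle arguments: there the candidates for two consecutive vertices
  are known, and the table tells which pairs of candidates are adjacent.\<close>

lemma adj_cols:
  assumes "lev a = 4" "lev b = 4"
  shows "adj (up a) (up b) \<longleftrightarrow> m5 a = b" "adj (up (up a)) (up b) \<longleftrightarrow> a = b"
      "adj (up b) (up (up a)) \<longleftrightarrow> a = b"
    "adj (up (up a)) (up (up b)) \<longleftrightarrow> m6 a = b" "adj a (up b) \<longleftrightarrow> a = b"
        "adj (up b) a \<longleftrightarrow> a = b" "adj a b \<longleftrightarrow> mate a = b"
    "\<not> adj (par a) (up b)" "\<not> adj (up b) (par a)" "\<not> adj (par a) (par b)"
    "\<not> adj a (up (up b))" "\<not> adj (up (up b)) a" "\<not> adj (par a) (up (up b))" "\<not> adj (up (up b)) (par a)"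
proof -
  note ca = col_facts(1-7)[OF assms(1)] and cb = col_facts(1-7)[OF assms(2)]
  have l6: "lev (up (up (m6 a))) = 6" and l5: "lev (up (m5 b)) = 5" using col_facts(1,2) ca cb by blast+
  have l5a: "lev (up (m5 a)) = 5" using col_facts(1) ca by blast
  have ne: "lev p \<noteq> lev q \<Longrightarrow> p \<noteq> q" for p q by auto
  have n: "up b \<noteq> a" "up b \<noteq> up (up a)" "up b \<noteq> up (up (m6 a))" "up b \<noteq> apex a"
      "up (up b) \<noteq> up a" "up (up b) \<noteq> apex a"
    "a \<noteq> up (m5 b)" "a \<noteq> up (up b)" "b \<noteq> par a" "b \<noteq> up a"
    by (rule ne; simp only: ca cb l6 l5 assms; simp)+
  show "adj (up a) (up b) \<longleftrightarrow> m5 a = b" using adj_5[OF assms(1)] n up_inj[OF ca(6) assms(2)] by auto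
  show 1: "adj (up (up a)) (up b) \<longleftrightarrow> a = b" using adj_6[OF assms(1)] n up_inj[OF assms] by auto
  show "adj (up b) (up (up a)) \<longleftrightarrow> a = b" using 1 adj_sym by blast
  show "adj (up (up a)) (up (up b)) \<longleftrightarrow> m6 a = b" using adj_6[OF assms(1)] n upup_inj[OF ca(7) assms(2)] by auto
  show 2: "adj (up b) a \<longleftrightarrow> a = b" using adj_5[OF assms(2)] n by auto
  show "adj a (up b) \<longleftrightarrow> a = b" using 2 adj_sym by blast
  show "adj a b \<longleftrightarrow> mate a = b" using adj_4[OF assms(1)] n by auto
  have gap: "lev p + 1 < lev q \<or> lev q + 1 < lev p \<Longrightarrow> \<not> adj p q" for p q using lev_gap[of p q] by linarith
  show "\<not> adj (par a) (up b)" "\<not> adj (up b) (par a)" "\<not> adj a (up (up b))" "\<not> adj (up (up b)) a"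
    "\<not> adj (par a) (up (up b))" "\<not> adj (up (up b)) (par a)"
    by (rule gap; simp only: ca cb assms; simp)+
  show "\<not> adj (par a) (par b)" using adj_low[of "par a" "par b"] ca cb lev_par[of "par a"] by auto
qed

lemma adj_7:
  assumes "lev u = 4" shows "adj (apex u) w \<longleftrightarrow> (\<exists>v. lev v = 4 \<and> w = up (up v) \<and>
      apex v = apex u)"
proof
  assume a: "adj (apex u) w"
  have l7: "lev (apex u) = 7" using col_facts[OF assms] by simp
  then have l6: "lev w = 6" using nbs_7 a by blast
  define v where "v = par (par w)"
  have v: "lev v = 4" "up (up v) = w" unfolding v_def using l6 by (simp_all add: lev_par up_par)
  have "adj (up (up v)) (apex u)" using a v adj_sym by auto
  then have "apex u = up v \<or> apex u = up (up (m6 v)) \<or> apex u = apex v" using adj_6[of v "apex u"] v by simp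
  moreover have "lev (up v) = 5" "lev (up (up (m6 v))) = 6" using col_facts[of v] col_facts[of "m6 v"] v by simp_all
  ultimately have "apex v = apex u" using l7 by auto
  then show "\<exists>v. lev v = 4 \<and> w = up (up v) \<and> apex v = apex u" using v by blast
next
  assume "\<exists>v. lev v = 4 \<and> w = up (up v) \<and> apex v = apex u"
  then obtain v where v: "lev v = 4" "w = up (up v)" "apex v = apex u" by blast
  then have "adj w (apex u)" using adj_6[of v "apex u"] by simp
  then show "adj (apex u) w" using adj_sym by blast
qed

text \<open>All three neighbours of a vertex on level 7 lie on level 6, and each of them is the top
  of exactly one column.\<close>

lemma apex_fibre:
  assumes "lev u = 4" shows "card {v. lev v = 4 \<and> apex v = apex u} = 3"
proof -
  have "{w. adj (apex u) w} = (\<lambda>v. up (up v)) ` {v. lev v = 4 \<and> apex v = apex u}"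
    using adj_7[OF assms] by blast
  moreover have "inj_on (\<lambda>v. up (up v)) {v. lev v = 4 \<and> apex v = apex u}"
    by (rule inj_onI) (simp add: upup_inj)
  ultimately have "card {w. adj (apex u) w} = card {v. lev v = 4 \<and> apex v = apex u}" using card_image by simp
  then show ?thesis using card_nb[of "apex u"] by simp
qed

section \<open>Nine-cycles translated into properties of the involutions on level 4\<close>

abbreviation "pp u \<equiv> par (par u)"
abbreviation "ppp u \<equiv> par (par (par u))"

text \<open>The nine-cycle through \<open>y\<close>, \<open>x\<close>, \<open>pp l\<close>,
  \<open>par l\<close>, \<open>l\<close> must climb from \<open>y\<close> and from \<open>l\<close>
  to level 4, and its last edge is then an edge inside level 4.\<close>

lemma cyc1:
  assumes "lev l = 3" "lev y = 1" "y \<noteq> pp l"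
  shows "\<exists>u. lev u = 4 \<and> par u = l \<and> ppp (mate u) = y"
proof -
  have l: "lev (par l) = 2" "lev (pp l) = 1" "adj l (par l)" "adj (par l) (pp l)"
    using assms lev_par adj_par by auto
  have n: "y \<noteq> pp l" "x \<noteq> par l" "pp l \<noteq> l" using l assms by auto
  have a: "adj y x" "adj x (pp l)" "adj (pp l) (par l)" "adj (par l) l" using l assms adj_0 adj_sym by blast+
  obtain v5 v6 v7 v8 where *: "adj l v5" "adj v5 v6" "adj v6 v7" "adj v7 v8" "adj v8 y"
    "v5 \<noteq> par l" "v6 \<noteq> l" "v7 \<noteq> v5" "v8 \<noteq> v6" "v7 \<noteq> y" "v8 \<noteq> x"
    by (rule nine_cycle[OF a n]) (rule that; assumption)
  have "par y = x" using lev_par[of y] assms by simp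
  then have 8: "lev v8 = 2" "par v8 = y" using *(5,11) adj_low[of y v8] assms adj_sym[of v8 y] by auto
  have 7: "lev v7 = 3" "par v7 = v8" using *(4,10) adj_low[of v8 v7] 8 adj_sym[of v7 v8] by auto
  have 6: "lev v6 = 4" "par v6 = v7" using *(3,9) adj_low[of v7 v6] 7 adj_sym[of v6 v7] by auto
  have 5: "lev v5 = 4" "par v5 = l" using *(1,6) adj_low[of l v5] assms by auto
  have "v6 = mate v5" using *(2,7) adj_4[of v5 v6] 5 6 col_facts[of v5] by auto
  then show ?thesis using 5 6 7 8 by blast
qed

text \<open>The nine-cycle through \<open>w\<close>, \<open>par w\<close>, \<open>x\<close>,
  \<open>par w'\<close>, \<open>w'\<close> climbs two levels on either side and closes with an edge
  inside level 4.\<close>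

lemma cyc2:
  assumes "lev w = 2" "lev w' = 2" "par w \<noteq> par w'"
  shows "\<exists>u. lev u = 4 \<and> pp u = w \<and> pp (mate u) = w'"
proof -
  have l: "lev (par w) = 1" "lev (par w') = 1" "adj w (par w)" "adj w' (par w')"
    using assms lev_par adj_par by auto
  have n: "w \<noteq> x" "par w \<noteq> par w'" "x \<noteq> w'" using assms by auto
  have a: "adj w (par w)" "adj (par w) x" "adj x (par w')" "adj (par w') w'" using l adj_0 adj_sym by blast+
  obtain v5 v6 v7 v8 where *: "adj w' v5" "adj v5 v6" "adj v6 v7" "adj v7 v8" "adj v8 w"
    "v5 \<noteq> par w'" "v6 \<noteq> w'" "v7 \<noteq> v5" "v8 \<noteq> v6" "v7 \<noteq> w" "v8 \<noteq> par w"
    by (rule nine_cycle[OF a n]) (rule that; assumption)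
  have 8: "lev v8 = 3" "par v8 = w" using *(5,11) adj_low[of w v8] assms adj_sym[of v8 w] by auto
  have 7: "lev v7 = 4" "par v7 = v8" using *(4,10) adj_low[of v8 v7] 8 adj_sym[of v7 v8] by auto
  have 5: "lev v5 = 3" "par v5 = w'" using *(1,6) adj_low[of w' v5] assms by auto
  have 6: "lev v6 = 4" "par v6 = v5" using *(2,7) adj_low[of v5 v6] 5 by auto
  have "v6 = mate v7" using *(3) adj_4[of v7 v6] 7 6 col_facts[of v7] adj_sym[of v6 v7] by auto
  then show ?thesis using 5 6 7 8 by blast
qed

lemma sib_ex:
  assumes "lev u = 4"
  obtains q where "lev q = 4" "q \<noteq> u" "par q = par u"
      "\<And>v. lev v = 4 \<Longrightarrow> par v = par u \<Longrightarrow> v = u \<or> v = q"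
proof -
  have "lev (par u) \<in> {1,2,3}" using col_facts[OF assms] by simp
  from children[OF this] obtain a b where ab: "a \<noteq> b"
      "\<And>w. lev w = lev (par u) + 1 \<and> par w = par u \<longleftrightarrow> w = a \<or> w = b"
    by blast
  have "lev (par u) + 1 = 4" using col_facts[OF assms] by simp
  then have *: "\<And>w. lev w = 4 \<and> par w = par u \<longleftrightarrow> w = a \<or> w = b" using ab by simp
  then have "u = a \<or> u = b" using assms by blast
  then show ?thesis using that[of a] that[of b] ab(1) * by metis
qed

text \<open>By \<open>cyc1\<close> the two children of a vertex on level 3 have to provide edges
  into both of the other branches at \<open>x\<close>. There are only two children, so each serves
  one of these branches.\<close>

lemma sib_branches:
  assumes "lev u = 4" "lev q = 4" "par q = par u" "q \<noteq> u"
  shows "ppp (mate u) \<noteq> ppp u" "ppp (mate u) \<noteq> ppp (mate q)"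
proof -
  let ?l = "par u"
  have l: "lev ?l = 3" "lev (pp ?l) = 1" using assms by (simp_all add: lev_par)
  obtain a b c where abc: "\<And>w. adj x w \<longleftrightarrow> w \<in> {a,b,c}" "a \<noteq> b" "a \<noteq> c" "b \<noteq> c"
    by (rule nbs_0[of x]) (rule that; assumption)
  have l1: "lev w = 1 \<longleftrightarrow> w \<in> {a,b,c}" for w using abc(1) adj_0 by simp
  obtain y1 y2 where y: "lev y1 = 1" "lev y2 = 1" "y1 \<noteq> y2" "y1 \<noteq> pp ?l" "y2 \<noteq> pp ?l"
    using l(2) abc(2-) unfolding l1 by auto
  obtain q' where q': "\<And>v. lev v = 4 \<Longrightarrow> par v = par u \<Longrightarrow> v = u \<or> v = q'"
    using sib_ex[OF assms(1)] by metis
  have qq: "\<And>v. lev v = 4 \<Longrightarrow> par v = par u \<Longrightarrow> v = u \<or> v = q" using q' assms by metis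
  obtain u1 where u1: "lev u1 = 4" "par u1 = ?l" "ppp (mate u1) = y1" using cyc1[OF l(1) y(1,4)] by blast
  obtain u2 where u2: "lev u2 = 4" "par u2 = ?l" "ppp (mate u2) = y2" using cyc1[OF l(1) y(2,5)] by blast
  have "u1 \<noteq> u2" using u1 u2 y by auto
  then have "u = u1 \<and> q = u2 \<or> u = u2 \<and> q = u1" using qq[OF u1(1,2)] qq[OF u2(1,2)] by auto
  then show "ppp (mate u) \<noteq> ppp u" "ppp (mate u) \<noteq> ppp (mate q)" using u1 u2 y by auto
qed

lemma mate_branch: "lev u = 4 \<Longrightarrow> ppp (mate u) \<noteq> ppp u"
  using sib_ex[of u] sib_branches(1)[of u] by metis

text \<open>The given path stays inside one branch at \<open>x\<close>. Each end of the nine-cycle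
  continues over level 4 either by \<open>mate\<close> or by \<open>up\<close>; mates leave the
  branch, so both sides go up, and the closing edge lies inside level 5.\<close>

lemma cyc3:
  assumes "lev l = 3" "lev l' = 3" "par l \<noteq> par l'" "pp l = pp l'"
  shows "\<exists>u. lev u = 4 \<and> par u = l \<and> par (m5 u) = l'"
proof -
  have l: "lev (par l) = 2" "lev (par l') = 2" "lev (pp l) = 1" "adj l (par l)" "adj l' (par l')" "adj (par l) (pp l)"
      "adj (par l') (pp l)"
    using assms lev_par[of l] lev_par[of l'] lev_par[of "par l"] adj_par[of l] adj_par[of l'] adj_par[of "par l"]
        adj_par[of "par l'"] by auto
  have n: "l \<noteq> pp l" "par l \<noteq> par l'" "pp l \<noteq> l'" using assms l by auto
  have a: "adj l (par l)" "adj (par l) (pp l)" "adj (pp l) (par l')" "adj (par l') l'" using l adj_sym by blast+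
  obtain v5 v6 v7 v8 where *: "adj l' v5" "adj v5 v6" "adj v6 v7" "adj v7 v8" "adj v8 l"
    "v5 \<noteq> par l'" "v6 \<noteq> l'" "v7 \<noteq> v5" "v8 \<noteq> v6" "v7 \<noteq> l" "v8 \<noteq> par l"
    by (rule nine_cycle[OF a n]) (rule that; assumption)
  have 8: "lev v8 = 4" "par v8 = l" using *(5,11) adj_low[of l v8] assms adj_sym[of v8 l] by auto
  have 5: "lev v5 = 4" "par v5 = l'" using *(1,6) adj_low[of l' v5] assms by auto
  have 6: "v6 = mate v5 \<or> v6 = up v5" using *(2,7) adj_4[of v5 v6] 5 by auto
  have 7: "v7 = mate v8 \<or> v7 = up v8" using *(4,10) adj_4[of v8 v7] adj_sym[of v7 v8] 8 by auto
  have m: "lev (mate v5) = 4" "lev (mate v8) = 4" using 5 8 col_facts(4) by blast+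
  have nb: "mate v5 \<noteq> v8" using mate_branch[OF 5(1)] 5 8 assms by auto
  have nb': "mate v8 \<noteq> v5" using mate_branch[OF 8(1)] 5 8 assms by auto
  have "v6 = up v5 \<and> v7 = up v8"
    using 6 7 *(3) nb nb' adj_cols(7)[OF m] adj_cols(5)[OF m(1) 8(1)] adj_cols(6)[OF m(2) 5(1)] m_invol(3)[OF 5(1)] by metis
  then have "m5 v8 = v5" using adj_cols(1)[OF 8(1) 5(1)] *(3) adj_sym[of v6 v7] by simp
  then show ?thesis using 5 8 by blast
qed

text \<open>The other level-2 vertex of the branch has two children, and \<open>cyc3\<close>
  connects \<open>par u\<close> with each of them through a different child of \<open>par u\<close>.
  So \<open>u\<close> is one of the two children used.\<close>

lemma m5_branch:
  assumes "lev u = 4" shows "pp (m5 u) \<noteq> pp u" "ppp (m5 u) = ppp u"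
proof -
  let ?l = "par u" let ?w = "pp u"
  have l: "lev ?l = 3" "lev ?w = 2" "lev (par ?w) = 1" using assms by (simp_all add: lev_par)
  have "lev (par ?w) \<in> {1,2,3}" using l by simp
  from children[OF this] obtain a b where ab: "a \<noteq> b"
      "\<And>v. lev v = lev (par ?w) + 1 \<and> par v = par ?w \<longleftrightarrow> v = a \<or> v = b"
    by blast
  have e: "lev (par ?w) + 1 = 2" using l(3) by simp
  have "\<And>v. lev v = 2 \<and> par v = par ?w \<longleftrightarrow> v = a \<or> v = b" using ab(2) unfolding e .
  then obtain w' where w': "lev w' = 2" "w' \<noteq> ?w" "par w' = par ?w" using ab(1) by metis
  have "lev w' \<in> {1,2,3}" using w' by simp
  from children[OF this] obtain l1 l2 where l12: "l1 \<noteq> l2"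
      "\<And>w. lev w = lev w' + 1 \<and> par w = w' \<longleftrightarrow> w = l1 \<or> w = l2"
    by blast
  have l12': "lev l1 = 3" "par l1 = w'" "lev l2 = 3" "par l2 = w'" using l12(2)[of l1] l12(2)[of l2] w'(1) by auto
  obtain u1 where u1: "lev u1 = 4" "par u1 = ?l" "par (m5 u1) = l1" using cyc3[of ?l l1] l12' l w' by auto
  obtain u2 where u2: "lev u2 = 4" "par u2 = ?l" "par (m5 u2) = l2" using cyc3[of ?l l2] l12' l w' by auto
  obtain q' where q': "\<And>v. lev v = 4 \<Longrightarrow> par v = par u \<Longrightarrow> v = u \<or> v = q'"
    using sib_ex[OF assms(1)] by metis
  have "u = u1 \<or> u = u2" using q' u1 u2 l12(1) by metis
  then show "pp (m5 u) \<noteq> pp u" "ppp (m5 u) = ppp u" using u1 u2 l12' w' by auto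
qed

text \<open>The path joins two vertices of level 4 over the same level-2 vertex. Both sides of the
  cycle leave by \<open>mate\<close> or both by \<open>up\<close>, which gives the two alternatives;
  the mixed cases would make \<open>u\<close> and \<open>u'\<close> mates, although they lie in the
  same branch. In the last case \<open>m5_branch\<close> rules out the shortcuts through level
  5.\<close>

lemma cyc4:
  assumes "lev u = 4" "lev u' = 4" "par u \<noteq> par u'" "pp u = pp u'"
  shows "m6 u = u' \<or> m5 (mate u) = mate u'"
proof -
  note c = col_facts(1-9)[OF assms(1)] and c' = col_facts(1-9)[OF assms(2)]
  have l: "lev (pp u) = 2" "adj u (par u)" "adj u' (par u')" "adj (par u) (pp u)" "adj (par u') (pp u)"
    using assms lev_par[of u] lev_par[of u'] lev_par[of "par u"] adj_par[of u] adj_par[of u'] adj_par[of "par u"]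
        adj_par[of "par u'"] by auto
  have n: "u \<noteq> pp u" "par u \<noteq> par u'" "pp u \<noteq> u'" using assms l by auto
  have a: "adj u (par u)" "adj (par u) (pp u)" "adj (pp u) (par u')" "adj (par u') u'" using l adj_sym by blast+
  obtain v5 v6 v7 v8 where *: "adj u' v5" "adj v5 v6" "adj v6 v7" "adj v7 v8" "adj v8 u"
    "v5 \<noteq> par u'" "v6 \<noteq> u'" "v7 \<noteq> v5" "v8 \<noteq> v6" "v7 \<noteq> u" "v8 \<noteq> par u"
    by (rule nine_cycle[OF a n]) (rule that; assumption)
  have 5: "v5 = mate u' \<or> v5 = up u'" using adj_4[OF assms(2), of v5] *(1,6) by blast
  have 8: "v8 = mate u \<or> v8 = up u" using adj_4[OF assms(1), of v8] *(5,11) adj_sym[of u v8] by blast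
  have ne: "u \<noteq> u'" using assms by auto
  have nb1: "mate u' \<noteq> u" using mate_branch[OF assms(2)] assms(4) by (metis)
  have nb2: "mate u \<noteq> u'" using mate_branch[OF assms(1)] assms(4) by (metis)
  have nb3: "m5 u \<noteq> u'" using m5_branch(1)[OF assms(1)] assms(4) by (metis)
  note nb = nb1 nb2 nb3
  have v6m: "v6 = par (mate u') \<or> v6 = up (mate u')" if "v5 = mate u'"
    using adj_4[OF c'(4), of v6] *(2,7) that m_invol(3)[OF assms(2)] by metis
  have v7m: "v7 = par (mate u) \<or> v7 = up (mate u)" if "v8 = mate u"
    using adj_4[OF c(4), of v7] *(4,10) that m_invol(3)[OF assms(1)] adj_sym[of v7 v8] by metis
  have v6u: "v6 = up (m5 u') \<or> v6 = up (up u')" if "v5 = up u'"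
    using adj_5[OF assms(2), of v6] *(2,7) that by metis
  have v7u: "v7 = up (m5 u) \<or> v7 = up (up u)" if "v8 = up u"
    using adj_5[OF assms(1), of v7] *(4,10) that adj_sym[of v7 v8] by metis
  note l4 = assms(1,2) c(4) c'(4) c(6) c'(6)
  have inj5: "m5 a = m5 b \<Longrightarrow> lev a = 4 \<Longrightarrow> lev b = 4 \<Longrightarrow> a = b" for a b
    by (metis m_invol(1))
  consider "v5 = mate u'" "v8 = mate u" | "v5 = mate u'" "v8 = up u" | "v5 = up u'" "v8 = mate u" | "v5 = up u'" "v8 = up u"
    using 5 8 by blast
  then show ?thesis
  proof cases
    case 1
    have "v6 = up (mate u')" "v7 = up (mate u)"
      using v6m[OF 1(1)] v7m[OF 1(2)] *(3) adj_cols(8,9,10)[OF c'(4) c(4)] adj_cols(8,9,10)[OF c(4) c'(4)] by blast+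
    then have "m5 (mate u) = mate u'" using adj_cols(1)[OF c(4) c'(4)] *(3) adj_sym[of v6 v7] by simp
    then show ?thesis by simp
  next
    case 2
    have "v6 = up (mate u')" using v6m[OF 2(1)] v7u[OF 2(2)] *(3) adj_cols(8)[OF c'(4) c(6)] adj_cols(13)[OF c'(4)
        assms(1)] by blast
    then have "m5 (mate u') = m5 u \<or> u = mate u'"
      using v7u[OF 2(2)] *(3) adj_cols(1)[OF c'(4) c(6)] adj_cols(3)[OF assms(1) c'(4)] by blast
    then have "mate u' = u" using inj5[of "mate u'" u] c'(4) assms(1) by blast
    then show ?thesis using nb by blast
  next
    case 3
    have "v7 = up (mate u)" using v7m[OF 3(2)] v6u[OF 3(1)] *(3) adj_cols(9)[OF c(4) c'(6)] adj_cols(14)[OF c(4)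
        assms(2)] by blast
    then have "m5 (mate u) = m5 u' \<or> u' = mate u"
      using v6u[OF 3(1)] *(3) adj_sym[of v6 v7] adj_cols(1)[OF c(4) c'(6)] adj_cols(2)[OF assms(2) c(4)] by blast
    then have "mate u = u'" using inj5[of "mate u" u'] c(4) assms(2) by blast
    then show ?thesis using nb by blast
  next
    case 4
    have "m5 (m5 u) = m5 u' \<or> u' = m5 u \<or> u = m5 u' \<or> m6 u = u'"
      using v6u[OF 4(1)] v7u[OF 4(2)] *(3) adj_sym[of v6 v7] adj_cols(1)[OF c(6) c'(6)] adj_cols(2)[OF assms(2) c(6)]
        adj_cols(2)[OF assms(1) c'(6)] adj_cols(4)[OF assms(1,2)] by blast
    then have "m5 u = u' \<or> m6 u = u'"
      using inj5[OF _ c(6) assms(2)] m_invol(1)[OF assms(2)] by metis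
    then show ?thesis using nb(3) by blast
  qed
qed

text \<open>The two vertices of level 4 over the sibling of \<open>par u\<close> have different
  mates, so the second alternative of \<open>cyc4\<close> fails for at least one of them, and
  \<open>m6 u\<close> is that vertex.\<close>

lemma m6_branch:
  assumes "lev u = 4" shows "ppp (m6 u) = ppp u"
proof -
  have l: "lev (par u) = 3" "lev (pp u) = 2" using assms by (simp_all add: lev_par)
  have "lev (pp u) \<in> {1,2,3}" using l by simp
  from children[OF this] obtain a b where ab: "a \<noteq> b"
      "\<And>v. lev v = lev (pp u) + 1 \<and> par v = pp u \<longleftrightarrow> v = a \<or> v = b"
    by blast
  have e: "lev (pp u) + 1 = 3" using l by simp
  have "\<And>v. lev v = 3 \<and> par v = pp u \<longleftrightarrow> v = a \<or> v = b" using ab(2) unfolding e .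
  then obtain l' where l': "lev l' = 3" "l' \<noteq> par u" "par l' = pp u" using ab(1) by metis
  have "lev l' \<in> {1,2,3}" using l' by simp
  from children[OF this] obtain c d where cd: "c \<noteq> d"
      "\<And>v. lev v = lev l' + 1 \<and> par v = l' \<longleftrightarrow> v = c \<or> v = d"
    by blast
  have e: "lev l' + 1 = 4" using l' by simp
  have "\<And>v. lev v = 4 \<and> par v = l' \<longleftrightarrow> v = c \<or> v = d" using cd(2) unfolding e .
  then have c: "lev c = 4" "par c = l'" "lev d = 4" "par d = l'" by blast+
  have m: "m6 u = c \<or> m5 (mate u) = mate c" "m6 u = d \<or> m5 (mate u) = mate d"
    using cyc4[OF assms c(1)] cyc4[OF assms c(3)] c(2,4) l' by simp_all
  have "mate c \<noteq> mate d" using cd(1) m_invol(3)[OF c(1)] m_invol(3)[OF c(3)] by metis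
  then have "m6 u = c \<or> m6 u = d" using m by auto
  then show ?thesis using c l' by auto
qed

text \<open>The path climbs from \<open>par u\<close> over the edge from \<open>u\<close> to
  \<open>mate u\<close> to the top of the column of \<open>mate u\<close>. The cycle has to return
  to \<open>par u\<close> through the sibling \<open>q\<close>. It cannot use the matching on level
  6, because \<open>m5\<close> and \<open>m6\<close> preserve the branch while
  \<open>mate u\<close>, \<open>q\<close> and \<open>mate q\<close> lie in three different branches.
  So it passes through the apex.\<close>

lemma cyc5:
  assumes "lev u = 4" "lev q = 4" "par q = par u" "q \<noteq> u"
  shows "apex q = apex (mate u)"
proof -
  let ?v = "mate u"
  have v: "lev ?v = 4" using col_facts(4)[OF assms(1)] .
  note c = col_facts(1-9)[OF assms(1)] and cv = col_facts(1-9)[OF v] and cq = col_facts(1-9)[OF assms(2)]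
  have mv: "mate ?v = u" using m_invol(3)[OF assms(1)] .
  have a: "adj (par u) u" "adj u ?v" "adj ?v (up ?v)" "adj (up ?v) (up (up ?v))"
    using adj_4[OF assms(1)] adj_4[OF v] adj_5[OF v] adj_sym by blast+
  have n: "par u \<noteq> ?v" "u \<noteq> up ?v" "?v \<noteq> up (up ?v)" using c cv assms by auto
  obtain v5 v6 v7 v8 where *: "adj (up (up ?v)) v5" "adj v5 v6" "adj v6 v7" "adj v7 v8" "adj v8 (par u)"
    "v5 \<noteq> up ?v" "v6 \<noteq> up (up ?v)" "v7 \<noteq> v5" "v8 \<noteq> v6" "v7 \<noteq> par u" "v8 \<noteq> u"
    by (rule nine_cycle[OF a n]) (rule that; assumption)
  let ?w = "m6 ?v"
  have w: "lev ?w = 4" using cv by simp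
  note cw = col_facts(1-9)[OF w]
  have 5: "v5 = up (up ?w) \<or> v5 = apex ?v" using adj_6[OF v, of v5] *(1,6) by blast
  have "6 \<le> lev v5" using 5 cw(2) cv(3) by auto
  then have l6: "5 \<le> lev v6" using lev_gap[OF *(2)] by linarith
  \<comment> \<open>\<open>pp u\<close> has level 2, whereas \<open>v6\<close> has level at least 5
    and is only two edges away from \<open>v8\<close>.\<close>
  have "v8 \<noteq> pp u"
  proof
    assume "v8 = pp u"
    then have "lev v8 = 2" using assms by (simp add: lev_par)
    then show False using lev_gap[OF *(4)] lev_gap[OF *(3)] l6 by linarith
  qed
  moreover have "v8 = pp u \<or> lev v8 = 4 \<and> par v8 = par u" using adj_low[of "par u" v8] c(5) *(5) adj_sym[of v8
      "par u"] by simp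
  moreover obtain q' where q': "\<And>v. lev v = 4 \<Longrightarrow> par v = par u \<Longrightarrow> v = u \<or> v = q'"
    using sib_ex[OF assms(1)] by metis
  ultimately have 8: "v8 = q" using q'[OF assms(2,3)] q'[of v8] *(11) assms(4) by blast
  have 7: "v7 = mate q \<or> v7 = up q" using adj_4[OF assms(2), of v7] *(4,10) adj_sym[of v7 v8] 8 assms(3) by auto
  have l7: "lev v7 = 4 \<or> lev v7 = 5" using 7 cq by auto
  have br: "ppp (mate u) \<noteq> ppp u" "ppp (mate u) \<noteq> ppp (mate q)" using sib_branches[OF assms] .
  have bw: "ppp ?w = ppp ?v" using m6_branch[OF v] .
  have bm: "ppp (m5 ?w) = ppp ?v" using m5_branch(2)[OF w] bw by simp
  have bq: "ppp q = ppp u" using assms by simp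
  from 5 show ?thesis
  proof
    \<comment> \<open>Here \<open>m6 (mate u) = mate q\<close> or
      \<open>m5 (m6 (mate u)) = q\<close>. The left sides lie in the branch of
      \<open>mate u\<close>, the right sides do not.\<close>
    assume e: "v5 = up (up ?w)"
    have "up (up (m6 ?w)) \<noteq> v6" using *(7) m_invol(2)[OF v] by auto
    then have "v6 = up ?w \<or> v6 = apex ?w" using adj_6[OF w, of v6] *(2) e by blast
    moreover have "v6 \<noteq> apex ?w" using lev_gap[OF *(3)] cw(3) l7 by auto
    ultimately have "v6 = up ?w" by blast
    then have "adj (up ?w) v7" using *(3) by simp
    then have "v7 = ?w \<or> v7 = up (m5 ?w) \<or> v7 = up (up ?w)" using adj_5[OF w, of v7] by simp
    then have v7: "v7 = ?w \<or> v7 = up (m5 ?w)" using *(8) e by blast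
    have "mate q \<noteq> up (m5 ?w)" "up q \<noteq> ?w" using cq(1,4) col_facts(1)[OF cw(6)] w by auto
    then have "?w = mate q \<or> m5 ?w = q"
      using 7 v7 up_inj[OF cw(6) assms(2)] by auto
    then have False using br bw bm bq by auto
    then show ?thesis ..
  next
    assume e: "v5 = apex ?v"
    then obtain s where s: "lev s = 4" "v6 = up (up s)" "apex s = apex ?v" using adj_7[OF v, of v6] *(2) by blast
    note cs = col_facts(1-9)[OF s(1)]
    have "v7 = s \<or> v7 = up s \<or> v7 = up (up (m6 s)) \<or> v7 = apex s" using adj_6[OF s(1), of v7] *(3) s by auto
    moreover have "lev (up (up (m6 s))) = 6" using col_facts(2)[OF cs(7)] .
    moreover have "v7 \<noteq> s" using lev_gap[OF *(3)] cs(2) s(1,2) by auto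
    ultimately have "v7 = up s" using l7 cs(3) by auto
    moreover have "up s \<noteq> mate q" using cs(1) cq(4) by auto
    ultimately have "s = q" using 7 up_inj[OF s(1) assms(2)] by auto
    then show ?thesis using s by simp
  qed
qed

end

section \<open>The graph is determined up to the choice of names\<close>

text \<open>Vertex \<open>i\<close> of the standard copy has level \<open>bs_lev ! i\<close> and the neighbours listed in
  \<open>bs_nbs ! i\<close>. The numbering is by level, and within each level it is the ordering in which
  the seeds have the prescribed coordinates.\<close>

definition bs_lev :: "nat list" where
  "bs_lev = replicate 1 0 @ replicate 3 1 @ replicate 6 2 @ replicate 12 3 @ replicate 24 4 @
     replicate 24 5 @ replicate 24 6 @ replicate 8 7"

definition bs_nbs :: "(nat \<times> nat \<times> nat) list" where
  "bs_nbs = [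
   (1,2,3), (0,4,5), (0,6,7), (0,8,9), (1,10,11), (1,12,13), (2,14,15), (2,16,17), (3,18,19),
   (3,20,21), (4,22,23), (4,24,25), (5,26,27), (5,28,29), (6,30,31), (6,32,33), (7,34,35),
   (7,36,37), (8,38,39), (8,40,41), (9,42,43), (9,44,45), (10,32,46), (10,41,47), (11,45,48),
   (11,36,49), (12,30,50), (12,43,51), (13,35,52), (13,38,53), (14,26,54), (14,42,55),
   (15,22,56), (15,40,57), (16,39,58), (16,28,59), (17,25,60), (17,44,61), (18,29,62),
   (18,34,63), (19,33,64), (19,23,65), (20,31,66), (20,27,67), (21,37,68), (21,24,69),
   (22,50,70), (23,53,71), (24,51,72), (25,52,73), (26,46,74), (27,48,75), (28,49,76),
   (29,47,77), (30,59,78), (31,61,79), (32,60,80), (33,58,81), (34,57,82), (35,54,83),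
   (36,56,84), (37,55,85), (38,67,86), (39,68,87), (40,66,88), (41,69,89), (42,64,90),
   (43,62,91), (44,63,92), (45,65,93), (46,72,94), (47,73,96), (48,70,97), (49,71,95),
   (50,77,98), (51,76,101), (52,75,99), (53,74,100), (54,81,101), (55,80,98), (56,79,96),
   (57,78,94), (58,84,99), (59,85,100), (60,82,97), (61,83,95), (62,88,99), (63,89,100),
   (64,86,96), (65,87,94), (66,93,101), (67,92,98), (68,91,97), (69,90,95), (70,81,89),
   (73,85,93), (71,80,88), (72,84,92), (74,79,91), (76,82,86), (77,83,87), (75,78,90)]"

text \<open>The entry 1 is written \<open>Suc 0\<close>, the form to which the simplifier normalises
  indices, so that the lookup equations derived from this list apply.\<close>

lemma upt_102: "[0..<102] = [0, Suc 0, 2, 3, 4, 5, 6, 7, 8, 9, 10, 11, 12, 13, 14, 15, 16, 17, 18, 19,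
    20, 21, 22, 23, 24, 25, 26, 27, 28, 29, 30, 31, 32, 33, 34, 35, 36, 37, 38, 39, 40, 41, 42, 43,
    44, 45, 46, 47, 48, 49, 50, 51, 52, 53, 54, 55, 56, 57, 58, 59, 60, 61, 62, 63, 64, 65, 66, 67,
    68, 69, 70, 71, 72, 73, 74, 75, 76, 77, 78, 79, 80, 81, 82, 83, 84, 85, 86, 87, 88, 89, 90, 91,
    92, 93, 94, 95, 96, 97, 98, 99, 100, 101 :: nat]"
  by code_simp

context rooted_biggs_smith begin

lemma ex_labels:
  obtains Y W :: "nat \<Rightarrow> 'n" where
    "\<And>b. b < 3 \<Longrightarrow> lev (Y b) = 1" "\<And>b c. b < 3 \<Longrightarrow> c < 3 \<Longrightarrow> Y b = Y
        c \<Longrightarrow> b = c"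
    "\<And>y. lev y = 1 \<Longrightarrow> \<exists>b<3. y = Y b"
    "\<And>X. X < 6 \<Longrightarrow> lev (W X) = 2 \<and> par (W X) = Y (X div 2)"
    "\<And>X Z. X < 6 \<Longrightarrow> Z < 6 \<Longrightarrow> W X = W Z \<Longrightarrow> X = Z"
    "\<And>w. lev w = 2 \<Longrightarrow> \<exists>X<6. w = W X"
    "\<exists>u q. lev u = 4 \<and> lev q = 4 \<and> par q = par u \<and> q \<noteq> u \<and> pp u = W 0 \<and> pp (mate
        u) = W 2 \<and> pp (mate q) = W 4"
proof -
  obtain y0 y1 y2 where y: "\<And>w. adj x w \<longleftrightarrow> w \<in> {y0,y1,y2}" and yd: "y0 \<noteq> y1"
      "y0 \<noteq> y2" "y1 \<noteq> y2"
    by (rule nbs_0[of x]) (rule that; assumption)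
  have y1: "lev w = 1 \<longleftrightarrow> w \<in> {y0,y1,y2}" for w using y adj_0 by simp
  have ch: "\<exists>a b. a \<noteq> b \<and> (\<forall>w. lev w = 2 \<and> par w = v \<longleftrightarrow> w = a \<or>
      w = b)" if "v \<in> {y0,y1,y2}" for v
  proof -
    have l: "lev v = 1" using that y1 by blast
    then have m: "lev v \<in> {1,2,3}" and e: "lev v + 1 = 2" by simp_all
    obtain a b where "a \<noteq> b" "\<And>w. lev w = lev v + 1 \<and> par w = v \<longleftrightarrow> w = a \<or> w = b"
      by (rule children[OF m]) (rule that; assumption)
    then show ?thesis unfolding e by blast
  qed
  obtain w0 w1 where w01: "w0 \<noteq> w1" "\<And>w. lev w = 2 \<and> par w = y0 \<longleftrightarrow> w = w0 \<or> w =
      w1" using ch[of y0] by auto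
  obtain w2 w3 where w23: "w2 \<noteq> w3" "\<And>w. lev w = 2 \<and> par w = y1 \<longleftrightarrow> w = w2 \<or> w =
      w3" using ch[of y1] by auto
  obtain c d where cd: "c \<noteq> d" "\<And>w. lev w = 2 \<and> par w = y2 \<longleftrightarrow> w = c \<or> w = d"
      using ch[of y2] by auto
  have l0: "lev w0 = 2" "par w0 = y0" "lev w2 = 2" "par w2 = y1" "lev w1 = 2" "par w1 = y0" "lev w3 = 2" "par w3 = y1"
    using w01 w23 by blast+
  then obtain u where u: "lev u = 4" "pp u = w0" "pp (mate u) = w2" using cyc2[of w0 w2] yd by auto
  obtain q where q: "lev q = 4" "q \<noteq> u" "par q = par u" using sib_ex[OF u(1)] by blast
  have mq: "lev (mate q) = 4" using col_facts(4)[OF q(1)] .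
  \<comment> \<open>\<open>w0\<close> and \<open>w2\<close> are free choices in two branches, and
    then the third branch has a distinguished vertex: the one below the mate of the sibling
    \<open>q\<close>. Naming it \<open>W 4\<close> removes the last ambiguity.\<close>
  define w4 where "w4 = pp (mate q)"
  have l4: "lev w4 = 2" "lev (par w4) = 1" unfolding w4_def using mq by (simp_all add: lev_par)
  have "par w4 \<noteq> y0" using mate_branch[OF q(1)] q u l0 unfolding w4_def by simp
  moreover have "par w4 \<noteq> y1" using sib_branches(2)[OF u(1) q(1,3,2)] u l0 unfolding w4_def by simp
  ultimately have p4: "par w4 = y2" using y1[of "par w4"] l4 by auto
  then obtain w5 where w45: "w4 \<noteq> w5" "\<And>w. lev w = 2 \<and> par w = y2 \<longleftrightarrow> w = w4 \<or> w = w5"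
    using cd(1) cd(2)[of w4] cd(2) l4 by metis
  have l5: "lev w5 = 2" "par w5 = y2" using w45 by blast+
  define Y where "Y = (\<lambda>b. [y0,y1,y2] ! b)"
  define W where "W = (\<lambda>X. [w0,w1,w2,w3,w4,w5] ! X)"
  have Yv: "Y 0 = y0" "Y (Suc 0) = y1" "Y 2 = y2" by (simp_all add: Y_def)
  have Wv: "W 0 = w0" "W (Suc 0) = w1" "W 2 = w2" "W 3 = w3" "W 4 = w4" "W 5 = w5" by (simp_all add: W_def)
  have b3: "b < 3 \<Longrightarrow> b = 0 \<or> b = Suc 0 \<or> b = 2" for b :: nat by linarith
  have b6: "b < 6 \<Longrightarrow> b = 0 \<or> b = Suc 0 \<or> b = 2 \<or> b = 3 \<or> b = 4 \<or> b = 5" for b :: nat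
      by linarith
  have ne: "w0 \<noteq> w2" "w0 \<noteq> w3" "w0 \<noteq> w4" "w0 \<noteq> w5" "w1 \<noteq> w2" "w1 \<noteq> w3"
      "w1 \<noteq> w4" "w1 \<noteq> w5"
    "w2 \<noteq> w4" "w2 \<noteq> w5" "w3 \<noteq> w4" "w3 \<noteq> w5" using l0 l5 p4 yd by auto
  have ly: "lev y0 = 1" "lev y1 = 1" "lev y2 = 1" using y1 by blast+
  show ?thesis
  proof (rule that[of Y W])
    show "b < 3 \<Longrightarrow> lev (Y b) = 1" for b using b3[of b] Yv ly by auto
    show "b < 3 \<Longrightarrow> c < 3 \<Longrightarrow> Y b = Y c \<Longrightarrow> b = c" for b c using b3[of b]
        b3[of c] Yv yd by auto
    show "lev y = 1 \<Longrightarrow> \<exists>b<3. y = Y b" for y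
    proof -
      assume "lev y = 1"
      then have "y = Y 0 \<or> y = Y (Suc 0) \<or> y = Y 2" using y1[of y] Yv by auto
      moreover have "0 < (3::nat)" "Suc 0 < 3" "2 < (3::nat)" by simp_all
      ultimately show ?thesis by blast
    qed
    show "X < 6 \<Longrightarrow> lev (W X) = 2 \<and> par (W X) = Y (X div 2)" for X using b6[of X] Wv Yv l0 l4 l5 p4 by auto
    show "X < 6 \<Longrightarrow> Z < 6 \<Longrightarrow> W X = W Z \<Longrightarrow> X = Z" for X Z
    proof -
      assume h: "X < 6" "Z < 6" "W X = W Z"
      note sym = ne w01(1) w23(1) w45(1)
      from b6[OF h(1)] b6[OF h(2)] show "X = Z"
        using h(3) by (elim disjE) (simp_all add: Wv sym sym[symmetric])
    qed
    show "lev w = 2 \<Longrightarrow> \<exists>X<6. w = W X" for w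
    proof -
      assume l: "lev w = 2"
      then have "lev (par w) = 1" by (simp add: lev_par)
      then have "par w \<in> {y0,y1,y2}" using y1 by blast
      then have "w = w0 \<or> w = w1 \<or> w = w2 \<or> w = w3 \<or> w = w4 \<or> w = w5" using l w01(2)[of w] w23(2)[of
          w] w45(2)[of w] by blast
      then have "w = W 0 \<or> w = W (Suc 0) \<or> w = W 2 \<or> w = W 3 \<or> w = W 4 \<or> w = W 5" using Wv by simp
      moreover have "0 < (6::nat)" "Suc 0 < 6" "2 < (6::nat)" "3 < (6::nat)" "4 < (6::nat)" "5 < (6::nat)" by simp_all
      ultimately show ?thesis by blast
    qed
    show "\<exists>u q. lev u = 4 \<and> lev q = 4 \<and> par q = par u \<and> q \<noteq> u \<and> pp u = W 0 \<and> pp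
        (mate u) = W 2 \<and> pp (mate q) = W 4"
      using u q Wv w4_def by metis
  qed
qed

end

text \<open>The vertices of level 2 are \<open>W 0, \<dots>, W 5\<close>, where \<open>W X\<close> lies over \<open>Y (X
    div 2)\<close> and
  \<open>bar X\<close> is the other index over the same vertex. A vertex \<open>u\<close> of level 4 is \<open>L X Z\<close> if
  \<open>W X\<close> lies below \<open>u\<close> and \<open>W Z\<close> below \<open>mate u\<close>, and the sibling of
      \<open>L X Z\<close> is \<open>L X (s X Z)\<close>.
  The assumption \<open>W4\<close> fixes which of the two vertices over \<open>Y 2\<close> is called \<open>W 4\<close>;
      after that
  all values of \<open>s\<close> are forced.\<close>

locale labelled_biggs_smith = rooted_biggs_smith adj x for adj :: "'n::finite \<Rightarrow> 'n \<Rightarrow> bool" and x +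
  fixes Y W :: "nat \<Rightarrow> 'n"
  assumes lev_Y: "b < 3 \<Longrightarrow> lev (Y b) = 1"
    and Y_inj: "b < 3 \<Longrightarrow> c < 3 \<Longrightarrow> Y b = Y c \<Longrightarrow> b = c"
    and Y_surj: "lev y = 1 \<Longrightarrow> \<exists>b<3. y = Y b"
    and W: "X < 6 \<Longrightarrow> lev (W X) = 2 \<and> par (W X) = Y (X div 2)"
    and W_inj: "X < 6 \<Longrightarrow> Z < 6 \<Longrightarrow> W X = W Z \<Longrightarrow> X = Z"
    and W_surj: "lev w = 2 \<Longrightarrow> \<exists>X<6. w = W X"
    and W4: "\<exists>u q. lev u = 4 \<and> lev q = 4 \<and> par q = par u \<and> q \<noteq> u \<and> pp u = W 0 \<and>
        pp (mate u) = W 2 \<and> pp (mate q) = W 4"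
begin

text \<open>Index pairs from different branches at \<open>x\<close>. There are 24 of them, as many
  as vertices on level 4.\<close>

definition "ok X Z \<longleftrightarrow> X < 6 \<and> Z < 6 \<and> X div 2 \<noteq> (Z div 2 :: nat)"
definition "bar X = (if even X then Suc X else X - 1)" for X :: nat
definition "L X Z = (SOME u. lev u = 4 \<and> pp u = W X \<and> pp (mate u) = W Z)"

lemma less6: "X < 6 \<longleftrightarrow> X \<in> {0,1,2,3,4,5::nat}" by auto

lemma bar: "X < 6 \<Longrightarrow> bar X < 6" "bar X div 2 = X div 2" "bar X \<noteq> X" "bar (bar X) = X"
  and bar_cases: "Z div 2 = X div 2 \<Longrightarrow> Z = X \<or> Z = bar X"
  unfolding bar_def by (auto simp: less6 elim!: evenE oddE) (presburger+)?

lemma div_lt: "X < 6 \<Longrightarrow> X div 2 < (3::nat)" by simp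

lemma W_branch: "X < 6 \<Longrightarrow> Z < 6 \<Longrightarrow> par (W X) = par (W Z) \<longleftrightarrow> X div 2 = Z div 2"
  using W[of X] W[of Z] Y_inj[of "X div 2" "Z div 2"] div_lt[of X] div_lt[of Z] by auto

lemma L: assumes "ok X Z" shows "lev (L X Z) = 4" "pp (L X Z) = W X" "pp (mate (L X Z)) = W Z"
proof -
  have "\<exists>u. lev u = 4 \<and> pp u = W X \<and> pp (mate u) = W Z"
    using cyc2[of "W X" "W Z"] W W_branch[of X Z] assms by (auto simp: ok_def)
  from someI_ex[OF this] show "lev (L X Z) = 4" "pp (L X Z) = W X" "pp (mate (L X Z)) = W Z"
    unfolding L_def by blast+
qed

lemma ok_sym: "ok X Z \<Longrightarrow> ok Z X" by (auto simp: ok_def)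
lemma ok_bar: "ok X Z \<Longrightarrow> ok X (bar Z)" "ok X Z \<Longrightarrow> ok (bar X) Z" by (auto simp: ok_def bar)

lemma leaf_label: assumes "lev u = 4" shows "\<exists>X Z. ok X Z \<and> pp u = W X \<and> pp (mate u) = W Z"
proof -
  have "lev (pp u) = 2" "lev (pp (mate u)) = 2" using assms col_facts(4)[OF assms] by (simp_all add: lev_par)
  then obtain X Z where "X < 6" "pp u = W X" "Z < 6" "pp (mate u) = W Z" using W_surj by metis
  moreover from this have "X div 2 \<noteq> Z div 2" using mate_branch[OF assms] W_branch[of Z X] by auto
  ultimately show ?thesis unfolding ok_def by blast
qed

lemma card_leaves: assumes "lev w = 2" shows "card {v. lev v = 4 \<and> pp v = w} \<le> 4"
proof -
  have ch: "\<exists>a b. \<forall>v. lev v = k + 1 \<and> par v = u \<longrightarrow> v = a \<or> v = b" if "lev u = k"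
      "k \<in> {1,2,3}" for u k
  proof -
    have m: "lev u \<in> {1,2,3}" using that by simp
    obtain a b where "\<And>w. lev w = lev u + 1 \<and> par w = u \<longleftrightarrow> w = a \<or> w = b"
      by (rule children[OF m]) (rule that; assumption)
    then show ?thesis using that by blast
  qed
  obtain a b where ab: "\<And>v. lev v = 3 \<Longrightarrow> par v = w \<Longrightarrow> v = a \<or> v = b" using ch[of
      w 2] assms by auto
  have three: "\<exists>c d. \<forall>v. lev v = 4 \<and> par v = u \<longrightarrow> v = c \<or> v = d" for u
  proof (cases "lev u = 3")
    case True then show ?thesis using ch[of u 3] by auto
  next
    case False
    then have "\<not> (lev v = 4 \<and> par v = u)" for v using lev_par[of v] by auto
    then show ?thesis by blast
  qed
  obtain a1 a2 where a: "\<And>v. lev v = 4 \<Longrightarrow> par v = a \<Longrightarrow> v = a1 \<or> v = a2" using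
      three[of a] by blast
  obtain b1 b2 where b: "\<And>v. lev v = 4 \<Longrightarrow> par v = b \<Longrightarrow> v = b1 \<or> v = b2" using
      three[of b] by blast
  have "{v. lev v = 4 \<and> pp v = w} \<subseteq> {a1,a2,b1,b2}"
  proof
    fix v assume "v \<in> {v. lev v = 4 \<and> pp v = w}"
    then have v: "lev v = 4" "pp v = w" by auto
    then have "par v = a \<or> par v = b" using ab[of "par v"] lev_par[of v] by simp
    then show "v \<in> {a1,a2,b1,b2}" using a[of v] b[of v] v by blast
  qed
  then have "card {v. lev v = 4 \<and> pp v = w} \<le> card {a1,a2,b1,b2}" by (intro card_mono) auto
  also have "\<dots> \<le> 4" by (simp add: card_insert_if)
  finally show ?thesis .
qed

text \<open>Over \<open>W X\<close> there are at most four vertices of level 4, and by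
  \<open>cyc2\<close> their mates reach all four level-2 vertices of the other branches. So the map
  to the vertex below the mate is injective.\<close>

lemma leaf_unique:
  assumes "lev u = 4" "lev v = 4" "pp u = pp v" "pp (mate u) = pp (mate v)" shows "u = v"
proof -
  obtain X where X: "X < 6" "pp u = W X" using leaf_label[OF assms(1)] by (auto simp: ok_def)
  let ?S = "{v. lev v = 4 \<and> pp v = W X}" let ?f = "\<lambda>v. pp (mate v)" let ?Z = "{Z. ok X Z}"
  have "?Z = set (filter (\<lambda>Z. X div 2 \<noteq> Z div 2) [0..<6])" using X(1) by (auto simp: ok_def)
  then have "card ?Z = length (filter (\<lambda>Z. X div 2 \<noteq> Z div 2) [0..<6])"
    by (simp add: distinct_card del: set_filter)
  also have "\<dots> = 4" using X(1) unfolding less6 by (elim insertE emptyE) (simp_all add: upt_rec)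
  finally have "card ?Z = 4" .
  moreover have "inj_on W ?Z" by (rule inj_onI) (auto simp: ok_def W_inj)
  ultimately have "card (W ` ?Z) = 4" by (simp add: card_image)
  moreover have "W ` ?Z \<subseteq> ?f ` ?S"
  proof (rule image_subsetI)
    fix Z assume "Z \<in> ?Z"
    then show "W Z \<in> ?f ` ?S" using L[of X Z] by (intro image_eqI[of _ _ "L X Z"]) auto
  qed
  ultimately have "4 \<le> card (?f ` ?S)" using card_mono[of "?f ` ?S" "W ` ?Z"] by simp
  moreover have "card ?S \<le> 4" using card_leaves W X by blast
  moreover have "card (?f ` ?S) \<le> card ?S" by (rule card_image_le) simp
  ultimately have "card (?f ` ?S) = card ?S" by linarith
  then have "inj_on ?f ?S" by (intro eq_card_imp_inj_on) simp_all
  then show ?thesis using assms X unfolding inj_on_def by auto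
qed

lemma L_eq: "ok X Z \<Longrightarrow> lev u = 4 \<Longrightarrow> pp u = W X \<Longrightarrow> pp (mate u) = W Z
    \<Longrightarrow> u = L X Z"
  using leaf_unique[of u "L X Z"] L[of X Z] by simp

lemma L_ex: "lev u = 4 \<Longrightarrow> \<exists>X Z. ok X Z \<and> u = L X Z"
  using leaf_label[of u] L_eq by blast

lemma L_inj: "ok X Z \<Longrightarrow> ok X' Z' \<Longrightarrow> L X Z = L X' Z' \<longleftrightarrow> X = X' \<and> Z = Z'"
  using L[of X Z] L[of X' Z'] W_inj by (auto simp: ok_def)

lemma mate_L: assumes "ok X Z" shows "mate (L X Z) = L Z X"
proof (rule L_eq[OF ok_sym[OF assms]])
  show "lev (mate (L X Z)) = 4" using col_facts(4)[OF L(1)[OF assms]] .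
  show "pp (mate (L X Z)) = W Z" using L[OF assms] by simp
  show "pp (mate (mate (L X Z))) = W X" using L[OF assms] m_invol(3)[OF L(1)[OF assms]] by simp
qed

definition "s X Z = (SOME Z'. ok X Z' \<and> L X Z' \<noteq> L X Z \<and> par (L X Z') = par (L X Z))"

text \<open>That the second index moves to another branch is \<open>sib_branches\<close>: the mates
  of two siblings lie in different branches.\<close>

lemma s:
  assumes "ok X Z"
  shows "ok X (s X Z)" "s X Z \<noteq> Z" "par (L X (s X Z)) = par (L X Z)" "s X Z div 2 \<noteq> Z div 2"
    and s_only: "lev v = 4 \<Longrightarrow> par v = par (L X Z) \<Longrightarrow> v = L X Z \<or> v = L X (s X Z)"
proof -
  obtain q where q: "lev q = 4" "q \<noteq> L X Z" "par q = par (L X Z)"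
      "\<And>v. lev v = 4 \<Longrightarrow> par v = par (L X Z) \<Longrightarrow> v = L X Z \<or> v = q"
    using sib_ex[OF L(1)[OF assms]] by metis
  obtain A B where AB: "ok A B" "q = L A B" using L_ex[OF q(1)] by blast
  have "W A = W X" using q(3) L(2)[OF AB(1)] L(2)[OF assms] AB(2) by simp
  then have "A = X" using W_inj AB(1) assms by (auto simp: ok_def)
  then have "\<exists>Z'. ok X Z' \<and> L X Z' \<noteq> L X Z \<and> par (L X Z') = par (L X Z)" using AB q by blast
  from someI_ex[OF this] have s: "ok X (s X Z)" "L X (s X Z) \<noteq> L X Z" "par (L X (s X Z)) = par (L X Z)"
    unfolding s_def by blast+
  have qs: "q = L X (s X Z)" using q(4)[OF L(1)[OF s(1)] s(3)] s(2) by blast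
  show "ok X (s X Z)" "par (L X (s X Z)) = par (L X Z)" by fact+
  show "s X Z \<noteq> Z" using s by auto
  show "lev v = 4 \<Longrightarrow> par v = par (L X Z) \<Longrightarrow> v = L X Z \<or> v = L X (s X Z)" using q(4) qs by blast
  have "ppp (mate (L X Z)) \<noteq> ppp (mate (L X (s X Z)))"
    using sib_branches(2)[OF L(1)[OF assms] L(1)[OF s(1)] s(3,2)] .
  then have "par (W Z) \<noteq> par (W (s X Z))" using L(3)[OF assms] L(3)[OF s(1)] by simp
  then show "s X Z div 2 \<noteq> Z div 2" using W_branch[of Z "s X Z"] s(1) assms by (auto simp: ok_def)
qed

lemma s_eqI:
  assumes "ok X Z" "ok X Z'" "par (L X Z') = par (L X Z)" "Z' \<noteq> Z" shows "s X Z = Z'"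
  using s_only[OF assms(1) L(1)[OF assms(2)] assms(3)] L_inj[OF assms(2,1)] L_inj[OF assms(2) s(1)[OF assms(1)]] assms(4) by blast

lemma s_invol: "ok X Z \<Longrightarrow> s X (s X Z) = Z"
  using s_eqI[of X "s X Z" Z] s(1,2,3)[of X Z] by metis

lemma ppp_L: "ok X Z \<Longrightarrow> ppp (L X Z) = Y (X div 2)"
  using L(2)[of X Z] W[of X] by (simp add: ok_def)

text \<open>There are only three branches, and two of them are taken by \<open>X\<close> and
  \<open>Z\<close>.\<close>

lemma branch3:
  assumes "ok X Z" "A < 6" "B < 6" "A div 2 \<noteq> X div 2" "A div 2 \<noteq> Z div 2" "B div 2 \<noteq> X div 2"
      "B div 2 \<noteq> Z div 2"
  shows "A div 2 = B div 2"
proof -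
  have third: "a + p + q = 3" if "p < 3" "q < 3" "a < 3" "p \<noteq> q" "a \<noteq> p" "a \<noteq> q" for p q a :: nat
    using that by linarith
  have "A div 2 + X div 2 + Z div 2 = 3" "B div 2 + X div 2 + Z div 2 = 3"
    using assms div_lt by (auto simp: ok_def intro!: third)
  then show ?thesis by simp
qed

text \<open>\<open>cyc4\<close> is applied to \<open>L Z X\<close> and to both children of the other
  level-3 vertex over \<open>W Z\<close>. For the child \<open>?d\<close> the alternative about
  \<open>m5\<close> would leave the branch of \<open>X\<close>, so \<open>m6\<close> leads to
  \<open>?d\<close>. Then it does not lead to \<open>?c\<close>, and there the alternative about
  \<open>m5\<close> must hold.\<close>

lemma m5_m6_L:
  assumes "ok X Z" shows "m5 (L X Z) = L (bar X) Z" "m6 (L Z X) = L Z (s Z (bar X))"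
proof -
  note zx = ok_sym[OF assms]
  note zb = ok_bar(1)[OF zx]
  note zs = s(1)[OF zb]
  let ?a = "L Z X" let ?c = "L Z (bar X)" let ?d = "L Z (s Z (bar X))"
  have la: "lev ?a = 4" "lev ?c = 4" "lev ?d = 4" using L zx zb zs by blast+
  have pc: "par ?d = par ?c" using s(3)[OF zb] .
  have ac: "par ?a \<noteq> par ?c"
  proof
    assume "par ?a = par ?c"
    then have "s Z (bar X) = X" using s_eqI[OF zb zx] bar(3)[of X] by metis
    then show False using s(4)[OF zb] bar(2)[of X] by simp
  qed
  have pps: "pp ?a = pp ?c" "pp ?a = pp ?d" using L(2) zx zb zs by simp_all
  have ma: "mate ?a = L X Z" "mate ?c = L (bar X) Z" "mate ?d = L (s Z (bar X)) Z" using mate_L zx zb zs by blast+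
  have c: "m6 ?a = ?c \<or> m5 (L X Z) = L (bar X) Z" using cyc4[OF la(1,2) ac pps(1)] ma by simp
  have d: "m6 ?a = ?d \<or> m5 (L X Z) = L (s Z (bar X)) Z" using cyc4[OF la(1,3) _ pps(2)] ma ac pc by simp
  have "ppp (m5 (L X Z)) = Y (X div 2)" using m5_branch(2)[OF L(1)[OF assms]] ppp_L[OF assms] by simp
  moreover have "ppp (L (s Z (bar X)) Z) = Y (s Z (bar X) div 2)" using ppp_L[OF ok_sym[OF zs]] .
  moreover have "s Z (bar X) div 2 \<noteq> X div 2" using s(4)[OF zb] bar(2)[of X] by simp
  moreover have "X div 2 < 3" "s Z (bar X) div 2 < 3" using assms zs by (auto simp: ok_def)
  ultimately have nd: "m5 (L X Z) \<noteq> L (s Z (bar X)) Z" using Y_inj by metis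
  then show 6: "m6 ?a = ?d" using d by blast
  have "?c \<noteq> ?d" using s(2)[OF zb] L_inj[OF zb zs] by simp
  then show "m5 (L X Z) = L (bar X) Z" using c 6 by simp
qed

text \<open>\<open>cyc3\<close> yields an edge inside level 5 between the columns over the two
  level-3 vertices. By \<open>m5_m6_L\<close> such an edge keeps the second index, so the pairs
  \<open>Z\<close>, \<open>s X Z\<close> and \<open>bar Z\<close>, \<open>s (bar X) (bar Z)\<close>
  share an element; comparing branches leaves one possibility.\<close>

lemma s_bar_bar: assumes "ok X Z" shows "s (bar X) (bar Z) = s X Z"
proof -
  note b = ok_bar(2)[OF ok_bar(1)[OF assms]]
  let ?l = "par (L X Z)" let ?l' = "par (L (bar X) (bar Z))"
  have l: "lev ?l = 3" "lev ?l' = 3" using L(1)[OF assms] L(1)[OF b] by (simp_all add: lev_par)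
  have "par ?l \<noteq> par ?l'" using L(2)[OF assms] L(2)[OF b] W_inj[of X "bar X"] assms bar(1,3)[of X] by (auto simp: ok_def)
  moreover have "pp ?l = pp ?l'" using ppp_L[OF assms] ppp_L[OF b] bar(2) by simp
  ultimately obtain u where u: "lev u = 4" "par u = ?l" "par (m5 u) = ?l'" using cyc3[OF l] by blast
  have "u = L X Z \<or> u = L X (s X Z)" using s_only[OF assms u(1,2)] .
  moreover have "lev (m5 u) = 4" using col_facts(6)[OF u(1)] .
  then have "m5 u = L (bar X) (bar Z) \<or> m5 u = L (bar X) (s (bar X) (bar Z))" using s_only[OF b _ u(3)] by blast
  moreover have ob: "ok (bar X) Z" "ok (bar X) (s X Z)" "ok X (s X Z)" using ok_bar(2) assms s(1)[OF assms] by blast+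
  ultimately have "Z = bar Z \<or> Z = s (bar X) (bar Z) \<or> s X Z = bar Z \<or> s X Z = s (bar X) (bar Z)"
    using m5_m6_L(1)[OF assms] m5_m6_L(1)[OF ob(3)] L_inj[OF ob(1) b] L_inj[OF ob(2) b] L_inj[OF ob(1) s(1)[OF b]]
        L_inj[OF ob(2) s(1)[OF b]]
    by metis
  then show ?thesis using bar(2,3)[of Z] s(4)[OF assms] s(4)[OF b] by metis
qed

text \<open>Both values lie in the third branch, and they differ because \<open>s X\<close> is an
  involution.\<close>

lemma s_bar: assumes "ok X Z" shows "s X (bar Z) = bar (s X Z)"
proof -
  note b = ok_bar(1)[OF assms]
  note o1 = s(1)[OF assms] and o2 = s(1)[OF b]
  have "s X (bar Z) \<noteq> s X Z" using s_invol[OF assms] s_invol[OF b] bar(3)[of Z] by metis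
  moreover have "s X (bar Z) div 2 = s X Z div 2"
    using o1 o2 s(4)[OF assms] s(4)[OF b] bar(2)[of Z] by (intro branch3[OF assms]) (auto simp: ok_def)
  ultimately show ?thesis using bar_cases by blast
qed

lemma apex_s: assumes "ok X Z" shows "apex (L X (s X Z)) = apex (L Z X)"
  using cyc5[OF L(1)[OF assms] L(1)[OF s(1)[OF assms]] s(3)[OF assms]] s(2)[OF assms] L_inj[OF assms s(1)[OF assms]]
      mate_L[OF assms]
  by metis

text \<open>Iterating \<open>apex_s\<close> produces four columns with the same apex, the first
  three of which are distinct. An apex has only three columns, so the fourth is the first one
  again.\<close>

lemma s_rot: assumes "ok X Z" shows "s (s X Z) X = Z"
  and apex_fibre_L: "{v. lev v = 4 \<and> apex v = apex (L Z X)} = {L Z X, L X (s X Z), L (s X Z) Z}"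
proof -
  let ?B = "s X Z" let ?A = "s ?B X"
  note zx = ok_sym[OF assms] and xb = s(1)[OF assms]
  note bx = ok_sym[OF xb] note ba = s(1)[OF bx] note ab = ok_sym[OF ba] note ac = s(1)[OF ab]
  let ?F = "{v. lev v = 4 \<and> apex v = apex (L Z X)}" let ?T = "{L Z X, L X ?B, L ?B ?A}"
  have e2: "apex (L X ?B) = apex (L Z X)" using apex_s[OF assms] .
  have e3: "apex (L ?B ?A) = apex (L Z X)" using apex_s[OF bx] e2 by simp
  have e4: "apex (L ?A (s ?A ?B)) = apex (L Z X)" using apex_s[OF ab] e3 by simp
  have d: "Z \<noteq> X" "Z \<noteq> ?B" "X \<noteq> ?B" "?A \<noteq> X" "?A \<noteq> ?B" using assms s(4)[OF assms] xb
      ba s(4)[OF bx] by (auto simp: ok_def)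
  have "card ?T = 3" using d L_inj[OF zx xb] L_inj[OF zx ba] L_inj[OF xb ba] by auto
  moreover have "?T \<subseteq> ?F" using e2 e3 L(1) zx xb ba by auto
  moreover have "card ?F = 3" using apex_fibre[OF L(1)[OF zx]] .
  ultimately have FT: "?F = ?T" using card_subset_eq[of ?F ?T] by simp
  have "L ?A (s ?A ?B) \<in> ?F" using e4 L(1)[OF ac] by simp
  then have "L ?A (s ?A ?B) = L Z X" unfolding FT using d L_inj[OF ac xb] L_inj[OF ac ba] by blast
  then show A: "?A = Z" using L_inj[OF ac zx] by simp
  show "?F = {L Z X, L X (s X Z), L (s X Z) Z}" using FT unfolding A .
qed

section \<open>Evaluation of the labels and of all adjacencies\<close>

lemma s02: "s 0 2 = 4"
proof -
  obtain u q where u: "lev u = 4" "lev q = 4" "par q = par u" "q \<noteq> u" "pp u = W 0" "pp (mate u) = W 2" "pp (mate q) = W 4"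
    using W4 by blast
  have o: "ok 0 2" "ok 0 4" by (simp_all add: ok_def)
  have "u = L 0 2" "q = L 0 4" using L_eq[OF o(1)] L_eq[OF o(2)] u by simp_all
  then show ?thesis using s_eqI[OF o] u by simp
qed

text \<open>From \<open>s 0 2 = 4\<close>, involution and rotation give the six values with even
  indices; \<open>s_bar\<close> and \<open>s_bar_bar\<close> extend them to the odd ones.\<close>

lemma s_values:
    "s 0 2 = 4" "s 0 3 = 5" "s 0 4 = 2" "s 0 5 = 3" "s (Suc 0) 2 = 5" "s (Suc 0) 3 = 4"
    "s (Suc 0) 4 = 3" "s (Suc 0) 5 = 2" "s 2 0 = 4" "s 2 (Suc 0) = 5" "s 2 4 = 0" "s 2 5 = Suc 0"
    "s 3 0 = 5" "s 3 (Suc 0) = 4" "s 3 4 = Suc 0" "s 3 5 = 0" "s 4 0 = 2" "s 4 (Suc 0) = 3" "s 4 2 = 0"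
    "s 4 3 = Suc 0" "s 5 0 = 3" "s 5 (Suc 0) = 2" "s 5 2 = Suc 0" "s 5 3 = 0"
proof -
  have o:
    "ok 0 2" "ok 0 3" "ok 0 4" "ok 0 5" "ok (Suc 0) 2" "ok (Suc 0) 3" "ok (Suc 0) 4" "ok (Suc 0) 5"
    "ok 2 0" "ok 2 (Suc 0)" "ok 2 4" "ok 2 5" "ok 3 0" "ok 3 (Suc 0)" "ok 3 4" "ok 3 5" "ok 4 0"
    "ok 4 (Suc 0)" "ok 4 2" "ok 4 3" "ok 5 0" "ok 5 (Suc 0)" "ok 5 2" "ok 5 3"
    by (simp_all add: ok_def)
  have b: "bar 0 = Suc 0" "bar (Suc 0) = 0" "bar 1 = 0" "bar 2 = 3" "bar 3 = 2" "bar 4 = 5" "bar 5 = 4" by (simp_all add: bar_def)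
  show 02: "s 0 2 = 4" by (rule s02)
  show 04: "s 0 4 = 2" using s_invol[OF o(1)] 02 by simp
  show 40: "s 4 0 = 2" using s_rot[OF o(1)] 02 by simp
  show 42: "s 4 2 = 0" using s_invol[of 4 0] o 40 by simp
  show 20: "s 2 0 = 4" using s_rot[of 0 4] o 04 by simp
  show 24: "s 2 4 = 0" using s_invol[of 2 0] o 20 by simp
  show "s 0 3 = 5" using s_bar[OF o(1)] 02 b by simp
  show "s 0 5 = 3" using s_bar[OF o(3)] 04 b by simp
  show "s 2 (Suc 0) = 5" using s_bar[OF o(9)] 20 b by simp
  show "s 2 5 = Suc 0" using s_bar[OF o(11)] 24 b by simp
  show "s 4 (Suc 0) = 3" using s_bar[OF o(17)] 40 b by simp
  show "s 4 3 = Suc 0" using s_bar[OF o(19)] 42 b by simp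
  show "s (Suc 0) 3 = 4" using s_bar_bar[OF o(1)] 02 b by simp
  show "s (Suc 0) 2 = 5" using s_bar_bar[OF o(2)] s_bar[OF o(1)] 02 b by simp
  show "s (Suc 0) 5 = 2" using s_bar_bar[OF o(3)] 04 b by simp
  show "s (Suc 0) 4 = 3" using s_bar_bar[OF o(4)] s_bar[OF o(3)] 04 b by simp
  show "s 3 (Suc 0) = 4" using s_bar_bar[OF o(9)] 20 b by simp
  show "s 3 0 = 5" using s_bar_bar[OF o(10)] s_bar[OF o(9)] 20 b by simp
  show "s 3 5 = 0" using s_bar_bar[OF o(11)] 24 b by simp
  show "s 3 4 = Suc 0" using s_bar_bar[OF o(12)] s_bar[OF o(11)] 24 b by simp
  show "s 5 (Suc 0) = 2" using s_bar_bar[OF o(17)] 40 b by simp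
  show "s 5 0 = 3" using s_bar_bar[OF o(18)] s_bar[OF o(17)] 40 b by simp
  show "s 5 3 = 0" using s_bar_bar[OF o(19)] 42 b by simp
  show "s 5 2 = Suc 0" using s_bar_bar[OF o(20)] s_bar[OF o(19)] 42 b by simp
qed

text \<open>A vertex of level 3 could be named after either of its two children and a vertex of
  level 7 after any of its three columns. The list fixes one name for each;
  \<open>par_values\<close> and \<open>apex_values\<close> rewrite the other names to it.\<close>

definition "vlist = [
   x, Y 0, Y (Suc 0), Y 2, W 0, W (Suc 0), W 2, W 3, W 4, W 5, par (L 0 2), par (L 0 5), par (L (Suc 0) 2),
   par (L (Suc 0) 3), par (L 2 (Suc 0)), par (L 2 0), par (L 3 4), par (L 3 0), par (L 4 (Suc 0)), par (L 4 2),
   par (L 5 2), par (L 5 3), L 0 2, L 0 4, L 0 5, L 0 3, L (Suc 0) 2, L (Suc 0) 5, L (Suc 0) 3, L (Suc 0) 4, L 2 (Suc 0),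
   L 2 5, L 2 0, L 2 4, L 3 4, L 3 (Suc 0), L 3 0, L 3 5, L 4 (Suc 0), L 4 3, L 4 2, L 4 0, L 5 2, L 5 (Suc 0),
   L 5 3, L 5 0, up (L 0 2), up (L 0 4), up (L 0 5), up (L 0 3), up (L (Suc 0) 2), up (L (Suc 0) 5),
   up (L (Suc 0) 3), up (L (Suc 0) 4), up (L 2 (Suc 0)), up (L 2 5), up (L 2 0), up (L 2 4), up (L 3 4),
   up (L 3 (Suc 0)), up (L 3 0), up (L 3 5), up (L 4 (Suc 0)), up (L 4 3), up (L 4 2), up (L 4 0),
   up (L 5 2), up (L 5 (Suc 0)), up (L 5 3), up (L 5 0), up (up (L 0 2)), up (up (L 0 4)),
   up (up (L 0 5)), up (up (L 0 3)), up (up (L (Suc 0) 2)), up (up (L (Suc 0) 5)), up (up (L (Suc 0) 3)),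
   up (up (L (Suc 0) 4)), up (up (L 2 (Suc 0))), up (up (L 2 5)), up (up (L 2 0)), up (up (L 2 4)),
   up (up (L 3 4)), up (up (L 3 (Suc 0))), up (up (L 3 0)), up (up (L 3 5)), up (up (L 4 (Suc 0))),
   up (up (L 4 3)), up (up (L 4 2)), up (up (L 4 0)), up (up (L 5 2)), up (up (L 5 (Suc 0))),
   up (up (L 5 3)), up (up (L 5 0)), apex (L 0 2), apex (L 0 3), apex (L 0 4), apex (L 0 5),
   apex (L (Suc 0) 2), apex (L (Suc 0) 3), apex (L (Suc 0) 4), apex (L (Suc 0) 5)]"

lemma ok_values:
    "ok 0 2" "ok 0 3" "ok 0 4" "ok 0 5" "ok (Suc 0) 2" "ok (Suc 0) 3" "ok (Suc 0) 4" "ok (Suc 0) 5"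
    "ok 2 0" "ok 2 (Suc 0)" "ok 2 4" "ok 2 5" "ok 3 0" "ok 3 (Suc 0)" "ok 3 4" "ok 3 5" "ok 4 0"
    "ok 4 (Suc 0)" "ok 4 2" "ok 4 3" "ok 5 0" "ok 5 (Suc 0)" "ok 5 2" "ok 5 3"
  by (simp_all add: ok_def)

lemma bar_values: "bar 0 = Suc 0" "bar (Suc 0) = 0" "bar 1 = 0" "bar 2 = 3" "bar 3 = 2" "bar 4 = 5" "bar 5 = 4"
  by (simp_all add: bar_def)

lemma par_values:
    "par (L 0 4) = par (L 0 2)" "par (L 0 3) = par (L 0 5)" "par (L (Suc 0) 5) = par (L (Suc 0) 2)"
    "par (L (Suc 0) 4) = par (L (Suc 0) 3)" "par (L 2 5) = par (L 2 (Suc 0))"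
    "par (L 2 4) = par (L 2 0)" "par (L 3 (Suc 0)) = par (L 3 4)" "par (L 3 5) = par (L 3 0)"
    "par (L 4 3) = par (L 4 (Suc 0))" "par (L 4 0) = par (L 4 2)" "par (L 5 (Suc 0)) = par (L 5 2)"
    "par (L 5 0) = par (L 5 3)"
  using
    s(3)[OF ok_values(1)] s(3)[OF ok_values(4)] s(3)[OF ok_values(5)] s(3)[OF ok_values(6)]
    s(3)[OF ok_values(10)] s(3)[OF ok_values(9)] s(3)[OF ok_values(15)] s(3)[OF ok_values(13)]
    s(3)[OF ok_values(18)] s(3)[OF ok_values(19)] s(3)[OF ok_values(23)] s(3)[OF ok_values(24)]
  by (simp_all add: s_values)

lemma apex_values:
    "apex (L 2 4) = apex (L 0 2)" "apex (L 4 0) = apex (L 0 2)" "apex (L 3 5) = apex (L 0 3)"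
    "apex (L 5 0) = apex (L 0 3)" "apex (L 2 0) = apex (L 0 4)" "apex (L 4 2) = apex (L 0 4)"
    "apex (L 3 0) = apex (L 0 5)" "apex (L 5 3) = apex (L 0 5)" "apex (L 2 5) = apex (L (Suc 0) 2)"
    "apex (L 5 (Suc 0)) = apex (L (Suc 0) 2)" "apex (L 3 4) = apex (L (Suc 0) 3)"
    "apex (L 4 (Suc 0)) = apex (L (Suc 0) 3)" "apex (L 3 (Suc 0)) = apex (L (Suc 0) 4)"
    "apex (L 4 3) = apex (L (Suc 0) 4)" "apex (L 2 (Suc 0)) = apex (L (Suc 0) 5)"
    "apex (L 5 2) = apex (L (Suc 0) 5)"
  using
    apex_s[OF ok_values(9)] apex_s[OF ok_values(3), symmetric] apex_s[OF ok_values(13)]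
    apex_s[OF ok_values(4), symmetric] apex_s[OF ok_values(1), symmetric] apex_s[OF ok_values(17)]
    apex_s[OF ok_values(2), symmetric] apex_s[OF ok_values(21)] apex_s[OF ok_values(10)]
    apex_s[OF ok_values(8), symmetric] apex_s[OF ok_values(14)] apex_s[OF ok_values(7), symmetric]
    apex_s[OF ok_values(6), symmetric] apex_s[OF ok_values(18)] apex_s[OF ok_values(5), symmetric]
    apex_s[OF ok_values(22)]
  by (simp_all add: s_values)

text \<open>These are the neighbourhoods on levels 2 to 7 in terms of labels; levels 0 and 1 are
  \<open>adj_x\<close> and \<open>adj_Y\<close>.\<close>

lemma adj_L:
  assumes "ok X Z"
  shows "adj (L X Z) w \<longleftrightarrow> w = par (L X Z) \<or> w = L Z X \<or> w = up (L X Z)"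
    and "adj (up (L X Z)) w \<longleftrightarrow> w = L X Z \<or> w = up (L (bar X) Z) \<or> w = up (up (L X Z))"
    and "adj (up (up (L X Z))) w \<longleftrightarrow> w = up (L X Z) \<or> w = up (up (L X (s X (bar Z)))) \<or> w =
        apex (L X Z)"
    and "adj (par (L X Z)) w \<longleftrightarrow> w = W X \<or> w = L X Z \<or> w = L X (s X Z)"
    and "adj (apex (L X Z)) w \<longleftrightarrow> w = up (up (L X Z)) \<or> w = up (up (L Z (s Z X))) \<or> w = up (up
        (L (s Z X) X))"
    and "adj (W X) w \<longleftrightarrow> w = Y (X div 2) \<or> w = par (L X Z) \<or> w = par (L X (bar Z))"
proof -
  note l = L(1)[OF assms] and zx = ok_sym[OF assms] and xs = s(1)[OF assms] and xb = ok_bar(1)[OF assms]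
  show "adj (L X Z) w \<longleftrightarrow> w = par (L X Z) \<or> w = L Z X \<or> w = up (L X Z)"
    using adj_4[OF l] mate_L[OF assms] by simp
  show "adj (up (L X Z)) w \<longleftrightarrow> w = L X Z \<or> w = up (L (bar X) Z) \<or> w = up (up (L X Z))"
    using adj_5[OF l] m5_m6_L(1)[OF assms] by simp
  show "adj (up (up (L X Z))) w \<longleftrightarrow> w = up (L X Z) \<or> w = up (up (L X (s X (bar Z)))) \<or> w = apex (L X Z)"
    using adj_6[OF l] m5_m6_L(2)[OF zx] by simp
  have "lev (par (L X Z)) = 3" using l by (simp add: lev_par)
  then have "adj (par (L X Z)) w \<longleftrightarrow> w = pp (L X Z) \<or> lev w = 4 \<and> par w = par (L X Z)"
    using adj_low[of "par (L X Z)" w] by simp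
  then show "adj (par (L X Z)) w \<longleftrightarrow> w = W X \<or> w = L X Z \<or> w = L X (s X Z)"
    using L(2)[OF assms] s_only[OF assms, of w] s(3)[OF assms] l L(1)[OF xs] by auto
  have "adj (apex (L X Z)) w \<longleftrightarrow> (\<exists>v \<in> {v. lev v = 4 \<and> apex v = apex (L X Z)}. w = up (up v))"
    using adj_7[OF l] by auto
  then show "adj (apex (L X Z)) w \<longleftrightarrow> w = up (up (L X Z)) \<or> w = up (up (L Z (s Z X))) \<or> w = up
      (up (L (s Z X) X))"
    unfolding apex_fibre_L[OF zx] by simp
  have X: "X < 6" using assms by (simp add: ok_def)
  have lw: "lev (W X) = 2" "par (W X) = Y (X div 2)" using W[OF X] by simp_all
  have m: "lev (W X) \<in> {1,2,3}" using lw by simp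
  obtain a b where ab: "\<And>w. lev w = lev (W X) + 1 \<and> par w = W X \<longleftrightarrow> w = a \<or> w = b"
    by (rule children[OF m]) (rule that; assumption)
  have e: "lev (W X) + 1 = 3" using lw by simp
  have l3: "lev (par (L X Z)) = 3" "lev (par (L X (bar Z))) = 3" using l L(1)[OF xb] by (simp_all add: lev_par)
  have "par (L X Z) \<noteq> par (L X (bar Z))"
    using s_eqI[OF assms xb] bar(3)[of Z] s(4)[OF assms] bar(2)[of Z] by metis
  moreover have "par (L X Z) = a \<or> par (L X Z) = b" "par (L X (bar Z)) = a \<or> par (L X (bar Z)) = b"
    using ab[unfolded e] l3 L(2)[OF assms] L(2)[OF xb] by blast+
  ultimately have "lev w = 3 \<and> par w = W X \<longleftrightarrow> w = par (L X Z) \<or> w = par (L X (bar Z))" using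
      ab[unfolded e] by metis
  then show "adj (W X) w \<longleftrightarrow> w = Y (X div 2) \<or> w = par (L X Z) \<or> w = par (L X (bar Z))"
    using adj_low[OF m, of w] lw by simp
qed

lemma adj_Y: assumes "b < 3" shows "adj (Y b) w \<longleftrightarrow> w = x \<or> w = W (2*b) \<or> w = W (Suc (2*b))"
proof -
  have l: "lev (Y b) = 1" using lev_Y assms by simp
  then have m: "lev (Y b) \<in> {1,2,3}" by simp
  have "par (Y b) = x" using lev_par[of "Y b"] l by simp
  moreover have "lev (Y b) + 1 = 2" using l by simp
  ultimately have *: "adj (Y b) w \<longleftrightarrow> w = x \<or> lev w = 2 \<and> par w = Y b" using adj_low[OF m, of
      w] by metis
  have d: "X div 2 = b \<Longrightarrow> X = 2 * b \<or> X = Suc (2 * b)" for X :: nat by presburger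
  have "lev w = 2 \<and> par w = Y b \<Longrightarrow> w = W (2*b) \<or> w = W (Suc (2*b))"
  proof -
    assume h: "lev w = 2 \<and> par w = Y b"
    then obtain X where X: "X < 6" "w = W X" using W_surj by blast
    then have "X div 2 = b" using W[OF X(1)] h Y_inj[of "X div 2" b] assms div_lt[OF X(1)] by simp
    from d[OF this] X show ?thesis by auto
  qed
  moreover have "2 * b < 6" "Suc (2 * b) < 6" using assms by simp_all
  ultimately show ?thesis using * W[of "2*b"] W[of "Suc (2*b)"] by auto
qed

lemma adj_x: "adj x w \<longleftrightarrow> w = Y 0 \<or> w = Y (Suc 0) \<or> w = Y 2"
proof -
  have "\<exists>b<3. w = Y b \<Longrightarrow> w = Y 0 \<or> w = Y (Suc 0) \<or> w = Y 2"
  proof -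
    assume "\<exists>b<3. w = Y b"
    then obtain b where "b < 3" "w = Y b" by blast
    moreover from this have "b = 0 \<or> b = 1 \<or> b = 2" by linarith
    ultimately show ?thesis by auto
  qed
  moreover have "lev (Y 0) = 1" "lev (Y (Suc 0)) = 1" "lev (Y 2) = 1" using lev_Y by simp_all
  ultimately show ?thesis unfolding adj_0 using Y_surj[of w] by auto
qed

lemma vlist_adj:
  "list_all2 (\<lambda>v (a,b,c). \<forall>w. adj v w \<longleftrightarrow> w = vlist ! a \<or> w = vlist ! b \<or> w =
      vlist ! c) vlist bs_nbs"
proof -
  have WX: "adj (W 0) w \<longleftrightarrow> w = Y 0 \<or> w = par (L 0 2) \<or> w = par (L 0 3)"
    "adj (W (Suc 0)) w \<longleftrightarrow> w = Y 0 \<or> w = par (L (Suc 0) 2) \<or> w = par (L (Suc 0) 3)"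
    "adj (W 2) w \<longleftrightarrow> w = Y (Suc 0) \<or> w = par (L 2 0) \<or> w = par (L 2 (Suc 0))"
    "adj (W 3) w \<longleftrightarrow> w = Y (Suc 0) \<or> w = par (L 3 0) \<or> w = par (L 3 (Suc 0))"
    "adj (W 4) w \<longleftrightarrow> w = Y 2 \<or> w = par (L 4 0) \<or> w = par (L 4 (Suc 0))"
    "adj (W 5) w \<longleftrightarrow> w = Y 2 \<or> w = par (L 5 0) \<or> w = par (L 5 (Suc 0))" for w
    using adj_L(6)[of 0 2 w] adj_L(6)[of "Suc 0" 2 w] adj_L(6)[of 2 0 w] adj_L(6)[of 3 0 w] adj_L(6)[of 4 0 w] adj_L(6)[of 5 0 w]
    by (simp_all add: ok_values bar_values)
  have Yb: "adj (Y 0) w \<longleftrightarrow> w = x \<or> w = W 0 \<or> w = W (Suc 0)"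
      "adj (Y (Suc 0)) w \<longleftrightarrow> w = x \<or> w = W 2 \<or> w = W 3"
    "adj (Y 2) w \<longleftrightarrow> w = x \<or> w = W 4 \<or> w = W 5" for w
    using adj_Y[of 0 w] adj_Y[of "Suc 0" w] adj_Y[of 2 w] by simp_all
  \<comment> \<open>An opaque copy of the list: its entries are looked up by 102 ready-made
    equations, and the list itself is not unfolded at every index.\<close>
  obtain V where V: "V = vlist" by simp
  have "length V = 102" by (simp add: V vlist_def)
  then have "map ((!) V) [0..<102] = vlist" unfolding V[symmetric] by (metis map_nth)
  note V_nth = this[unfolded vlist_def upt_102 list.map list.inject simp_thms]
  define P where "P v t \<longleftrightarrow> (case t of (a,b,c) \<Rightarrow> \<forall>w. adj v w \<longleftrightarrow>
      w = V ! a \<or> w = V ! b \<or> w = V ! c)" for v t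
  have "list_all2 P vlist bs_nbs"
    unfolding vlist_def bs_nbs_def
    apply (simp only: list_all2_Cons list_all2_Nil simp_thms)
    apply (intro conjI)
    apply (simp_all add: P_def V_nth adj_x WX Yb adj_L(1-5) ok_values s_values bar_values par_values apex_values disj_ac)
    done
  then show ?thesis by (simp add: P_def[abs_def] V)
qed

lemma vlist_lev: "map lev vlist = bs_lev"
proof -
  have "bs_lev = [0, 1, 1, 1, 2, 2, 2, 2, 2, 2, 3, 3, 3, 3, 3, 3, 3, 3, 3, 3, 3, 3, 4, 4, 4, 4, 4, 4,
     4, 4, 4, 4, 4, 4, 4, 4, 4, 4, 4, 4, 4, 4, 4, 4, 4, 4, 5, 5, 5, 5, 5, 5, 5, 5, 5, 5, 5, 5, 5, 5, 5,
     5, 5, 5, 5, 5, 5, 5, 5, 5, 6, 6, 6, 6, 6, 6, 6, 6, 6, 6, 6, 6, 6, 6, 6, 6, 6, 6, 6, 6, 6, 6, 6, 6,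
     7, 7, 7, 7, 7, 7, 7, 7]" by code_simp
  moreover have "lev (par (L X Z)) = 3" "lev (L X Z) = 4" "lev (up (L X Z)) = 5" "lev (up (up (L X Z))) = 6"
      "lev (apex (L X Z)) = 7"
    if "ok X Z" for X Z
    using L(1)[OF that] col_facts(1-3,5)[OF L(1)[OF that]] by simp_all
  moreover have "X < 6 \<Longrightarrow> lev (W X) = 2" for X using W by blast
  ultimately show ?thesis unfolding vlist_def
    by (simp add: lev_Y ok_values)
qed

text \<open>Surjectivity suffices for distinctness as well: 102 names cover 102 vertices, so no two
  names have to be compared.\<close>

lemma vlist_surj: "set vlist = UNIV"
proof -
  \<comment> \<open>Behind the opaque \<open>P\<close> the memberships become 102 atomic facts that
    the simplifier can use as rewrite rules.\<close>
  define P where "P v \<longleftrightarrow> v \<in> set vlist" for v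
  have all: "list_all P vlist" by (simp add: P_def list_all_iff)
  note all' = all[unfolded vlist_def list.pred_inject simp_thms]
  have "\<forall>X \<in> set [0..<6]. \<forall>Z \<in> set [0..<6]. X div 2 \<noteq> Z div (2::nat) \<longrightarrow>
      (X,Z) \<in> set [(0,2), (0,3), (0,4), (0,5), (1,2), (1,3), (1,4), (1,5), (2,0), (2,1), (2,4), (2,5), (3,0), (3,1),
      (3,4), (3,5), (4,0), (4,1), (4,2), (4,3), (5,0), (5,1), (5,2), (5,3)]"
    by code_simp
  then have oks: "(X,Z) \<in> {(0,2), (0,3), (0,4), (0,5), (1,2), (1,3), (1,4), (1,5), (2,0), (2,1), (2,4), (2,5),
      (3,0), (3,1), (3,4), (3,5), (4,0), (4,1), (4,2), (4,3), (5,0), (5,1), (5,2), (5,3)}" if "ok X Z" for X Z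
    using that by (simp add: ok_def)
  have "P (L X Z) \<and> P (up (L X Z)) \<and> P (up (up (L X Z))) \<and> P (apex (L X Z)) \<and> P (par (L X Z))"
    if "ok X Z" for X Z
    using oks[OF that] by (elim insertE emptyE; simp add: all' par_values apex_values)
  then have inL: "L X Z \<in> set vlist \<and> up (L X Z) \<in> set vlist \<and> up (up (L X Z)) \<in> set vlist \<and>
      apex (L X Z) \<in> set vlist \<and> par (L X Z) \<in> set vlist"
    if "ok X Z" for X Z
    using that unfolding P_def by blast
  have l4: "u \<in> set vlist \<and> up u \<in> set vlist \<and> up (up u) \<in> set vlist \<and> apex u \<in> set vlist
      \<and> par u \<in> set vlist" if "lev u = 4" for u
    using L_ex[OF that] inL by blast
  have "v \<in> set vlist" for v
  proof -
    have "lev v \<le> 7" by (rule gdist_le_7)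
    then consider "lev v = 0" | "lev v = 1" | "lev v = 2" | "lev v = 3" | "lev v = 4" | "lev v = 5" | "lev v = 6" |
        "lev v = 7" by linarith
    then show ?thesis
    proof cases
      case 1
      then have "v = x" by simp
      moreover have "x \<in> set vlist" by (simp add: vlist_def)
      ultimately show ?thesis by simp
    next
      case 2
      then have "adj x v" using adj_0 by simp
      then show ?thesis using adj_x[of v] by (auto simp: vlist_def)
    next
      case 3
      then obtain X where "X < 6" "v = W X" using W_surj by blast
      then show ?thesis unfolding less6 by (auto simp: vlist_def)
    next
      case 4
      then have m: "lev v \<in> {1,2,3}" by simp
      obtain a b where "\<And>w. lev w = lev v + 1 \<and> par w = v \<longleftrightarrow> w = a \<or> w = b"
        by (rule children[OF m]) (rule that; assumption)
      then have "lev a = 4 \<and> par a = v" using 4 by simp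
      then show ?thesis using l4 by blast
    next
      case 5 then show ?thesis using l4 by blast
    next
      case 6
      then have "v = up (par v)" "lev (par v) = 4" by (simp_all add: up_par lev_par)
      then show ?thesis using l4 by metis
    next
      case 7
      then have "v = up (up (par (par v)))" "lev (par (par v)) = 4" by (simp_all add: up_par lev_par)
      then show ?thesis using l4 by metis
    next
      case 8
      obtain w where w: "adj v w" by (rule nbs_0[of v]) auto
      then have w6: "lev w = 6" using nbs_7 8 by blast
      then have u: "w = up (up (par (par w)))" "lev (par (par w)) = 4" by (simp_all add: up_par lev_par)
      have "lev w \<in> {4,5,6}" using w6 by simp
      from nb_high(1)[OF this, of v] nb_high(2,3)[OF this] have "v = up w" using w adj_sym[of v w] w6 8 by auto
      then have "v = apex (par (par w))" using u unfolding apex_def by simp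
      then show ?thesis using l4[OF u(2)] by simp
    qed
  qed
  then show ?thesis by blast
qed

end

theorem biggs_smith_labelling:
  assumes "is_biggs_smith (adj :: 'n::finite \<Rightarrow> 'n \<Rightarrow> bool)"
  obtains vs where "distinct vs" "set vs = UNIV" "map (gdist adj x) vs = bs_lev"
    "list_all2 (\<lambda>v (a,b,c). \<forall>w. adj v w \<longleftrightarrow> w = vs ! a \<or> w = vs ! b \<or> w = vs !
        c) vs bs_nbs"
proof -
  interpret rooted_biggs_smith adj x by unfold_locales (rule assms)
  obtain Y W where "labelled_biggs_smith adj x Y W"
    by (rule ex_labels, rule that, rule labelled_biggs_smith.intro, rule rooted_biggs_smith_axioms,
        rule labelled_biggs_smith_axioms.intro) blast+
  then interpret labelled_biggs_smith adj x Y W .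
  have "card (set vlist) = length vlist"
    unfolding vlist_surj using assms by (simp add: is_biggs_smith_def vlist_def)
  then have "distinct vlist" by (rule card_distinct)
  then show ?thesis using that vlist_surj vlist_lev vlist_adj by blast
qed

section \<open>Hermitian form and adjoints\<close>

lemma hermitian_add_left: "hermitian (u + v) w = hermitian u w + hermitian v w"
  by (simp add: hermitian_def algebra_simps sum.distrib)
lemma hermitian_scale_left: "hermitian (c *s u) w = c * hermitian u w"
  by (simp add: hermitian_def algebra_simps sum_distrib_left)
lemma hermitian_cnj: "hermitian u v = cnj (hermitian v u)"
  by (simp add: hermitian_def mult.commute)
lemma hermitian_0_left [simp]: "hermitian 0 w = 0" by (simp add: hermitian_def)
lemma hermitian_0_right [simp]: "hermitian w 0 = 0" by (simp add: hermitian_def)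
lemma hermitian_sum_left: "hermitian (\<Sum>i\<in>I. f i) w = (\<Sum>i\<in>I. hermitian (f i) w)"
  by (induction I rule: infinite_finite_induct) (simp_all add: hermitian_add_left)
lemma hermitian_add_right: "hermitian w (u + v) = hermitian w u + hermitian w v"
  by (simp add: hermitian_def algebra_simps sum.distrib)
lemma hermitian_scale_right: "hermitian w (c *s u) = cnj c * hermitian w u"
  by (simp add: hermitian_def algebra_simps sum_distrib_left)
lemma hermitian_sum_right: "hermitian w (\<Sum>i\<in>I. f i) = (\<Sum>i\<in>I. hermitian w (f i))"
  by (induction I rule: infinite_finite_induct) (simp_all add: hermitian_add_right)

definition adjoint_mat :: "complex^'n^'n \<Rightarrow> complex^'n^'n" where
  "adjoint_mat M = (\<chi> i j. cnj (M $ j $ i))"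

lemma hermitian_adjoint: "hermitian (M *v u) w = hermitian u (adjoint_mat M *v w)"
proof -
  have "hermitian (M *v u) w = (\<Sum>i\<in>UNIV. \<Sum>j\<in>UNIV. M $ i $ j * u $ j * cnj (w $ i))"
    by (simp add: hermitian_def matrix_vector_mult_def sum_distrib_right)
  also have "\<dots> = (\<Sum>j\<in>UNIV. \<Sum>i\<in>UNIV. M $ i $ j * u $ j * cnj (w $ i))" by (rule sum.swap)
  also have "\<dots> = hermitian u (adjoint_mat M *v w)"
    by (simp add: hermitian_def matrix_vector_mult_def adjoint_mat_def sum_distrib_left mult_ac)
  finally show ?thesis .
qed

lemma adjoint_mat_mult: "adjoint_mat (M ** N) = adjoint_mat N ** adjoint_mat M"
  by (simp add: adjoint_mat_def matrix_matrix_mult_def Finite_Cartesian_Product.vec_eq_iff mult.commute)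

lemma adjoint_adjoint [simp]: "adjoint_mat (adjoint_mat M) = M"
  by (simp add: adjoint_mat_def Finite_Cartesian_Product.vec_eq_iff)

lemma mat_scale_mult_vec: "mat_scale c M *v v = c *s (M *v v)"
  by (simp add: mat_scale_def matrix_vector_mult_def Finite_Cartesian_Product.vec_eq_iff sum_distrib_left mult_ac map_matrix_def)

lemma matrix_mult_sum_right: "M *v (\<Sum>i\<in>I. f i) = (\<Sum>i\<in>I. M *v f i)" for M :: "complex^'n^'k"
  by (induction I rule: infinite_finite_induct) (simp_all add: matrix_vector_right_distrib)

lemma matrix_sum_mult_vec: "(\<Sum>i\<in>I. f i) *v u = (\<Sum>i\<in>I. f i *v u)" for u :: "complex^'n"
  by (induction I rule: infinite_finite_induct) (simp_all add: matrix_vector_mult_add_rdistrib)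

lemma matrix_mult_add_right: "P ** (Q + R) = P ** Q + P ** R" for P Q :: "complex^'n^'n"
  by (simp add: matrix_matrix_mult_def Finite_Cartesian_Product.vec_eq_iff algebra_simps sum.distrib)
lemma matrix_mult_add_left: "(P + Q) ** R = P ** R + Q ** R" for P Q :: "complex^'n^'n"
  by (simp add: matrix_matrix_mult_def Finite_Cartesian_Product.vec_eq_iff algebra_simps sum.distrib)
lemma mat_scale_mult_right: "P ** mat_scale c Q = mat_scale c (P ** Q)"
  by (simp add: mat_scale_def map_matrix_def matrix_matrix_mult_def Finite_Cartesian_Product.vec_eq_iff sum_distrib_left mult_ac)
lemma mat_scale_mult_left: "mat_scale c P ** Q = mat_scale c (P ** Q)"
  by (simp add: mat_scale_def map_matrix_def matrix_matrix_mult_def Finite_Cartesian_Product.vec_eq_iff sum_distrib_left mult_ac)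

section \<open>The Terwilliger algebra is closed under adjoints\<close>

lemma matrix_subalgebra_Inter: "(\<And>S. S \<in> F \<Longrightarrow> matrix_subalgebra S) \<Longrightarrow>
    matrix_subalgebra (\<Inter>F)"
  unfolding matrix_subalgebra_def by (auto intro: cmat.subspace_Inter)

lemma subalgebra_T: "matrix_subalgebra (terwilliger_algebra adj x)"
  unfolding terwilliger_algebra_def by (rule hull_in) (auto intro: matrix_subalgebra_Inter)

lemma A_in_T: "adj_matrix adj \<in> terwilliger_algebra adj x"
  unfolding terwilliger_algebra_def by (rule hull_inc) simp
lemma E_in_T: "i \<le> graph_diameter adj \<Longrightarrow> Estar adj x i \<in> terwilliger_algebra adj x"
  unfolding terwilliger_algebra_def by (rule hull_inc) simp
lemma one_in_T: "Finite_Cartesian_Product.mat 1 \<in> terwilliger_algebra adj x"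
  using subalgebra_T unfolding matrix_subalgebra_def by blast
lemma mult_in_T: "M \<in> terwilliger_algebra adj x \<Longrightarrow> N \<in> terwilliger_algebra adj x
    \<Longrightarrow> M ** N \<in> terwilliger_algebra adj x"
  using subalgebra_T unfolding matrix_subalgebra_def by blast
lemma subspace_T: "cmat.subspace (terwilliger_algebra adj x)"
  using subalgebra_T unfolding matrix_subalgebra_def by blast

lemma T_induct:
  assumes "M \<in> terwilliger_algebra adj x" "matrix_subalgebra S" "adj_matrix adj \<in> S"
    "\<And>i. i \<le> graph_diameter adj \<Longrightarrow> Estar adj x i \<in> S"
  shows "M \<in> S"
proof -
  have "terwilliger_algebra adj x \<subseteq> S"
    unfolding terwilliger_algebra_def by (rule hull_minimal) (use assms in auto)
  then show ?thesis using assms(1) by blast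
qed

text \<open>The generators are self-adjoint, and the matrices whose adjoint lies in T form a
  subalgebra.\<close>

lemma adjoint_in_T:
  assumes "symp adj" "M \<in> terwilliger_algebra adj x"
  shows "adjoint_mat M \<in> terwilliger_algebra adj x"
proof -
  let ?T = "terwilliger_algebra adj x"
  have "M \<in> {M. adjoint_mat M \<in> ?T}"
  proof (rule T_induct[OF assms(2)])
    have "adjoint_mat 0 = (0 :: complex^'a^'a)" "adjoint_mat (M + N) = adjoint_mat M + adjoint_mat N"
      "adjoint_mat (mat_scale c M) = mat_scale (cnj c) (adjoint_mat M)"
          "adjoint_mat (Finite_Cartesian_Product.mat 1 :: complex^'a^'a) = Finite_Cartesian_Product.mat 1"
      for M N :: "complex^'a^'a" and c
      by (auto simp: adjoint_mat_def Finite_Cartesian_Product.vec_eq_iff mat_scale_def map_matrix_def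
          Finite_Cartesian_Product.mat_def)
    then show "matrix_subalgebra {M. adjoint_mat M \<in> ?T}"
      using subalgebra_T[of adj x] unfolding matrix_subalgebra_def cmat.subspace_def by (auto simp: adjoint_mat_mult)
    have "adjoint_mat (adj_matrix adj) = adj_matrix adj"
      using assms(1) by (auto simp: adjoint_mat_def adj_matrix_def Finite_Cartesian_Product.vec_eq_iff dest: sympD)
    then show "adj_matrix adj \<in> {M. adjoint_mat M \<in> ?T}" using A_in_T by simp
    have "adjoint_mat (Estar adj x i) = Estar adj x i" for i
      by (auto simp: adjoint_mat_def Estar_def Finite_Cartesian_Product.vec_eq_iff)
    then show "i \<le> graph_diameter adj \<Longrightarrow> Estar adj x i \<in> {M. adjoint_mat M \<in> ?T}" for i using
        E_in_T by simp
  qed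
  then show ?thesis by simp
qed

lemma Estar_mult_vec: "Estar adj x i *v u = (\<chi> y. if gdist adj x y = i then u $ y else 0)"
proof -
  have "(\<Sum>z\<in>UNIV. (if y = z \<and> gdist adj x y = i then 1 else 0) * u $ z) = (if gdist adj x y = i then u $ y
      else 0)" for y
  proof (cases "gdist adj x y = i")
    case True
    then show ?thesis by (simp add: if_distrib[of "\<lambda>a. a * _"] cong: if_cong)
  qed simp
  then show ?thesis by (simp add: Estar_def matrix_vector_mult_def Finite_Cartesian_Product.vec_eq_iff)
qed

section \<open>Modules with compatible bases\<close>

text \<open>Module \<open>k < m\<close> has type \<open>ty k\<close> and basis \<open>v k 0, \<dots>, v k (n (ty k) -
    1)\<close>. The action of \<open>A\<close>
  and the Gram matrix up to the factor \<open>sc k\<close> depend on the type only; \<open>gi t\<close> is the inverse of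
  the transposed Gram matrix, and \<open>p t i\<close> sends each seed of type \<open>t\<close> to the
      \<open>i\<close>-th basis vector.\<close>

locale module_family =
  fixes adj :: "'n::finite \<Rightarrow> 'n \<Rightarrow> bool" and x :: 'n
    and m :: nat and q :: nat and ty :: "nat \<Rightarrow> nat" and n :: "nat \<Rightarrow> nat" and lv ::
        "nat \<Rightarrow> nat \<Rightarrow> nat"
    and B g gi :: "nat \<Rightarrow> nat \<Rightarrow> nat \<Rightarrow> complex" and sc :: "nat \<Rightarrow> complex"
    and v :: "nat \<Rightarrow> nat \<Rightarrow> complex^'n" and p :: "nat \<Rightarrow> nat \<Rightarrow> complex^'n^'n"
  assumes sym: "symp adj"
    and ty: "k < m \<Longrightarrow> ty k < q" and ty_surj: "t < q \<Longrightarrow> \<exists>k<m. ty k = t"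
    and n_pos: "t < q \<Longrightarrow> 0 < n t"
    and lv_le: "t < q \<Longrightarrow> j < n t \<Longrightarrow> lv t j \<le> graph_diameter adj"
    and lv_0: "t < q \<Longrightarrow> lv t 0 = t"
    and lv_gt: "t < q \<Longrightarrow> 0 < j \<Longrightarrow> j < n t \<Longrightarrow> t < lv t j"
    and A_v: "k < m \<Longrightarrow> j < n (ty k) \<Longrightarrow> adj_matrix adj *v v k j = (\<Sum>i<n (ty k). B (ty
        k) i j *s v k i)"
    and E_v: "k < m \<Longrightarrow> j < n (ty k) \<Longrightarrow> Estar adj x i *v v k j = (if lv (ty k) j = i then v
        k j else 0)"
    and gram: "k < m \<Longrightarrow> l < m \<Longrightarrow> i < n (ty k) \<Longrightarrow> j < n (ty l) \<Longrightarrow>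
      hermitian (v k i) (v l j) = (if k = l then sc k * g (ty k) i j else 0)"
    and gi: "t < q \<Longrightarrow> i < n t \<Longrightarrow> j < n t \<Longrightarrow> (\<Sum>l<n t. gi t i l * g t j
        l) = (if i = j then 1 else 0)"
    and sc: "k < m \<Longrightarrow> sc k \<noteq> 0"
    and total: "(\<Sum>k<m. n (ty k)) = CARD('n)"
    and p: "t < q \<Longrightarrow> i < n t \<Longrightarrow> p t i \<in> terwilliger_algebra adj x"
    and p_v: "k < m \<Longrightarrow> i < n (ty k) \<Longrightarrow> p (ty k) i *v v k 0 = v k i"
begin

abbreviation "T \<equiv> terwilliger_algebra adj x"

text \<open>The dual basis up to the factor \<open>sc k\<close>. The conjugation compensates that
  \<open>hermitian\<close> is conjugate-linear in its second argument.\<close>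

definition dual where "dual k j = (\<Sum>l<n (ty k). cnj (gi (ty k) j l) *s v k l)"
definition coord where "coord k j u = hermitian u (dual k j) / sc k"
definition I where "I = Sigma {..<m} (\<lambda>k. {..<n (ty k)})"

lemma dual:
  assumes "k < m" "l < m" "i < n (ty k)" "j < n (ty l)"
  shows "hermitian (v k i) (dual l j) = (if k = l \<and> i = j then sc k else 0)"
proof -
  have "hermitian (v k i) (dual l j) = (\<Sum>a<n (ty l). gi (ty l) j a * hermitian (v k i) (v l a))"
    by (simp add: dual_def hermitian_sum_right hermitian_scale_right)
  also have "\<dots> = (\<Sum>a<n (ty l). if k = l then sc k * (gi (ty k) j a * g (ty k) i a) else 0)"
    by (rule sum.cong) (use assms in \<open>auto simp: gram\<close>)
  also have "\<dots> = (if k = l \<and> i = j then sc k else 0)"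
    using assms gi[of "ty k" j i] ty[of k] by (cases "k = l") (auto simp: sum_distrib_left[symmetric])
  finally show ?thesis .
qed

lemma coord_v: "k < m \<Longrightarrow> l < m \<Longrightarrow> i < n (ty k) \<Longrightarrow> j < n (ty l)
    \<Longrightarrow> coord l j (v k i) = (if k = l \<and> i = j then 1 else 0)"
  by (simp add: coord_def dual sc)

lemma coord_add: "coord k i (a + b) = coord k i a + coord k i b"
  and coord_scale: "coord k i (c *s a) = c * coord k i a"
  and coord_sum: "coord k i (\<Sum>z\<in>Z. f z) = (\<Sum>z\<in>Z. coord k i (f z))"
  by (simp_all add: coord_def hermitian_add_left hermitian_scale_left hermitian_sum_left add_divide_distrib sum_divide_distrib)

lemma coord_0 [simp]: "coord k i 0 = 0" by (simp add: coord_def)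

lemma finite_I [simp]: "finite I" by (simp add: I_def)

lemma I_iff: "(k,i) \<in> I \<longleftrightarrow> k < m \<and> i < n (ty k)" by (simp add: I_def)

lemma v_inj: "inj_on (\<lambda>(k,i). v k i) I"
proof (rule inj_onI, clarify)
  fix k i l j assume h: "(k,i) \<in> I" "(l,j) \<in> I" "v k i = v l j"
  have "coord l j (v k i) = 1" using h coord_v[of l l j j] by (simp add: I_iff)
  then show "k = l \<and> i = j" using h coord_v[of k l i j] by (auto simp: I_iff split: if_splits)
qed

lemma coord_comb:
  assumes "(l,j) \<in> I"
  shows "coord l j (\<Sum>(k,i)\<in>I. c k i *s v k i) = c l j"
proof -
  have "coord l j (\<Sum>(k,i)\<in>I. c k i *s v k i) = (\<Sum>(k,i)\<in>I. c k i * coord l j (v k i))"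
    by (simp add: coord_sum coord_scale case_prod_beta)
  also have "\<dots> = (\<Sum>z\<in>I. if z = (l,j) then c l j else 0)"
    by (rule sum.cong) (use assms in \<open>auto simp: coord_v I_iff split: if_splits\<close>)
  also have "\<dots> = c l j" using assms by simp
  finally show ?thesis .
qed

lemma v_ne: "(k,i) \<in> I \<Longrightarrow> v k i \<noteq> 0"
  using coord_v[of k k i i] by (auto simp: I_iff)

lemma indep_all: "vec.independent ((\<lambda>(k,i). v k i) ` I)"
proof -
  have fin: "finite ((\<lambda>(k,i). v k i) ` I)" by simp
  show ?thesis
  proof (rule vec.independent_if_scalars_zero[OF fin])
    fix f z assume s: "(\<Sum>w\<in>(\<lambda>(k,i). v k i) ` I. f w *s w) = 0" and z: "z \<in> (\<lambda>(k,i). v k i) ` I"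
    have "(\<Sum>(k,i)\<in>I. f (v k i) *s v k i) = 0"
      using s unfolding sum.reindex[OF v_inj] by (simp add: case_prod_beta)
    moreover obtain l j where "(l,j) \<in> I" "z = v l j" using z by auto
    ultimately show "f z = 0" using coord_comb[of l j "\<lambda>k i. f (v k i)"] by simp
  qed
qed

text \<open>By \<open>total\<close> there are as many independent vectors as the dimension of the
  standard module.\<close>

lemma span_all: "vec.span ((\<lambda>(k,i). v k i) ` I) = UNIV"
proof -
  have "card ((\<lambda>(k,i). v k i) ` I) = card I" by (rule card_image[OF v_inj])
  also have "\<dots> = CARD('n)" by (simp add: I_def total)
  finally have "card ((\<lambda>(k,i). v k i) ` I) = vec.dim (UNIV :: (complex^'n) set)" by (simp only: vec_dim_card)
  then have "UNIV \<subseteq> vec.span ((\<lambda>(k,i). v k i) ` I)"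
    by (intro vec.card_ge_dim_independent indep_all) auto
  then show ?thesis by blast
qed

lemma expand: "u = (\<Sum>(k,i)\<in>I. coord k i u *s v k i)"
proof -
  have "u \<in> vec.span ((\<lambda>(k,i). v k i) ` I)" using span_all by simp
  then obtain f where "u = (\<Sum>w\<in>(\<lambda>(k,i). v k i) ` I. f w *s w)"
    unfolding vec.span_finite[OF finite_imageI[OF finite_I]] by auto
  then have u: "u = (\<Sum>(k,i)\<in>I. f (v k i) *s v k i)"
    unfolding sum.reindex[OF v_inj] by (simp add: case_prod_beta)
  have "coord k i u = f (v k i)" if "(k,i) \<in> I" for k i
    unfolding u using coord_comb[OF that, of "\<lambda>k i. f (v k i)"] by simp
  then have "(\<Sum>(k,i)\<in>I. coord k i u *s v k i) = (\<Sum>(k,i)\<in>I. f (v k i) *s v k i)"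
    by (intro sum.cong) auto
  then show ?thesis using u by simp
qed

lemma expand2: "u = (\<Sum>k<m. \<Sum>i<n (ty k). coord k i u *s v k i)"
  using expand[of u] by (simp add: I_def sum.Sigma)

lemma vec_eqI: assumes "\<And>k i. (k,i) \<in> I \<Longrightarrow> coord k i a = coord k i b" shows "a = b"
proof -
  have "(\<Sum>(k,i)\<in>I. coord k i a *s v k i) = (\<Sum>(k,i)\<in>I. coord k i b *s v k i)"
    using assms by (intro sum.cong) auto
  then show ?thesis using expand[of a] expand[of b] by simp
qed

lemma vec_eqI_hermitian: assumes "\<And>k i. (k,i) \<in> I \<Longrightarrow> hermitian a (v k i) = hermitian b (v k i)"
    shows "a = b"
proof (rule vec_eqI)
  fix k i assume h: "(k,i) \<in> I"
  have "hermitian a (dual k i) = hermitian b (dual k i)"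
    unfolding dual_def hermitian_sum_right hermitian_scale_right using h assms[of k] by (intro sum.cong) (auto simp: I_iff)
  then show "coord k i a = coord k i b" by (simp add: coord_def)
qed

lemma mat_eqI: fixes M N :: "complex^'n^'n" assumes "\<And>k i. (k,i) \<in> I \<Longrightarrow> M *v v k i = N *v v k i"
    shows "M = N"
proof -
  have "M *v u = N *v u" for u
  proof -
    have "M *v (\<Sum>(k,i)\<in>I. coord k i u *s v k i) = N *v (\<Sum>(k,i)\<in>I. coord k i u *s v k i)"
      unfolding matrix_mult_sum_right using assms by (intro sum.cong) (auto simp: vector_scalar_commute)
    then show ?thesis using expand[of u] by simp
  qed
  then show ?thesis by (simp add: matrix_eq)
qed

section \<open>Matrix units and the dimension of T\<close>

definition Phi where "Phi t i j = matrix (\<lambda>u. \<Sum>k\<in>{k. k < m \<and> ty k = t}. coord k j u *s v k i)"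

lemma Phi: "Phi t i j *v u = (\<Sum>k\<in>{k. k < m \<and> ty k = t}. coord k j u *s v k i)"
proof -
  have "Vector_Spaces.linear (*s) (*s) (\<lambda>u. \<Sum>k\<in>{k. k < m \<and> ty k = t}. coord k j u *s v k i)"
    by unfold_locales (simp_all add: coord_add coord_scale vec.scale_left_distrib sum.distrib vec.scale_sum_right)
  then show ?thesis unfolding Phi_def by (rule matrix_works)
qed

lemma Phi_v:
  assumes "(l,a) \<in> I" "j < n t"
  shows "Phi t i j *v v l a = (if ty l = t \<and> a = j then v l i else 0)"
proof -
  have "Phi t i j *v v l a = (\<Sum>k\<in>{k. k < m \<and> ty k = t}. if k = l then (if a = j then v l i else 0) else 0)"
    unfolding Phi using assms by (intro sum.cong) (auto simp: coord_v I_iff)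
  also have "\<dots> = (if ty l = t \<and> a = j then v l i else 0)" using assms by (simp add: I_iff)
  finally show ?thesis .
qed

lemma Phi_mult: "t < q \<Longrightarrow> i < n t \<Longrightarrow> j < n t \<Longrightarrow> s < q \<Longrightarrow> a <
    n s \<Longrightarrow> b < n s \<Longrightarrow>
   Phi t i j ** Phi s a b = (if t = s \<and> j = a then Phi t i b else 0)"
  by (rule mat_eqI) (auto simp: matrix_vector_mul_assoc[symmetric] Phi_v I_iff)

lemma one_Phi: "Finite_Cartesian_Product.mat 1 = (\<Sum>t<q. \<Sum>i<n t. Phi t i i)"
proof (rule mat_eqI)
  fix k i assume h: "(k,i) \<in> I"
  have "(\<Sum>t<q. \<Sum>j<n t. Phi t j j) *v v k i = (\<Sum>t<q. \<Sum>j<n t. if ty k = t \<and> i = j then v k j else 0)"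
    unfolding matrix_sum_mult_vec by (intro sum.cong) (auto simp: Phi_v[OF h])
  also have "\<dots> = (\<Sum>t<q. if t = ty k then (\<Sum>j<n (ty k). if j = i then v k j else 0) else 0)"
    by (intro sum.cong) auto
  also have "\<dots> = v k i" using h ty by (simp add: I_iff)
  finally show "Finite_Cartesian_Product.mat 1 *v v k i = (\<Sum>t<q. \<Sum>i<n t. Phi t i i) *v v k i" by simp
qed

definition PhiSet where "PhiSet = (\<lambda>(t,i,j). Phi t i j) ` (SIGMA t:{..<q}. {..<n t} \<times> {..<n t})"

lemma PhiSetI: "t < q \<Longrightarrow> i < n t \<Longrightarrow> j < n t \<Longrightarrow> Phi t i j \<in> PhiSet"
  unfolding PhiSet_def by (rule image_eqI[of _ _ "(t,i,j)"]) auto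

lemma Phi_sum_v:
  assumes "(k,j) \<in> I"
  shows "(\<Sum>t<q. \<Sum>a<n t. \<Sum>b<n t. mat_scale (c t a b) (Phi t a b)) *v v k j = (\<Sum>a<n (ty k). c (ty k) a
      j *s v k a)"
proof -
  have "(\<Sum>t<q. \<Sum>a<n t. \<Sum>b<n t. mat_scale (c t a b) (Phi t a b)) *v v k j
      = (\<Sum>t<q. \<Sum>a<n t. \<Sum>b<n t. if t = ty k \<and> b = j then c t a b *s v k a else 0)"
    unfolding matrix_sum_mult_vec mat_scale_mult_vec by (intro sum.cong) (auto simp: Phi_v[OF assms])
  also have "\<dots> = (\<Sum>t<q. if t = ty k then (\<Sum>a<n (ty k). \<Sum>b<n (ty k). if b = j then c (ty k) a b *s v
      k a else 0) else 0)"
    by (intro sum.cong) auto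
  also have "\<dots> = (\<Sum>a<n (ty k). c (ty k) a j *s v k a)" using assms ty by (simp add: I_iff)
  finally show ?thesis .
qed

lemma Phi_sum_in_span: "(\<Sum>t<q. \<Sum>a<n t. \<Sum>b<n t. mat_scale (c t a b) (Phi t a b)) \<in> cmat.span PhiSet"
  by (intro cmat.span_sum cmat.span_scale cmat.span_base) (auto intro: PhiSetI)

text \<open>The multiplication rule for matrix units makes their span a subalgebra. It contains
  \<open>A\<close> because the coefficients \<open>B\<close> depend on the type only, and the
  \<open>Estar\<close> matrices because the basis vectors are pure.\<close>

lemma T_subset_span: "T \<subseteq> cmat.span PhiSet"
proof
  fix M assume "M \<in> T"
  then show "M \<in> cmat.span PhiSet"
  proof (rule T_induct)
    have "Finite_Cartesian_Product.mat 1 \<in> cmat.span PhiSet"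
      unfolding one_Phi by (intro cmat.span_sum cmat.span_base) (auto intro: PhiSetI)
    moreover have "M ** N \<in> cmat.span PhiSet" if "M \<in> cmat.span PhiSet" "N \<in> cmat.span PhiSet" for M N
      using that(1)
    proof (induction rule: cmat.span_induct_alt)
      case base then show ?case by (simp add: cmat.span_zero)
    next
      case (step c P M)
      have "P ** N \<in> cmat.span PhiSet" using that(2)
      proof (induction rule: cmat.span_induct_alt)
        case base then show ?case by (simp add: cmat.span_zero)
      next
        case (step c Q N)
        have "P ** Q = 0 \<or> P ** Q \<in> PhiSet"
        proof -
          obtain t i j where P: "P = Phi t i j" "t < q" "i < n t" "j < n t" using \<open>P \<in> PhiSet\<close>
              unfolding PhiSet_def by auto
          obtain s a b where Q: "Q = Phi s a b" "s < q" "a < n s" "b < n s" using step(1) unfolding PhiSet_def by auto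
          show ?thesis unfolding P(1) Q(1) Phi_mult[OF P(2-) Q(2-)] using P Q by (auto intro: PhiSetI)
        qed
        then have "P ** Q \<in> cmat.span PhiSet" using cmat.span_base cmat.span_zero by metis
        moreover have "P ** (mat_scale c Q + N) = mat_scale c (P ** Q) + P ** N"
          by (simp add: matrix_mult_add_right mat_scale_mult_right)
        ultimately show ?case using step by (simp add: cmat.span_add cmat.span_scale)
      qed
      moreover have "(mat_scale c P + M) ** N = mat_scale c (P ** N) + M ** N"
        by (simp add: matrix_mult_add_left mat_scale_mult_left)
      ultimately show ?case using step by (simp add: cmat.span_add cmat.span_scale)
    qed
    ultimately show "matrix_subalgebra (cmat.span PhiSet)" unfolding matrix_subalgebra_def by simp
  next
    have "adj_matrix adj = (\<Sum>t<q. \<Sum>a<n t. \<Sum>b<n t. mat_scale (B t a b) (Phi t a b))"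
      by (rule mat_eqI) (simp add: Phi_sum_v A_v I_iff)
    then show "adj_matrix adj \<in> cmat.span PhiSet" using Phi_sum_in_span by simp
  next
    fix i
    have "Estar adj x i = (\<Sum>t<q. \<Sum>a<n t. \<Sum>b<n t. mat_scale (if a = b \<and> lv t a = i then 1 else 0) (Phi t a b))"
    proof (rule mat_eqI)
      fix k j assume h: "(k,j) \<in> I"
      have "(\<Sum>a<n (ty k). (if a = j \<and> lv (ty k) a = i then 1 else 0) *s v k a) = (\<Sum>a<n (ty k). if a = j
          then (if lv (ty k) j = i then v k j else 0) else 0)"
        by (intro sum.cong) auto
      also have "\<dots> = (if lv (ty k) j = i then v k j else 0)" using h by (simp add: I_iff)
      finally show "Estar adj x i *v v k j = (\<Sum>t<q. \<Sum>a<n t. \<Sum>b<n t. mat_scale (if a = b \<and> lv t a = i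
          then 1 else 0) (Phi t a b)) *v v k j"
        unfolding Phi_sum_v[OF h] using h E_v by (simp add: I_iff)
    qed
    then show "Estar adj x i \<in> cmat.span PhiSet" using Phi_sum_in_span by simp
  qed
qed

text \<open>By \<open>lv_gt\<close> the seed is the only basis vector of its module on level
  \<open>t\<close>, and vectors on different levels are orthogonal.\<close>

lemma g_row_0:
  assumes "t < q" "0 < j" "j < n t" shows "g t 0 j = 0" "g t j 0 = 0"
proof -
  obtain k where k: "k < m" "ty k = t" using ty_surj assms by blast
  have E: "adjoint_mat (Estar adj x t) = Estar adj x t"
    by (auto simp: adjoint_mat_def Estar_def Finite_Cartesian_Product.vec_eq_iff)
  have n0: "0 < n (ty k)" using n_pos assms k by simp
  have e0: "Estar adj x t *v v k 0 = v k 0" using E_v[OF k(1) n0, of t] lv_0 assms k by simp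
  have ej: "Estar adj x t *v v k j = 0" using E_v[OF k(1), of j t] lv_gt[OF assms] assms k by simp
  have "hermitian (v k 0) (v k j) = hermitian (Estar adj x t *v v k 0) (v k j)" using e0 by simp
  also have "\<dots> = 0" unfolding hermitian_adjoint E ej by simp
  finally have h: "hermitian (v k 0) (v k j) = 0" .
  then have h': "hermitian (v k j) (v k 0) = 0" using hermitian_cnj[of "v k j" "v k 0"] by simp
  show "g t 0 j = 0" using h gram[OF k(1) k(1) n0, of j] sc[OF k(1)] assms k by simp
  show "g t j 0 = 0" using h' gram[OF k(1) k(1) _ n0, of j] sc[OF k(1)] assms k by simp
qed

lemma g_00: assumes "t < q" shows "g t 0 0 \<noteq> 0"
proof
  assume "g t 0 0 = 0"
  then have "(\<Sum>l<n t. gi t 0 l * g t 0 l) = (\<Sum>l<n t. 0)"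
    using g_row_0(1)[OF assms] by (intro sum.cong) (auto, metis mult_zero_right neq0_conv)
  then show False using gi[OF assms n_pos n_pos] assms by simp
qed

text \<open>Since the seed is orthogonal to the rest of its basis, the adjoint maps back into the
  line of the seed; the Gram entries are the coefficients of this functional.\<close>

lemma adjoint_Phi:
  assumes t: "t < q" "i < n t"
  shows "adjoint_mat (Phi t i 0) = (\<Sum>l<n t. mat_scale (g t l i / g t 0 0) (Phi t 0 l))"
proof (rule mat_eqI)
  fix k l assume h: "(k,l) \<in> I"
  have n0: "0 < n t" using n_pos t by simp
  have "(\<Sum>a<n t. mat_scale (g t a i / g t 0 0) (Phi t 0 a)) *v v k l = (\<Sum>a<n t. if a = l then (if ty k = t
      then (g t l i / g t 0 0) *s v k 0 else 0) else 0)"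
    unfolding matrix_sum_mult_vec mat_scale_mult_vec by (intro sum.cong) (auto simp: Phi_v[OF h])
  also have "\<dots> = (if ty k = t then (g t l i / g t 0 0) *s v k 0 else 0)" using h by (auto simp: I_iff)
  finally have R: "(\<Sum>a<n t. mat_scale (g t a i / g t 0 0) (Phi t 0 a)) *v v k l = (if ty k = t then (g t l i / g t
      0 0) *s v k 0 else 0)" .
  show "adjoint_mat (Phi t i 0) *v v k l = (\<Sum>l<n t. mat_scale (g t l i / g t 0 0) (Phi t 0 l)) *v v k l"
    unfolding R
  proof (rule vec_eqI_hermitian)
    fix k' a assume h': "(k',a) \<in> I"
    have "hermitian (v k' a) (adjoint_mat (Phi t i 0) *v v k l) = hermitian (Phi t i 0 *v v k' a) (v k l)"
      by (simp add: hermitian_adjoint)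
    then have "hermitian (adjoint_mat (Phi t i 0) *v v k l) (v k' a) = hermitian (v k l) (Phi t i 0 *v v k' a)"
      by (metis hermitian_cnj)
    also have "\<dots> = (if ty k' = t \<and> a = 0 then hermitian (v k l) (v k' i) else 0)" using Phi_v[OF h' n0, of i] by simp
    also have "\<dots> = (if ty k = t \<and> k = k' \<and> a = 0 then sc k * g t l i else 0)"
      using h h' t gram[of k k' l i] by (auto simp: I_iff)
    also have "\<dots> = hermitian (if ty k = t then (g t l i / g t 0 0) *s v k 0 else 0) (v k' a)"
    proof (cases "ty k = t")
      case True
      then have "hermitian (v k 0) (v k' a) = (if k = k' then sc k * g t 0 a else 0)" using gram[of k k' 0 a] h h' n0 by
          (auto simp: I_iff)
      moreover have "a = 0 \<or> k \<noteq> k' \<or> g t 0 a = 0" using g_row_0(1)[OF t(1), of a] h' True by (auto simp: I_iff)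
      ultimately show ?thesis using True g_00[OF t(1)] by (auto simp: hermitian_scale_left)
    qed simp
    finally show "hermitian (adjoint_mat (Phi t i 0) *v v k l) (v k' a) = hermitian (if ty k = t then (g t l i / g t 0
        0) *s v k 0 else 0) (v k' a)" .
  qed
qed

text \<open>\<open>Phi t i j\<close> is the matrix unit that sends \<open>v k j\<close> to \<open>v k i\<close> for all
    \<open>k\<close> of type \<open>t\<close>.
  Subtracting the contributions of smaller types from \<open>Estar t\<close> leaves the projection \<open>Phi t 0 0\<close>
  onto the seeds of type \<open>t\<close>; composition with \<open>p\<close> and taking adjoints yields the other units.\<close>

lemma Phi_in_T: "t < q \<Longrightarrow> i < n t \<Longrightarrow> j < n t \<Longrightarrow> Phi t i j \<in> T"
proof (induction t arbitrary: i j rule: less_induct)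
  case (less t)
  have n0: "0 < n t" using n_pos less by simp
  define Q where "Q = Estar adj x t - (\<Sum>s<t. \<Sum>i\<in>{i. i < n s \<and> lv s i = t}. Phi s i i)"
  have "t \<le> graph_diameter adj" using lv_le[OF less.prems(1) n0] lv_0[OF less.prems(1)] by simp
  then have Q: "Q \<in> T" unfolding Q_def
    using less by (intro cmat.subspace_diff[OF subspace_T] cmat.subspace_sum[OF subspace_T] E_in_T) auto
  have "Q = Phi t 0 0"
  proof (rule mat_eqI)
    fix k a assume h: "(k,a) \<in> I"
    then have k: "k < m" "a < n (ty k)" "ty k < q" using ty by (auto simp: I_iff)
    have "(\<Sum>s<t. \<Sum>i\<in>{i. i < n s \<and> lv s i = t}. Phi s i i) *v v k a
       = (\<Sum>s<t. if s = ty k then (\<Sum>i\<in>{i. i < n s \<and> lv s i = t}. if i = a then v k a else 0) else 0)"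
      unfolding matrix_sum_mult_vec by (intro sum.cong) (auto simp: Phi_v[OF h])
    also have "\<dots> = (if ty k < t \<and> lv (ty k) a = t then v k a else 0)" using k by simp
    finally have Qv: "Q *v v k a = (if lv (ty k) a = t then v k a else 0) - (if ty k < t \<and> lv (ty k) a = t then v k
        a else 0)"
      unfolding Q_def using E_v[OF k(1,2)] by (simp add: matrix_vector_mult_diff_rdistrib)
    have "lv (ty k) a = t \<and> \<not> ty k < t \<longleftrightarrow> ty k = t \<and> a = 0"
      using lv_0[OF k(3)] lv_gt[OF k(3), of a] k(2) by (cases "a = 0") auto
    then show "Q *v v k a = Phi t 0 0 *v v k a" unfolding Qv Phi_v[OF h n0] by auto
  qed
  then have P: "Phi t 0 0 \<in> T" using Q by simp
  have c0: "Phi t i 0 \<in> T" if "i < n t" for i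
  proof -
    have "p t i ** Phi t 0 0 = Phi t i 0"
      by (rule mat_eqI) (use that n0 p_v in \<open>auto simp: matrix_vector_mul_assoc[symmetric] Phi_v I_iff\<close>)
    then show ?thesis using mult_in_T[OF p[OF less.prems(1) that] P] by simp
  qed
  have r0: "Phi t 0 j \<in> T" if j: "j < n t" for j
  proof -
    \<comment> \<open>The rows of \<open>gi\<close> invert the combination in
      \<open>adjoint_Phi\<close>, and \<open>g t 0 0\<close> cancels its denominator.\<close>
    have "(\<Sum>i<n t. mat_scale (gi t j i * g t 0 0) (adjoint_mat (Phi t i 0))) = Phi t 0 j"
    proof (rule mat_eqI)
      fix k l assume h: "(k,l) \<in> I"
      have a: "adjoint_mat (Phi t i 0) *v v k l = (if ty k = t then (g t l i / g t 0 0) *s v k 0 else 0)" if "i < n t" for i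
      proof -
        have "adjoint_mat (Phi t i 0) *v v k l = (\<Sum>a<n t. if a = l then (if ty k = t then (g t l i / g t 0 0) *s v
            k 0 else 0) else 0)"
          unfolding adjoint_Phi[OF less.prems(1) that] matrix_sum_mult_vec mat_scale_mult_vec by (intro sum.cong) (auto
              simp: Phi_v[OF h])
        then show ?thesis using h by (auto simp: I_iff)
      qed
      have "(\<Sum>i<n t. mat_scale (gi t j i * g t 0 0) (adjoint_mat (Phi t i 0))) *v v k l = (\<Sum>i<n t. if ty k = t
          then (gi t j i * g t l i) *s v k 0 else 0)"
        unfolding matrix_sum_mult_vec mat_scale_mult_vec using g_00[OF less.prems(1)] by (intro sum.cong) (auto simp: a)
      also have "\<dots> = (if ty k = t then (\<Sum>i<n t. gi t j i * g t l i) *s v k 0 else 0)" by (simp add: vec.scale_sum_left)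
      also have "\<dots> = Phi t 0 j *v v k l" using gi[OF less.prems(1) j, of l] h by (auto simp: Phi_v[OF h j] I_iff)
      finally show "(\<Sum>i<n t. mat_scale (gi t j i * g t 0 0) (adjoint_mat (Phi t i 0))) *v v k l = Phi t 0 j *v v k l" .
    qed
    moreover have "(\<Sum>i<n t. mat_scale (gi t j i * g t 0 0) (adjoint_mat (Phi t i 0))) \<in> T"
      by (intro cmat.subspace_sum[OF subspace_T] cmat.subspace_scale[OF subspace_T] adjoint_in_T[OF sym] c0) auto
    ultimately show ?thesis by simp
  qed
  have "Phi t i 0 ** Phi t 0 j = Phi t i j" using Phi_mult less.prems n0 by simp
  then show ?case using mult_in_T[OF c0[OF less.prems(2)] r0[OF less.prems(3)]] by simp
qed

lemma T_eq_span: "T = cmat.span PhiSet"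
proof
  have "PhiSet \<subseteq> T" using Phi_in_T by (auto simp: PhiSet_def)
  then show "cmat.span PhiSet \<subseteq> T" by (rule cmat.span_minimal[OF _ subspace_T])
qed (rule T_subset_span)

text \<open>Each type is realised by some module, and there the coefficients can be read off as
  coordinates of the image of a basis vector.\<close>

lemma Phi_sum_0:
  assumes "(\<Sum>t<q. \<Sum>a<n t. \<Sum>b<n t. mat_scale (c t a b) (Phi t a b)) = 0" "t < q" "i < n t" "j < n t"
  shows "c t i j = 0"
proof -
  obtain k where k: "k < m" "ty k = t" using ty_surj assms by blast
  have h: "(k,j) \<in> I" "(k,i) \<in> I" using k assms by (auto simp: I_iff)
  have "(\<Sum>a<n t. c t a j *s v k a) = 0" using Phi_sum_v[OF h(1), of c] assms(1) k by simp
  then have "0 = (\<Sum>a<n t. c t a j * coord k i (v k a))" by (metis (no_types, lifting) coord_0 coord_scale coord_sum sum.cong)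
  also have "\<dots> = (\<Sum>a<n t. if a = i then c t a j else 0)" using h k by (intro sum.cong) (auto simp: coord_v I_iff)
  also have "\<dots> = c t i j" using assms by simp
  finally show ?thesis by simp
qed

lemma Phi_inj: "inj_on (\<lambda>(t,i,j). Phi t i j) (SIGMA t:{..<q}. {..<n t} \<times> {..<n t})"
proof (rule inj_onI)
  fix z w assume zw: "z \<in> (SIGMA t:{..<q}. {..<n t} \<times> {..<n t})"
      "w \<in> (SIGMA t:{..<q}. {..<n t} \<times> {..<n t})" "(\<lambda>(t,i,j). Phi t i j) z = (\<lambda>(t,i,j). Phi t i j) w"
  obtain t i j where z: "z = (t,i,j)" by (cases z)
  obtain s a b where w: "w = (s,a,b)" by (cases w)
  have h: "t < q" "i < n t" "j < n t" "s < q" "a < n s" "b < n s" "Phi t i j = Phi s a b" using zw z w by auto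
  obtain k where k: "k < m" "ty k = t" using ty_surj h by blast
  have kj: "(k,j) \<in> I" using k h by (simp add: I_iff)
  have "v k i = (if t = s \<and> j = b then v k a else 0)"
    using Phi_v[OF kj h(3), of i] Phi_v[OF kj h(6), of a] h(7) k by simp
  moreover have "v k i \<noteq> 0" using v_ne[of k i] k h by (simp add: I_iff)
  ultimately have "t = s \<and> j = b \<and> v k i = v k a" by (auto split: if_splits)
  moreover from this have "i = a" using inj_onD[OF v_inj, of "(k,i)" "(k,a)"] k h by (auto simp: I_iff)
  ultimately show "z = w" using z w by simp
qed

lemma sum_PhiSet: "(\<Sum>M\<in>PhiSet. mat_scale (f M) M) = (\<Sum>t<q. \<Sum>a<n t. \<Sum>b<n t. mat_scale (f (Phi t a
    b)) (Phi t a b))"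
proof -
  let ?J = "SIGMA t:{..<q}. {..<n t} \<times> {..<n t}"
  have "(\<Sum>M\<in>PhiSet. mat_scale (f M) M) = (\<Sum>(t,i,j)\<in>?J. mat_scale (f (Phi t i j)) (Phi t i j))"
    unfolding PhiSet_def sum.reindex[OF Phi_inj] by (simp add: case_prod_beta)
  also have "\<dots> = (\<Sum>t<q. \<Sum>(a,b)\<in>{..<n t} \<times> {..<n t}. mat_scale (f (Phi t a b)) (Phi t a b))"
    by (subst sum.Sigma) (auto simp: case_prod_beta)
  also have "\<dots> = (\<Sum>t<q. \<Sum>a<n t. \<Sum>b<n t. mat_scale (f (Phi t a b)) (Phi t a b))"
    by (simp add: sum.cartesian_product)
  finally show ?thesis .
qed

lemma dim_T: "cmat.dim T = (\<Sum>t<q. n t ^ 2)"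
proof -
  note inj = Phi_inj
  have fin: "finite PhiSet" by (simp add: PhiSet_def)
  have "cmat.independent PhiSet"
  proof (rule cmat.independent_if_scalars_zero[OF fin])
    fix f M assume s: "(\<Sum>M\<in>PhiSet. mat_scale (f M) M) = 0" and M: "M \<in> PhiSet"
    have "(\<Sum>t<q. \<Sum>a<n t. \<Sum>b<n t. mat_scale (f (Phi t a b)) (Phi t a b)) = 0" using s unfolding sum_PhiSet .
    note z = Phi_sum_0[of "\<lambda>t a b. f (Phi t a b)", OF this]
    from M obtain t i j where "M = Phi t i j" "t < q" "i < n t" "j < n t" unfolding PhiSet_def by auto
    with z[of t i j] show "f M = 0" by (simp only:)
  qed
  then have "cmat.dim T = card PhiSet" unfolding T_eq_span by (rule cmat.dim_span_eq_card_independent)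
  also have "\<dots> = card (SIGMA t:{..<q}. {..<n t} \<times> {..<n t})" unfolding PhiSet_def by (rule card_image[OF inj])
  also have "\<dots> = (\<Sum>t<q. n t ^ 2)" by (subst card_SigmaI) (simp_all add: card_cartesian_product power2_eq_square)
  finally show ?thesis .
qed

end

section \<open>Irreducibility, isomorphism and multiplicity\<close>

lemma hermitian_self: "hermitian u u = 0 \<longleftrightarrow> u = 0"
proof
  assume h: "hermitian u u = 0"
  have "hermitian u u = of_real (\<Sum>y\<in>UNIV. (cmod (u $ y))\<^sup>2)"
    by (simp only: hermitian_def of_real_sum complex_norm_square)
  then have "(\<Sum>y\<in>UNIV. (cmod (u $ y))\<^sup>2) = 0" using h by (metis of_real_eq_0_iff)
  then have "\<forall>y. (cmod (u $ y))\<^sup>2 = 0" by (subst (asm) sum_nonneg_eq_0_iff) auto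
  then show "u = 0" by (simp add: Finite_Cartesian_Product.vec_eq_iff)
qed simp

lemma subspace_linear_image:
  assumes "vec.subspace U" "\<And>a b. f (a + b) = f a + f b" "\<And>c a. f (c *s a) = c *s f a"
  shows "vec.subspace (f ` U)"
  unfolding vec.subspace_def
proof (intro conjI ballI allI)
  have "f 0 = 0" using assms(3)[of 0 0] by simp
  then show "0 \<in> f ` U" using vec.subspace_0[OF assms(1)] by (intro image_eqI[of _ _ 0]) auto
  fix a b c assume "a \<in> f ` U"
  then obtain a' where a: "a' \<in> U" "a = f a'" by blast
  then show "c *s a \<in> f ` U" using vec.subspace_scale[OF assms(1) a(1)] by (intro image_eqI[of _ _ "c *s a'"]) (auto
      simp: assms)
  assume "b \<in> f ` U"
  then obtain b' where b: "b' \<in> U" "b = f b'" by blast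
  then show "a + b \<in> f ` U" using a vec.subspace_add[OF assms(1) a(1) b(1)] by (intro image_eqI[of _ _ "a' + b'"])
      (auto simp: assms)
qed

lemma T_isomorphic_trans:
  assumes "T_isomorphic adj x U V" "T_isomorphic adj x V W" "T_module adj x U"
  shows "T_isomorphic adj x U W"
proof -
  obtain f where f: "bij_betw f U V" "\<forall>u\<in>U. \<forall>v\<in>U. f (u + v) = f u + f v"
      "\<forall>c. \<forall>v\<in>U. f (c *s v) = c *s f v"
    "\<forall>M\<in>terwilliger_algebra adj x. \<forall>v\<in>U. f (M *v v) = M *v f v" using assms(1) unfolding
        T_isomorphic_def by blast
  obtain g where g: "bij_betw g V W" "\<forall>u\<in>V. \<forall>v\<in>V. g (u + v) = g u + g v"
      "\<forall>c. \<forall>v\<in>V. g (c *s v) = c *s g v"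
    "\<forall>M\<in>terwilliger_algebra adj x. \<forall>v\<in>V. g (M *v v) = M *v g v" using assms(2) unfolding
        T_isomorphic_def by blast
  have fV: "f u \<in> V" if "u \<in> U" for u using f(1) that by (auto simp: bij_betw_def)
  show ?thesis unfolding T_isomorphic_def
    by (rule exI[of _ "g \<circ> f"]) (use f g fV bij_betw_trans[OF f(1) g(1)] in auto)
qed

context module_family begin

definition W where "W k = vec.span (v k ` {..<n (ty k)})"

lemma v_inj_on: "k < m \<Longrightarrow> inj_on (v k) {..<n (ty k)}"
  by (rule inj_onI) (use inj_onD[OF v_inj, of "(k,_)" "(k,_)"] in \<open>force simp: I_iff\<close>)

lemma coord_comb1:
  assumes "k < m" "l < m" "j < n (ty l)"
  shows "coord l j (\<Sum>i<n (ty k). c i *s v k i) = (if k = l then c j else 0)"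
proof -
  have "coord l j (\<Sum>i<n (ty k). c i *s v k i) = (\<Sum>i<n (ty k). if i = j then (if k = l then c j else 0) else 0)"
    unfolding coord_sum coord_scale by (intro sum.cong) (use assms in \<open>auto simp: coord_v\<close>)
  then show ?thesis using assms by auto
qed

lemma W_sum: "(\<Sum>i<n (ty k). c i *s v k i) \<in> W k"
  unfolding W_def by (intro vec.span_sum vec.span_scale vec.span_base) auto

lemma v_in_W: "i < n (ty k) \<Longrightarrow> v k i \<in> W k"
  unfolding W_def by (intro vec.span_base) auto

lemma subspace_W: "vec.subspace (W k)" unfolding W_def by (rule vec.subspace_span)

lemma W_expand: assumes "k < m" "u \<in> W k" shows "u = (\<Sum>i<n (ty k). coord k i u *s v k i)"
proof -
  obtain f where "u = (\<Sum>w\<in>v k ` {..<n (ty k)}. f w *s w)"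
    using assms(2) unfolding W_def by (subst (asm) vec.span_finite) auto
  then have u: "u = (\<Sum>i<n (ty k). f (v k i) *s v k i)" unfolding sum.reindex[OF v_inj_on[OF assms(1)]] by simp
  have "coord k i u = f (v k i)" if "i < n (ty k)" for i unfolding u using coord_comb1[OF assms(1,1) that] by simp
  then show ?thesis using u by simp
qed

lemma W_coord: "k < m \<Longrightarrow> l < m \<Longrightarrow> u \<in> W k \<Longrightarrow> j < n (ty l)
    \<Longrightarrow> l \<noteq> k \<Longrightarrow> coord l j u = 0"
  using coord_comb1[of k l j "\<lambda>i. coord k i u"] W_expand[of k u] by simp

text \<open>Matrix units act alike on all modules of a type, so one coefficient matrix per type
  describes the action, both on basis vectors and on the coordinates of arbitrary vectors.\<close>

lemma T_action:
  assumes "M \<in> T"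
  obtains c where "\<And>k j. (k,j) \<in> I \<Longrightarrow> M *v v k j = (\<Sum>a<n (ty k). c (ty k) a j *s v k a)"
    and "\<And>k a u. (k,a) \<in> I \<Longrightarrow> coord k a (M *v u) = (\<Sum>j<n (ty k). c (ty k) a j * coord k j u)"
proof -
  have "finite PhiSet" by (simp add: PhiSet_def)
  then obtain f where "M = (\<Sum>P\<in>PhiSet. mat_scale (f P) P)"
    using T_subset_span assms cmat.span_finite[of PhiSet] by auto
  then have M: "M = (\<Sum>t<q. \<Sum>a<n t. \<Sum>b<n t. mat_scale (f (Phi t a b)) (Phi t a b))" using sum_PhiSet by simp
  define c where "c t a b = f (Phi t a b)" for t a b
  have 1: "M *v v k j = (\<Sum>a<n (ty k). c (ty k) a j *s v k a)" if "(k,j) \<in> I" for k j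
    unfolding M c_def using Phi_sum_v[OF that] by simp
  have "coord k a (M *v u) = (\<Sum>j<n (ty k). c (ty k) a j * coord k j u)" if h: "(k,a) \<in> I" for k a u
  proof -
    have k: "k < m" "a < n (ty k)" using h by (auto simp: I_iff)
    define X where "X l j = (\<Sum>b<n (ty l). c (ty l) b j *s v l b)" for l j
    have X: "coord k a (X l j) = (if l = k then c (ty l) a j else 0)" if "l < m" for l j
      unfolding X_def using coord_comb1[OF that k] by auto
    have "M *v u = M *v (\<Sum>l<m. \<Sum>j<n (ty l). coord l j u *s v l j)" using expand2[of u] by simp
    also have "\<dots> = (\<Sum>l<m. \<Sum>j<n (ty l). coord l j u *s X l j)"
      unfolding matrix_mult_sum_right X_def by (intro sum.cong) (auto simp: 1 I_iff vector_scalar_commute)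
    finally have "coord k a (M *v u) = (\<Sum>l<m. \<Sum>j<n (ty l). coord l j u * coord k a (X l j))"
      by (simp only: coord_sum coord_scale)
    also have "\<dots> = (\<Sum>l<m. \<Sum>j<n (ty l). coord l j u * (if l = k then c (ty l) a j else 0))"
      by (intro sum.cong) (auto simp: X)
    also have "\<dots> = (\<Sum>l<m. if l = k then (\<Sum>j<n (ty k). c (ty k) a j * coord k j u) else 0)"
      by (intro sum.cong) (auto simp: mult.commute)
    also have "\<dots> = (\<Sum>j<n (ty k). c (ty k) a j * coord k j u)" using k by simp
    finally show ?thesis .
  qed
  then show ?thesis using 1 that by blast
qed

lemma T_module_W: assumes "k < m" shows "T_module adj x (W k)"
  unfolding T_module_def
proof (intro conjI ballI)
  show "vec.subspace (W k)" by (rule subspace_W)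
  fix M w assume "M \<in> T" "w \<in> W k"
  obtain c where c: "\<And>k j. (k,j) \<in> I \<Longrightarrow> M *v v k j = (\<Sum>a<n (ty k). c (ty k) a j *s v k a)"
    by (rule T_action[OF \<open>M \<in> T\<close>]) blast
  have "M *v w = M *v (\<Sum>i<n (ty k). coord k i w *s v k i)" using W_expand[OF assms \<open>w \<in> W k\<close>] by simp
  also have "\<dots> = (\<Sum>i<n (ty k). coord k i w *s (M *v v k i))"
    unfolding matrix_mult_sum_right by (simp add: vector_scalar_commute)
  also have "\<dots> \<in> W k"
    by (intro vec.subspace_sum[OF subspace_W] vec.subspace_scale[OF subspace_W])
       (use assms in \<open>auto simp: c I_iff intro: W_sum\<close>)
  finally show "M *v w \<in> W k" .
qed

text \<open>It copies coordinates from module \<open>k\<close> to module \<open>l\<close> and is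
  defined on the whole space, so that \<open>transfer k k\<close> is the projection onto
  \<open>W k\<close>.\<close>

definition transfer where "transfer k l w = (\<Sum>i<n (ty k). coord k i w *s v l i)"

lemma transfer_linear: "transfer k l (a + b) = transfer k l a + transfer k l b" "transfer k l (c *s a) = c *s transfer k l a"
  by (simp_all add: transfer_def coord_add coord_scale vec.scale_left_distrib sum.distrib vec.scale_sum_right)

lemma transfer_coord:
  assumes "k < m" "l < m" "ty k = ty l" "j < n (ty l)" shows "coord l j (transfer k l w) = coord k j w"
  unfolding transfer_def assms(3) using coord_comb1[OF assms(2,2,4)] by simp

lemma transfer_in: "ty k = ty l \<Longrightarrow> transfer k l w \<in> W l"
  unfolding transfer_def using W_sum[where k=l] by simp

lemma transfer_T:
  assumes "k < m" "l < m" "ty k = ty l" "M \<in> T" shows "transfer k l (M *v w) = M *v transfer k l w"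
proof -
  obtain c where c: "\<And>k a u. (k,a) \<in> I \<Longrightarrow> coord k a (M *v u) = (\<Sum>j<n (ty k). c (ty k) a j *
      coord k j u)"
    by (rule T_action[OF assms(4)]) blast
  have W: "M *v transfer k l w \<in> W l" using T_module_W[OF assms(2)] transfer_in[OF assms(3)] assms(4) unfolding
      T_module_def by blast
  have "coord l a (M *v transfer k l w) = coord k a (M *v w)" if "a < n (ty l)" for a
    using c[of k a w] c[of l a "transfer k l w"] assms that by (simp add: I_iff transfer_coord)
  then show ?thesis using W_expand[OF assms(2) W] assms(3) unfolding transfer_def[of k l "M *v w"] by simp
qed

lemma iso_same_type:
  assumes "k < m" "l < m" "ty k = ty l" shows "T_isomorphic adj x (W k) (W l)"
proof -
  have inv: "transfer l k (transfer k l w) = w" if "k < m" "l < m" "ty k = ty l" "w \<in> W k" for k l w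
    using W_expand[OF that(1,4)] that unfolding transfer_def[of l k] by (simp add: transfer_coord)
  have "bij_betw (transfer k l) (W k) (W l)"
    by (rule bij_betw_byWitness[of _ "transfer l k"]) (use inv assms transfer_in in auto)
  then show ?thesis unfolding T_isomorphic_def
    using transfer_linear transfer_T[OF assms] by blast
qed

lemma Phi_00_in_T: "t < q \<Longrightarrow> Phi t 0 0 \<in> T" using Phi_in_T n_pos by blast

lemma Phi_00_W:
  assumes "k < m" "w \<in> W k" shows "Phi t 0 0 *v w = (if ty k = t then coord k 0 w *s v k 0 else 0)"
proof -
  have "Phi t 0 0 *v w = (\<Sum>l\<in>{l. l < m \<and> ty l = t}. if l = k then coord k 0 w *s v k 0 else 0)"
    unfolding Phi using W_coord[OF assms(1) _ assms(2)] n_pos ty by (intro sum.cong) auto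
  also have "\<dots> = (if ty k = t then coord k 0 w *s v k 0 else 0)" using assms by simp
  finally show ?thesis .
qed

text \<open>If some vector of a submodule has a nonzero seed coordinate, the seed lies in the
  submodule and \<open>p\<close> produces the whole basis. Otherwise the inner product of
  \<open>u\<close> with a basis vector equals that of \<open>adjoint_mat (p (ty k) i) *v u\<close>
  with the seed, which vanishes because this vector is again in the submodule; so
  \<open>u = 0\<close>.\<close>

lemma irreducible_W: assumes k: "k < m" shows "irreducible_T_module adj x (W k)"
  unfolding irreducible_T_module_def
proof (intro conjI notI)
  have t: "ty k < q" and n0: "0 < n (ty k)" using ty n_pos k by auto
  show "T_module adj x (W k)" by (rule T_module_W[OF k])
  have "v k 0 \<in> W k" "v k 0 \<noteq> 0" using v_in_W[OF n0] v_ne[of k 0] k n0 by (auto simp: I_iff)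
  then show "W k = {0} \<Longrightarrow> False" by auto
  assume "\<exists>U. T_module adj x U \<and> U \<noteq> {0} \<and> U \<subset> W k"
  then obtain U where U: "T_module adj x U" "U \<noteq> {0}" "U \<subset> W k" by blast
  have sub: "vec.subspace U" and closed: "M \<in> T \<Longrightarrow> u \<in> U \<Longrightarrow> M *v u \<in> U" for M
      u using U unfolding T_module_def by auto
  have pu: "Phi (ty k) 0 0 *v u = coord k 0 u *s v k 0" if "u \<in> U" for u
    using Phi_00_W[OF k, of u "ty k"] that U by auto
  show False
  proof (cases "\<exists>u\<in>U. coord k 0 u \<noteq> 0")
    case True
    then obtain u where u: "u \<in> U" "coord k 0 u \<noteq> 0" by blast
    have "coord k 0 u *s v k 0 \<in> U" using closed[OF Phi_00_in_T[OF t] u(1)] pu[OF u(1)] by simp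
    then have "(1 / coord k 0 u) *s (coord k 0 u *s v k 0) \<in> U" by (rule vec.subspace_scale[OF sub])
    then have "v k 0 \<in> U" using u by simp
    then have "p (ty k) i *v v k 0 \<in> U" if "i < n (ty k)" for i using closed p[OF t that] by blast
    then have "v k ` {..<n (ty k)} \<subseteq> U" using p_v[OF k] by auto
    then have "W k \<subseteq> U" unfolding W_def by (rule vec.span_minimal[OF _ sub])
    then show False using U by blast
  next
    case False
    have "u = 0" if u: "u \<in> U" for u
    proof -
      have "hermitian u (v l i) = hermitian 0 (v l i)" if h: "(l,i) \<in> I" for l i
      proof (cases "l = k")
        case True
        have i: "i < n (ty k)" using h True by (simp add: I_iff)
        let ?u' = "adjoint_mat (p (ty k) i) *v u"
        have u': "?u' \<in> U" using closed[OF adjoint_in_T[OF sym p[OF t i]] u] .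
        have "hermitian u (v k i) = hermitian u (p (ty k) i *v v k 0)" using p_v[OF k i] by simp
        also have "\<dots> = hermitian ?u' (v k 0)" by (simp add: hermitian_adjoint)
        also have "\<dots> = hermitian (\<Sum>j<n (ty k). coord k j ?u' *s v k j) (v k 0)" using W_expand[OF k, of ?u']
            u' U by auto
        also have "\<dots> = (\<Sum>j<n (ty k). coord k j ?u' * (sc k * g (ty k) j 0))"
          unfolding hermitian_sum_left hermitian_scale_left using gram[OF k k _ n0] by (intro sum.cong) auto
        also have "\<dots> = 0"
        proof (rule sum.neutral, rule ballI)
          fix j assume j: "j \<in> {..<n (ty k)}"
          show "coord k j ?u' * (sc k * g (ty k) j 0) = 0"
            using False u' g_row_0(2)[OF t, of j] j by (cases "j = 0") auto
        qed
        finally show ?thesis using True by simp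
      next
        case l: False
        have "hermitian u (v l i) = hermitian (\<Sum>j<n (ty k). coord k j u *s v k j) (v l i)" using W_expand[OF k, of
            u] u U by auto
        also have "\<dots> = 0"
          unfolding hermitian_sum_left hermitian_scale_left using gram[OF k, of l] h l by (intro sum.neutral) (auto simp: I_iff)
        finally show ?thesis by simp
      qed
      then show ?thesis by (rule vec_eqI_hermitian)
    qed
    then show False using U(2) vec.subspace_0[OF sub] by blast
  qed
qed

text \<open>An isomorphism commutes with the projection \<open>Phi (ty k) 0 0\<close>, which fixes
  the seed of \<open>W k\<close> and annihilates every module of another type.\<close>

lemma iso_iff: assumes "k < m" "l < m" shows "T_isomorphic adj x (W k) (W l) \<longleftrightarrow> ty k = ty l"
proof
  assume "T_isomorphic adj x (W k) (W l)"
  then obtain f where f: "bij_betw f (W k) (W l)" "\<forall>c. \<forall>v\<in>W k. f (c *s v) = c *s f v"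
      "\<forall>M\<in>T. \<forall>v\<in>W k. f (M *v v) = M *v f v"
    unfolding T_isomorphic_def by blast
  have t: "ty k < q" and n0: "0 < n (ty k)" using ty n_pos assms by auto
  have vk: "v k 0 \<in> W k" "v k 0 \<noteq> 0" using v_in_W[OF n0] v_ne[of k 0] assms n0 by (auto simp: I_iff)
  have z: "0 \<in> W k" using vec.subspace_0[OF subspace_W] .
  have f0: "f 0 = 0" using f(2) z by (metis vec.scale_zero_left)
  have "f (v k 0) = f (Phi (ty k) 0 0 *v v k 0)" using Phi_00_W[OF assms(1) vk(1), of "ty k"] coord_v[OF assms(1,1) n0 n0] by simp
  also have "\<dots> = Phi (ty k) 0 0 *v f (v k 0)" using f(3) Phi_00_in_T[OF t] vk by blast
  also have "\<dots> = 0" if "ty k \<noteq> ty l" using Phi_00_W[OF assms(2), of "f (v k 0)" "ty k"] that f(1) vk by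
      (auto simp: bij_betw_def)
  finally have "ty k \<noteq> ty l \<Longrightarrow> f (v k 0) = f 0" using f0 by simp
  then show "ty k = ty l" using f(1) vk z unfolding bij_betw_def inj_on_def by blast
qed (rule iso_same_type[OF assms])

text \<open>Schur's lemma: a nonzero vector of \<open>U\<close> has a nonzero projection to some
  \<open>W k\<close>. The projection commutes with T, so its restriction to \<open>U\<close> has
  zero kernel and full image by irreducibility of both modules.\<close>

lemma irreducible_iso_W:
  assumes "irreducible_T_module adj x U" shows "\<exists>k<m. T_isomorphic adj x U (W k)"
proof -
  have U: "T_module adj x U" "U \<noteq> {0}" and irr: "\<And>U'. T_module adj x U' \<Longrightarrow> U' \<noteq> {0}
      \<Longrightarrow> U' \<subseteq> U \<Longrightarrow> U' = U"
    using assms unfolding irreducible_T_module_def by blast+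
  have sub: "vec.subspace U" and closed: "M \<in> T \<Longrightarrow> u \<in> U \<Longrightarrow> M *v u \<in> U" for M
      u using U unfolding T_module_def by auto
  obtain u where u: "u \<in> U" "u \<noteq> 0" using U(2) vec.subspace_0[OF sub] by blast
  obtain k i where ki: "(k,i) \<in> I" "coord k i u \<noteq> 0" using vec_eqI[of u 0] u by auto
  then have k: "k < m" "i < n (ty k)" by (auto simp: I_iff)
  let ?f = "transfer k k"
  have fu: "?f u \<noteq> 0" using transfer_coord[OF k(1,1) refl k(2), of u] ki(2) by auto
  have fT: "?f (M *v w) = M *v ?f w" if "M \<in> T" for M w using transfer_T[OF k(1,1) refl that] .
  have f0: "?f 0 = 0" by (simp add: transfer_def)
  have "T_module adj x {w \<in> U. ?f w = 0}"
    unfolding T_module_def vec.subspace_def using sub closed f0 by (auto simp: vec.subspace_def transfer_linear fT)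
  then have ker: "{w \<in> U. ?f w = 0} = {0}" using irr[of "{w \<in> U. ?f w = 0}"] u fu by blast
  have inj: "inj_on ?f U"
  proof (rule inj_onI)
    fix a b assume ab: "a \<in> U" "b \<in> U" "?f a = ?f b"
    have "?f (a - b) = 0" using transfer_linear(1)[of k k "a - b" b] ab by simp
    moreover have "a - b \<in> U" using ab vec.subspace_diff[OF sub] by blast
    ultimately have "a - b = 0" using ker by blast
    then show "a = b" by simp
  qed
  have sW: "?f ` U \<subseteq> W k" using transfer_in by auto
  have "T_module adj x (?f ` U)"
    unfolding T_module_def
  proof (intro conjI ballI)
    show "vec.subspace (?f ` U)" using subspace_linear_image[OF sub transfer_linear] .
    fix M a assume M: "M \<in> T" and "a \<in> ?f ` U"
    then obtain w where w: "w \<in> U" "a = ?f w" by blast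
    show "M *v a \<in> ?f ` U" unfolding w(2) fT[OF M, symmetric] by (intro imageI closed[OF M w(1)])
  qed
  moreover have "?f ` U \<noteq> {0}" using u fu by blast
  ultimately have "?f ` U = W k" using irreducible_W[OF k(1)] sW unfolding irreducible_T_module_def by blast
  then have "T_isomorphic adj x U (W k)" unfolding T_isomorphic_def using inj fT transfer_linear
    by (intro exI[of _ ?f]) (auto simp: bij_betw_def)
  then show ?thesis using k by blast
qed

text \<open>The right-hand side does not mention the decomposition. The projection has rank one on
  each summand isomorphic to \<open>W k\<close> and vanishes on the others, and the resulting lines
  are pairwise orthogonal.\<close>

lemma count_eq_dim:
  assumes Us: "orthogonal_decomposition adj x Us" and k: "k < m"
  shows "length (filter (\<lambda>U. T_isomorphic adj x U (W k)) Us) = vec.dim (range ((*v) (Phi (ty k) 0 0)))"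
proof -
  let ?P = "Phi (ty k) 0 0" let ?J = "{j. j < length Us \<and> T_isomorphic adj x (Us ! j) (W k)}"
  have t: "ty k < q" and n0: "0 < n (ty k)" using ty n_pos k by auto
  have PT: "?P \<in> T" using Phi_00_in_T[OF t] .
  have irr: "irreducible_T_module adj x (Us ! j)" if "j < length Us" for j
    using Us that unfolding orthogonal_decomposition_def by auto
  have orth: "hermitian a b = 0" if "i < length Us" "j < length Us" "i \<noteq> j" "a \<in> Us ! i" "b \<in> Us ! j" for i j a b
    using Us that unfolding orthogonal_decomposition_def by blast
  have modl: "T_module adj x (Us ! j)" if "j < length Us" for j using irr[OF that] unfolding irreducible_T_module_def by blast
  \<comment> \<open>The vector \<open>u\<close> is the preimage of the seed under the isomorphism
    with \<open>W k\<close>.\<close>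
  have "\<exists>u\<in>Us ! j. u \<noteq> 0 \<and> ?P *v u = u \<and> (\<forall>w\<in>Us ! j. ?P *v w \<in> vec.span
      {u})" if j: "j \<in> ?J" for j
  proof -
    have jl: "j < length Us" using j by simp
    obtain f where f: "bij_betw f (Us ! j) (W k)" "\<forall>c. \<forall>v\<in>Us ! j. f (c *s v) = c *s f v"
        "\<forall>M\<in>T. \<forall>v\<in>Us ! j. f (M *v v) = M *v f v"
      using j unfolding T_isomorphic_def by blast
    have sub: "vec.subspace (Us ! j)" and closed: "u \<in> Us ! j \<Longrightarrow> ?P *v u \<in> Us ! j" for u using
        modl[OF jl] PT unfolding T_module_def by auto
    have inj: "a = b" if "a \<in> Us ! j" "b \<in> Us ! j" "f a = f b" for a b using f(1) that unfolding bij_betw_def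
        inj_on_def by blast
    have fin: "f a \<in> W k" if "a \<in> Us ! j" for a using f(1) that unfolding bij_betw_def by blast
    obtain u where u: "u \<in> Us ! j" "f u = v k 0" using f(1) v_in_W[OF n0] unfolding bij_betw_def by (metis imageE)
    have "f (?P *v u) = f u" using f(3) PT u Phi_00_W[OF k v_in_W[OF n0], of "ty k"] coord_v[OF k k n0 n0] by simp
    then have Pu: "?P *v u = u" using inj closed u by blast
    have "?P *v w \<in> vec.span {u}" if w: "w \<in> Us ! j" for w
    proof -
      have "f (?P *v w) = coord k 0 (f w) *s v k 0" using f(3) PT w Phi_00_W[OF k fin[OF w], of "ty k"] by simp
      also have "\<dots> = f (coord k 0 (f w) *s u)" using f(2) u by simp
      finally have "?P *v w = coord k 0 (f w) *s u" using inj closed[OF w] vec.subspace_scale[OF sub u(1)] by blast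
      then show ?thesis by (auto simp: vec.span_singleton)
    qed
    moreover have "u \<noteq> 0"
    proof
      assume "u = 0"
      then have "f u = 0" using f(2) u by (metis vec.scale_zero_left)
      then show False using u v_ne[of k 0] k n0 by (auto simp: I_iff)
    qed
    ultimately show ?thesis using u Pu by blast
  qed
  then have "\<forall>j\<in>?J. \<exists>u. u \<in> Us ! j \<and> u \<noteq> 0 \<and> ?P *v u = u \<and>
      (\<forall>w\<in>Us ! j. ?P *v w \<in> vec.span {u})" by blast
  from bchoice[OF this] obtain u where u: "\<And>j. j \<in> ?J \<Longrightarrow> u j \<in> Us ! j \<and> u j \<noteq> 0
      \<and> ?P *v u j = u j \<and> (\<forall>w\<in>Us ! j. ?P *v w \<in> vec.span {u j})"
    by blast
  \<comment> \<open>Such a summand is isomorphic to a module of another type, which the projection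
    annihilates.\<close>
  have zero: "?P *v w = 0" if j: "j < length Us" "j \<notin> ?J" and w: "w \<in> Us ! j" for j w
  proof -
    obtain l where l: "l < m" "T_isomorphic adj x (Us ! j) (W l)" using irreducible_iso_W[OF irr[OF j(1)]] by blast
    then obtain f where f: "bij_betw f (Us ! j) (W l)" "\<forall>c. \<forall>v\<in>Us ! j. f (c *s v) = c *s f v"
        "\<forall>M\<in>T. \<forall>v\<in>Us ! j. f (M *v v) = M *v f v"
      unfolding T_isomorphic_def by blast
    have "ty l \<noteq> ty k" using T_isomorphic_trans[OF l(2) iso_same_type[OF l(1) k] modl[OF j(1)]] j by auto
    moreover have "f w \<in> W l" using f(1) w unfolding bij_betw_def by blast
    ultimately have "f (?P *v w) = 0" using f(3) PT w Phi_00_W[OF l(1), of "f w" "ty k"] by simp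
    moreover have "f 0 = 0" using f(2) w by (metis vec.scale_zero_left)
    moreover have "?P *v w \<in> Us ! j" "0 \<in> Us ! j" using modl[OF j(1)] PT w vec.subspace_0 unfolding T_module_def by blast+
    ultimately show ?thesis using f(1) unfolding bij_betw_def inj_on_def by metis
  qed
  have uorth: "hermitian (u i) (u j) = 0" if "i \<in> ?J" "j \<in> ?J" "i \<noteq> j" for i j
    using orth[of i j "u i" "u j"] u[OF that(1)] u[OF that(2)] that by auto
  have inj: "inj_on u ?J"
  proof (rule inj_onI)
    fix i j assume h: "i \<in> ?J" "j \<in> ?J" "u i = u j"
    show "i = j" using uorth[OF h(1,2)] u[OF h(1)] h(3) hermitian_self[of "u i"] by metis
  qed
  have fin: "finite (u ` ?J)" by simp
  have indep: "vec.independent (u ` ?J)"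
  proof (rule vec.independent_if_scalars_zero[OF fin])
    fix f z assume s: "(\<Sum>w\<in>u ` ?J. f w *s w) = 0" and z: "z \<in> u ` ?J"
    obtain j where j: "j \<in> ?J" "z = u j" using z by blast
    have "0 = hermitian (\<Sum>i\<in>?J. f (u i) *s u i) (u j)" using s unfolding sum.reindex[OF inj] by simp
    also have "\<dots> = (\<Sum>i\<in>?J. if i = j then f (u j) * hermitian (u j) (u j) else 0)"
      unfolding hermitian_sum_left hermitian_scale_left using uorth j by (intro sum.cong) auto
    also have "\<dots> = f (u j) * hermitian (u j) (u j)" using j by simp
    finally show "f z = 0" using j u[OF j(1)] hermitian_self[of "u j"] by auto
  qed
  have "range ((*v) ?P) = vec.span (u ` ?J)"
  proof
    have sub: "vec.subspace {w. ?P *v w \<in> vec.span (u ` ?J)}"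
      unfolding vec.subspace_def
      by (auto simp: matrix_vector_right_distrib vector_scalar_commute vec.span_add vec.span_scale vec.span_zero)
    have "w \<in> {w. ?P *v w \<in> vec.span (u ` ?J)}" if "w \<in> Us ! j" "j < length Us" for w j
    proof (cases "j \<in> ?J")
      case True
      then have "?P *v w \<in> vec.span {u j}" using u that by blast
      moreover have "vec.span {u j} \<subseteq> vec.span (u ` ?J)" using True by (intro vec.span_mono) auto
      ultimately show ?thesis by blast
    next
      case False then show ?thesis using zero[OF that(2) False that(1)] by (simp add: vec.span_zero)
    qed
    then have "\<Union>(set Us) \<subseteq> {w. ?P *v w \<in> vec.span (u ` ?J)}" by (auto simp: in_set_conv_nth)
    then have "vec.span (\<Union>(set Us)) \<subseteq> {w. ?P *v w \<in> vec.span (u ` ?J)}" by (rule vec.span_minimal[OF _ sub])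
    moreover have "vec.span (\<Union>(set Us)) = UNIV" using Us unfolding orthogonal_decomposition_def by blast
    ultimately show "range ((*v) ?P) \<subseteq> vec.span (u ` ?J)" by auto
    have "vec.subspace (range ((*v) ?P))"
      by (rule subspace_linear_image) (simp_all add: vec.subspace_UNIV matrix_vector_right_distrib vector_scalar_commute)
    moreover have "u ` ?J \<subseteq> range ((*v) ?P)" using u by (intro image_subsetI) (metis (no_types, lifting) rangeI)
    ultimately show "vec.span (u ` ?J) \<subseteq> range ((*v) ?P)" by (intro vec.span_minimal)
  qed
  then have "vec.dim (range ((*v) ?P)) = card (u ` ?J)" using vec.dim_span_eq_card_independent[OF indep] by simp
  then show ?thesis using card_image[OF inj] by (simp add: length_filter_conv_card)
qed

lemma orthogonal_W:
  assumes "k < m" "l < m" "k \<noteq> l" "a \<in> W k" "b \<in> W l" shows "hermitian a b = 0"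
proof -
  have "hermitian a b = hermitian (\<Sum>i<n (ty k). coord k i a *s v k i) (\<Sum>i<n (ty l). coord l i b *s v l i)"
    by (rule arg_cong2[OF W_expand[OF assms(1,4)] W_expand[OF assms(2,5)]])
  also have "\<dots> = 0"
    unfolding hermitian_sum_left hermitian_scale_left hermitian_sum_right hermitian_scale_right
    using gram[OF assms(1,2)] assms(3) by (simp add: sum.neutral)
  finally show ?thesis .
qed

lemma decomposition_W: "orthogonal_decomposition adj x (map W [0..<m])"
proof -
  have "UNIV \<subseteq> vec.span (\<Union>(W ` {..<m}))"
  proof
    fix u :: "complex^'n"
    have "u = (\<Sum>k<m. \<Sum>i<n (ty k). coord k i u *s v k i)" by (rule expand2)
    moreover have "(\<Sum>k<m. \<Sum>i<n (ty k). coord k i u *s v k i) \<in> vec.span (\<Union>(W ` {..<m}))"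
      by (intro vec.span_sum vec.span_base) (auto intro: W_sum)
    ultimately show "u \<in> vec.span (\<Union>(W ` {..<m}))" by simp
  qed
  then show ?thesis
    unfolding orthogonal_decomposition_def using irreducible_W orthogonal_W by (auto simp: lessThan_atLeast0)
qed

text \<open>\<open>count_eq_dim\<close> makes the definite description in
  \<open>T_multiplicity\<close> well defined, and the decomposition into the modules
  \<open>W l\<close> supplies its value.\<close>

lemma multiplicity_W: assumes "k < m" shows "T_multiplicity adj x (W k) = length (filter (\<lambda>l. ty l = ty k) [0..<m])"
proof -
  have "length (filter (\<lambda>U. T_isomorphic adj x U (W k)) (map W [0..<m])) = length (filter (\<lambda>l. ty l = ty
      k) [0..<m])"
    unfolding filter_map length_map comp_def using iso_iff[OF _ assms] by (intro arg_cong[of _ _ length] filter_cong) auto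
  then have d: "vec.dim (range ((*v) (Phi (ty k) 0 0))) = length (filter (\<lambda>l. ty l = ty k) [0..<m])"
    using count_eq_dim[OF decomposition_W assms] by simp
  show ?thesis unfolding T_multiplicity_def
    using count_eq_dim[OF _ assms] decomposition_W d by (intro the_equality) metis+
qed

section \<open>Endpoint, diameter, shape and pure bases of the modules\<close>

lemma Estar_W: assumes "k < m" shows "(*v) (Estar adj x i) ` W k = vec.span (v k ` {j. j < n (ty k) \<and> lv (ty k) j = i})"
proof
  let ?S = "v k ` {j. j < n (ty k) \<and> lv (ty k) j = i}"
  have E: "Estar adj x i *v w = (\<Sum>j<n (ty k). coord k j w *s (if lv (ty k) j = i then v k j else 0))" if "w \<in> W k" for w
  proof -
    have "Estar adj x i *v w = Estar adj x i *v (\<Sum>j<n (ty k). coord k j w *s v k j)" using W_expand[OF assms that] by simp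
    also have "\<dots> = (\<Sum>j<n (ty k). coord k j w *s (Estar adj x i *v v k j))"
      unfolding matrix_mult_sum_right by (simp add: vector_scalar_commute)
    also have "\<dots> = (\<Sum>j<n (ty k). coord k j w *s (if lv (ty k) j = i then v k j else 0))"
      using E_v[OF assms] by (intro sum.cong) auto
    finally show ?thesis .
  qed
  show "(*v) (Estar adj x i) ` W k \<subseteq> vec.span ?S"
  proof clarify
    fix w assume "w \<in> W k"
    show "Estar adj x i *v w \<in> vec.span ?S"
      unfolding E[OF \<open>w \<in> W k\<close>] by (intro vec.span_sum vec.span_scale) (auto intro: vec.span_base vec.span_zero)
  qed
  show "vec.span ?S \<subseteq> (*v) (Estar adj x i) ` W k"
  proof
    fix w assume w: "w \<in> vec.span ?S"
    have "vec.span ?S \<subseteq> W k" unfolding W_def by (intro vec.span_mono) auto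
    moreover have "vec.span ?S \<subseteq> {w. Estar adj x i *v w = w}"
      by (rule vec.span_minimal) (use E_v[OF assms] in \<open>auto simp: vec.subspace_def matrix_vector_right_distrib
          vector_scalar_commute\<close>)
    ultimately have "w \<in> W k" "w = Estar adj x i *v w" using w by auto
    then show "w \<in> (*v) (Estar adj x i) ` W k" by (metis image_eqI)
  qed
qed

lemma indep_v: assumes "k < m" "S \<subseteq> {..<n (ty k)}" shows "vec.independent (v k ` S)" "card (v k ` S) = card S"
proof -
  have "v k ` S \<subseteq> (\<lambda>(k,i). v k i) ` I"
  proof (rule image_subsetI)
    fix j assume "j \<in> S"
    then show "v k j \<in> (\<lambda>(k,i). v k i) ` I" using assms by (intro image_eqI[of _ _ "(k,j)"]) (auto simp: I_iff)
  qed
  then show "vec.independent (v k ` S)" using indep_all vec.independent_mono by blast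
  show "card (v k ` S) = card S" using card_image inj_on_subset[OF v_inj_on[OF assms(1)] assms(2)] by blast
qed

lemma dim_W: "k < m \<Longrightarrow> vec.dim (W k) = n (ty k)"
  unfolding W_def using vec.dim_span_eq_card_independent[OF indep_v(1)[of k "{..<n (ty k)}"]] indep_v(2)[of k
      "{..<n (ty k)}"] by simp

lemma dim_Estar_W: "k < m \<Longrightarrow> vec.dim ((*v) (Estar adj x i) ` W k) = card {j. j < n (ty k) \<and> lv (ty k) j = i}"
  unfolding Estar_W using vec.dim_span_eq_card_independent[OF indep_v(1)[of k "{j. j < n (ty k) \<and> lv (ty k) j = i}"]]
    indep_v(2)[of k "{j. j < n (ty k) \<and> lv (ty k) j = i}"] by auto

lemma supports_W: assumes "k < m" shows "module_supports adj x (W k) = lv (ty k) ` {..<n (ty k)}"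
proof -
  have "(*v) (Estar adj x i) ` W k \<noteq> {0} \<longleftrightarrow> i \<in> lv (ty k) ` {..<n (ty k)}" for i
  proof
    assume "(*v) (Estar adj x i) ` W k \<noteq> {0}"
    then have "{j. j < n (ty k) \<and> lv (ty k) j = i} \<noteq> {}" unfolding Estar_W[OF assms] by (metis image_empty
        vec.span_empty)
    then show "i \<in> lv (ty k) ` {..<n (ty k)}" by auto
  next
    assume "i \<in> lv (ty k) ` {..<n (ty k)}"
    then obtain j where j: "j < n (ty k)" "lv (ty k) j = i" by auto
    then have "v k j \<in> (*v) (Estar adj x i) ` W k" unfolding Estar_W[OF assms] by (intro vec.span_base) auto
    then show "(*v) (Estar adj x i) ` W k \<noteq> {0}" using v_ne[of k j] j assms by (auto simp: I_iff)
  qed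
  then show ?thesis unfolding module_supports_def using lv_le[OF ty[OF assms]] by auto
qed

lemma endpoint_W: assumes "k < m" shows "endpoint adj x (W k) = ty k"
  unfolding endpoint_def supports_W[OF assms]
proof (rule Min_eqI)
  have t: "ty k < q" using ty assms by simp
  show "ty k \<in> lv (ty k) ` {..<n (ty k)}" using lv_0[OF t] n_pos[OF t] by (metis image_eqI lessThan_iff)
  show "ty k \<le> y" if "y \<in> lv (ty k) ` {..<n (ty k)}" for y
  proof -
    obtain j where "j < n (ty k)" "y = lv (ty k) j" using \<open>y \<in> lv (ty k) ` {..<n (ty k)}\<close> by auto
    then show ?thesis using lv_0[OF t] lv_gt[OF t, of j] by (cases "j = 0") auto
  qed
qed simp

lemma pure_v: assumes "(k,j) \<in> I" shows "pure_vector adj x (lv (ty k) j) (v k j)"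
proof -
  have k: "k < m" "j < n (ty k)" using assms by (auto simp: I_iff)
  have "v k j = Estar adj x (lv (ty k) j) *v v k j" using E_v[OF k] by simp
  then have "v k j \<in> range ((*v) (Estar adj x (lv (ty k) j)))" by (metis rangeI)
  then show ?thesis unfolding pure_vector_def using v_ne[OF assms] lv_le[OF ty k(2)] k by simp
qed

lemma pure_basis_W:
  assumes "k < m" "sorted (map (lv (ty k)) [0..<n (ty k)])"
  shows "pure_basis adj x (W k) (map (v k) [0..<n (ty k)])"
  unfolding pure_basis_def
proof (intro conjI exI)
  show "distinct (map (v k) [0..<n (ty k)])" using v_inj_on[OF assms(1)] by (simp add: distinct_map lessThan_atLeast0)
  show "vec.independent (set (map (v k) [0..<n (ty k)]))" using indep_v(1)[OF assms(1), of "{..<n (ty k)}"] by (simp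
      add: lessThan_atLeast0)
  show "vec.span (set (map (v k) [0..<n (ty k)])) = W k" unfolding W_def by (simp add: lessThan_atLeast0)
  show "sorted (map (lv (ty k)) [0..<n (ty k)])" by (rule assms)
  show "list_all2 (pure_vector adj x) (map (lv (ty k)) [0..<n (ty k)]) (map (v k) [0..<n (ty k)])"
    using pure_v assms(1) by (auto simp: list_all2_conv_all_nth I_iff)
qed

lemma represents_W:
  assumes "k < m" "length M = n (ty k)" "\<And>i j. i < n (ty k) \<Longrightarrow> j < n (ty k) \<Longrightarrow> B (ty
      k) i j = M ! i ! j"
  shows "represents (adj_matrix adj) (map (v k) [0..<n (ty k)]) (mat_of_rows_list (n (ty k)) M)"
  unfolding represents_def using assms A_v[OF assms(1)] by (auto simp: mat_of_rows_list_def intro!: sum.cong)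

lemma module_data_W:
  assumes "k < m" "sorted (map (lv (ty k)) [0..<n (ty k)])"
    "length M = n (ty k)" "\<And>i j. i < n (ty k) \<Longrightarrow> j < n (ty k) \<Longrightarrow> B (ty k) i j = M ! i ! j"
    "has_eigenvalues (mat_of_rows_list (n (ty k)) M) es"
    "d = card (lv (ty k) ` {..<n (ty k)}) - 1"
    "shape = map (\<lambda>i. card {j. j < n (ty k) \<and> lv (ty k) j = ty k + i}) [0..<d + 1]"
  shows "has_module_data adj x (W k) (ty k) (length (filter (\<lambda>l. ty l = ty k) [0..<m])) (n (ty k)) d shape (map
      (v k) [0..<n (ty k)]) M es"
  unfolding has_module_data_def module_shape_def module_diameter_def
  using assms by (simp add: endpoint_W multiplicity_W dim_W supports_W pure_basis_W represents_W dim_Estar_W)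

end

section \<open>Explicit bases\<close>

text \<open>Pure vectors with integer coordinates are given as pairs of a level and the coordinates on that
  level; \<open>pad\<close> extends them by zeros.\<close>

definition pad :: "nat \<times> int list \<Rightarrow> int list" where
  "pad = (\<lambda>(r, c). let k = [0,1,4,10,22,46,70,94] ! r in replicate k 0 @ c @ replicate (102 - k - length c) 0)"

definition nbr_sum :: "int list \<Rightarrow> int list" where
  "nbr_sum xs = map (\<lambda>(a,b,c). xs ! a + xs ! b + xs ! c) bs_nbs"

text \<open>Zero coefficients are skipped: the representing matrices are sparse and every row has
  102 entries.\<close>

fun lcomb :: "int list \<Rightarrow> int list list \<Rightarrow> int list" where
  "lcomb (a # as) (r # rs) = (if a = 0 then lcomb as rs else map2 (\<lambda>x y. a * x + y) r (lcomb as rs))"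
| "lcomb _ _ = replicate 102 0"

definition dot :: "int list \<Rightarrow> int list \<Rightarrow> int" where
  "dot xs ys = sum_list (map2 (*) xs ys)"

text \<open>Inner product of pure vectors without padding them to 102 entries.\<close>

definition pdot :: "nat \<times> int list \<Rightarrow> nat \<times> int list \<Rightarrow> int" where
  "pdot = (\<lambda>(r, c) (r', c'). if r = r' then dot c c' else 0)"

section \<open>Integer tables for the five types and the ten bases\<close>

definition bmat_I :: "int list list" where
  "bmat_I = [[0,3,0,0,0,0,0,0],
    [1,0,2,0,0,0,0,0],
    [0,1,0,2,0,0,0,0],
    [0,0,1,0,2,0,0,0],
    [0,0,0,1,1,1,0,0],
    [0,0,0,0,1,1,1,0],
    [0,0,0,0,0,1,1,1],
    [0,0,0,0,0,0,3,0]]"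

definition gram_I :: "int list list" where
  "gram_I = [[1,0,0,0,0,0,0,0],
    [0,3,0,0,0,0,0,0],
    [0,0,6,0,0,0,0,0],
    [0,0,0,12,0,0,0,0],
    [0,0,0,0,24,0,0,0],
    [0,0,0,0,0,24,0,0],
    [0,0,0,0,0,0,24,0],
    [0,0,0,0,0,0,0,8]]"

text \<open>The inverse of the Gram matrix times the common denominator 24, so that the tables stay
  integral; the other types are treated in the same way with their own denominators.\<close>

definition gram_inv_I :: "int list list" where
  "gram_inv_I = [[24,0,0,0,0,0,0,0],
    [0,8,0,0,0,0,0,0],
    [0,0,4,0,0,0,0,0],
    [0,0,0,2,0,0,0,0],
    [0,0,0,0,1,0,0,0],
    [0,0,0,0,0,1,0,0],
    [0,0,0,0,0,0,1,0],
    [0,0,0,0,0,0,0,3]]"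

definition bmat_II :: "int list list" where
  "bmat_II = [[0,2,0,0,0,0,0,0,0],
    [1,0,2,0,0,0,0,0,0],
    [0,1,0,2,-1,0,0,0,0],
    [0,0,1,0,1,1,1,0,0],
    [0,0,0,1,0,0,1,0,0],
    [0,0,0,1,-1,1,0,1,1],
    [0,0,0,0,1,0,1,0,1],
    [0,0,0,0,0,1,-1,1,3],
    [0,0,0,0,0,0,1,0,-1]]"

definition gram_II :: "int list list" where
  "gram_II = [[2,0,0,0,0,0,0,0,0],
    [0,4,0,0,0,0,0,0,0],
    [0,0,8,0,0,0,0,0,0],
    [0,0,0,16,-8,0,0,0,0],
    [0,0,0,-8,16,0,0,0,0],
    [0,0,0,0,0,16,8,0,0],
    [0,0,0,0,0,8,16,0,0],
    [0,0,0,0,0,0,0,16,24],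
    [0,0,0,0,0,0,0,24,48]]"

definition gram_inv_II :: "int list list" where
  "gram_inv_II = [[12,0,0,0,0,0,0,0,0],
    [0,6,0,0,0,0,0,0,0],
    [0,0,3,0,0,0,0,0,0],
    [0,0,0,2,1,0,0,0,0],
    [0,0,0,1,2,0,0,0,0],
    [0,0,0,0,0,2,-1,0,0],
    [0,0,0,0,0,-1,2,0,0],
    [0,0,0,0,0,0,0,6,-3],
    [0,0,0,0,0,0,0,-3,2]]"

definition bmat_III :: "int list list" where
  "bmat_III = [[0,2,0,0,0,0,0,0,0,0,0,0,0],
    [1,0,0,2,0,0,0,0,0,0,0,0,0],
    [0,0,0,0,1,1,0,0,0,0,0,0,0],
    [0,1,0,0,1,0,1,0,0,0,0,0,0],
    [0,0,1,1,0,0,0,1,0,0,0,0,0],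
    [0,0,1,0,0,1,0,0,1,0,0,0,0],
    [0,0,0,1,0,0,-1,0,0,1,0,0,0],
    [0,0,0,0,1,0,0,1,0,0,1,0,0],
    [0,0,0,0,0,1,0,0,-1,0,0,1,0],
    [0,0,0,0,0,0,1,0,0,1,0,0,1],
    [0,0,0,0,0,0,0,1,0,0,0,-1,1],
    [0,0,0,0,0,0,0,0,1,0,-1,0,1],
    [0,0,0,0,0,0,0,0,0,1,1,1,0]]"

definition gram_III :: "int list list" where
  "gram_III = [[2,0,0,0,0,0,0,0,0,0,0,0,0],
    [0,4,0,0,0,0,0,0,0,0,0,0,0],
    [0,0,8,0,0,0,0,0,0,0,0,0,0],
    [0,0,0,8,0,0,0,0,0,0,0,0,0],
    [0,0,0,0,8,0,0,0,0,0,0,0,0],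
    [0,0,0,0,0,8,0,0,0,0,0,0,0],
    [0,0,0,0,0,0,8,0,0,0,0,0,0],
    [0,0,0,0,0,0,0,8,0,0,0,0,0],
    [0,0,0,0,0,0,0,0,8,0,0,0,0],
    [0,0,0,0,0,0,0,0,0,8,0,0,0],
    [0,0,0,0,0,0,0,0,0,0,8,0,0],
    [0,0,0,0,0,0,0,0,0,0,0,8,0],
    [0,0,0,0,0,0,0,0,0,0,0,0,8]]"

definition gram_inv_III :: "int list list" where
  "gram_inv_III = [[4,0,0,0,0,0,0,0,0,0,0,0,0],
    [0,2,0,0,0,0,0,0,0,0,0,0,0],
    [0,0,1,0,0,0,0,0,0,0,0,0,0],
    [0,0,0,1,0,0,0,0,0,0,0,0,0],
    [0,0,0,0,1,0,0,0,0,0,0,0,0],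
    [0,0,0,0,0,1,0,0,0,0,0,0,0],
    [0,0,0,0,0,0,1,0,0,0,0,0,0],
    [0,0,0,0,0,0,0,1,0,0,0,0,0],
    [0,0,0,0,0,0,0,0,1,0,0,0,0],
    [0,0,0,0,0,0,0,0,0,1,0,0,0],
    [0,0,0,0,0,0,0,0,0,0,1,0,0],
    [0,0,0,0,0,0,0,0,0,0,0,1,0],
    [0,0,0,0,0,0,0,0,0,0,0,0,1]]"

definition bmat_IV :: "int list list" where
  "bmat_IV = [[0,1,1,0,0,0,0,0,0,0,0],
    [1,1,0,0,1,0,0,0,0,0,0],
    [1,-1,-1,0,0,1,0,0,0,0,0],
    [-1,-1,0,-1,0,0,1,0,0,0,0],
    [0,1,0,0,1,1,1,1,0,0,0],
    [0,0,1,0,0,-1,0,0,1,0,0],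
    [0,0,0,1,0,0,-1,0,0,1,0],
    [0,0,0,0,1,0,0,0,0,1,0],
    [0,0,0,0,0,1,0,-1,-1,-1,0],
    [0,0,0,0,0,0,1,1,0,0,1],
    [0,0,0,0,0,0,0,2,1,3,0]]"

definition gram_IV :: "int list list" where
  "gram_IV = [[16,0,0,0,0,0,0,0,0,0,0],
    [0,16,8,8,0,0,0,0,0,0,0],
    [0,8,12,4,0,0,0,0,0,0,0],
    [0,8,4,12,0,0,0,0,0,0,0],
    [0,0,0,0,16,8,8,0,0,0,0],
    [0,0,0,0,8,12,4,0,0,0,0],
    [0,0,0,0,8,4,12,0,0,0,0],
    [0,0,0,0,0,0,0,16,8,8,0],
    [0,0,0,0,0,0,0,8,12,4,0],
    [0,0,0,0,0,0,0,8,4,12,0],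
    [0,0,0,0,0,0,0,0,0,0,4]]"

definition gram_inv_IV :: "int list list" where
  "gram_inv_IV = [[1,0,0,0,0,0,0,0,0,0,0],
    [0,2,-1,-1,0,0,0,0,0,0,0],
    [0,-1,2,0,0,0,0,0,0,0,0],
    [0,-1,0,2,0,0,0,0,0,0,0],
    [0,0,0,0,2,-1,-1,0,0,0,0],
    [0,0,0,0,-1,2,0,0,0,0,0],
    [0,0,0,0,-1,0,2,0,0,0,0],
    [0,0,0,0,0,0,0,2,-1,-1,0],
    [0,0,0,0,0,0,0,-1,2,0,0],
    [0,0,0,0,0,0,0,-1,0,2,0],
    [0,0,0,0,0,0,0,0,0,0,4]]"

definition bmat_V :: "int list list" where
  "bmat_V = [[-1,1,0,0],
    [1,1,1,0],
    [0,1,-1,3],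
    [0,0,1,0]]"

definition gram_V :: "int list list" where
  "gram_V = [[24,0,0,0],
    [0,24,0,0],
    [0,0,24,0],
    [0,0,0,72]]"

definition gram_inv_V :: "int list list" where
  "gram_inv_V = [[3,0,0,0],
    [0,3,0,0],
    [0,0,3,0],
    [0,0,0,1]]"

definition base_I :: "(nat \<times> int list) list" where
  "base_I = [(0, [1]),
    (1, [1,1,1]),
    (2, [1,1,1,1,1,1]),
    (3, [1,1,1,1,1,1,1,1,1,1,1,1]),
    (4, [1,1,1,1,1,1,1,1,1,1,1,1,1,1,1,1,1,1,1,1,1,1,1,1]),
    (5, [1,1,1,1,1,1,1,1,1,1,1,1,1,1,1,1,1,1,1,1,1,1,1,1]),
    (6, [1,1,1,1,1,1,1,1,1,1,1,1,1,1,1,1,1,1,1,1,1,1,1,1]),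
    (7, [1,1,1,1,1,1,1,1])]"

definition base_IIa :: "(nat \<times> int list) list" where
  "base_IIa = [(1, [1,-1,0]),
    (2, [1,1,-1,-1,0,0]),
    (3, [1,1,1,1,-1,-1,-1,-1,0,0,0,0]),
    (4, [1,1,1,1,1,1,1,1,-1,-1,-1,-1,-1,-1,-1,-1,0,0,0,0,0,0,0,0]),
    (4, [-1,0,0,-1,-1,0,-1,0,1,0,1,0,0,1,1,0,1,-1,-1,1,-1,1,-1,1]),
    (5, [1,1,1,1,1,1,1,1,-1,-1,-1,-1,-1,-1,-1,-1,0,0,0,0,0,0,0,0]),
    (5, [0,1,1,0,0,1,0,1,0,-1,0,-1,-1,0,0,-1,1,-1,-1,1,-1,1,-1,1]),
    (6, [1,1,1,1,1,1,1,1,-1,-1,-1,-1,-1,-1,-1,-1,0,0,0,0,0,0,0,0]),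
    (6, [1,2,2,1,1,2,1,2,-1,-2,-1,-2,-2,-1,-1,-2,1,-1,-1,1,-1,1,-1,1])]"

definition base_IIb :: "(nat \<times> int list) list" where
  "base_IIb = [(1, [1,1,-2]),
    (2, [1,1,1,1,-2,-2]),
    (3, [1,1,1,1,1,1,1,1,-2,-2,-2,-2]),
    (4, [1,1,1,1,1,1,1,1,1,1,1,1,1,1,1,1,-2,-2,-2,-2,-2,-2,-2,-2]),
    (4, [1,-2,-2,1,1,-2,1,-2,1,-2,1,-2,-2,1,1,-2,1,1,1,1,1,1,1,1]),
    (5, [1,1,1,1,1,1,1,1,1,1,1,1,1,1,1,1,-2,-2,-2,-2,-2,-2,-2,-2]),
    (5, [2,-1,-1,2,2,-1,2,-1,2,-1,2,-1,-1,2,2,-1,-1,-1,-1,-1,-1,-1,-1,-1]),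
    (6, [1,1,1,1,1,1,1,1,1,1,1,1,1,1,1,1,-2,-2,-2,-2,-2,-2,-2,-2]),
    (6, [3,0,0,3,3,0,3,0,3,0,3,0,0,3,3,0,-3,-3,-3,-3,-3,-3,-3,-3])]"

text \<open>Levels 4, 5 and 6 are numbered along the columns. This is why the vectors of types III
  to V repeat the same coordinate lists on these levels.\<close>

definition base_IIIa :: "(nat \<times> int list) list" where
  "base_IIIa = [(2, [1,-1,0,0,0,0]),
    (3, [1,1,-1,-1,0,0,0,0,0,0,0,0]),
    (3, [0,0,0,0,-1,1,-1,1,-1,1,-1,1]),
    (4, [1,1,1,1,-1,-1,-1,-1,0,0,0,0,0,0,0,0,0,0,0,0,0,0,0,0]),
    (4, [0,0,0,0,0,0,0,0,-1,0,1,0,0,-1,1,0,-1,0,0,1,0,-1,0,1]),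
    (4, [0,0,0,0,0,0,0,0,0,-1,0,1,-1,0,0,1,0,-1,1,0,-1,0,1,0]),
    (5, [1,1,1,1,-1,-1,-1,-1,0,0,0,0,0,0,0,0,0,0,0,0,0,0,0,0]),
    (5, [0,0,0,0,0,0,0,0,-1,0,1,0,0,-1,1,0,-1,0,0,1,0,-1,0,1]),
    (5, [0,0,0,0,0,0,0,0,0,-1,0,1,-1,0,0,1,0,-1,1,0,-1,0,1,0]),
    (6, [1,1,1,1,-1,-1,-1,-1,0,0,0,0,0,0,0,0,0,0,0,0,0,0,0,0]),
    (6, [0,0,0,0,0,0,0,0,-1,0,1,0,0,-1,1,0,-1,0,0,1,0,-1,0,1]),
    (6, [0,0,0,0,0,0,0,0,0,-1,0,1,-1,0,0,1,0,-1,1,0,-1,0,1,0]),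
    (7, [1,1,1,1,-1,-1,-1,-1])]"

definition base_IIIb :: "(nat \<times> int list) list" where
  "base_IIIb = [(2, [0,0,1,-1,0,0]),
    (3, [0,0,0,0,1,1,-1,-1,0,0,0,0]),
    (3, [1,-1,1,-1,0,0,0,0,-1,1,1,-1]),
    (4, [0,0,0,0,0,0,0,0,1,1,1,1,-1,-1,-1,-1,0,0,0,0,0,0,0,0]),
    (4, [1,0,0,-1,1,0,-1,0,0,0,0,0,0,0,0,0,0,-1,1,0,1,0,-1,0]),
    (4, [0,1,-1,0,0,1,0,-1,0,0,0,0,0,0,0,0,-1,0,0,1,0,1,0,-1]),
    (5, [0,0,0,0,0,0,0,0,1,1,1,1,-1,-1,-1,-1,0,0,0,0,0,0,0,0]),
    (5, [1,0,0,-1,1,0,-1,0,0,0,0,0,0,0,0,0,0,-1,1,0,1,0,-1,0]),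
    (5, [0,1,-1,0,0,1,0,-1,0,0,0,0,0,0,0,0,-1,0,0,1,0,1,0,-1]),
    (6, [0,0,0,0,0,0,0,0,1,1,1,1,-1,-1,-1,-1,0,0,0,0,0,0,0,0]),
    (6, [1,0,0,-1,1,0,-1,0,0,0,0,0,0,0,0,0,0,-1,1,0,1,0,-1,0]),
    (6, [0,1,-1,0,0,1,0,-1,0,0,0,0,0,0,0,0,-1,0,0,1,0,1,0,-1]),
    (7, [1,-1,1,-1,1,-1,-1,1])]"

definition base_IIIc :: "(nat \<times> int list) list" where
  "base_IIIc = [(2, [0,0,0,0,1,-1]),
    (3, [0,0,0,0,0,0,0,0,1,1,-1,-1]),
    (3, [1,-1,-1,1,-1,1,1,-1,0,0,0,0]),
    (4, [0,0,0,0,0,0,0,0,0,0,0,0,0,0,0,0,1,1,1,1,-1,-1,-1,-1]),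
    (4, [0,1,-1,0,0,-1,0,1,0,-1,0,1,1,0,0,-1,0,0,0,0,0,0,0,0]),
    (4, [1,0,0,-1,-1,0,1,0,-1,0,1,0,0,1,-1,0,0,0,0,0,0,0,0,0]),
    (5, [0,0,0,0,0,0,0,0,0,0,0,0,0,0,0,0,1,1,1,1,-1,-1,-1,-1]),
    (5, [0,1,-1,0,0,-1,0,1,0,-1,0,1,1,0,0,-1,0,0,0,0,0,0,0,0]),
    (5, [1,0,0,-1,-1,0,1,0,-1,0,1,0,0,1,-1,0,0,0,0,0,0,0,0,0]),
    (6, [0,0,0,0,0,0,0,0,0,0,0,0,0,0,0,0,1,1,1,1,-1,-1,-1,-1]),
    (6, [0,1,-1,0,0,-1,0,1,0,-1,0,1,1,0,0,-1,0,0,0,0,0,0,0,0]),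
    (6, [1,0,0,-1,-1,0,1,0,-1,0,1,0,0,1,-1,0,0,0,0,0,0,0,0,0]),
    (7, [1,-1,1,-1,-1,1,1,-1])]"

definition base_IVa :: "(nat \<times> int list) list" where
  "base_IVa = [(3, [2,-2,-2,2,2,-2,-2,2,0,0,0,0]),
    (4, [0,2,-2,0,0,-2,0,2,0,2,0,-2,-2,0,0,2,0,0,0,0,0,0,0,0]),
    (4, [1,1,-1,-1,-1,-1,1,1,1,1,-1,-1,-1,-1,1,1,-1,1,1,-1,-1,1,-1,1]),
    (4, [-1,1,-1,1,1,-1,-1,1,-1,1,1,-1,-1,1,-1,1,-1,1,1,-1,-1,1,-1,1]),
    (5, [0,2,-2,0,0,-2,0,2,0,2,0,-2,-2,0,0,2,0,0,0,0,0,0,0,0]),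
    (5, [1,1,-1,-1,-1,-1,1,1,1,1,-1,-1,-1,-1,1,1,-1,1,1,-1,-1,1,-1,1]),
    (5, [-1,1,-1,1,1,-1,-1,1,-1,1,1,-1,-1,1,-1,1,-1,1,1,-1,-1,1,-1,1]),
    (6, [0,2,-2,0,0,-2,0,2,0,2,0,-2,-2,0,0,2,0,0,0,0,0,0,0,0]),
    (6, [1,1,-1,-1,-1,-1,1,1,1,1,-1,-1,-1,-1,1,1,-1,1,1,-1,-1,1,-1,1]),
    (6, [-1,1,-1,1,1,-1,-1,1,-1,1,1,-1,-1,1,-1,1,-1,1,1,-1,-1,1,-1,1]),
    (7, [-1,1,1,-1,1,-1,1,-1])]"

definition base_IVb :: "(nat \<times> int list) list" where
  "base_IVb = [(3, [1,-1,1,-1,-1,1,-1,1,2,-2,0,0]),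
    (4, [1,0,0,-1,1,0,-1,0,-1,0,1,0,0,-1,1,0,1,1,-1,-1,-1,1,1,-1]),
    (4, [0,1,0,-1,1,0,0,-1,-1,0,0,1,-1,0,1,0,1,1,-1,-1,0,0,0,0]),
    (4, [0,0,1,-1,1,-1,0,0,-1,1,0,0,0,0,1,-1,0,0,0,0,-1,1,1,-1]),
    (5, [1,0,0,-1,1,0,-1,0,-1,0,1,0,0,-1,1,0,1,1,-1,-1,-1,1,1,-1]),
    (5, [0,1,0,-1,1,0,0,-1,-1,0,0,1,-1,0,1,0,1,1,-1,-1,0,0,0,0]),
    (5, [0,0,1,-1,1,-1,0,0,-1,1,0,0,0,0,1,-1,0,0,0,0,-1,1,1,-1]),
    (6, [1,0,0,-1,1,0,-1,0,-1,0,1,0,0,-1,1,0,1,1,-1,-1,-1,1,1,-1]),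
    (6, [0,1,0,-1,1,0,0,-1,-1,0,0,1,-1,0,1,0,1,1,-1,-1,0,0,0,0]),
    (6, [0,0,1,-1,1,-1,0,0,-1,1,0,0,0,0,1,-1,0,0,0,0,-1,1,1,-1]),
    (7, [0,-1,0,1,1,0,0,-1])]"

definition base_IVc :: "(nat \<times> int list) list" where
  "base_IVc = [(3, [1,-1,1,-1,1,-1,1,-1,0,0,-2,2]),
    (4, [1,0,0,-1,1,0,-1,0,1,0,-1,0,0,1,-1,0,-1,1,-1,1,-1,-1,1,1]),
    (4, [1,0,-1,0,0,1,-1,0,0,1,-1,0,0,1,0,-1,0,0,0,0,-1,-1,1,1]),
    (4, [1,-1,0,0,0,0,-1,1,0,0,-1,1,-1,1,0,0,-1,1,-1,1,0,0,0,0]),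
    (5, [1,0,0,-1,1,0,-1,0,1,0,-1,0,0,1,-1,0,-1,1,-1,1,-1,-1,1,1]),
    (5, [1,0,-1,0,0,1,-1,0,0,1,-1,0,0,1,0,-1,0,0,0,0,-1,-1,1,1]),
    (5, [1,-1,0,0,0,0,-1,1,0,0,-1,1,-1,1,0,0,-1,1,-1,1,0,0,0,0]),
    (6, [1,0,0,-1,1,0,-1,0,1,0,-1,0,0,1,-1,0,-1,1,-1,1,-1,-1,1,1]),
    (6, [1,0,-1,0,0,1,-1,0,0,1,-1,0,0,1,0,-1,0,0,0,0,-1,-1,1,1]),
    (6, [1,-1,0,0,0,0,-1,1,0,0,-1,1,-1,1,0,0,-1,1,-1,1,0,0,0,0]),
    (7, [1,0,-1,0,0,-1,1,0])]"

definition base_V :: "(nat \<times> int list) list" where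
  "base_V = [(4, [1,-1,-1,1,1,-1,1,-1,-1,1,-1,1,1,-1,-1,1,1,-1,-1,1,-1,1,-1,1]),
    (5, [1,-1,-1,1,1,-1,1,-1,-1,1,-1,1,1,-1,-1,1,1,-1,-1,1,-1,1,-1,1]),
    (6, [1,-1,-1,1,1,-1,1,-1,-1,1,-1,1,1,-1,-1,1,1,-1,-1,1,-1,1,-1,1]),
    (7, [3,3,-3,-3,3,3,-3,-3])]"

text \<open>The 102 index lookups are carried out once, on variables; afterwards a neighbour sum of
  concrete integers is a single rewriting step.\<close>

lemma nbr_sum_eq: "nbr_sum [
   x0, x1, x2, x3, x4, x5, x6, x7, x8, x9, x10, x11, x12, x13, x14, x15, x16, x17, x18, x19,
   x20, x21, x22, x23, x24, x25, x26, x27, x28, x29, x30, x31, x32, x33, x34, x35, x36, x37,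
   x38, x39, x40, x41, x42, x43, x44, x45, x46, x47, x48, x49, x50, x51, x52, x53, x54, x55,
   x56, x57, x58, x59, x60, x61, x62, x63, x64, x65, x66, x67, x68, x69, x70, x71, x72, x73,
   x74, x75, x76, x77, x78, x79, x80, x81, x82, x83, x84, x85, x86, x87, x88, x89, x90, x91,
   x92, x93, x94, x95, x96, x97, x98, x99, x100, x101] = [
   x1 + x2 + x3, x0 + x4 + x5, x0 + x6 + x7, x0 + x8 + x9, x1 + x10 + x11, x1 + x12 + x13,
   x2 + x14 + x15, x2 + x16 + x17, x3 + x18 + x19, x3 + x20 + x21, x4 + x22 + x23,
   x4 + x24 + x25, x5 + x26 + x27, x5 + x28 + x29, x6 + x30 + x31, x6 + x32 + x33,
   x7 + x34 + x35, x7 + x36 + x37, x8 + x38 + x39, x8 + x40 + x41, x9 + x42 + x43,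
   x9 + x44 + x45, x10 + x32 + x46, x10 + x41 + x47, x11 + x45 + x48, x11 + x36 + x49,
   x12 + x30 + x50, x12 + x43 + x51, x13 + x35 + x52, x13 + x38 + x53, x14 + x26 + x54,
   x14 + x42 + x55, x15 + x22 + x56, x15 + x40 + x57, x16 + x39 + x58, x16 + x28 + x59,
   x17 + x25 + x60, x17 + x44 + x61, x18 + x29 + x62, x18 + x34 + x63, x19 + x33 + x64,
   x19 + x23 + x65, x20 + x31 + x66, x20 + x27 + x67, x21 + x37 + x68, x21 + x24 + x69,
   x22 + x50 + x70, x23 + x53 + x71, x24 + x51 + x72, x25 + x52 + x73, x26 + x46 + x74,
   x27 + x48 + x75, x28 + x49 + x76, x29 + x47 + x77, x30 + x59 + x78, x31 + x61 + x79,
   x32 + x60 + x80, x33 + x58 + x81, x34 + x57 + x82, x35 + x54 + x83, x36 + x56 + x84,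
   x37 + x55 + x85, x38 + x67 + x86, x39 + x68 + x87, x40 + x66 + x88, x41 + x69 + x89,
   x42 + x64 + x90, x43 + x62 + x91, x44 + x63 + x92, x45 + x65 + x93, x46 + x72 + x94,
   x47 + x73 + x96, x48 + x70 + x97, x49 + x71 + x95, x50 + x77 + x98, x51 + x76 + x101,
   x52 + x75 + x99, x53 + x74 + x100, x54 + x81 + x101, x55 + x80 + x98, x56 + x79 + x96,
   x57 + x78 + x94, x58 + x84 + x99, x59 + x85 + x100, x60 + x82 + x97, x61 + x83 + x95,
   x62 + x88 + x99, x63 + x89 + x100, x64 + x86 + x96, x65 + x87 + x94, x66 + x93 + x101,
   x67 + x92 + x98, x68 + x91 + x97, x69 + x90 + x95, x70 + x81 + x89, x73 + x85 + x93,
   x71 + x80 + x88, x72 + x84 + x92, x74 + x79 + x91, x76 + x82 + x86, x77 + x83 + x87,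
   x75 + x78 + x90]" (is "nbr_sum ?xs = _")
proof -
  obtain V where V: "V = ?xs" by simp
  have "length V = 102" unfolding V by simp
  then have "map ((!) V) [0..<102] = V" by (metis map_nth)
  note eqs = trans[OF this V, unfolded upt_102 list.map list.inject simp_thms]
  show ?thesis unfolding V[symmetric] nbr_sum_def bs_nbs_def by (simp add: eqs)
qed

section \<open>Verification of the tables: action of A, Gram matrices, orthogonality,
  inverses\<close>

lemma action_I: "map nbr_sum (map pad base_I) = map (\<lambda>j. lcomb (map (\<lambda>r. r ! j) bmat_I) (map pad base_I)) [0..<8]"
  unfolding base_I_def bmat_I_def pad_def
  by (simp add: nbr_sum_eq numeral_eq_Suc)

lemma action_IIa: "map nbr_sum (map pad base_IIa) = map (\<lambda>j. lcomb (map (\<lambda>r. r ! j) bmat_II) (map pad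
    base_IIa)) [0..<9]"
  unfolding base_IIa_def bmat_II_def pad_def
  by (simp add: nbr_sum_eq numeral_eq_Suc)

lemma action_IIb: "map nbr_sum (map pad base_IIb) = map (\<lambda>j. lcomb (map (\<lambda>r. r ! j) bmat_II) (map pad
    base_IIb)) [0..<9]"
  unfolding base_IIb_def bmat_II_def pad_def
  by (simp add: nbr_sum_eq numeral_eq_Suc)

lemma action_IIIa: "map nbr_sum (map pad base_IIIa) = map (\<lambda>j. lcomb (map (\<lambda>r. r ! j) bmat_III) (map pad
    base_IIIa)) [0..<13]"
  unfolding base_IIIa_def bmat_III_def pad_def
  by (simp add: nbr_sum_eq numeral_eq_Suc)

lemma action_IIIb: "map nbr_sum (map pad base_IIIb) = map (\<lambda>j. lcomb (map (\<lambda>r. r ! j) bmat_III) (map pad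
    base_IIIb)) [0..<13]"
  unfolding base_IIIb_def bmat_III_def pad_def
  by (simp add: nbr_sum_eq numeral_eq_Suc)

lemma action_IIIc: "map nbr_sum (map pad base_IIIc) = map (\<lambda>j. lcomb (map (\<lambda>r. r ! j) bmat_III) (map pad
    base_IIIc)) [0..<13]"
  unfolding base_IIIc_def bmat_III_def pad_def
  by (simp add: nbr_sum_eq numeral_eq_Suc)

lemma action_IVa: "map nbr_sum (map pad base_IVa) = map (\<lambda>j. lcomb (map (\<lambda>r. r ! j) bmat_IV) (map pad
    base_IVa)) [0..<11]"
  unfolding base_IVa_def bmat_IV_def pad_def
  by (simp add: nbr_sum_eq numeral_eq_Suc)

lemma action_IVb: "map nbr_sum (map pad base_IVb) = map (\<lambda>j. lcomb (map (\<lambda>r. r ! j) bmat_IV) (map pad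
    base_IVb)) [0..<11]"
  unfolding base_IVb_def bmat_IV_def pad_def
  by (simp add: nbr_sum_eq numeral_eq_Suc)

lemma action_IVc: "map nbr_sum (map pad base_IVc) = map (\<lambda>j. lcomb (map (\<lambda>r. r ! j) bmat_IV) (map pad
    base_IVc)) [0..<11]"
  unfolding base_IVc_def bmat_IV_def pad_def
  by (simp add: nbr_sum_eq numeral_eq_Suc)

lemma action_V: "map nbr_sum (map pad base_V) = map (\<lambda>j. lcomb (map (\<lambda>r. r ! j) bmat_V) (map pad base_V)) [0..<4]"
  unfolding base_V_def bmat_V_def pad_def
  by (simp add: nbr_sum_eq numeral_eq_Suc)

lemma gram_I: "map (\<lambda>v. map (pdot v) base_I) base_I = map (map ((*) 1)) gram_I"
  unfolding base_I_def gram_I_def pdot_def dot_def by simp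

lemma gram_IIa: "map (\<lambda>v. map (pdot v) base_IIa) base_IIa = map (map ((*) 1)) gram_II"
  unfolding base_IIa_def gram_II_def pdot_def dot_def by simp

lemma gram_IIb: "map (\<lambda>v. map (pdot v) base_IIb) base_IIb = map (map ((*) 3)) gram_II"
  unfolding base_IIb_def gram_II_def pdot_def dot_def by simp

lemma gram_IIIa: "map (\<lambda>v. map (pdot v) base_IIIa) base_IIIa = map (map ((*) 1)) gram_III"
  unfolding base_IIIa_def gram_III_def pdot_def dot_def by simp

lemma gram_IIIb: "map (\<lambda>v. map (pdot v) base_IIIb) base_IIIb = map (map ((*) 1)) gram_III"
  unfolding base_IIIb_def gram_III_def pdot_def dot_def by simp

lemma gram_IIIc: "map (\<lambda>v. map (pdot v) base_IIIc) base_IIIc = map (map ((*) 1)) gram_III"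
  unfolding base_IIIc_def gram_III_def pdot_def dot_def by simp

lemma gram_IVa: "map (\<lambda>v. map (pdot v) base_IVa) base_IVa = map (map ((*) 2)) gram_IV"
  unfolding base_IVa_def gram_IV_def pdot_def dot_def by simp

lemma gram_IVb: "map (\<lambda>v. map (pdot v) base_IVb) base_IVb = map (map ((*) 1)) gram_IV"
  unfolding base_IVb_def gram_IV_def pdot_def dot_def by simp

lemma gram_IVc: "map (\<lambda>v. map (pdot v) base_IVc) base_IVc = map (map ((*) 1)) gram_IV"
  unfolding base_IVc_def gram_IV_def pdot_def dot_def by simp

lemma gram_V: "map (\<lambda>v. map (pdot v) base_V) base_V = map (map ((*) 1)) gram_V"
  unfolding base_V_def gram_V_def pdot_def dot_def by simp

text \<open>Each basis is compared with the later ones only; symmetry of \<open>pdot\<close> covers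
  the remaining pairs.\<close>

lemma orth_I: "list_all (\<lambda>v. list_all (\<lambda>w. pdot v w = 0) (base_IIa @ base_IIb @ base_IIIa @ base_IIIb @
    base_IIIc @ base_IVa @ base_IVb @ base_IVc @ base_V)) base_I"
  unfolding base_IIa_def base_IIb_def base_IIIa_def base_IIIb_def base_IIIc_def base_IVa_def base_IVb_def base_IVc_def
      base_V_def base_I_def pdot_def dot_def by simp

lemma orth_IIa: "list_all (\<lambda>v. list_all (\<lambda>w. pdot v w = 0) (base_IIb @ base_IIIa @ base_IIIb @ base_IIIc
    @ base_IVa @ base_IVb @ base_IVc @ base_V)) base_IIa"
  unfolding base_IIb_def base_IIIa_def base_IIIb_def base_IIIc_def base_IVa_def base_IVb_def base_IVc_def base_V_def
      base_IIa_def pdot_def dot_def by simp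

lemma orth_IIb: "list_all (\<lambda>v. list_all (\<lambda>w. pdot v w = 0) (base_IIIa @ base_IIIb @ base_IIIc @ base_IVa
    @ base_IVb @ base_IVc @ base_V)) base_IIb"
  unfolding base_IIIa_def base_IIIb_def base_IIIc_def base_IVa_def base_IVb_def base_IVc_def base_V_def base_IIb_def
      pdot_def dot_def by simp

lemma orth_IIIa: "list_all (\<lambda>v. list_all (\<lambda>w. pdot v w = 0) (base_IIIb @ base_IIIc @ base_IVa @ base_IVb
    @ base_IVc @ base_V)) base_IIIa"
  unfolding base_IIIb_def base_IIIc_def base_IVa_def base_IVb_def base_IVc_def base_V_def base_IIIa_def pdot_def dot_def by simp

lemma orth_IIIb: "list_all (\<lambda>v. list_all (\<lambda>w. pdot v w = 0) (base_IIIc @ base_IVa @ base_IVb @ base_IVc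
    @ base_V)) base_IIIb"
  unfolding base_IIIc_def base_IVa_def base_IVb_def base_IVc_def base_V_def base_IIIb_def pdot_def dot_def by simp

lemma orth_IIIc: "list_all (\<lambda>v. list_all (\<lambda>w. pdot v w = 0) (base_IVa @ base_IVb @ base_IVc @ base_V)) base_IIIc"
  unfolding base_IVa_def base_IVb_def base_IVc_def base_V_def base_IIIc_def pdot_def dot_def by simp

lemma orth_IVa: "list_all (\<lambda>v. list_all (\<lambda>w. pdot v w = 0) (base_IVb @ base_IVc @ base_V)) base_IVa"
  unfolding base_IVb_def base_IVc_def base_V_def base_IVa_def pdot_def dot_def by simp

lemma orth_IVb: "list_all (\<lambda>v. list_all (\<lambda>w. pdot v w = 0) (base_IVc @ base_V)) base_IVb"
  unfolding base_IVc_def base_V_def base_IVb_def pdot_def dot_def by simp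

lemma orth_IVc: "list_all (\<lambda>v. list_all (\<lambda>w. pdot v w = 0) (base_V)) base_IVc"
  unfolding base_V_def base_IVc_def pdot_def dot_def by simp

lemma gram_inv_I: "map (\<lambda>r. map (dot r) gram_I) gram_inv_I = map (\<lambda>i. map (\<lambda>j. if i = j then 24
    else 0) [0..<8]) [0..<8]"
  unfolding gram_I_def gram_inv_I_def dot_def by (simp add: numeral_eq_Suc)

lemma gram_inv_II: "map (\<lambda>r. map (dot r) gram_II) gram_inv_II = map (\<lambda>i. map (\<lambda>j. if i = j then
    24 else 0) [0..<9]) [0..<9]"
  unfolding gram_II_def gram_inv_II_def dot_def by (simp add: numeral_eq_Suc)

lemma gram_inv_III: "map (\<lambda>r. map (dot r) gram_III) gram_inv_III = map (\<lambda>i. map (\<lambda>j. if i = j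
    then 8 else 0) [0..<13]) [0..<13]"
  unfolding gram_III_def gram_inv_III_def dot_def by (simp add: numeral_eq_Suc)

lemma gram_inv_IV: "map (\<lambda>r. map (dot r) gram_IV) gram_inv_IV = map (\<lambda>i. map (\<lambda>j. if i = j then
    16 else 0) [0..<11]) [0..<11]"
  unfolding gram_IV_def gram_inv_IV_def dot_def by (simp add: numeral_eq_Suc)

lemma gram_inv_V: "map (\<lambda>r. map (dot r) gram_V) gram_inv_V = map (\<lambda>i. map (\<lambda>j. if i = j then 72
    else 0) [0..<4]) [0..<4]"
  unfolding gram_V_def gram_inv_V_def dot_def by (simp add: numeral_eq_Suc)

section \<open>The rank of an idempotent matrix is its trace\<close>

text \<open>A basis of the range is extended to a basis of the whole space. In this basis the
  diagonal of \<open>P\<close> is 1 at the range vectors and 0 elsewhere, and the trace is invariant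
  under conjugation.\<close>

lemma dim_range_idempotent:
  fixes P :: "complex^'n^'n"
  assumes "P ** P = P"
  shows "of_nat (vec.dim (range ((*v) P))) = trace P"
proof -
  have PP: "P *v (P *v u) = P *v u" for u by (simp add: matrix_vector_mul_assoc assms)
  obtain R where R: "R \<subseteq> range ((*v) P)" "vec.independent R" "range ((*v) P) \<subseteq> vec.span R"
      "card R = vec.dim (range ((*v) P))"
    using vec.basis_exists by blast
  obtain C where C': "R \<subseteq> C" "C \<subseteq> UNIV" "vec.independent C" "UNIV \<subseteq> vec.span C"
    by (rule vec.maximal_independent_subset_extend[OF subset_UNIV R(2)])
  note C = C'(1,3,4)
  have finC: "finite C" using C(2) vec.finiteI_independent by blast
  have "card C = vec.dim (vec.span C)" using vec.dim_span_eq_card_independent[OF C(2)] by simp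
  also have "vec.span C = UNIV" using C(3) by blast
  finally have "card C = card (UNIV :: 'n set)" by (simp only: vec_dim_card)
  then obtain f where f: "bij_betw f (UNIV :: 'n set) C" using finite_same_card_bij[of "UNIV :: 'n set" C] finC by auto
  define Q where "Q = (\<chi> i j. f j $ i)"
  define Q' where "Q' = (\<chi> j i. vec.representation C (axis i 1) (f j))"
  have "(\<Sum>j\<in>UNIV. f j $ i * vec.representation C (axis k 1) (f j)) = axis k 1 $ i" for i k
  proof -
    have "(\<Sum>j\<in>UNIV. f j $ i * vec.representation C (axis k 1) (f j)) = (\<Sum>b\<in>C. b $ i *
        vec.representation C (axis k 1) b)"
      by (rule sum.reindex_bij_betw[OF f])
    also have "\<dots> = (\<Sum>b\<in>C. vec.representation C (axis k 1) b *s b) $ i" by (simp add: mult.commute)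
    also have "(\<Sum>b\<in>C. vec.representation C (axis k 1) b *s b) = axis k 1"
      using C finC by (intro vec.sum_representation_eq) auto
    finally show ?thesis .
  qed
  then have QQ': "Q ** Q' = Finite_Cartesian_Product.mat 1"
    by (auto simp: Q_def Q'_def matrix_matrix_mult_def Finite_Cartesian_Product.mat_def
        Finite_Cartesian_Product.vec_eq_iff axis_def)
  then have Q'Q: "Q' ** Q = Finite_Cartesian_Product.mat 1" using matrix_left_right_inverse by blast
  have Qf: "Q *v axis j 1 = f j" for j
    by (simp add: Q_def matrix_vector_mult_def axis_def Finite_Cartesian_Product.vec_eq_iff if_distrib[of
        "\<lambda>a. _ * a"] cong: if_cong)
  have Q'f: "Q' *v f j = axis j 1" for j
    by (simp add: Qf[symmetric] matrix_vector_mul_assoc Q'Q)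
  \<comment> \<open>For \<open>f j\<close> outside \<open>R\<close> the image
    \<open>P *v f j\<close> lies in the span of \<open>R\<close>, so its coordinate at
    \<open>f j\<close> is zero.\<close>
  have d: "(Q' ** (P ** Q)) $ j $ j = (if f j \<in> R then 1 else 0)" for j
  proof -
    have "(Q' ** (P ** Q)) $ j $ j = ((Q' ** (P ** Q)) *v axis j 1) $ j"
      by (simp add: matrix_vector_mult_def axis_def if_distrib[of "\<lambda>a. _ * a"] cong: if_cong)
    also have "\<dots> = (Q' *v (P *v f j)) $ j" by (simp add: matrix_vector_mul_assoc[symmetric] Qf)
    also have "\<dots> = (if f j \<in> R then 1 else 0)"
    proof (cases "f j \<in> R")
      case True
      then have "P *v f j = f j" using R(1) PP by auto
      then show ?thesis using True by (simp add: Q'f)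
    next
      case False
      have "vec.subspace {w. (Q' *v w) $ j = 0}"
        by (auto simp: vec.subspace_def matrix_vector_right_distrib vector_scalar_commute)
      moreover have "R \<subseteq> {w. (Q' *v w) $ j = 0}"
      proof
        fix b assume b: "b \<in> R"
        then obtain l where "b = f l" using C(1) f by (auto simp: bij_betw_def)
        moreover from this have "l \<noteq> j" using b False by auto
        ultimately show "b \<in> {w. (Q' *v w) $ j = 0}" by (simp add: Q'f axis_def)
      qed
      ultimately have "vec.span R \<subseteq> {w. (Q' *v w) $ j = 0}" by (rule vec.span_minimal[rotated])
      then have "(Q' *v (P *v f j)) $ j = 0" using R(3) by auto
      then show ?thesis using False by simp
    qed
    finally show ?thesis .
  qed
  have "trace P = trace ((P ** Q) ** Q')" by (simp add: matrix_mul_assoc[symmetric] QQ')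
  also have "\<dots> = trace (Q' ** (P ** Q))" by (rule trace_mul_sym)
  also have "\<dots> = (\<Sum>j\<in>UNIV. if f j \<in> R then 1 else 0)" by (simp add: trace_def d)
  also have "\<dots> = (\<Sum>b\<in>C. if b \<in> R then 1 else 0)" by (rule sum.reindex_bij_betw[OF f])
  also have "\<dots> = of_nat (card R)" using C(1) finC by (simp add: sum.If_cases Int_absorb1)
  finally show ?thesis using R(4) by simp
qed

section \<open>Spectra from power sums\<close>

text \<open>The vector p(A)u. It uses iterated application because \<open>^\<close> on this matrix
  type acts entrywise.\<close>

definition pact :: "complex^'n^'n \<Rightarrow> complex poly \<Rightarrow> complex^'n \<Rightarrow> complex^'n" where
  "pact A p u = (\<Sum>i\<le>degree p. coeff p i *s ((*v) A ^^ i) u)"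

lemma pact_bound: "degree p < n \<Longrightarrow> pact A p u = (\<Sum>i<n. coeff p i *s ((*v) A ^^ i) u)"
  unfolding pact_def by (rule sum.mono_neutral_left) (auto simp: coeff_eq_0)

lemma pact_diff: "pact A (p - q) u = pact A p u - pact A q u"
proof -
  define n where "n = Suc (max (degree p) (degree q))"
  have "degree p < n" "degree q < n" "degree (p - q) < n"
    unfolding n_def using degree_diff_le_max[of p q] by auto
  then show ?thesis by (simp add: pact_bound[of _ n] vec.scale_left_diff_distrib sum_subtractf)
qed

lemma pact_smult: "pact A (Polynomial.smult c p) u = c *s pact A p u"
proof -
  define n where "n = Suc (degree p)"
  have "degree p < n" "degree (Polynomial.smult c p) < n"
    unfolding n_def using degree_smult_le[of c p] by auto
  then show ?thesis by (simp add: pact_bound[of _ n] vec.scale_sum_right)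
qed

lemma pact_pCons_0: "pact A (pCons 0 p) u = A *v pact A p u"
proof -
  have "degree (pCons 0 p) < Suc (Suc (degree p))" using degree_pCons_le[of 0 p] by simp
  then have "pact A (pCons 0 p) u = (\<Sum>i<Suc (degree p). coeff p i *s ((*v) A ^^ Suc i) u)"
    by (simp add: pact_bound sum.lessThan_Suc_shift[of _ "Suc (degree p)"] del: sum.lessThan_Suc degree_pCons_eq_if)
  also have "\<dots> = A *v pact A p u" unfolding pact_bound[OF lessI[of "degree p"]]
    by (simp add: matrix_mult_sum_right vector_scalar_commute del: sum.lessThan_Suc)
  finally show ?thesis .
qed

lemma pact_linear: "pact A ([:- c, 1:] * p) u = A *v pact A p u - c *s pact A p u"
proof -
  have "[:- c, 1:] * p = pCons 0 p - Polynomial.smult c p" by simp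
  then show ?thesis by (simp only: pact_diff pact_smult pact_pCons_0)
qed

lemma pact_eigen: assumes "A *v u = c *s u" shows "pact A p u = poly p c *s u"
proof -
  have "((*v) A ^^ i) u = c ^ i *s u" for i
    by (induction i) (simp_all add: vector_scalar_commute assms mult.commute)
  then show ?thesis by (simp add: pact_def poly_altdef vec.scale_sum_left)
qed

text \<open>The Lagrange basis polynomial of the node \<open>c\<close> without its normalising
  factor.\<close>

definition lagrange :: "complex set \<Rightarrow> complex \<Rightarrow> complex poly" where
  "lagrange S c = (\<Prod>d\<in>S - {c}. [:- d, 1:])"

lemma lagrange:
  assumes "finite S" "c \<in> S"
  shows "(\<Prod>d\<in>S. [:- d, 1:]) = [:- c, 1:] * lagrange S c" "poly (lagrange S c) c \<noteq> 0"
    "d \<in> S \<Longrightarrow> d \<noteq> c \<Longrightarrow> poly (lagrange S c) d = 0" "degree (lagrange S c) < card S"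
proof -
  show "(\<Prod>d\<in>S. [:- d, 1:]) = [:- c, 1:] * lagrange S c" unfolding lagrange_def using assms by (rule prod.remove)
  show "poly (lagrange S c) c \<noteq> 0" using assms by (auto simp: lagrange_def poly_prod)
  show "d \<in> S \<Longrightarrow> d \<noteq> c \<Longrightarrow> poly (lagrange S c) d = 0" using assms by (auto simp:
      lagrange_def poly_prod)
  have "degree (lagrange S c) \<le> (\<Sum>d\<in>S - {c}. (degree \<circ> (\<lambda>d. [:- d, 1:])) d)" unfolding
      lagrange_def by (rule degree_prod_sum_le) (use assms in auto)
  also have "\<dots> = card (S - {c})" by simp
  also have "\<dots> < card S" using assms by (metis card_Diff1_less)
  finally show "degree (lagrange S c) < card S" .
qed

text \<open>Summing the Lagrange polynomial over the list leaves only the occurrences of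
  \<open>c\<close>. Its degree is below \<open>card S\<close>, so the power sums with exponents
  below \<open>card S\<close> determine all multiplicities.\<close>

lemma count_by_power_sums:
  assumes "finite S" "c \<in> S" "set fs \<subseteq> S"
  shows "(\<Sum>k<card S. coeff (lagrange S c) k * (\<Sum>e\<leftarrow>fs. e ^ k)) = of_nat (count (mset fs) c) * poly
      (lagrange S c) c"
proof -
  have p: "poly (lagrange S c) e = (\<Sum>k<card S. coeff (lagrange S c) k * e ^ k)" for e
    unfolding poly_altdef by (rule sum.mono_neutral_left) (use lagrange(4)[OF assms(1,2)] in \<open>auto simp: coeff_eq_0\<close>)
  have "(\<Sum>k<card S. coeff (lagrange S c) k * (\<Sum>e\<leftarrow>fs. e ^ k)) = (\<Sum>e\<leftarrow>fs. poly
      (lagrange S c) e)"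
    unfolding p by (induction fs) (simp_all add: algebra_simps sum.distrib)
  also have "\<dots> = of_nat (count (mset fs) c) * poly (lagrange S c) c"
    using assms(3) by (induction fs) (auto simp: lagrange(3)[OF assms(1,2)] algebra_simps)
  finally show ?thesis .
qed

text \<open>For \<open>c\<close> in \<open>S\<close> the normalised Lagrange polynomial of
  \<open>A\<close> is idempotent with the eigenspace as its range, because its product with
  \<open>A - c\<close> is the annihilating polynomial. Its rank is its trace, a combination of
  traces of powers.\<close>

theorem eigenspace_dims:
  fixes A :: "complex^'n^'n"
  assumes S: "finite S" and ann: "\<And>u. pact A (\<Prod>d\<in>S. [:- d, 1:]) u = 0"
    and fs: "set fs \<subseteq> S" and tr: "\<And>k. k < card S \<Longrightarrow> trace (((**) A ^^ k)
        (Finite_Cartesian_Product.mat 1)) = (\<Sum>e\<leftarrow>fs. e ^ k)"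
  shows "vec.dim {u. A *v u = c *s u} = count (mset fs) c"
proof (cases "c \<in> S")
  case False
  have "u = 0" if "A *v u = c *s u" for u
  proof -
    have "poly (\<Prod>d\<in>S. [:- d, 1:]) c *s u = 0" using ann[of u] pact_eigen[OF that] by simp
    moreover have "poly (\<Prod>d\<in>S. [:- d, 1:]) c \<noteq> 0" using S False by (auto simp: poly_prod)
    ultimately show ?thesis by simp
  qed
  then have "{u. A *v u = c *s u} = {0}" by auto
  moreover have "vec.dim {0 :: complex^'n} = 0" by (metis vec.dim_span vec.span_empty vec.dim_empty)
  moreover have "count (mset fs) c = 0" using False fs by (auto simp: count_eq_zero_iff)
  ultimately show ?thesis by simp
next
  case True
  let ?L = "lagrange S c" and ?l = "poly (lagrange S c) c"
  have l: "?l \<noteq> 0" using lagrange(2)[OF S True] .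
  define P where "P = (\<Sum>k<card S. mat_scale (coeff ?L k / ?l) (((**) A ^^ k) (Finite_Cartesian_Product.mat 1)))"
  have pw: "((**) A ^^ k) (Finite_Cartesian_Product.mat 1) *v u = ((*v) A ^^ k) u" for k u
    by (induction k) (simp_all add: matrix_vector_mul_assoc[symmetric])
  have Pv: "P *v u = (1 / ?l) *s pact A ?L u" for u
    unfolding P_def matrix_sum_mult_vec mat_scale_mult_vec pw pact_bound[OF lagrange(4)[OF S True]] vec.scale_sum_right
    by (intro sum.cong) auto
  have eig: "A *v (P *v u) = c *s (P *v u)" for u
  proof -
    have "A *v pact A ?L u - c *s pact A ?L u = 0"
      using ann[of u] unfolding lagrange(1)[OF S True] pact_linear .
    then have e: "A *v pact A ?L u = c *s pact A ?L u" by simp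
    show ?thesis unfolding Pv by (simp add: vector_scalar_commute e mult.commute)
  qed
  have fixed: "P *v u = u" if "A *v u = c *s u" for u
    unfolding Pv pact_eigen[OF that] using l by simp
  have "P ** P = P" unfolding matrix_eq by (simp add: matrix_vector_mul_assoc[symmetric] fixed[OF eig])
  moreover have "range ((*v) P) = {u. A *v u = c *s u}" using eig fixed by (auto, metis rangeI)
  ultimately have "of_nat (vec.dim {u. A *v u = c *s u}) = trace P" using dim_range_idempotent[of P] by simp
  also have "\<dots> = (\<Sum>k<card S. coeff ?L k / ?l * trace (((**) A ^^ k) (Finite_Cartesian_Product.mat 1)))"
    unfolding P_def by (simp add: trace_def sum.swap[of _ UNIV] sum_distrib_left mat_scale_def map_matrix_def)
  also have "\<dots> = (\<Sum>k<card S. coeff ?L k / ?l * (\<Sum>e\<leftarrow>fs. e ^ k))"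
    using tr by simp
  also have "\<dots> = (\<Sum>k<card S. coeff ?L k * (\<Sum>e\<leftarrow>fs. e ^ k)) / ?l" by (simp add: sum_divide_distrib)
  also have "\<dots> = of_nat (count (mset fs) c)" unfolding count_by_power_sums[OF S True fs] using l by simp
  finally show ?thesis by (simp only: of_nat_eq_iff)
qed

section \<open>Characteristic polynomials from traces of powers\<close>

definition mat_trace :: "complex mat \<Rightarrow> complex" where
  "mat_trace M = (\<Sum>i<dim_row M. M $$ (i,i))"

lemma mat_trace_comm:
  assumes "P \<in> carrier_mat n n" "Q \<in> carrier_mat n n" shows "mat_trace (P * Q) = mat_trace (Q * P)"
proof -
  have "mat_trace (P * Q) = (\<Sum>i<n. \<Sum>k<n. P $$ (i,k) * Q $$ (k,i))"
    using assms by (auto simp: mat_trace_def scalar_prod_def atLeast0LessThan intro!: sum.cong)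
  also have "\<dots> = (\<Sum>k<n. \<Sum>i<n. P $$ (i,k) * Q $$ (k,i))" by (rule sum.swap)
  also have "\<dots> = mat_trace (Q * P)"
    using assms by (auto simp: mat_trace_def scalar_prod_def atLeast0LessThan mult.commute intro!: sum.cong)
  finally show ?thesis .
qed

lemma upper_triangular_power:
  assumes U: "(U :: complex mat) \<in> carrier_mat n n" "upper_triangular U"
  shows "upper_triangular (U ^\<^sub>m k)" "i < n \<Longrightarrow> (U ^\<^sub>m k) $$ (i,i) = (U $$ (i,i)) ^ k"
proof (induction k arbitrary: i)
  case 0
  show "upper_triangular (U ^\<^sub>m 0)" "i < n \<Longrightarrow> (U ^\<^sub>m 0) $$ (i,i) = (U $$ (i,i)) ^ 0" for i
      using U by auto
next
  case (Suc k)
  have c: "U ^\<^sub>m k \<in> carrier_mat n n" using U by simp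
  have e: "(U ^\<^sub>m Suc k) $$ (i,j) = (\<Sum>l<n. (U ^\<^sub>m k) $$ (i,l) * U $$ (l,j))" if "i < n" "j < n" for i j
    using U c that by (simp add: scalar_prod_def atLeast0LessThan)
  have z: "(U ^\<^sub>m k) $$ (i,l) = 0" if "i < n" "l < i" for i l using upper_triangularD[OF Suc.IH(1), of l i] c that by auto
  have zu: "U $$ (i,l) = 0" if "i < n" "l < i" for i l using upper_triangularD[OF U(2), of l i] U(1) that by auto
  show "upper_triangular (U ^\<^sub>m Suc k)"
  proof (rule upper_triangularI)
    fix j i assume h: "j < i" "i < dim_row (U ^\<^sub>m Suc k)"
    then have i: "i < n" using U c by simp
    show "(U ^\<^sub>m Suc k) $$ (i,j) = 0" unfolding e[OF i less_trans[OF h(1) i]]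
    proof (rule sum.neutral, rule ballI)
      fix l assume "l \<in> {..<n}"
      then show "(U ^\<^sub>m k) $$ (i,l) * U $$ (l,j) = 0" using z[of i l] zu[of l j] i h(1) by (cases "l < i") auto
    qed
  qed
  show "(U ^\<^sub>m Suc k) $$ (i,i) = (U $$ (i,i)) ^ Suc k" if i: "i < n" for i
  proof -
    have "(U ^\<^sub>m Suc k) $$ (i,i) = (\<Sum>l<n. if l = i then (U ^\<^sub>m k) $$ (i,i) * U $$ (i,i) else 0)"
      unfolding e[OF i i]
    proof (rule sum.cong)
      fix l assume "l \<in> {..<n}"
      then show "(U ^\<^sub>m k) $$ (i,l) * U $$ (l,i) = (if l = i then (U ^\<^sub>m k) $$ (i,i) * U $$ (i,i) else 0)"
        using z[of i l] zu[of l i] i by (cases l i rule: linorder_cases) auto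
    qed simp
    then show ?thesis using i Suc.IH(2)[OF i] by simp
  qed
qed

text \<open>The diagonal of a Schur form lists the eigenvalues with multiplicity. It has the same
  low power sums as \<open>fs\<close>, and both lists take their values in \<open>S\<close>.\<close>

theorem char_poly_by_power_sums:
  fixes M :: "complex mat"
  assumes M: "M \<in> carrier_mat n n" and S: "finite S" and fs: "set fs \<subseteq> S"
    and ev: "\<And>e. eigenvalue M e \<Longrightarrow> e \<in> S"
    and tr: "\<And>k. k < card S \<Longrightarrow> mat_trace (M ^\<^sub>m k) = (\<Sum>e\<leftarrow>fs. e ^ k)"
  shows "char_poly M = (\<Prod>e\<leftarrow>fs. [:- e, 1:])"
proof -
  obtain as where "char_poly M = (\<Prod>a\<leftarrow>as. [:- a, 1:])" using char_poly_factorized[OF M] by blast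
  from schur_decomposition_exists[OF M this] obtain U where U: "U \<in> carrier_mat n n" "upper_triangular U"
      "similar_mat M U" by blast
  let ?es = "diag_mat U"
  have cp: "char_poly M = (\<Prod>e\<leftarrow>?es. [:- e, 1:])"
    using char_poly_similar[OF U(3)] char_poly_upper_triangular[OF U(1,2)] by simp
  have es: "set ?es \<subseteq> S"
  proof
    fix e assume "e \<in> set ?es"
    then have "poly (char_poly M) e = 0" unfolding cp by (simp add: poly_prod_list prod_list_zero_iff image_iff)
    then show "e \<in> S" using ev eigenvalue_root_char_poly[OF M] by blast
  qed
  obtain P Q where w: "similar_mat_wit M U P Q" using U(3) unfolding similar_mat_def by blast
  note wd = similar_mat_witD2[OF M w]
  have tre: "mat_trace (M ^\<^sub>m k) = (\<Sum>e\<leftarrow>?es. e ^ k)" for k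
  proof -
    have Uk: "U ^\<^sub>m k \<in> carrier_mat n n" using U(1) by simp
    have "mat_trace (M ^\<^sub>m k) = mat_trace ((P * U ^\<^sub>m k) * Q)" using similar_mat_wit_pow_id[OF w] by simp
    also have "\<dots> = mat_trace (Q * (P * U ^\<^sub>m k))" by (rule mat_trace_comm) (use wd Uk in auto)
    also have "Q * (P * U ^\<^sub>m k) = (Q * P) * U ^\<^sub>m k" by (rule assoc_mult_mat[symmetric]) (use wd Uk in auto)
    also have "\<dots> = U ^\<^sub>m k" using wd Uk by simp
    also have "mat_trace (U ^\<^sub>m k) = (\<Sum>i<n. (U $$ (i,i)) ^ k)"
      using upper_triangular_power(2)[OF U(1,2)] Uk by (auto simp: mat_trace_def)
    also have "\<dots> = (\<Sum>e\<leftarrow>?es. e ^ k)" using U(1) by (simp add: diag_mat_def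
        interv_sum_list_conv_sum_set_nat comp_def atLeast0LessThan)
    finally show ?thesis .
  qed
  have "count (mset ?es) c = count (mset fs) c" for c
  proof (cases "c \<in> S")
    case True
    have "(\<Sum>k<card S. coeff (lagrange S c) k * (\<Sum>e\<leftarrow>?es. e ^ k)) = (\<Sum>k<card S. coeff (lagrange
        S c) k * (\<Sum>e\<leftarrow>fs. e ^ k))"
      by (intro sum.cong) (auto simp: tr[symmetric] tre[symmetric])
    then have "of_nat (count (mset ?es) c) * poly (lagrange S c) c = of_nat (count (mset fs) c) * poly (lagrange S c) c"
      unfolding count_by_power_sums[OF S True es] count_by_power_sums[OF S True fs] .
    then show ?thesis using lagrange(2)[OF S True] by simp
  next
    case False
    then show ?thesis using es fs by (metis count_eq_zero_iff set_mset_mset subsetD)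
  qed
  then have "mset ?es = mset fs" by (rule multiset_eqI)
  then have "mset (map (\<lambda>e. [:- e, 1:]) ?es) = mset (map (\<lambda>e. [:- e, 1:]) fs)" by simp
  then show ?thesis unfolding cp by (metis prod_mset_prod_list)
qed

section \<open>The cubic eigenvalues\<close>

text \<open>The triple angle formula 4 c^3 - 3 c = 1/2, rewritten in t = 2 c - 1.\<close>

lemma cubic_of_cos:
  assumes "cos (3 * a) = 1 / 2" shows "(2 * cos a - 1) ^ 3 + 3 * (2 * cos a - 1) ^ 2 - 3 = (0::real)"
proof -
  have "4 * cos a ^ 3 - 3 * cos a = 1 / 2" using assms cos_treble_cos[of a] by simp
  then show ?thesis by (simp add: power2_eq_square power3_eq_cube algebra_simps)
qed

lemma theta_cubic: "theta1 ^ 3 + 3 * theta1 ^ 2 - 3 = 0" "theta2 ^ 3 + 3 * theta2 ^ 2 - 3 = 0"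
    "theta3 ^ 3 + 3 * theta3 ^ 2 - 3 = 0"
proof -
  have 1: "cos (3 * (pi / 9)) = 1 / 2" using cos_60 by simp
  have "3 * (13 * pi / 9) = pi / 3 + 2 * pi + 2 * pi" by simp
  then have 2: "cos (3 * (13 * pi / 9)) = 1 / 2" using cos_60 by (metis cos_periodic)
  have "3 * (7 * pi / 9) = pi / 3 + 2 * pi" by simp
  then have 3: "cos (3 * (7 * pi / 9)) = 1 / 2" using cos_60 by (metis cos_periodic)
  show "theta1 ^ 3 + 3 * theta1 ^ 2 - 3 = 0" "theta2 ^ 3 + 3 * theta2 ^ 2 - 3 = 0" "theta3 ^ 3 + 3 * theta3 ^ 2 - 3 = 0"
    unfolding theta1_def theta2_def theta3_def using cubic_of_cos 1 2 3 by blast+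
qed

text \<open>Coarse enclosures that separate the three roots and fix the sign of the cofactor in
  \<open>cubic_diff\<close>.\<close>

lemma theta_bounds:
  "0 < theta1" "theta1 \<le> 1" "-2 \<le> theta2" "theta2 \<le> -1" "-3 \<le> theta3" "theta3 < -2.4"
proof -
  have "cos (pi / 3) < cos (pi / 9)" by (rule cos_monotone_0_pi) auto
  then show "0 < theta1" unfolding theta1_def cos_60 by simp
  show "theta1 \<le> 1" unfolding theta1_def using cos_le_one[of "pi/9"] by simp
  have "13 * pi / 9 = 2 * pi - 5 * pi / 9" by simp
  then have c2: "cos (13 * pi / 9) = cos (5 * pi / 9)" by (metis cos_2pi_minus)
  have "cos (5 * pi / 9) \<le> cos (pi / 2)" by (rule cos_monotone_0_pi_le) auto
  then show "theta2 \<le> -1" unfolding theta2_def c2 cos_pi_half by simp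
  have "cos (2 * pi / 3) \<le> cos (5 * pi / 9)" by (rule cos_monotone_0_pi_le) auto
  moreover have "cos (2 * pi / 3) = - 1 / 2" using cos_120 by simp
  ultimately show "-2 \<le> theta2" unfolding theta2_def c2 by simp
  show "-3 \<le> theta3" unfolding theta3_def using cos_ge_minus_one[of "7*pi/9"] by linarith
  have "7 * pi / 9 = pi - 2 * pi / 9" by simp
  then have c3: "cos (7 * pi / 9) = - cos (2 * pi / 9)" by (metis cos_pi_minus)
  have "cos (pi / 4) < cos (2 * pi / 9)" by (rule cos_monotone_0_pi) auto
  moreover have "1.4 < sqrt 2" by (rule real_less_rsqrt) (simp add: power2_eq_square)
  ultimately show "theta3 < -2.4" unfolding theta3_def c3 cos_45 by simp
qed

text \<open>For a root \<open>t\<close>, the sign of the cubic at \<open>a\<close> decides on which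
  side of \<open>a\<close> the root lies, once the sign of the quadratic cofactor is known. The
  decimal approximations arise in this way at the two ends of the interval.\<close>

lemma cubic_diff: "t ^ 3 + 3 * t ^ 2 - 3 = 0 \<Longrightarrow> (t - a) * (t ^ 2 + t * a + a ^ 2 + 3 * t + 3 * a) = - (a
    ^ 3 + 3 * a ^ 2 - 3)" for t a :: real
  by (simp add: power2_eq_square power3_eq_cube algebra_simps)

lemma theta1_approx: "\<bar>theta1 - 0.879\<bar> \<le> 0.0005"
proof -
  note b = theta_bounds(1,2)
  have f: "0 < theta1 ^ 2 + theta1 * a + a ^ 2 + 3 * theta1 + 3 * a" if "a > 0" for a using b that
    by (auto intro!: add_pos_pos)
  have "0 < (theta1 - 0.8785) * (theta1 ^ 2 + theta1 * 0.8785 + 0.8785 ^ 2 + 3 * theta1 + 3 * 0.8785)"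
    unfolding cubic_diff[OF theta_cubic(1)] by (simp add: power2_eq_square power3_eq_cube)
  then have 1: "theta1 > 0.8785" using f[of "0.8785"] by (simp add: zero_less_mult_iff)
  have "(theta1 - 0.8795) * (theta1 ^ 2 + theta1 * 0.8795 + 0.8795 ^ 2 + 3 * theta1 + 3 * 0.8795) < 0"
    unfolding cubic_diff[OF theta_cubic(1)] by (simp add: power2_eq_square power3_eq_cube)
  then have 2: "theta1 < 0.8795" using f[of "0.8795"] by (simp add: mult_less_0_iff)
  show ?thesis unfolding abs_le_iff using 1 2 by simp
qed

lemma theta2_approx: "\<bar>theta2 - (-1.347)\<bar> \<le> 0.0005"
proof -
  note b = theta_bounds(3,4)
  have f: "theta2 ^ 2 + theta2 * a + a ^ 2 + 3 * theta2 + 3 * a < 0" if "-1.4 < a" "a < -1.3" for a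
  proof -
    \<comment> \<open>Both theta2^2 + 3 theta2 and a^2 + 3 a are at most -2, and the mixed product
      is at most 2.8, so the cofactor is at most -1.2.\<close>
    have "(theta2 + 1) * (theta2 + 2) \<le> 0" using b by (simp add: mult_le_0_iff)
    moreover have "(a + 1) * (a + 2) \<le> 0" using that by (simp add: mult_le_0_iff)
    moreover have "theta2 * a \<le> 2 * 1.4" using mult_mono[of "-theta2" 2 "-a" "1.4"] b that by simp
    ultimately show ?thesis by (simp add: power2_eq_square algebra_simps)
  qed
  have "(theta2 - (-1.3475)) * (theta2 ^ 2 + theta2 * (-1.3475) + (-1.3475) ^ 2 + 3 * theta2 + 3 * (-1.3475)) < 0"
    unfolding cubic_diff[OF theta_cubic(2)] by (simp add: power2_eq_square power3_eq_cube)
  then have 1: "theta2 > -1.3475" using f[of "-1.3475"] by (simp add: mult_less_0_iff)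
  have "0 < (theta2 - (-1.3465)) * (theta2 ^ 2 + theta2 * (-1.3465) + (-1.3465) ^ 2 + 3 * theta2 + 3 * (-1.3465))"
    unfolding cubic_diff[OF theta_cubic(2)] by (simp add: power2_eq_square power3_eq_cube)
  then have 2: "theta2 < -1.3465" using f[of "-1.3465"] by (simp add: zero_less_mult_iff)
  show ?thesis unfolding abs_le_iff using 1 2 by simp
qed

lemma theta3_approx: "\<bar>theta3 - (-2.532)\<bar> \<le> 0.0005"
proof -
  note b = theta_bounds(5,6)
  have f: "0 < theta3 ^ 2 + theta3 * a + a ^ 2 + 3 * theta3 + 3 * a" if "-2.6 < a" "a < -2.5" for a
  proof -
    \<comment> \<open>The three summands are at least -1.8, -1.3 and 6, so the cofactor is at least
      2.9.\<close>
    have "theta3 * theta3 + 3 * theta3 \<ge> - 3 * 0.6" using mult_mono[of "-theta3" 3 "theta3 + 3" "0.6"] b by (simp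
        add: algebra_simps)
    moreover have "a * a + 3 * a \<ge> - 2.6 * 0.5" using mult_mono[of "-a" "2.6" "a + 3" "0.5"] that by (simp add: algebra_simps)
    moreover have "theta3 * a \<ge> 2.4 * 2.5" using mult_mono[of "2.4" "-theta3" "2.5" "-a"] b that by simp
    ultimately show ?thesis by (simp add: power2_eq_square)
  qed
  have "0 < (theta3 - (-2.5325)) * (theta3 ^ 2 + theta3 * (-2.5325) + (-2.5325) ^ 2 + 3 * theta3 + 3 * (-2.5325))"
    unfolding cubic_diff[OF theta_cubic(3)] by (simp add: power2_eq_square power3_eq_cube)
  then have 1: "theta3 > -2.5325" using f[of "-2.5325"] by (simp add: zero_less_mult_iff)
  have "(theta3 - (-2.5315)) * (theta3 ^ 2 + theta3 * (-2.5315) + (-2.5315) ^ 2 + 3 * theta3 + 3 * (-2.5315)) < 0"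
    unfolding cubic_diff[OF theta_cubic(3)] by (simp add: power2_eq_square power3_eq_cube)
  then have 2: "theta3 < -2.5315" using f[of "-2.5315"] by (simp add: mult_less_0_iff)
  show ?thesis unfolding abs_le_iff using 1 2 by simp
qed

lemma theta_sums: "theta1 + theta2 + theta3 = -3" "theta1 * theta2 + theta1 * theta3 + theta2 * theta3 = 0"
    "theta1 * theta2 * theta3 = 3"
proof -
  let ?a = theta1 and ?b = theta2 and ?c = theta3
  have ne: "?a - ?b \<noteq> 0" "?a - ?c \<noteq> 0" "?b - ?c \<noteq> 0" using theta_bounds by auto
  have "(?a - ?b) * (?a^2 + ?a * ?b + ?b^2 + 3 * ?a + 3 * ?b) = 0" using cubic_diff[OF theta_cubic(1), of ?b]
      theta_cubic(2) by simp
  then have ab: "?a^2 + ?a * ?b + ?b^2 + 3 * ?a + 3 * ?b = 0" using ne(1) mult_eq_0_iff by blast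
  have "(?a - ?c) * (?a^2 + ?a * ?c + ?c^2 + 3 * ?a + 3 * ?c) = 0" using cubic_diff[OF theta_cubic(1), of ?c]
      theta_cubic(3) by simp
  then have ac: "?a^2 + ?a * ?c + ?c^2 + 3 * ?a + 3 * ?c = 0" using ne(2) mult_eq_0_iff by blast
  \<comment> \<open>The difference of the two quadratic relations.\<close>
  have "(?b - ?c) * (?a + ?b + ?c + 3) = 0" using ab ac by (simp add: power2_eq_square algebra_simps)
  then show 1: "?a + ?b + ?c = -3" using ne(3) by simp
  then have c: "?c = -3 - ?a - ?b" by simp
  show 2: "?a * ?b + ?a * ?c + ?b * ?c = 0" using ab unfolding c by (simp add: power2_eq_square algebra_simps)
  have "?a ^ 3 = ?a^2 * (?a + ?b + ?c) - ?a * (?a * ?b + ?a * ?c + ?b * ?c) + ?a * ?b * ?c"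
    by (simp add: power2_eq_square power3_eq_cube algebra_simps)
  then show "?a * ?b * ?c = 3" using theta_cubic(1) unfolding 1 2 by simp
qed

lemma cubic_roots: "{z::complex. z ^ 3 + 3 * z ^ 2 - 3 = 0} = complex_of_real ` {theta1, theta2, theta3}"
proof -
  let ?a = "complex_of_real theta1" and ?b = "complex_of_real theta2" and ?c = "complex_of_real theta3"
  have s: "?a + ?b + ?c = -3" "?a * ?b + ?a * ?c + ?b * ?c = 0" "?a * ?b * ?c = 3"
    using theta_sums[THEN arg_cong[where f=complex_of_real]] by simp_all
  have "z ^ 3 + 3 * z ^ 2 - 3 = (z - ?a) * (z - ?b) * (z - ?c)" for z
  proof -
    have "(z - ?a) * (z - ?b) * (z - ?c) = z ^ 3 - (?a + ?b + ?c) * z ^ 2 + (?a * ?b + ?a * ?c + ?b * ?c) * z - ?a * ?b * ?c"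
      by (simp add: power2_eq_square power3_eq_cube algebra_simps)
    then show ?thesis unfolding s by simp
  qed
  then show ?thesis by auto
qed

lemma theta_power_sums:
  "theta1 ^ 2 + theta2 ^ 2 + theta3 ^ 2 = 9" "theta1 ^ 3 + theta2 ^ 3 + theta3 ^ 3 = -18"
  "theta1 ^ 4 + theta2 ^ 4 + theta3 ^ 4 = 45" "theta1 ^ 5 + theta2 ^ 5 + theta3 ^ 5 = -108"
  "theta1 ^ 6 + theta2 ^ 6 + theta3 ^ 6 = 270" "theta1 ^ 7 + theta2 ^ 7 + theta3 ^ 7 = -675"
proof -
  have rec: "theta1 ^ (k + 3) + theta2 ^ (k + 3) + theta3 ^ (k + 3)
      = 3 * (theta1 ^ k + theta2 ^ k + theta3 ^ k) - 3 * (theta1 ^ (k + 2) + theta2 ^ (k + 2) + theta3 ^ (k + 2))" for k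
  proof -
    have "t ^ (k + 3) = 3 * t ^ k - 3 * t ^ (k + 2)" if "t ^ 3 + 3 * t ^ 2 - 3 = 0" for t :: real
    proof -
      have "t ^ k * (t ^ 3 + 3 * t ^ 2 - 3) = 0" using that by simp
      then show ?thesis unfolding power_add by (simp add: algebra_simps)
    qed
    then show ?thesis using theta_cubic by simp
  qed
  have "theta1 ^ 2 + theta2 ^ 2 + theta3 ^ 2 = (theta1 + theta2 + theta3) ^ 2 - 2 * (theta1 * theta2 + theta1 * theta3 +
      theta2 * theta3)"
    by (simp add: power2_eq_square algebra_simps)
  then show 2: "theta1 ^ 2 + theta2 ^ 2 + theta3 ^ 2 = 9" unfolding theta_sums by simp
  show 3: "theta1 ^ 3 + theta2 ^ 3 + theta3 ^ 3 = -18" using rec[of 0] 2 by (simp add: power2_eq_square)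
  show 4: "theta1 ^ 4 + theta2 ^ 4 + theta3 ^ 4 = 45" using rec[of 1] 3 theta_sums(1) by (simp add: eval_nat_numeral)
  show 5: "theta1 ^ 5 + theta2 ^ 5 + theta3 ^ 5 = -108" using rec[of 2] 4 2 by simp
  show 6: "theta1 ^ 6 + theta2 ^ 6 + theta3 ^ 6 = 270" using rec[of 3] 5 3 by simp
  show "theta1 ^ 7 + theta2 ^ 7 + theta3 ^ 7 = -675" using rec[of 4] 6 4 by simp
qed

lemma phi_power_sums:
  defines "a \<equiv> (1 + sqrt 17) / 2" and "b \<equiv> (1 - sqrt 17) / 2"
  shows "a + b = 1" "a ^ 2 + b ^ 2 = 9" "a ^ 3 + b ^ 3 = 13" "a ^ 4 + b ^ 4 = 49" "a ^ 5 + b ^ 5 = 101"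
    "a ^ 6 + b ^ 6 = 297" "a ^ 7 + b ^ 7 = 701" "a ^ 2 = a + 4" "b ^ 2 = b + 4" "2.5 < a" "a < 2.6" "-1.6 < b" "b < -1.5"
proof -
  have "sqrt 17 < 4.2" by (rule real_less_lsqrt) (simp_all add: power2_eq_square)
  moreover have "4.1 < sqrt 17" by (rule real_less_rsqrt) (simp_all add: power2_eq_square)
  ultimately show "2.5 < a" "a < 2.6" "-1.6 < b" "b < -1.5" unfolding a_def b_def by auto
  show qa: "a ^ 2 = a + 4" and qb: "b ^ 2 = b + 4" unfolding a_def b_def by (simp_all add: power2_eq_square field_simps)
  have rec: "a ^ (k + 2) + b ^ (k + 2) = (a ^ (k + 1) + b ^ (k + 1)) + 4 * (a ^ k + b ^ k)" for k
    unfolding power_add qa qb by (simp add: algebra_simps)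
  show 1: "a + b = 1" unfolding a_def b_def by (simp add: field_simps)
  show 2: "a ^ 2 + b ^ 2 = 9" using rec[of 0] 1 by (simp add: power2_eq_square)
  show 3: "a ^ 3 + b ^ 3 = 13" using rec[of 1] 1 2 by (simp add: eval_nat_numeral)
  show 4: "a ^ 4 + b ^ 4 = 49" using rec[of 2] 2 3 by (simp add: numeral_eq_Suc)
  show 5: "a ^ 5 + b ^ 5 = 101" using rec[of 3] 3 4 by (simp add: numeral_eq_Suc)
  show 6: "a ^ 6 + b ^ 6 = 297" using rec[of 4] 4 5 by (simp add: numeral_eq_Suc)
  show "a ^ 7 + b ^ 7 = 701" using rec[of 5] 5 6 by (simp add: numeral_eq_Suc)
qed

definition eigs :: "real set" where
  "eigs = {3, (1 + sqrt 17) / 2, 2, theta1, 0, theta2, (1 - sqrt 17) / 2, theta3}"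

text \<open>The decimal enclosures of the irrational eigenvalues keep all eight values
  apart.\<close>

lemma card_eigs: "card (complex_of_real ` eigs) = 8" "finite (complex_of_real ` eigs)"
proof -
  have "theta1 > 0.8" "theta1 < 0.9" "theta2 > -1.4" "theta2 < -1.3" "theta3 > -2.6" "theta3 < -2.5"
    using theta1_approx[unfolded abs_le_iff] theta2_approx[unfolded abs_le_iff] theta3_approx[unfolded abs_le_iff] by auto
  then have "distinct [3, (1 + sqrt 17) / 2, 2, theta1, 0, theta2, (1 - sqrt 17) / 2, theta3]"
    using phi_power_sums(10-) by auto
  from distinct_card[OF this] have "card eigs = 8" unfolding eigs_def by simp
  then show "card (complex_of_real ` eigs) = 8" by (simp add: card_image inj_on_def)
  show "finite (complex_of_real ` eigs)" by (simp add: eigs_def)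
qed

lemma two_linear_factors: "[:- a, 1:] * [:- b, 1:] = [:a * b, - (a + b), 1:]" for a b :: complex
  by (simp add: algebra_simps)

lemma three_linear_factors:
  "[:- a, 1:] * [:- b, 1:] * [:- c, 1:] = [:- (a * b * c), a * b + a * c + b * c, - (a + b + c), 1:]" for a b c :: complex
  by (simp add: algebra_simps)

text \<open>The irrational eigenvalues combine to t^2 - t - 4 and t^3 + 3 t^2 - 3, so the
  coefficients are integers.\<close>

lemma eigs_poly: "(\<Prod>d\<in>complex_of_real ` eigs. [:- d, 1:]) = [:0, 72, -42, -93, 36, 32, -11, -3, 1:]"
proof -
  have d: "distinct (map complex_of_real [3, (1 + sqrt 17) / 2, 2, theta1, 0, theta2, (1 - sqrt 17) / 2, theta3])"
    by (rule card_distinct) (use card_eigs(1) in \<open>simp add: eigs_def\<close>)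
  have "(\<Prod>d\<in>complex_of_real ` eigs. [:- d, 1:]) = (\<Prod>d\<leftarrow>map complex_of_real [3, (1 + sqrt 17) /
      2, 2, theta1, 0, theta2, (1 - sqrt 17) / 2, theta3]. [:- d, 1:])"
    unfolding prod.distinct_set_conv_list[OF d, symmetric] by (simp add: eigs_def)
  also have "\<dots> = [:-3, 1:] * [:-2, 1:] * [:0, 1:] * ([:- complex_of_real ((1 + sqrt 17) / 2), 1:] * [:-
      complex_of_real ((1 - sqrt 17) / 2), 1:])
     * ([:- complex_of_real theta1, 1:] * [:- complex_of_real theta2, 1:] * [:- complex_of_real theta3, 1:])"
    by (simp only: list.map prod_list.Cons prod_list.Nil mult_1_right mult_1_left of_real_numeral of_real_0 minus_zero mult_ac)
  also have "[:- complex_of_real ((1 + sqrt 17) / 2), 1:] * [:- complex_of_real ((1 - sqrt 17) / 2), 1:] = [:-4, -1, 1:]"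
  proof -
    have "complex_of_real ((1 + sqrt 17) / 2) * complex_of_real ((1 - sqrt 17) / 2) = complex_of_real (-4)"
      unfolding of_real_mult[symmetric] by (rule arg_cong[where f=complex_of_real]) (simp add: field_simps)
    moreover have "complex_of_real ((1 + sqrt 17) / 2) + complex_of_real ((1 - sqrt 17) / 2) = complex_of_real 1"
      unfolding of_real_add[symmetric] using phi_power_sums(1) by presburger
    ultimately show ?thesis unfolding two_linear_factors by simp
  qed
  also have "[:- complex_of_real theta1, 1:] * [:- complex_of_real theta2, 1:] * [:- complex_of_real theta3, 1:] = [:-3,
      0, 3, 1:]"
  proof -
    have s: "complex_of_real theta1 + complex_of_real theta2 + complex_of_real theta3 = -3"
      "complex_of_real theta1 * complex_of_real theta2 + complex_of_real theta1 * complex_of_real theta3 +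
          complex_of_real theta2 * complex_of_real theta3 = 0"
      "complex_of_real theta1 * complex_of_real theta2 * complex_of_real theta3 = 3"
      using theta_sums[THEN arg_cong[where f=complex_of_real]] by simp_all
    show ?thesis unfolding three_linear_factors s by simp
  qed
  finally show ?thesis by simp
qed

section \<open>Linear combinations and matrix powers on lists\<close>

text \<open>Coefficient lists allow computations inside a module that do not refer to the vertices
  and depend on the type only.\<close>

fun lc :: "complex list \<Rightarrow> (complex^'n) list \<Rightarrow> complex^'n" where
  "lc (c # cs) (w # ws) = c *s w + lc cs ws"
| "lc _ _ = 0"

definition bmul :: "complex list list \<Rightarrow> complex list \<Rightarrow> complex list" where
  "bmul M cs = map (\<lambda>r. sum_list (map2 (*) r cs)) M"

lemma lc_sum: "length cs = length ws \<Longrightarrow> lc cs ws = (\<Sum>i<length ws. cs ! i *s ws ! i)"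
  by (induction cs ws rule: lc.induct) (auto simp: sum.lessThan_Suc_shift simp del: sum.lessThan_Suc)

lemma lc_scale: "a *s lc cs ws = lc (map ((*) a) cs) ws"
  by (induction cs ws rule: lc.induct) (auto simp: vec.scale_right_distrib)

lemma lc_add: "length cs = length ws \<Longrightarrow> length ds = length ws \<Longrightarrow> lc cs ws + lc ds ws = lc
    (map2 (+) cs ds) ws"
proof (induction ws arbitrary: cs ds)
  case (Cons w ws)
  then obtain c cs' d ds' where "cs = c # cs'" "ds = d # ds'" by (metis length_Suc_conv)
  then show ?case using Cons by (simp add: vec.scale_left_distrib algebra_simps)
qed simp

lemma lc_diff: "length cs = length ws \<Longrightarrow> length ds = length ws \<Longrightarrow> lc cs ws - lc ds ws = lc
    (map2 (-) cs ds) ws"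
proof (induction ws arbitrary: cs ds)
  case (Cons w ws)
  then obtain c cs' d ds' where "cs = c # cs'" "ds = d # ds'" by (metis length_Suc_conv)
  moreover from this have "lc cs' ws - lc ds' ws = lc (map2 (-) cs' ds') ws" using Cons by simp
  ultimately show ?case by (simp add: add_diff_add vec.scale_left_diff_distrib)
qed simp

lemma length_bmul [simp]: "length (bmul M cs) = length M" by (simp add: bmul_def)

lemma bmul_nth:
  assumes "i < length M" "length (M ! i) = length cs"
  shows "bmul M cs ! i = (\<Sum>j<length cs. M ! i ! j * cs ! j)"
  using assms by (simp add: bmul_def sum_list_sum_nth atLeast0LessThan)

text \<open>The trace of the \<open>k\<close>-th power is read off the orbits of the unit vectors.\<close>

fun orbit :: "nat \<Rightarrow> complex list list \<Rightarrow> complex list \<Rightarrow> complex list list" where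
  "orbit 0 M cs = []"
| "orbit (Suc k) M cs = cs # orbit k M (bmul M cs)"

definition unit_list :: "nat \<Rightarrow> nat \<Rightarrow> complex list" where
  "unit_list n j = map (\<lambda>i. if i = j then 1 else 0) [0..<n]"

definition traces :: "nat \<Rightarrow> nat \<Rightarrow> complex list list \<Rightarrow> complex list" where
  "traces m n M = foldr (map2 (+)) (map (\<lambda>j. map (\<lambda>c. c ! j) (orbit m M (unit_list n j))) [0..<n])
      (replicate m 0)"

lemma length_orbit [simp]: "length (orbit m M cs) = m" by (induction m arbitrary: cs) auto

lemma orbit_nth: "k < m \<Longrightarrow> orbit m M cs ! k = (bmul M ^^ k) cs"
proof (induction m arbitrary: k cs)
  case (Suc m)
  then show ?case by (cases k) (simp_all add: funpow_swap1)
qed simp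

lemma foldr_map2_nth:
  assumes "\<And>r. r \<in> set rs \<Longrightarrow> length r = m" "k < m"
  shows "length (foldr (map2 (+)) rs (replicate m 0)) = m \<and> foldr (map2 (+)) rs (replicate m (0::complex)) ! k =
      (\<Sum>r\<leftarrow>rs. r ! k)"
  using assms by (induction rs) auto

lemma mat_pow_vec:
  assumes "length M = n" "\<And>r. r \<in> set M \<Longrightarrow> length r = n" "length cs = n"
  shows "(mat_of_rows_list n M ^\<^sub>m k) *\<^sub>v vec_of_list cs = vec_of_list ((bmul M ^^ k) cs) \<and> length
      ((bmul M ^^ k) cs) = n"
  using assms(3)
proof (induction k arbitrary: cs)
  case 0
  have "vec_of_list cs \<in> carrier_vec n" using 0 by (simp add: carrier_vecI)
  then show ?case using 0 assms(1) by (simp add: mat_of_rows_list_def)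
next
  case (Suc k)
  let ?A = "mat_of_rows_list n M"
  have A: "?A \<in> carrier_mat n n" using assms(1) by (simp add: mat_of_rows_list_def)
  have Ak: "?A ^\<^sub>m k \<in> carrier_mat n n" using A by simp
  have v: "vec_of_list cs \<in> carrier_vec n" using Suc.prems by (simp add: carrier_vecI)
  have "?A *\<^sub>v vec_of_list cs = vec_of_list (bmul M cs)"
  proof (rule eq_vecI)
    show "dim_vec (?A *\<^sub>v vec_of_list cs) = dim_vec (vec_of_list (bmul M cs))" using assms(1) by (simp add:
        mat_of_rows_list_def)
    fix i assume "i < dim_vec (vec_of_list (bmul M cs))"
    then have i: "i < n" using assms by simp
    then have "length (M ! i) = n" using assms by simp
    then show "(?A *\<^sub>v vec_of_list cs) $ i = vec_of_list (bmul M cs) $ i"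
      using i assms(1) Suc.prems bmul_nth[of i M cs]
      by (simp add: mat_of_rows_list_def scalar_prod_def vec_of_list_index atLeast0LessThan)
  qed
  then have "(?A ^\<^sub>m Suc k) *\<^sub>v vec_of_list cs = ?A ^\<^sub>m k *\<^sub>v vec_of_list (bmul M cs)"
    using assoc_mult_mat_vec[OF Ak A v] by simp
  then show ?case using Suc.IH[of "bmul M cs"] assms(1) by (simp add: funpow_swap1)
qed

lemma mat_trace_pow:
  assumes "length M = n" "\<And>r. r \<in> set M \<Longrightarrow> length r = n" "k < m"
  shows "mat_trace (mat_of_rows_list n M ^\<^sub>m k) = traces m n M ! k"
proof -
  let ?A = "mat_of_rows_list n M"
  have A: "?A \<in> carrier_mat n n" using assms by (simp add: mat_of_rows_list_def)
  have Ak: "?A ^\<^sub>m k \<in> carrier_mat n n" using A by simp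
  have d: "(?A ^\<^sub>m k) $$ (j,j) = (bmul M ^^ k) (unit_list n j) ! j" if j: "j < n" for j
  proof -
    have u: "vec_of_list (unit_list n j) = unit_vec n j"
      by (rule eq_vecI) (auto simp: unit_list_def vec_of_list_index unit_vec_def)
    have l: "length (unit_list n j) = n" by (simp add: unit_list_def)
    have "(?A ^\<^sub>m k) $$ (j,j) = ((?A ^\<^sub>m k) *\<^sub>v unit_vec n j) $ j"
      using carrier_matD[OF Ak] j by (subst index_mult_mat_vec) (simp_all add: scalar_prod_right_unit)
    also have "\<dots> = (bmul M ^^ k) (unit_list n j) ! j"
      using mat_pow_vec[OF assms(1,2) l, of k] by (simp add: u vec_of_list_index)
    finally show ?thesis .
  qed
  have "mat_trace (?A ^\<^sub>m k) = (\<Sum>j<n. (bmul M ^^ k) (unit_list n j) ! j)"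
    using carrier_matD[OF Ak] d by (simp add: mat_trace_def)
  also have "\<dots> = (\<Sum>r\<leftarrow>map (\<lambda>j. map (\<lambda>c. c ! j) (orbit m M (unit_list n j))) [0..<n]. r ! k)"
    using assms(3) by (simp add: comp_def orbit_nth interv_sum_list_conv_sum_set_nat atLeast0LessThan)
  also have "\<dots> = traces m n M ! k" unfolding traces_def
    by (rule foldr_map2_nth[THEN conjunct2, symmetric]) (use assms in auto)
  finally show ?thesis .
qed

text \<open>The sparse matrix is multiplied out once with symbolic entries, which keeps the
  iterations for traces and bases cheap.\<close>

lemma bmul_I: "bmul matrix_I [c0, c1, c2, c3, c4, c5, c6, c7] =
   [3 * c1,
    c0 + 2 * c2,
    c1 + 2 * c3,
    c2 + 2 * c4,
    c3 + c4 + c5,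
    c4 + c5 + c6,
    c5 + c6 + c7,
    3 * c6]"
  by (simp add: bmul_def matrix_I_def)

lemma bmul_II: "bmul matrix_II [c0, c1, c2, c3, c4, c5, c6, c7, c8] =
   [2 * c1,
    c0 + 2 * c2,
    c1 + 2 * c3 - c4,
    c2 + c4 + c5 + c6,
    c3 + c6,
    c3 - c4 + c5 + c7 + c8,
    c4 + c6 + c8,
    c5 - c6 + c7 + 3 * c8,
    c6 - c8]"
  by (simp add: bmul_def matrix_II_def)

lemma bmul_III: "bmul matrix_III [c0, c1, c2, c3, c4, c5, c6, c7, c8, c9, c10, c11, c12] =
   [2 * c1,
    c0 + 2 * c3,
    c4 + c5,
    c1 + c4 + c6,
    c2 + c3 + c7,
    c2 + c5 + c8,
    c3 - c6 + c9,
    c4 + c7 + c10,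
    c5 - c8 + c11,
    c6 + c9 + c12,
    c7 - c11 + c12,
    c8 - c10 + c12,
    c9 + c10 + c11]"
  by (simp add: bmul_def matrix_III_def)

lemma bmul_IV: "bmul matrix_IV [c0, c1, c2, c3, c4, c5, c6, c7, c8, c9, c10] =
   [c1 + c2,
    c0 + c1 + c4,
    c0 - c1 - c2 + c5,
    - c0 - c1 - c3 + c6,
    c1 + c4 + c5 + c6 + c7,
    c2 - c5 + c8,
    c3 - c6 + c9,
    c4 + c9,
    c5 - c7 - c8 - c9,
    c6 + c7 + c10,
    2 * c7 + c8 + 3 * c9]"
  by (simp add: bmul_def matrix_IV_def)

lemma bmul_V: "bmul matrix_V [c0, c1, c2, c3] =
   [- c0 + c1,
    c0 + c1 + c2,
    c1 - c2 + 3 * c3,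
    c2]"
  by (simp add: bmul_def matrix_V_def)

lemma traces_I: "traces 8 8 matrix_I = [8,3,31,30,191,268,1360,2341]"
proof -
  have upt: "[0..<8] = [0, 1, 2, 3, 4, 5, 6, 7]" by code_simp
  show ?thesis unfolding traces_def upt list.map by (simp add: unit_list_def bmul_I numeral_eq_Suc)
qed

lemma traces_II: "traces 8 9 matrix_II = [9,2,26,11,126,57,695,282]"
proof -
  have upt: "[0..<9] = [0, 1, 2, 3, 4, 5, 6, 7, 8]" by code_simp
  show ?thesis unfolding traces_def upt list.map by (simp add: unit_list_def bmul_II numeral_eq_Suc)
qed

lemma traces_III: "traces 8 13 matrix_III = [13,1,39,1,187,-19,1029,-265]"
proof -
  have upt: "[0..<13] = [0, 1, 2, 3, 4, 5, 6, 7, 8, 9, 10, 11, 12]" by code_simp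
  show ?thesis unfolding traces_def upt list.map by (simp add: unit_list_def bmul_III numeral_eq_Suc)
qed

lemma traces_IV: "traces 8 11 matrix_IV = [11,-3,31,-15,155,-83,901,-521]"
proof -
  have upt: "[0..<11] = [0, 1, 2, 3, 4, 5, 6, 7, 8, 9, 10]" by code_simp
  show ?thesis unfolding traces_def upt list.map by (simp add: unit_list_def bmul_IV numeral_eq_Suc)
qed

lemma traces_V: "traces 8 4 matrix_V = [4,-1,13,-10,61,-76,334,-547]"
proof -
  have upt: "[0..<4] = [0, 1, 2, 3]" by code_simp
  show ?thesis unfolding traces_def upt list.map by (simp add: unit_list_def bmul_V numeral_eq_Suc)
qed

section \<open>Power sums of the eigenvalues\<close>

definition phi1 :: real where "phi1 = (1 + sqrt 17) / 2"
definition phi2 :: real where "phi2 = (1 - sqrt 17) / 2"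

lemma power_sums_list:
  "k < 8 \<Longrightarrow> phi1 ^ k + phi2 ^ k = [2,1,9,13,49,101,297,701] ! k"
  "k < 8 \<Longrightarrow> theta1 ^ k + theta2 ^ k + theta3 ^ k = [3,-3,9,-18,45,-108,270,-675] ! k"
  "k < 8 \<Longrightarrow> (3::real) ^ k = [1,3,9,27,81,243,729,2187] ! k"
      "k < 8 \<Longrightarrow> (2::real) ^ k = [1,2,4,8,16,32,64,128] ! k"
  "k < 8 \<Longrightarrow> (0::real) ^ k = [1,0,0,0,0,0,0,0] ! k"
proof -
  have k8: "k < 8 \<Longrightarrow> k \<in> {0,1,2,3,4,5,6,7::nat}" by auto
  show "phi1 ^ k + phi2 ^ k = [2,1,9,13,49,101,297,701] ! k"
    if "k < 8"
    using k8[OF that] phi_power_sums(1-7)[folded phi1_def phi2_def] by (elim insertE emptyE) simp_all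
  show "theta1 ^ k + theta2 ^ k + theta3 ^ k = [3,-3,9,-18,45,-108,270,-675] ! k"
    if "k < 8"
    using k8[OF that] theta_power_sums theta_sums(1) by (elim insertE emptyE) simp_all
  show "k < 8 \<Longrightarrow> (3::real) ^ k = [1,3,9,27,81,243,729,2187] ! k"
      "k < 8 \<Longrightarrow> (2::real) ^ k = [1,2,4,8,16,32,64,128] ! k"
    "k < 8 \<Longrightarrow> (0::real) ^ k = [1,0,0,0,0,0,0,0] ! k"
    by (drule k8, elim insertE emptyE; simp)+
qed

definition "es_I = [3, phi1, 2, theta1, 0, theta2, phi2, theta3]"
definition "es_II = [phi1, 2, 2, theta1, 0, 0, theta2, phi2, theta3]"
definition "es_III = [phi1, 2, 2, 2, theta1, theta1, 0, 0, theta2, theta2, phi2, theta3, theta3]"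
definition "es_IV = [phi1, 2, theta1, theta1, 0, 0, theta2, theta2, phi2, theta3, theta3]"
definition "es_V = [2, theta1, theta2, theta3]"
definition "es_A = replicate 1 3 @ replicate 9 phi1 @ replicate 18 2 @ replicate 16 theta1 @ replicate 17 0 @ replicate 16 theta2
   @ replicate 9 phi2 @ replicate 16 theta3"

lemma sum_list_power_replicate: "(\<Sum>e\<leftarrow>replicate m a. e ^ k) = of_nat m * a ^ k" for a :: real
  by (simp add: sum_list_replicate)

text \<open>The values agree with the traces of the representing matrices. In the last line, 1, 0,
  3, 0, 15, 0, 87, 0 counts the closed walks of length \<open>k\<close> at a vertex: the girth is 9,
  so these are the numbers for the cubic tree.\<close>

lemma power_sums_es:
  assumes "k < 8"
  shows "(\<Sum>e\<leftarrow>es_I. e ^ k) = [8,3,31,30,191,268,1360,2341] ! k"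
      "(\<Sum>e\<leftarrow>es_II. e ^ k) = [9,2,26,11,126,57,695,282] ! k"
      "(\<Sum>e\<leftarrow>es_III. e ^ k) = [13,1,39,1,187,-19,1029,-265] ! k"
    "(\<Sum>e\<leftarrow>es_IV. e ^ k) = [11,-3,31,-15,155,-83,901,-521] ! k"
        "(\<Sum>e\<leftarrow>es_V. e ^ k) = [4,-1,13,-10,61,-76,334,-547] ! k"
        "(\<Sum>e\<leftarrow>es_A. e ^ k) = 102 * [1,0,3,0,15,0,87,0] ! k"
proof -
  note s = power_sums_list[OF assms]
  have e: "(\<Sum>e\<leftarrow>es_I. e ^ k) = 3 ^ k + 2 ^ k + 0 ^ k + (phi1 ^ k + phi2 ^ k) + (theta1 ^ k + theta2 ^ k +
      theta3 ^ k)"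
    "(\<Sum>e\<leftarrow>es_II. e ^ k) = 2 * 2 ^ k + 2 * 0 ^ k + (phi1 ^ k + phi2 ^ k) + (theta1 ^ k + theta2 ^ k + theta3 ^ k)"
    "(\<Sum>e\<leftarrow>es_III. e ^ k) = 3 * 2 ^ k + 2 * 0 ^ k + (phi1 ^ k + phi2 ^ k) + 2 * (theta1 ^ k + theta2 ^ k +
        theta3 ^ k)"
    "(\<Sum>e\<leftarrow>es_IV. e ^ k) = 2 ^ k + 2 * 0 ^ k + (phi1 ^ k + phi2 ^ k) + 2 * (theta1 ^ k + theta2 ^ k + theta3 ^ k)"
    "(\<Sum>e\<leftarrow>es_V. e ^ k) = 2 ^ k + (theta1 ^ k + theta2 ^ k + theta3 ^ k)"
    by (simp_all only: es_I_def es_II_def es_III_def es_IV_def es_V_def list.map sum_list.Cons sum_list.Nil) (simp_all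
        add: algebra_simps)
  have "(\<Sum>e\<leftarrow>es_A. e ^ k) = 3 ^ k + 18 * 2 ^ k + 17 * 0 ^ k + 9 * (phi1 ^ k + phi2 ^ k) + 16 * (theta1 ^
      k + theta2 ^ k + theta3 ^ k)"
    unfolding es_A_def map_append sum_list_append sum_list_power_replicate by (simp add: algebra_simps)
  note e = e this
  have k8: "k \<in> {0,1,2,3,4,5,6,7::nat}" using assms by auto
  show "(\<Sum>e\<leftarrow>es_I. e ^ k) = [8,3,31,30,191,268,1360,2341] ! k"
      "(\<Sum>e\<leftarrow>es_II. e ^ k) = [9,2,26,11,126,57,695,282] ! k"
      "(\<Sum>e\<leftarrow>es_III. e ^ k) = [13,1,39,1,187,-19,1029,-265] ! k"
    "(\<Sum>e\<leftarrow>es_IV. e ^ k) = [11,-3,31,-15,155,-83,901,-521] ! k"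
        "(\<Sum>e\<leftarrow>es_V. e ^ k) = [4,-1,13,-10,61,-76,334,-547] ! k"
        "(\<Sum>e\<leftarrow>es_A. e ^ k) = 102 * [1,0,3,0,15,0,87,0] ! k"
    unfolding e s using k8 by (elim insertE emptyE; simp)+
qed

lemma eigs_phi: "eigs = {3, phi1, 2, theta1, 0, theta2, phi2, theta3}"
  by (simp add: eigs_def phi1_def phi2_def)

lemma es_subset: "set es_I \<subseteq> eigs" "set es_II \<subseteq> eigs" "set es_III \<subseteq> eigs"
    "set es_IV \<subseteq> eigs" "set es_V \<subseteq> eigs" "set es_A \<subseteq> eigs"
  by (auto simp: eigs_phi es_I_def es_II_def es_III_def es_IV_def es_V_def es_A_def)

lemma has_eigenvaluesI:
  assumes M: "length M = n" "\<And>r. r \<in> set M \<Longrightarrow> length r = n" and es: "set es \<subseteq> eigs"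
    and ev: "\<And>e. eigenvalue (mat_of_rows_list n M) e \<Longrightarrow> e \<in> complex_of_real ` eigs"
    and tr: "traces 8 n M = map complex_of_real ts" "\<And>k. k < 8 \<Longrightarrow> (\<Sum>e\<leftarrow>es. e ^ k) = ts ! k"
  shows "has_eigenvalues (mat_of_rows_list n M) es"
proof -
  have l: "length ts = 8"
  proof -
    have "length (traces 8 n M) = 8" unfolding traces_def by (rule foldr_map2_nth[THEN conjunct1, of _ 8 0]) auto
    then show ?thesis unfolding tr(1) by simp
  qed
  have "char_poly (mat_of_rows_list n M) = (\<Prod>e\<leftarrow>map complex_of_real es. [:- e, 1:])"
  proof (rule char_poly_by_power_sums[OF _ card_eigs(2) _ ev])
    show "mat_of_rows_list n M \<in> carrier_mat n n" using M by (simp add: mat_of_rows_list_def)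
    show "set (map complex_of_real es) \<subseteq> complex_of_real ` eigs" using es by auto
    fix k assume "k < card (complex_of_real ` eigs)"
    then have k: "k < 8" using card_eigs(1) by simp
    have "mat_trace (mat_of_rows_list n M ^\<^sub>m k) = complex_of_real (\<Sum>e\<leftarrow>es. e ^ k)"
      using mat_trace_pow[OF M k] tr k l by simp
    also have "\<dots> = (\<Sum>e\<leftarrow>map complex_of_real es. e ^ k)" by (induction es) auto
    finally show "mat_trace (mat_of_rows_list n M ^\<^sub>m k) = (\<Sum>e\<leftarrow>map complex_of_real es. e ^ k)" .
  qed
  then show ?thesis unfolding has_eigenvalues_def by (simp add: comp_def)
qed

section \<open>The ten modules\<close>

text \<open>The Gram matrix of module \<open>k\<close> is \<open>scales ! k\<close> times that of its type, whose inverse is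
  \<open>gram_invs ! t\<close> divided by \<open>dens ! t\<close>. Types are numbered from 0.\<close>

definition "bases = [base_I, base_IIa, base_IIb, base_IIIa, base_IIIb, base_IIIc, base_IVa, base_IVb, base_IVc, base_V]"
definition "mtype k = [0,1,1,2,2,2,3,3,3,4::nat] ! k"
definition "scales = [1,1,3,1,1,1,2,1,1,1::int]"
definition "dims = [8,9,13,11,4::nat]"
definition "levels = [[0,1,2,3,4,5,6,7],
    [1,2,3,4,4,5,5,6,6],
    [2,3,3,4,4,4,5,5,5,6,6,6,7],
    [3,4,4,4,5,5,5,6,6,6,7],
    [4,5,6,7] :: nat list]"
definition "bmats = [bmat_I, bmat_II, bmat_III, bmat_IV, bmat_V]"
definition "grams = [gram_I, gram_II, gram_III, gram_IV, gram_V]"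
definition "gram_invs = [gram_inv_I, gram_inv_II, gram_inv_III, gram_inv_IV, gram_inv_V]"
definition "dens = [24,24,8,16,72::int]"
definition "matrices = [matrix_I, matrix_II, matrix_III, matrix_IV, matrix_V]"

text \<open>Indices in successor form, so that list lookups evaluate with
  \<open>nth_Cons_Suc\<close> alone.\<close>

lemma less_10: "k < 10 \<Longrightarrow> k \<in> {0, Suc 0, Suc (Suc 0), Suc (Suc (Suc 0)), Suc (Suc (Suc (Suc 0))), Suc
    (Suc (Suc (Suc (Suc 0)))), Suc (Suc (Suc (Suc (Suc (Suc 0))))), Suc (Suc (Suc (Suc (Suc (Suc (Suc 0)))))), Suc (Suc
    (Suc (Suc (Suc (Suc (Suc (Suc 0))))))), Suc (Suc (Suc (Suc (Suc (Suc (Suc (Suc (Suc 0))))))))}" by auto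
lemma less_5: "t < 5 \<Longrightarrow> t \<in> {0, Suc 0, Suc (Suc 0), Suc (Suc (Suc 0)), Suc (Suc (Suc (Suc 0)))}" by auto

lemma nth_five: "[a,b,c,d,e] ! 0 = a" "[a,b,c,d,e] ! 1 = b" "[a,b,c,d,e] ! 2 = c" "[a,b,c,d,e] ! 3 = d" "[a,b,c,d,e] ! 4 = e"
  by simp_all

lemma mtype_less: "k < 10 \<Longrightarrow> mtype k < 5"
  by (drule less_10) (elim insertE emptyE; simp add: mtype_def)

lemma bases_action:
  assumes "k < 10"
  shows "map nbr_sum (map pad (bases ! k)) = map (\<lambda>j. lcomb (map (\<lambda>r. r ! j) (bmats ! mtype k)) (map pad
      (bases ! k))) [0..<dims ! mtype k]"
  using less_10[OF assms]
  by (elim insertE emptyE; simp only: bases_def mtype_def bmats_def dims_def nth_five nth_Cons_0 nth_Cons_Suc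
    action_I action_IIa action_IIb action_IIIa action_IIIb action_IIIc action_IVa action_IVb action_IVc action_V)

lemma bases_gram:
  assumes "k < 10"
  shows "map (\<lambda>v. map (pdot v) (bases ! k)) (bases ! k) = map (map ((*) (scales ! k))) (grams ! mtype k)"
  using less_10[OF assms]
  by (elim insertE emptyE; simp only: bases_def mtype_def grams_def scales_def nth_five nth_Cons_0 nth_Cons_Suc
    gram_I gram_IIa gram_IIb gram_IIIa gram_IIIb gram_IIIc gram_IVa gram_IVb gram_IVc gram_V)

lemma bases_orth:
  assumes "k < 9"
  shows "list_all (\<lambda>v. list_all (\<lambda>w. pdot v w = 0) (concat (drop (Suc k) bases))) (bases ! k)"
proof -
  have "k \<in> {0, Suc 0, Suc (Suc 0), Suc (Suc (Suc 0)), Suc (Suc (Suc (Suc 0))), Suc (Suc (Suc (Suc (Suc 0)))), Suc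
      (Suc (Suc (Suc (Suc (Suc 0))))), Suc (Suc (Suc (Suc (Suc (Suc (Suc 0)))))), Suc (Suc (Suc (Suc (Suc (Suc (Suc (Suc
      0)))))))}" using assms by auto
  then show ?thesis
    by (elim insertE emptyE; simp only: bases_def drop_Suc_Cons drop_0 concat.simps append_Nil2 nth_five nth_Cons_0 nth_Cons_Suc
      orth_I orth_IIa orth_IIb orth_IIIa orth_IIIb orth_IIIc orth_IVa orth_IVb orth_IVc)
qed

lemma gram_invs:
  assumes "t < 5"
  shows "map (\<lambda>r. map (dot r) (grams ! t)) (gram_invs ! t) = map (\<lambda>i. map (\<lambda>j. if i = j then
      dens ! t else 0) [0..<dims ! t]) [0..<dims ! t]"
  using less_5[OF assms]
  by (elim insertE emptyE; simp only: grams_def gram_invs_def dens_def dims_def nth_five nth_Cons_0 nth_Cons_Suc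
    gram_inv_I gram_inv_II gram_inv_III gram_inv_IV gram_inv_V)

lemma bases_levels: "k < 10 \<Longrightarrow> map fst (bases ! k) = levels ! mtype k"
  by (drule less_10) (elim insertE emptyE; simp add: bases_def mtype_def levels_def base_I_def base_IIa_def base_IIb_def
      base_IIIa_def base_IIIb_def base_IIIc_def base_IVa_def base_IVb_def base_IVc_def base_V_def)

definition "valid v \<longleftrightarrow> fst v < 8 \<and> length (snd v) = [1,3,6,12,24,24,24,8] ! fst v" for v ::
    "nat \<times> int list"

lemma bases_valid: "k < 10 \<Longrightarrow> list_all valid (bases ! k)"
  by (drule less_10) (elim insertE emptyE; simp add: bases_def valid_def base_I_def base_IIa_def base_IIb_def
      base_IIIa_def base_IIIb_def base_IIIc_def base_IVa_def base_IVb_def base_IVc_def base_V_def)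

lemma levels_length: "t < 5 \<Longrightarrow> length (levels ! t) = dims ! t"
  by (drule less_5) (elim insertE emptyE; simp add: levels_def dims_def)

lemma bases_length: "k < 10 \<Longrightarrow> length (bases ! k) = dims ! mtype k"
  using bases_levels[of k] levels_length[of "mtype k"] mtype_less[of k] by (metis length_map)

lemma bmats_length: "t < 5 \<Longrightarrow> length (bmats ! t) = dims ! t \<and> list_all (\<lambda>r. length r = dims
    ! t) (bmats ! t)"
  by (drule less_5) (elim insertE emptyE; simp add: bmats_def dims_def bmat_I_def bmat_II_def bmat_III_def bmat_IV_def bmat_V_def)

lemma grams_length: "t < 5 \<Longrightarrow> length (grams ! t) = dims ! t \<and> list_all (\<lambda>r. length r = dims
    ! t) (grams ! t)
   \<and> length (gram_invs ! t) = dims ! t \<and> list_all (\<lambda>r. length r = dims ! t) (gram_invs ! t)"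
  by (drule less_5) (elim insertE emptyE; simp add: grams_def gram_invs_def dims_def gram_I_def gram_II_def gram_III_def
      gram_IV_def gram_V_def
     gram_inv_I_def gram_inv_II_def gram_inv_III_def gram_inv_IV_def gram_inv_V_def)

lemma matrices_bmats: "t < 5 \<Longrightarrow> matrices ! t = map (map of_int) (bmats ! t)"
  by (drule less_5) (elim insertE emptyE; simp add: matrices_def bmats_def matrix_I_def matrix_II_def matrix_III_def
      matrix_IV_def matrix_V_def
    bmat_I_def bmat_II_def bmat_III_def bmat_IV_def bmat_V_def)

lemma dot_append: "length a = length c \<Longrightarrow> dot (a @ b) (c @ d) = dot a c + dot b d"
  by (simp add: dot_def)

lemma dot_zeros: "dot (replicate n 0) xs = 0"
proof (induction n arbitrary: xs)
  case (Suc n)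
  then show ?case by (cases xs) (auto simp: dot_def)
qed (simp add: dot_def)

lemma dot_nth: "length xs = n \<Longrightarrow> length ys = n \<Longrightarrow> dot xs ys = (\<Sum>i<n. xs ! i * ys ! i)"
  by (simp add: dot_def sum_list_sum_nth atLeast0LessThan)

lemma pad_same:
  assumes "valid (r, c)" "valid (r, d)" shows "dot (pad (r, c)) (pad (r, d)) = dot c d"
  using assms by (simp add: pad_def Let_def valid_def dot_append dot_zeros)

lemma valid_range:
  assumes "valid (r, c)"
  shows "[0,1,4,10,22,46,70,94] ! r + length c \<le> 102"
proof -
  have "\<forall>r\<in>set [0..<8]. [0,1,4,10,22,46,70,94] ! r + [1,3,6,12,24,24,24,8] ! r \<le> (102::nat)" by code_simp
  then show ?thesis using assms by (simp add: valid_def)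
qed

lemma length_pad: "valid v \<Longrightarrow> length (pad v) = 102"
  using valid_range[of "fst v" "snd v"] by (cases v) (simp add: pad_def Let_def)

lemma bs_lev_at:
  assumes "r < 8" "[0,1,4,10,22,46,70,94] ! r \<le> i" "i < [0,1,4,10,22,46,70,94] ! r + [1,3,6,12,24,24,24,8] ! r"
  shows "bs_lev ! i = r"
proof -
  have "\<forall>r\<in>set [0..<8]. \<forall>i\<in>set [[0,1,4,10,22,46,70,94] ! r ..< [0,1,4,10,22,46,70,94] ! r +
      [1,3,6,12,24,24,24,8] ! r]. bs_lev ! i = r"
    by code_simp
  then show ?thesis using assms by simp
qed

lemma pad_nonzero:
  assumes "valid (r, c)" "i < 102" "pad (r, c) ! i \<noteq> 0" shows "bs_lev ! i = r"
proof -
  let ?k = "[0,1,4,10,22,46,70,94] ! r :: nat"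
  have "?k \<le> i \<and> i < ?k + length c"
  proof (rule ccontr)
    assume h: "\<not> (?k \<le> i \<and> i < ?k + length c)"
    show False
      using h assms(2,3) by (auto simp: pad_def Let_def nth_append split: if_splits)
  qed
  then show ?thesis using assms(1) bs_lev_at[of r i] by (simp add: valid_def)
qed

lemma pad_at:
  assumes "valid (r, c)" "i < length c" shows "pad (r, c) ! ([0,1,4,10,22,46,70,94] ! r + i) = c ! i"
  using assms by (simp add: pad_def Let_def nth_append)

lemma length_nbr_sum [simp]: "length (nbr_sum xs) = length bs_nbs" by (simp add: nbr_sum_def)
lemma length_bs_nbs [simp]: "length bs_nbs = 102" by (simp add: bs_nbs_def)

lemma bs_nbs_ok: "list_all (\<lambda>(a,b,c). a < 102 \<and> b < 102 \<and> c < 102 \<and> a \<noteq> b \<and> a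
    \<noteq> c \<and> b \<noteq> c) bs_nbs"
  by (simp add: bs_nbs_def)

lemma length_lcomb: "list_all (\<lambda>r. length r = 102) rs \<Longrightarrow> length (lcomb cs rs) = 102"
  by (induction cs rs rule: lcomb.induct) auto

locale bs_vertices =
  fixes adj :: "'n::finite \<Rightarrow> 'n \<Rightarrow> bool" and x :: 'n and vs :: "'n list"
  assumes bs: "is_biggs_smith adj" and distinct_vs: "distinct vs" and set_vs: "set vs = UNIV"
    and lev_vs: "map (gdist adj x) vs = bs_lev"
    and adj_vs: "list_all2 (\<lambda>v (a,b,c). \<forall>w. adj v w \<longleftrightarrow> w = vs ! a \<or> w = vs ! b
        \<or> w = vs ! c) vs bs_nbs"
begin

lemma length_vs: "length vs = 102" using list_all2_lengthD[OF adj_vs] by simp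

definition "idx z = (SOME i. i < 102 \<and> vs ! i = z)"

lemma idx: "idx z < 102" "vs ! idx z = z"
proof -
  have "z \<in> set vs" using set_vs by simp
  then have "\<exists>i. i < 102 \<and> vs ! i = z" using length_vs by (metis in_set_conv_nth)
  from someI_ex[OF this] show "idx z < 102" "vs ! idx z = z" unfolding idx_def by blast+
qed

lemma idx_vs: "i < 102 \<Longrightarrow> idx (vs ! i) = i"
  using idx[of "vs ! i"] distinct_vs length_vs by (metis nth_eq_iff_index_eq)

lemma bij_vs: "bij_betw ((!) vs) {..<102} UNIV"
  using bij_betw_nth[OF distinct_vs, of "{..<102}" UNIV] length_vs set_vs by simp

lemma lev_idx: "gdist adj x z = bs_lev ! idx z"
  using arg_cong[OF lev_vs, of "\<lambda>l. l ! idx z"] idx length_vs by simp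

definition vec :: "int list \<Rightarrow> complex^'n" where "vec xs = (\<chi> z. of_int (xs ! idx z))"

lemma vec_at: "i < 102 \<Longrightarrow> vec xs $ (vs ! i) = of_int (xs ! i)" by (simp add: vec_def idx_vs)

lemma adj_idx:
  assumes "bs_nbs ! idx z = (a,b,c)" shows "adj z w \<longleftrightarrow> w = vs ! a \<or> w = vs ! b \<or> w = vs ! c"
  using list_all2_nthD[OF adj_vs, of "idx z"] idx[of z] length_vs assms by simp

lemma A_vec: "adj_matrix adj *v vec xs = vec (nbr_sum xs)"
proof -
  have "(\<Sum>w\<in>UNIV. (if adj z w then 1 else 0) * of_int (xs ! idx w)) = (of_int (nbr_sum xs ! idx z) :: complex)" for z
  proof -
    obtain a b c where n: "bs_nbs ! idx z = (a,b,c)" using prod_cases3 by blast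
    have ok: "a < 102" "b < 102" "c < 102" "a \<noteq> b" "a \<noteq> c" "b \<noteq> c"
      using bs_nbs_ok idx(1)[of z] n unfolding list_all_length by fastforce+
    have d: "vs ! a \<noteq> vs ! b" "vs ! a \<noteq> vs ! c" "vs ! b \<noteq> vs ! c"
      using ok distinct_vs length_vs by (simp_all add: nth_eq_iff_index_eq)
    have "(\<Sum>w\<in>UNIV. (if adj z w then 1 else 0) * of_int (xs ! idx w)) = (\<Sum>w\<in>{vs ! a, vs ! b, vs ! c}.
        of_int (xs ! idx w) :: complex)"
      by (rule sum.mono_neutral_cong_right) (auto simp: adj_idx[OF n])
    also have "\<dots> = of_int (xs ! a + xs ! b + xs ! c)" using d ok by (simp add: idx_vs)
    also have "xs ! a + xs ! b + xs ! c = nbr_sum xs ! idx z" using idx(1)[of z] by (simp add: nbr_sum_def n)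
    finally show ?thesis .
  qed
  then show ?thesis by (simp add: adj_matrix_def vec_def matrix_vector_mult_def Finite_Cartesian_Product.vec_eq_iff)
qed

lemma vec_zeros: "vec (replicate 102 0) = 0"
  using idx(1) by (simp add: vec_def Finite_Cartesian_Product.vec_eq_iff)

lemma vec_map2: "length r = 102 \<Longrightarrow> length s = 102 \<Longrightarrow> vec (map2 (\<lambda>x y. a * x + y) r
    s) = of_int a *s vec r + vec s"
  using idx(1) by (simp add: vec_def Finite_Cartesian_Product.vec_eq_iff)

lemma vec_lcomb:
  "length cs = length rs \<Longrightarrow> list_all (\<lambda>r. length r = 102) rs \<Longrightarrow> vec (lcomb cs rs)
      = (\<Sum>i<length rs. of_int (cs ! i) *s vec (rs ! i))"
proof (induction cs rs rule: lcomb.induct)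
  case (1 a as r rs)
  then show ?case
    by (auto simp: sum.lessThan_Suc_shift vec_map2 length_lcomb simp del: sum.lessThan_Suc)
qed (auto simp: vec_zeros)

lemma hermitian_vec: "length xs = 102 \<Longrightarrow> length ys = 102 \<Longrightarrow> hermitian (vec xs) (vec ys) =
    of_int (dot xs ys)"
proof -
  assume l: "length xs = 102" "length ys = 102"
  have "hermitian (vec xs) (vec ys) = (\<Sum>z\<in>UNIV. of_int (xs ! idx z) * of_int (ys ! idx z))"
    by (simp add: hermitian_def vec_def)
  also have "\<dots> = (\<Sum>i<102. of_int (xs ! i) * of_int (ys ! i))"
    unfolding sum.reindex_bij_betw[OF bij_vs, symmetric] by (rule sum.cong) (auto simp: idx_vs)
  also have "\<dots> = of_int (dot xs ys)" unfolding dot_nth[OF l] by simp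
  finally show ?thesis .
qed

lemma Estar_vec:
  assumes "valid (r, c)" shows "Estar adj x i *v vec (pad (r, c)) = (if r = i then vec (pad (r, c)) else 0)"
  using pad_nonzero[OF assms idx(1)] by (auto simp: Estar_mult_vec vec_def Finite_Cartesian_Product.vec_eq_iff lev_idx)

lemma hermitian_pad:
  assumes "valid v" "valid w" shows "hermitian (vec (pad v)) (vec (pad w)) = of_int (pdot v w)"
proof -
  obtain r c s d where vw: "v = (r,c)" "w = (s,d)" by (cases v, cases w)
  show ?thesis
  proof (cases "r = s")
    case True
    then show ?thesis using assms by (simp add: hermitian_vec length_pad vw pad_same pdot_def)
  next
    case False
    have E: "adjoint_mat (Estar adj x r) = Estar adj x r"
      by (auto simp: adjoint_mat_def Estar_def Finite_Cartesian_Product.vec_eq_iff)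
    have "hermitian (vec (pad v)) (vec (pad w)) = hermitian (Estar adj x r *v vec (pad v)) (vec (pad w))"
      using Estar_vec[of r c r] assms vw by simp
    also have "\<dots> = 0" unfolding hermitian_adjoint E using Estar_vec[of s d r] assms vw False by simp
    finally show ?thesis using False vw by (simp add: pdot_def)
  qed
qed

definition "v k i = vec (pad (bases ! k ! i))"

lemma valid_base: "k < 10 \<Longrightarrow> i < dims ! mtype k \<Longrightarrow> valid (bases ! k ! i)"
  using bases_valid[of k] bases_length[of k] by (simp add: list_all_length)

lemma fst_base: "k < 10 \<Longrightarrow> i < dims ! mtype k \<Longrightarrow> fst (bases ! k ! i) = levels ! mtype k ! i"
  using bases_levels[of k] bases_length[of k] by (metis nth_map)

lemma A_v:
  assumes "k < 10" "j < dims ! mtype k"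
  shows "adj_matrix adj *v v k j = (\<Sum>i<dims ! mtype k. matrices ! mtype k ! i ! j *s v k i)"
proof -
  have l: "length (bases ! k) = dims ! mtype k" using bases_length assms by simp
  have lb: "length (bmats ! mtype k) = dims ! mtype k" "\<And>i. i < dims ! mtype k \<Longrightarrow> length (bmats !
      mtype k ! i) = dims ! mtype k"
    using bmats_length[OF mtype_less[OF assms(1)]] by (auto simp: list_all_length)
  have "nbr_sum (pad (bases ! k ! j)) = lcomb (map (\<lambda>r. r ! j) (bmats ! mtype k)) (map pad (bases ! k))"
    using arg_cong[OF bases_action[OF assms(1)], of "\<lambda>l. l ! j"] assms l by simp
  then have "adj_matrix adj *v v k j = vec (lcomb (map (\<lambda>r. r ! j) (bmats ! mtype k)) (map pad (bases ! k)))"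
    by (simp add: v_def A_vec)
  also have "\<dots> = (\<Sum>i<dims ! mtype k. of_int (bmats ! mtype k ! i ! j) *s v k i)"
    using bases_valid[OF assms(1)] l lb by (subst vec_lcomb) (auto simp: list_all_iff length_pad v_def)
  also have "\<dots> = (\<Sum>i<dims ! mtype k. matrices ! mtype k ! i ! j *s v k i)"
    using matrices_bmats[OF mtype_less[OF assms(1)]] lb assms by (intro sum.cong) auto
  finally show ?thesis .
qed

lemma E_v:
  assumes "k < 10" "j < dims ! mtype k"
  shows "Estar adj x i *v v k j = (if levels ! mtype k ! j = i then v k j else 0)"
proof -
  obtain r c where b: "bases ! k ! j = (r, c)" by (cases "bases ! k ! j")
  then show ?thesis using Estar_vec[of r c i] valid_base[OF assms] fst_base[OF assms] by (simp add: v_def)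
qed

lemma gram_v:
  assumes "k < 10" "l < 10" "i < dims ! mtype k" "j < dims ! mtype l"
  shows "hermitian (v k i) (v l j) = (if k = l then of_int (scales ! k) * of_int (grams ! mtype k ! i ! j) else 0)"
proof -
  have h: "hermitian (v k i) (v l j) = of_int (pdot (bases ! k ! i) (bases ! l ! j))"
    unfolding v_def using valid_base assms by (intro hermitian_pad) auto
  have orth: "pdot (bases ! k ! i) (bases ! l ! j) = 0" if "k < l" "l < 10" "i < dims ! mtype k" "j < dims ! mtype l" for k l i j
  proof -
    \<comment> \<open>The tables treat only the bases after \<open>k\<close>, hence membership in
      the dropped list.\<close>
    have k9: "k < 9" "k < 10" using that by auto
    have "bases ! l \<in> set (drop (Suc k) bases)"
      using that nth_drop[of "Suc k" bases "l - Suc k"] by (simp add: bases_def in_set_conv_nth) (intro exI[of _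
          "l - Suc k"], simp add: bases_def)
    moreover have "bases ! l ! j \<in> set (bases ! l)" using that bases_length[of l] by simp
    ultimately have "bases ! l ! j \<in> set (concat (drop (Suc k) bases))" by auto
    moreover have "bases ! k ! i \<in> set (bases ! k)" using that k9 bases_length[of k] by simp
    ultimately show ?thesis using bases_orth[OF k9(1)] unfolding list_all_iff by blast
  qed
  have comm: "pdot v w = pdot w v" for v w
    by (cases v; cases w) (auto simp: pdot_def dot_def zip_commute[of _ "snd _"] mult.commute intro!: arg_cong[of _ _
        sum_list] nth_equalityI)
  consider "k = l" | "k < l" | "l < k" by linarith
  then show ?thesis
  proof cases
    case 1
    have g: "length (grams ! mtype k) = dims ! mtype k" "length (grams ! mtype k ! i) = dims ! mtype k"
      using grams_length[OF mtype_less[OF assms(1)]] assms by (auto simp: list_all_length)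
    have "pdot (bases ! k ! i) (bases ! k ! j) = scales ! k * grams ! mtype k ! i ! j"
      using arg_cong[OF bases_gram[OF assms(1)], of "\<lambda>l. l ! i ! j"] assms g bases_length[OF assms(1)] 1 by simp
    then show ?thesis using h 1 by simp
  next
    case 2 then show ?thesis using h orth[of k l i j] assms by simp
  next
    case 3 then show ?thesis using h orth[of l k j i] comm assms by simp
  qed
qed

end

section \<open>Recovering a basis from its seed\<close>

text \<open>Maps given by an element of T. The closure rules below show that every entry of the
  prescribed bases arises from the seed in this way.\<close>

definition in_alg where "in_alg adj x f \<longleftrightarrow> (\<exists>M\<in>terwilliger_algebra adj x. \<forall>u. M
    *v u = f u)"

lemma in_alg_id: "in_alg adj x (\<lambda>u. u)"
  unfolding in_alg_def by (intro bexI[OF _ one_in_T]) simp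

lemma in_alg_A: "in_alg adj x f \<Longrightarrow> in_alg adj x (\<lambda>u. adj_matrix adj *v f u)"
  unfolding in_alg_def using mult_in_T[OF A_in_T] by (metis matrix_vector_mul_assoc)

lemma in_alg_E: "i \<le> graph_diameter adj \<Longrightarrow> in_alg adj x f \<Longrightarrow> in_alg adj x (\<lambda>u.
    Estar adj x i *v f u)"
  unfolding in_alg_def using mult_in_T[OF E_in_T] by (metis matrix_vector_mul_assoc)

lemma in_alg_EA: assumes "i \<le> graph_diameter adj" shows "in_alg adj x (\<lambda>u. EA adj x i k u)"
proof -
  have "in_alg adj x (\<lambda>u. ((*v) (adj_matrix adj) ^^ k) u)"
    by (induction k) (auto intro: in_alg_id in_alg_A)
  then show ?thesis unfolding EA_def by (rule in_alg_E[OF assms])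
qed

lemma in_alg_scale: "in_alg adj x f \<Longrightarrow> in_alg adj x (\<lambda>u. c *s f u)"
  unfolding in_alg_def using cmat.subspace_scale[OF subspace_T] by (metis mat_scale_mult_vec)

lemma in_alg_add: "in_alg adj x f \<Longrightarrow> in_alg adj x g \<Longrightarrow> in_alg adj x (\<lambda>u. f u + g u)"
  unfolding in_alg_def using cmat.subspace_add[OF subspace_T] by (metis matrix_vector_mult_add_rdistrib)

lemma in_alg_diff: "in_alg adj x f \<Longrightarrow> in_alg adj x g \<Longrightarrow> in_alg adj x (\<lambda>u. f u - g u)"
  unfolding in_alg_def using cmat.subspace_diff[OF subspace_T] by (metis matrix_vector_mult_diff_rdistrib)

lemma in_alg_uminus: "in_alg adj x f \<Longrightarrow> in_alg adj x (\<lambda>u. - f u)"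
  using in_alg_scale[of adj x f "- 1"] by simp

lemmas in_alg_intros = in_alg_id in_alg_uminus in_alg_A in_alg_E in_alg_EA in_alg_scale in_alg_add in_alg_diff

text \<open>An expression of the level vectors through the seed, parallel to the other types. Lower
  neighbours are unique up to level 6, while a vertex on level 7 has three of them; this accounts
  for the factor 1/3.\<close>

definition basis_I :: "('n::finite \<Rightarrow> 'n \<Rightarrow> bool) \<Rightarrow> 'n \<Rightarrow> complex^'n
    \<Rightarrow> (complex^'n) list" where
  "basis_I adj x u = (let e = EA adj x in [u, e 1 1 u, e 2 2 u, e 3 3 u, e 4 4 u, e 5 5 u, e 6 6 u, (1/3) *s e 7 7 u])"

definition "basis_of t adj x u = [basis_I adj x u, basis_II adj x u, basis_III adj x u, basis_IV adj x u, basis_V adj x u] ! t"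

lemma in_alg_basis_of:
  assumes "graph_diameter adj = 7" "t < 5" "i < dims ! t" shows "in_alg adj x (\<lambda>u. basis_of t adj x u ! i)"
proof -
  have upt: "[0..<8] = [0, 1, 2, 3, 4, 5, 6, 7]" "[0..<9] = [0, 1, 2, 3, 4, 5, 6, 7, 8]"
    "[0..<13] = [0, 1, 2, 3, 4, 5, 6, 7, 8, 9, 10, 11, 12]" "[0..<11] = [0, 1, 2, 3, 4, 5, 6, 7, 8, 9, 10]"
        "[0..<4] = [0, 1, 2, 3]"
    by code_simp+
  have "list_all (\<lambda>i. in_alg adj x (\<lambda>u. basis_of t adj x u ! i)) [0..<dims ! t]"
    using less_5[OF assms(2)]
    by (elim insertE emptyE; hypsubst)
      (simp_all add: dims_def upt basis_of_def basis_I_def basis_II_def basis_III_def basis_IV_def basis_V_def Let_def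
          in_alg_intros assms(1))
  then show ?thesis using assms(3) by (simp add: list_all_iff)
qed

definition mask :: "nat \<Rightarrow> nat list \<Rightarrow> complex list \<Rightarrow> complex list" where
  "mask i ls cs = map2 (\<lambda>l c. if l = i then c else 0) ls cs"

lemma lc_uminus: "- lc cs ws = lc (map uminus cs) ws"
  by (induction cs ws rule: lc.induct) auto

text \<open>Here \<open>A\<close> and the \<open>Estar\<close> matrices act on coefficient lists by
  data that depend on the type only, so each prescribed basis formula is verified once per type and
  not once per module.\<close>

locale lc_action =
  fixes adj :: "'n::finite \<Rightarrow> 'n \<Rightarrow> bool" and x :: 'n and M :: "complex list list" and L ::
      "nat list" and ws :: "(complex^'n) list"
  assumes lens: "length M = length ws" "length L = length ws"
    and A_lc: "\<And>cs. length cs = length ws \<Longrightarrow> adj_matrix adj *v lc cs ws = lc (bmul M cs) ws"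
    and E_lc: "\<And>i cs. length cs = length ws \<Longrightarrow> Estar adj x i *v lc cs ws = lc (mask i L cs) ws"
begin

lemma pow_lc:
  assumes "length cs = length ws"
  shows "((*v) (adj_matrix adj) ^^ k) (lc cs ws) = lc ((bmul M ^^ k) cs) ws \<and> length ((bmul M ^^ k) cs) = length ws"
  using assms by (induction k) (simp_all add: A_lc lens)

lemma EA_lc: "length cs = length ws \<Longrightarrow> EA adj x i k (lc cs ws) = lc (mask i L ((bmul M ^^ k) cs)) ws"
  by (simp add: EA_def E_lc pow_lc)

end

lemma basis_I_lc:
  assumes "lc_action adj x matrix_I [0,1,2,3,4,5,6,7] ws"
  shows "basis_I adj x (lc (unit_list 8 0) ws) = map (\<lambda>j. lc (unit_list 8 j) ws) [0..<8]"
proof -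
  interpret lc_action adj x matrix_I "[0,1,2,3,4,5,6,7]" ws by fact
  have l: "length ws = 8" using lens by simp
  have upt: "[0..<8] = [0, 1, 2, 3, 4, 5, 6, 7]" by code_simp
  show ?thesis unfolding basis_I_def Let_def upt list.map unit_list_def
    by (simp add: EA_lc l bmul_I mask_def lc_scale eval_nat_numeral)
qed

lemma basis_II_lc:
  assumes "lc_action adj x matrix_II [1,2,3,4,4,5,5,6,6] ws"
  shows "basis_II adj x (lc (unit_list 9 0) ws) = map (\<lambda>j. lc (unit_list 9 j) ws) [0..<9]"
proof -
  interpret lc_action adj x matrix_II "[1,2,3,4,4,5,5,6,6]" ws by fact
  have l: "length ws = 9" using lens by simp
  have upt: "[0..<9] = [0, 1, 2, 3, 4, 5, 6, 7, 8]" by code_simp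
  show ?thesis unfolding basis_II_def Let_def upt list.map unit_list_def
    by (simp add: EA_lc A_lc l bmul_II mask_def eval_nat_numeral)
qed

lemma basis_III_lc:
  assumes "lc_action adj x matrix_III [2,3,3,4,4,4,5,5,5,6,6,6,7] ws"
  shows "basis_III adj x (lc (unit_list 13 0) ws) = map (\<lambda>j. lc (unit_list 13 j) ws) [0..<13]"
proof -
  interpret lc_action adj x matrix_III "[2,3,3,4,4,4,5,5,5,6,6,6,7]" ws by fact
  have l: "length ws = 13" using lens by simp
  have upt: "[0..<13] = [0, 1, 2, 3, 4, 5, 6, 7, 8, 9, 10, 11, 12]" by code_simp
  show ?thesis unfolding basis_III_def Let_def upt list.map unit_list_def
    by (simp add: EA_lc A_lc E_lc l bmul_III mask_def lc_scale lc_add lc_diff eval_nat_numeral)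
qed

lemma basis_IV_lc:
  assumes "lc_action adj x matrix_IV [3,4,4,4,5,5,5,6,6,6,7] ws"
  shows "basis_IV adj x (lc (unit_list 11 0) ws) = map (\<lambda>j. lc (unit_list 11 j) ws) [0..<11]"
proof -
  interpret lc_action adj x matrix_IV "[3,4,4,4,5,5,5,6,6,6,7]" ws by fact
  have l: "length ws = 11" using lens by simp
  have upt: "[0..<11] = [0, 1, 2, 3, 4, 5, 6, 7, 8, 9, 10]" by code_simp
  show ?thesis unfolding basis_IV_def Let_def upt list.map unit_list_def
    by (simp add: EA_lc A_lc l bmul_IV mask_def lc_scale lc_add lc_diff lc_uminus eval_nat_numeral)
qed

lemma basis_V_lc:
  assumes "lc_action adj x matrix_V [4,5,6,7] ws"
  shows "basis_V adj x (lc (unit_list 4 0) ws) = map (\<lambda>j. lc (unit_list 4 j) ws) [0..<4]"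
proof -
  interpret lc_action adj x matrix_V "[4,5,6,7]" ws by fact
  have l: "length ws = 4" using lens by simp
  have upt: "[0..<4] = [0, 1, 2, 3]" by code_simp
  show ?thesis unfolding basis_V_def upt list.map unit_list_def
    by (simp add: EA_lc l bmul_V mask_def eval_nat_numeral)
qed

context bs_vertices begin

sublocale biggs_smith adj by unfold_locales (rule bs)

lemma sym: "symp adj" by (auto intro: sympI simp: adj_sym)

lemma lc_unit: "length ws = n \<Longrightarrow> j < n \<Longrightarrow> lc (unit_list n j) ws = ws ! j"
  by (simp add: lc_sum unit_list_def if_distrib[of "\<lambda>c. c *s _"] cong: if_cong)

lemma lc_action_v:
  assumes k: "k < 10"
  shows "lc_action adj x (matrices ! mtype k) (levels ! mtype k) (map (v k) [0..<dims ! mtype k])"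
proof -
  let ?n = "dims ! mtype k" and ?M = "matrices ! mtype k"
  let ?ws = "map (v k) [0..<?n]"
  have l: "length ?M = ?n" "length (levels ! mtype k) = ?n" "\<And>i. i < ?n \<Longrightarrow> length (?M ! i) = ?n"
    using bmats_length[OF mtype_less[OF k]] levels_length[OF mtype_less[OF k]]
    by (auto simp: matrices_bmats[OF mtype_less[OF k]] list_all_length)
  show ?thesis
  proof
    show "length ?M = length ?ws" "length (levels ! mtype k) = length ?ws" using l by simp_all
    fix cs :: "complex list" assume c: "length cs = length ?ws"
    have "adj_matrix adj *v lc cs ?ws = (\<Sum>j<?n. cs ! j *s (adj_matrix adj *v v k j))"
      using c by (simp add: lc_sum matrix_mult_sum_right vector_scalar_commute)
    also have "\<dots> = (\<Sum>j<?n. \<Sum>i<?n. (?M ! i ! j * cs ! j) *s v k i)"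
      by (intro sum.cong) (simp_all add: A_v[OF k] vec.scale_sum_right mult.commute)
    also have "\<dots> = (\<Sum>i<?n. (\<Sum>j<?n. ?M ! i ! j * cs ! j) *s v k i)"
      by (subst sum.swap) (simp add: vec.scale_sum_left)
    also have "\<dots> = lc (bmul ?M cs) ?ws"
      using c l by (simp add: lc_sum bmul_nth)
    finally show "adj_matrix adj *v lc cs ?ws = lc (bmul ?M cs) ?ws" .
    fix i
    have "Estar adj x i *v lc cs ?ws = (\<Sum>j<?n. cs ! j *s (Estar adj x i *v v k j))"
      using c by (simp add: lc_sum matrix_mult_sum_right vector_scalar_commute)
    also have "\<dots> = lc (mask i (levels ! mtype k) cs) ?ws"
      using c l by (auto simp: lc_sum mask_def E_v[OF k] intro!: sum.cong)
    finally show "Estar adj x i *v lc cs ?ws = lc (mask i (levels ! mtype k) cs) ?ws" .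
  qed
qed

lemma basis_of_v:
  assumes k: "k < 10" shows "basis_of (mtype k) adj x (v k 0) = map (v k) [0..<dims ! mtype k]"
proof -
  let ?n = "dims ! mtype k"
  have n: "0 < ?n" using less_5[OF mtype_less[OF k]] by (auto simp: dims_def)
  let ?ws = "map (v k) [0..<?n]"
  have u: "lc (unit_list ?n j) ?ws = v k j" if "j < ?n" for j using that by (simp add: lc_unit)
  have u': "map (\<lambda>j. lc (unit_list ?n j) ?ws) [0..<?n] = ?ws" using u by (intro map_cong) auto
  have "basis_of (mtype k) adj x (lc (unit_list ?n 0) ?ws) = map (\<lambda>j. lc (unit_list ?n j) ?ws) [0..<?n]"
    if "lc_action adj x (matrices ! mtype k) (levels ! mtype k) ?ws"
    using less_5[OF mtype_less[OF k]] that
      basis_I_lc[of adj x ?ws] basis_II_lc[of adj x ?ws] basis_III_lc[of adj x ?ws] basis_IV_lc[of adj x ?ws]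
          basis_V_lc[of adj x ?ws]
    by (elim insertE emptyE) (simp_all only: basis_of_def matrices_def levels_def dims_def nth_Cons_0 nth_Cons_Suc)
  from this[OF lc_action_v[OF k]] show ?thesis unfolding u' u[OF n] .
qed

definition "p t i = (SOME M. M \<in> terwilliger_algebra adj x \<and> (\<forall>u. M *v u = basis_of t adj x u ! i))"

lemma p:
  assumes "t < 5" "i < dims ! t"
  shows "p t i \<in> terwilliger_algebra adj x \<and> (\<forall>u. p t i *v u = basis_of t adj x u ! i)"
proof -
  have "\<exists>M. M \<in> terwilliger_algebra adj x \<and> (\<forall>u. M *v u = basis_of t adj x u ! i)"
    using in_alg_basis_of[OF diam assms, of x] unfolding in_alg_def by (simp only: Bex_def)
  from someI_ex[OF this] show ?thesis unfolding p_def .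
qed

sublocale mf: module_family adj x 10 5 mtype "\<lambda>t. dims ! t" "\<lambda>t j. levels ! t ! j"
    "\<lambda>t i j. matrices ! t ! i ! j"
  "\<lambda>t i j. of_int (grams ! t ! i ! j)" "\<lambda>t i j. of_int (gram_invs ! t ! i ! j) / of_int (dens ! t)"
      "\<lambda>k. of_int (scales ! k)" v p
proof
  show "symp adj" by (rule sym)
  show "k < 10 \<Longrightarrow> mtype k < 5" for k by (rule mtype_less)
  show "t < 5 \<Longrightarrow> \<exists>k<10. mtype k = t" for t
    \<comment> \<open>The list names the first module of each type.\<close>
    by (rule exI[of _ "[0,1,3,6,9] ! t"], drule less_5) (auto simp: mtype_def)
  show "t < 5 \<Longrightarrow> 0 < dims ! t" for t by (drule less_5) (auto simp: dims_def)
  have lv: "t < 5 \<Longrightarrow> list_all (\<lambda>i. i \<le> 7) (levels ! t) \<and> levels ! t ! 0 = t \<and>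
      list_all (\<lambda>i. t < i) (tl (levels ! t))" for t
    by (drule less_5) (elim insertE emptyE; simp add: levels_def)
  show "t < 5 \<Longrightarrow> j < dims ! t \<Longrightarrow> levels ! t ! j \<le> graph_diameter adj" for t j
    using lv[of t] levels_length[of t] by (simp add: list_all_length diam)
  show "t < 5 \<Longrightarrow> levels ! t ! 0 = t" for t using lv by blast
  show "t < 5 \<Longrightarrow> 0 < j \<Longrightarrow> j < dims ! t \<Longrightarrow> t < levels ! t ! j" for t j
    using lv[of t] levels_length[of t] by (cases j) (auto simp: list_all_length nth_tl)
  show "k < 10 \<Longrightarrow> j < dims ! mtype k \<Longrightarrow> adj_matrix adj *v v k j = (\<Sum>i<dims ! mtype k.
      matrices ! mtype k ! i ! j *s v k i)" for k j
    by (rule A_v)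
  show "k < 10 \<Longrightarrow> j < dims ! mtype k \<Longrightarrow> Estar adj x i *v v k j = (if levels ! mtype k ! j
      = i then v k j else 0)" for k j i
    by (rule E_v)
  show "k < 10 \<Longrightarrow> l < 10 \<Longrightarrow> i < dims ! mtype k \<Longrightarrow> j < dims ! mtype l
      \<Longrightarrow>
      hermitian (v k i) (v l j) = (if k = l then of_int (scales ! k) * of_int (grams ! mtype k ! i ! j) else 0)" for k l i j
    by (rule gram_v)
  show "t < 5 \<Longrightarrow> i < dims ! t \<Longrightarrow> j < dims ! t \<Longrightarrow>
      (\<Sum>l<dims ! t. of_int (gram_invs ! t ! i ! l) / of_int (dens ! t) * of_int (grams ! t ! j ! l)) = (if i = j
          then (1::complex) else 0)" for t i j
  proof -
    assume a: "t < 5" "i < dims ! t" "j < dims ! t"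
    have l: "length (grams ! t) = dims ! t" "length (gram_invs ! t) = dims ! t" "length (grams ! t ! j) = dims ! t"
        "length (gram_invs ! t ! i) = dims ! t"
      using grams_length[OF a(1)] a by (auto simp: list_all_length)
    have d: "dens ! t \<noteq> 0" using less_5[OF a(1)] by (auto simp: dens_def)
    have "dot (gram_invs ! t ! i) (grams ! t ! j) = (if i = j then dens ! t else 0)"
      using arg_cong[OF gram_invs[OF a(1)], of "\<lambda>r. r ! i ! j"] a l by simp
    then have s: "(\<Sum>l<dims ! t. gram_invs ! t ! i ! l * grams ! t ! j ! l) = (if i = j then dens ! t else 0)"
      using dot_nth[OF l(4,3)] by simp
    have "(\<Sum>l<dims ! t. of_int (gram_invs ! t ! i ! l) / of_int (dens ! t) * of_int (grams ! t ! j ! l))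
      = complex_of_int (\<Sum>l<dims ! t. gram_invs ! t ! i ! l * grams ! t ! j ! l) / of_int (dens ! t)"
      by (simp add: sum_divide_distrib)
    also have "\<dots> = (if i = j then 1 else 0)" unfolding s using d by simp
    finally show ?thesis .
  qed
  show "k < 10 \<Longrightarrow> of_int (scales ! k) \<noteq> (0::complex)" for k
    by (drule less_10) (auto simp: scales_def)
  have "[0..<10] = [0, 1, 2, 3, 4, 5, 6, 7, 8, 9]" by code_simp
  then have "sum_list (map (\<lambda>k. dims ! mtype k) [0..<10]) = 102" by (simp add: dims_def mtype_def)
  then show "(\<Sum>k<10. dims ! mtype k) = CARD('n)"
    using bs by (simp add: is_biggs_smith_def interv_sum_list_conv_sum_set_nat atLeast0LessThan)
  show "t < 5 \<Longrightarrow> i < dims ! t \<Longrightarrow> p t i \<in> terwilliger_algebra adj x" for t i using p by blast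
  show "k < 10 \<Longrightarrow> i < dims ! mtype k \<Longrightarrow> p (mtype k) i *v v k 0 = v k i" for k i
    using p[OF mtype_less, of k i] basis_of_v[of k] by simp
qed

end

section \<open>The spectrum\<close>

lemma power_mult_vec: "((**) A ^^ k) (Finite_Cartesian_Product.mat 1) *v u = ((*v) A ^^ k) u" for A :: "complex^'n^'n"
  by (induction k) (simp_all add: matrix_vector_mul_assoc[symmetric])

lemma mult_vec_axis: "vec_nth (M *v axis y 1) z = vec_nth (vec_nth M z) y" for M :: "complex^'n^'k"
  by (simp add: matrix_vector_mult_def axis_def if_distrib[of "\<lambda>c. _ * c"] cong: if_cong)

lemma bases_I_pad:
  assumes "i < 8" shows "pad (bases ! 0 ! i) = map (\<lambda>l. if l = i then 1 else 0) bs_lev"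
proof -
  have "\<forall>i\<in>set [0..<8]. pad (base_I ! i) = map (\<lambda>l. if l = i then 1 else 0) bs_lev" by code_simp
  then show ?thesis using assms by (simp add: bases_def)
qed

context bs_vertices begin

lemma v_estar: "i < 8 \<Longrightarrow> v 0 i = estar adj x i"
  unfolding v_def using idx(1) lev_vs length_vs
  by (simp add: bases_I_pad vec_def estar_def Finite_Cartesian_Product.vec_eq_iff lev_idx arg_cong[OF lev_vs, of length,
      simplified])

lemma v_axis: "v 0 0 = axis x 1"
  by (auto simp: v_estar estar_def axis_def Finite_Cartesian_Product.vec_eq_iff)

lemma v_at_base: "i < 8 \<Longrightarrow> v 0 i $ x = (if i = 0 then 1 else 0)"
  by (auto simp: v_estar estar_def gdist_0[THEN iffD2])

lemma lc_action_I: "lc_action adj x matrix_I [0,1,2,3,4,5,6,7] (map (v 0) [0..<8])"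
  using lc_action_v[of 0] by (simp add: mtype_def matrices_def levels_def dims_def)

text \<open>The vector A^k e_0* stays in the module of type I, and among its basis vectors only e_0*
  is nonzero at \<open>x\<close>; the count is therefore the first coefficient.\<close>

lemma closed_walks:
  assumes "k < 8" shows "((*v) (adj_matrix adj) ^^ k) (axis x 1) $ x = [1,0,3,0,15,0,87,0] ! k"
proof -
  interpret lc_action adj x matrix_I "[0,1,2,3,4,5,6,7]" "map (v 0) [0..<8]" by (rule lc_action_I)
  let ?u = "[1,0,0,0,0,0,0,0] :: complex list"
  have upt: "[0..<8] = [0, 1, 2, 3, 4, 5, 6, 7]" by code_simp
  have u: "axis x 1 = lc ?u (map (v 0) [0..<8])" by (simp add: upt v_axis)
  have "lc cs (map (v 0) [0..<8]) $ x = cs ! 0" if "length cs = 8" for cs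
  proof -
    have "lc cs (map (v 0) [0..<8]) $ x = (\<Sum>i<8. if i = 0 then cs ! i else 0)"
      using that by (simp add: lc_sum sum_component v_at_base if_distrib[of "\<lambda>c. _ * c"] cong: if_cong)
    then show ?thesis by simp
  qed
  then have "((*v) (adj_matrix adj) ^^ k) (axis x 1) $ x = (bmul matrix_I ^^ k) ?u ! 0"
    unfolding u using pow_lc[of ?u k] by simp
  moreover have "k \<in> {0,1,2,3,4,5,6,7}" using assms by auto
  ultimately show ?thesis by (elim insertE emptyE) (simp_all add: bmul_I eval_nat_numeral)
qed

text \<open>The unit vector at \<open>x\<close> generates the module of type I, so evaluating the
  polynomial takes eight integer coefficients instead of 102 coordinates.\<close>

lemma annihilates_axis: "pact (adj_matrix adj) (\<Prod>d\<in>complex_of_real ` eigs. [:- d, 1:]) (axis x 1) = 0"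
proof -
  interpret lc_action adj x matrix_I "[0,1,2,3,4,5,6,7]" "map (v 0) [0..<8]" by (rule lc_action_I)
  let ?u = "[1,0,0,0,0,0,0,0] :: complex list" and ?q = "[:0, 72, -42, -93, 36, 32, -11, -3, 1:] :: complex poly"
  define ws where "ws = map (v 0) [0..<8]"
  have upt: "[0..<8] = [0, 1, 2, 3, 4, 5, 6, 7]" by code_simp
  have u: "axis x 1 = lc ?u ws" by (simp add: ws_def upt v_axis)
  have l: "length ws = 8" by (simp add: ws_def)
  have "pact (adj_matrix adj) ?q (axis x 1) = (\<Sum>i<9. coeff ?q i *s lc ((bmul matrix_I ^^ i) ?u) ws)"
    unfolding u using pow_lc[of ?u, folded ws_def] l by (subst pact_bound[of _ 9]) auto
  also have "\<dots> = lc [0,0,0,0,0,0,0,0] ws"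
    by (simp add: eval_nat_numeral bmul_I lc_scale lc_add l)
  also have "\<dots> = 0" by (simp add: ws_def upt)
  finally show ?thesis unfolding eigs_poly .
qed

end

lemma bs_vertices_exist:
  assumes "is_biggs_smith (adj :: 'n::finite \<Rightarrow> 'n \<Rightarrow> bool)" obtains vs where "bs_vertices adj x vs"
  by (rule biggs_smith_labelling[OF assms]) (rule that, rule bs_vertices.intro, rule assms)

text \<open>The base vertex was arbitrary: with each vertex \<open>y\<close> as the base in turn,
  the polynomial in \<open>A\<close> annihilates the unit vector at \<open>y\<close>.\<close>

lemma annihilates:
  fixes adj :: "'n::finite \<Rightarrow> 'n \<Rightarrow> bool"
  assumes "is_biggs_smith adj" shows "pact (adj_matrix adj) (\<Prod>d\<in>complex_of_real ` eigs. [:- d, 1:]) u = 0"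
proof -
  let ?A = "adj_matrix adj" and ?q = "\<Prod>d\<in>complex_of_real ` eigs. [:- d, 1:]"
  define P where "P = (\<Sum>i\<le>degree ?q. mat_scale (coeff ?q i) (((**) ?A ^^ i) (Finite_Cartesian_Product.mat 1)))"
  have P: "P *v w = pact ?A ?q w" for w
    unfolding P_def pact_def by (simp add: matrix_sum_mult_vec mat_scale_mult_vec power_mult_vec)
  have "P *v axis y 1 = 0" for y
  proof -
    obtain vs where "bs_vertices adj y vs" using bs_vertices_exist[OF assms] .
    from bs_vertices.annihilates_axis[OF this] show ?thesis unfolding P .
  qed
  then have "vec_nth (vec_nth P i) j = 0" for i j using mult_vec_axis[of P j i] by simp
  then have "P = 0" by (simp add: Finite_Cartesian_Product.vec_eq_iff)
  then show ?thesis using P[of u] by simp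
qed

lemma of_real_sum_list: "of_real (sum_list xs) = (\<Sum>x\<leftarrow>xs. of_real x)"
  by (induction xs) auto

text \<open>All diagonal entries of a power of \<open>A\<close> coincide, since every vertex may
  serve as the base of \<open>closed_walks\<close>; the trace is 102 times that entry.\<close>

theorem spectrum:
  fixes adj :: "'n::finite \<Rightarrow> 'n \<Rightarrow> bool"
  assumes "is_biggs_smith adj"
  shows "vec.dim {u. adj_matrix adj *v u = c *s u} = count (mset (map complex_of_real es_A)) c"
proof (rule eigenspace_dims[OF card_eigs(2) annihilates[OF assms]])
  show "set (map complex_of_real es_A) \<subseteq> complex_of_real ` eigs" using es_subset by auto
  fix k assume "k < card (complex_of_real ` eigs)"
  then have k: "k < 8" by (simp add: card_eigs(1))
  let ?P = "((**) (adj_matrix adj) ^^ k) (Finite_Cartesian_Product.mat 1)"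
  have "?P $ y $ y = [1,0,3,0,15,0,87,0] ! k" for y
  proof -
    obtain vs where "bs_vertices adj y vs" using bs_vertices_exist[OF assms] .
    note bs_vertices.closed_walks[OF this k, folded power_mult_vec]
    then show ?thesis unfolding mult_vec_axis .
  qed
  then have "trace ?P = 102 * [1,0,3,0,15,0,87,0] ! k"
    using assms by (simp add: trace_def is_biggs_smith_def)
  also have "\<dots> = complex_of_real (102 * [1,0,3,0,15,0,87,0] ! k)"
  proof -
    have "k \<in> {0,1,2,3,4,5,6,7}" using k by auto
    then show ?thesis by (elim insertE emptyE) simp_all
  qed
  also have "\<dots> = complex_of_real (\<Sum>e\<leftarrow>es_A. e ^ k)" unfolding power_sums_es(6)[OF k] ..
  also have "\<dots> = (\<Sum>e\<leftarrow>map complex_of_real es_A. e ^ k)"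
    using of_real_power[of _ k] by (simp add: comp_def of_real_sum_list)
  finally show "trace ?P = (\<Sum>e\<leftarrow>map complex_of_real es_A. e ^ k)" .
qed

context bs_vertices begin

text \<open>An eigenvector of the representing matrix is the coefficient list of a nonzero
  eigenvector of \<open>A\<close>, whose eigenvalue is a root of the annihilating
  polynomial.\<close>

lemma eigenvalue_matrices:
  assumes k: "k < 10" and e: "eigenvalue (mat_of_rows_list (dims ! mtype k) (matrices ! mtype k)) e"
  shows "e \<in> complex_of_real ` eigs"
proof -
  let ?n = "dims ! mtype k" and ?M = "matrices ! mtype k"
  let ?ws = "map (v k) [0..<?n]"
  interpret lc_action adj x ?M "levels ! mtype k" ?ws by (rule lc_action_v[OF k])
  have l: "length ?M = ?n" "\<And>i. i < ?n \<Longrightarrow> length (?M ! i) = ?n"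
    using bmats_length[OF mtype_less[OF k]] by (auto simp: matrices_bmats[OF mtype_less[OF k]] list_all_length)
  obtain w where w: "w \<in> carrier_vec ?n" "w \<noteq> 0\<^sub>v ?n" "mat_of_rows_list ?n ?M *\<^sub>v w = e \<cdot>\<^sub>v w"
    using e l unfolding eigenvalue_def eigenvector_def by (auto simp: mat_of_rows_list_def)
  let ?cs = "list_of_vec w"
  have c: "length ?cs = ?n" "\<And>i. i < ?n \<Longrightarrow> ?cs ! i = w $ i" using w(1) by (auto simp: list_of_vec_index)
  have "bmul ?M ?cs = map ((*) e) ?cs"
  proof (rule nth_equalityI)
    show "length (bmul ?M ?cs) = length (map ((*) e) ?cs)" using l c by simp
    fix i assume "i < length (bmul ?M ?cs)"
    then have i: "i < ?n" using l by simp
    have "(mat_of_rows_list ?n ?M *\<^sub>v w) $ i = (\<Sum>j<?n. ?M ! i ! j * w $ j)"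
      using i l w(1) by (simp add: mat_of_rows_list_def scalar_prod_def atLeast0LessThan)
    then show "bmul ?M ?cs ! i = map ((*) e) ?cs ! i"
      using w(1,3) i l c by (simp add: bmul_nth)
  qed
  then have "adj_matrix adj *v lc ?cs ?ws = e *s lc ?cs ?ws"
    using A_lc[of ?cs] c by (simp add: lc_scale)
  then have "poly (\<Prod>d\<in>complex_of_real ` eigs. [:- d, 1:]) e *s lc ?cs ?ws = 0"
    using pact_eigen annihilates[OF bs] by metis
  moreover have "lc ?cs ?ws \<noteq> 0"
  proof
    assume z: "lc ?cs ?ws = 0"
    have "w $ i = 0" if "i < ?n" for i
      using mf.coord_comb1[OF k k that, of "(!) ?cs"] z c that by (simp add: lc_sum)
    then show False using w(1,2) by (auto intro!: eq_vecI)
  qed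
  ultimately have "poly (\<Prod>d\<in>complex_of_real ` eigs. [:- d, 1:]) e = 0" by simp
  then show ?thesis using card_eigs(2) by (auto simp: poly_prod)
qed

lemma matrix_data:
  assumes "k < 10" shows "length (matrices ! mtype k) = dims ! mtype k"
      "r \<in> set (matrices ! mtype k) \<Longrightarrow> length r = dims ! mtype k"
  using bmats_length[OF mtype_less[OF assms]] by (auto simp: matrices_bmats[OF mtype_less[OF assms]] list_all_iff)

definition "eigenvalues = [es_I, es_II, es_III, es_IV, es_V]"

lemma has_eigenvalues:
  assumes "k < 10" shows "has_eigenvalues (mat_of_rows_list (dims ! mtype k) (matrices ! mtype k)) (eigenvalues ! mtype k)"
proof -
  note h = has_eigenvaluesI[OF matrix_data[OF assms] _ eigenvalue_matrices[OF assms]]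
  show ?thesis
    using less_5[OF mtype_less[OF assms]]
  proof (elim insertE emptyE)
    assume t: "mtype k = 0"
    show ?thesis by (rule h[where ts = "[8,3,31,30,191,268,1360,2341]"])
      (use power_sums_es(1) in \<open>simp_all add: t eigenvalues_def matrices_def dims_def es_subset traces_I\<close>)
  next
    assume t: "mtype k = Suc 0"
    show ?thesis by (rule h[where ts = "[9,2,26,11,126,57,695,282]"])
      (use power_sums_es(2) in \<open>simp_all add: t eigenvalues_def matrices_def dims_def es_subset traces_II\<close>)
  next
    assume t: "mtype k = Suc (Suc 0)"
    show ?thesis by (rule h[where ts = "[13,1,39,1,187,-19,1029,-265]"])
      (use power_sums_es(3) in \<open>simp_all add: t eigenvalues_def matrices_def dims_def es_subset traces_III\<close>)
  next
    assume t: "mtype k = Suc (Suc (Suc 0))"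
    show ?thesis by (rule h[where ts = "[11,-3,31,-15,155,-83,901,-521]"])
      (use power_sums_es(4) in \<open>simp_all add: t eigenvalues_def matrices_def dims_def es_subset traces_IV\<close>)
  next
    assume t: "mtype k = Suc (Suc (Suc (Suc 0)))"
    show ?thesis by (rule h[where ts = "[4,-1,13,-10,61,-76,334,-547]"])
      (use power_sums_es(5) in \<open>simp_all add: t eigenvalues_def matrices_def dims_def es_subset traces_V\<close>)
  qed
qed

end

section \<open>The decomposition\<close>

definition "offsets = [0,1,4,10,22,46,70,94::nat]"
definition "sizes = [1,3,6,12,24,24,24,8::nat]"
definition "mults = [1,2,3,3,1::nat]"
definition "diams = [7,5,5,4,3::nat]"
definition "shapes = [[1,1,1,1,1,1,1,1],[1,1,1,2,2,2],[1,2,3,3,3,1],[1,3,3,3,1],[1,1,1,1::nat]]"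

lemma offsets_sizes: "r < 8 \<Longrightarrow> offsets ! r + sizes ! r \<le> 102"
proof -
  have "\<forall>r\<in>set [0..<8]. offsets ! r + sizes ! r \<le> 102" by code_simp
  then show "r < 8 \<Longrightarrow> offsets ! r + sizes ! r \<le> 102" by simp
qed

lemma bs_lev_offsets: "i < 102 \<Longrightarrow> offsets ! (bs_lev ! i) \<le> i \<and> i < offsets ! (bs_lev ! i) +
    sizes ! (bs_lev ! i)"
proof -
  have "\<forall>i\<in>set [0..<102]. offsets ! (bs_lev ! i) \<le> i \<and> i < offsets ! (bs_lev ! i) + sizes ! (bs_lev
      ! i)" by code_simp
  then show "i < 102 \<Longrightarrow> offsets ! (bs_lev ! i) \<le> i \<and> i < offsets ! (bs_lev ! i) + sizes !
      (bs_lev ! i)" by simp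
qed

context bs_vertices begin

definition "ord r = map ((!) vs) [offsets ! r ..< offsets ! r + sizes ! r]"

lemma vertex_ordering: "vertex_ordering adj x ord"
  unfolding vertex_ordering_def
proof (intro allI impI conjI)
  fix r assume "r \<le> graph_diameter adj"
  then have r: "r < 8" by (simp add: diam)
  have s: "offsets ! r + sizes ! r \<le> 102" using offsets_sizes[OF r] .
  show "distinct (ord r)" unfolding ord_def distinct_map
    using s distinct_vs length_vs by (auto intro!: inj_onI simp: nth_eq_iff_index_eq)
  show "set (ord r) = sphere_at adj r x"
  proof
    show "set (ord r) \<subseteq> sphere_at adj r x"
      using s bs_lev_at[of r] r by (auto simp: ord_def sphere_at_def lev_idx idx_vs offsets_def sizes_def)
    show "sphere_at adj r x \<subseteq> set (ord r)"
    proof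
      fix y assume "y \<in> sphere_at adj r x"
      then have "bs_lev ! idx y = r" by (simp add: sphere_at_def lev_idx)
      then have "idx y \<in> set [offsets ! r ..< offsets ! r + sizes ! r]" using bs_lev_offsets[OF idx(1)[of y]] by simp
      then show "y \<in> set (ord r)" unfolding ord_def using idx(2)[of y] by (metis image_eqI list.set_map)
    qed
  qed
qed

lemma essential_part:
  assumes "valid (r, c)" shows "essential_part ord r (vec (pad (r, c))) = map of_int c"
proof (rule nth_equalityI)
  have l: "length c = sizes ! r" "r < 8" using assms by (simp_all add: valid_def sizes_def)
  show "length (essential_part ord r (vec (pad (r, c)))) = length (map complex_of_int c)"
    using l by (simp add: essential_part_def ord_def)
  fix i assume "i < length (essential_part ord r (vec (pad (r, c))))"
  then have i: "i < sizes ! r" by (simp add: essential_part_def ord_def)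
  have "offsets ! r + i < 102" using offsets_sizes[OF l(2)] i by simp
  then show "essential_part ord r (vec (pad (r, c))) ! i = map complex_of_int c ! i"
    using i l vec_at[of "offsets ! r + i" "pad (r, c)"] pad_at[OF assms, of i, folded offsets_def] by (simp add:
        essential_part_def ord_def)
qed

lemma dims_pos: "k < 10 \<Longrightarrow> 0 < dims ! mtype k"
  using mf.n_pos mtype_less by blast

lemma seed:
  assumes k: "k < 10" shows "is_seed adj x ord (mf.W k) (v k 0) (map of_int (snd (bases ! k ! 0)))"
proof -
  note t = mtype_less[OF k] and n = dims_pos[OF k]
  obtain r c where b: "bases ! k ! 0 = (r, c)" by (cases "bases ! k ! 0")
  have r: "r = mtype k" using fst_base[OF k n] mf.lv_0[OF t] b by simp
  have "{j. j < dims ! mtype k \<and> levels ! mtype k ! j = mtype k} = {0}"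
    using mf.lv_0[OF t] mf.lv_gt[OF t] n by (metis (mono_tags, lifting) Collect_cong gr0I less_irrefl singleton_conv)
  then have "vec.span {v k 0} = (*v) (Estar adj x (mtype k)) ` mf.W k" unfolding mf.Estar_W[OF k] by simp
  moreover have "pure_vector adj x (mtype k) (v k 0)"
    using mf.pure_v[of k 0] k n mf.lv_0[OF t] by (simp add: mf.I_iff)
  moreover have "essential_part ord (mtype k) (v k 0) = map of_int c"
    using essential_part[of r c] valid_base[OF k n] b r by (simp add: v_def)
  ultimately show ?thesis using b by (simp add: is_seed_def mf.endpoint_W[OF k])
qed

text \<open>For types II to IV the first column of the matrix is supported on the level just above
  the seed. Type V is different: its first column has the entry -1 at the seed itself.\<close>

lemma A_seed: "k \<in> {1,2,3,4,5,6,7,8} \<Longrightarrow> adj_matrix adj *v v k 0 = EA adj x (Suc (mtype k)) 1 (v k 0)"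
proof -
  assume k: "k \<in> {1,2,3,4,5,6,7,8}"
  then have k10: "k < 10" by auto
  note t = mtype_less[OF k10] and n = dims_pos[OF k10]
  let ?n = "dims ! mtype k" and ?M = "matrices ! mtype k"
  have "list_all2 (\<lambda>row l. hd row \<noteq> 0 \<longrightarrow> l = Suc (mtype k)) ?M (levels ! mtype k)"
    using k by (elim insertE emptyE) (simp_all add: mtype_def matrices_def levels_def matrix_II_def matrix_III_def matrix_IV_def)
  then have lev: "levels ! mtype k ! i = Suc (mtype k)" if i: "i < ?n" and "?M ! i ! 0 \<noteq> 0" for i
  proof -
    have "?M ! i \<in> set ?M" using matrix_data(1)[OF k10] i by simp
    then have "?M ! i \<noteq> []" using matrix_data(2)[OF k10, of "?M ! i"] n by auto
    then show ?thesis using list_all2_nthD[OF \<open>list_all2 _ _ _\<close>, of i] matrix_data(1)[OF k10] that by (simp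
        add: hd_conv_nth)
  qed
  have e: "?M ! i ! 0 *s (Estar adj x (Suc (mtype k)) *v v k i) = ?M ! i ! 0 *s v k i" if "i < ?n" for i
    using E_v[OF k10 that] lev[OF that] by (cases "?M ! i ! 0 = 0") simp_all
  have "EA adj x (Suc (mtype k)) 1 (v k 0) = (\<Sum>i<?n. ?M ! i ! 0 *s (Estar adj x (Suc (mtype k)) *v v k i))"
    by (simp add: EA_def A_v[OF k10 n] matrix_mult_sum_right vector_scalar_commute)
  also have "\<dots> = (\<Sum>i<?n. ?M ! i ! 0 *s v k i)" by (rule sum.cong[OF refl], rule e) simp
  finally show ?thesis unfolding A_v[OF k10 n] ..
qed

lemma data:
  assumes k: "k < 10"
  shows "has_module_data adj x (mf.W k) (mtype k) (mults ! mtype k) (dims ! mtype k) (diams ! mtype k) (shapes ! mtype k)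
    (basis_of (mtype k) adj x (v k 0)) (matrices ! mtype k) (eigenvalues ! mtype k)"
proof -
  note t = mtype_less[OF k]
  have upt: "[0..<10] = [0, 1, 2, 3, 4, 5, 6, 7, 8, 9]" "[0..<8] = [0, 1, 2, 3, 4, 5, 6, 7]"
     "[0..<6] = [0, 1, 2, 3, 4, 5]" "[0..<5] = [0, 1, 2, 3, 4]" "[0..<4] = [0, 1, 2, 3]" by code_simp+
  have mult: "length (filter (\<lambda>l. mtype l = mtype k) [0..<10]) = mults ! mtype k"
    using less_10[OF k] by (elim insertE emptyE) (simp_all add: upt mtype_def mults_def)
  have lv: "map (\<lambda>j. levels ! mtype k ! j) [0..<dims ! mtype k] = levels ! mtype k"
    using levels_length[OF t] map_nth[of "levels ! mtype k"] by simp
  have "sorted (levels ! mtype k) \<and> card (set (levels ! mtype k)) - 1 = diams ! mtype k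
      \<and> map (\<lambda>i. length (filter (\<lambda>l. l = mtype k + i) (levels ! mtype k))) [0..<diams ! mtype k +
          1] = shapes ! mtype k"
    using less_5[OF t] by (elim insertE emptyE) (simp_all add: upt levels_def diams_def shapes_def)
  then have h: "sorted (levels ! mtype k)" "diams ! mtype k = card (set (levels ! mtype k)) - 1"
      "shapes ! mtype k = map (\<lambda>i. length (filter (\<lambda>l. l = mtype k + i) (levels ! mtype k))) [0..<diams
          ! mtype k + 1]" by simp_all
  have s: "set (levels ! mtype k) = (\<lambda>j. levels ! mtype k ! j) ` {..<dims ! mtype k}"
    using arg_cong[OF lv, of set] by (simp add: atLeast0LessThan)
  show ?thesis unfolding basis_of_v[OF k] mult[symmetric]
  proof (rule mf.module_data_W[OF k])
    show "sorted (map (\<lambda>j. levels ! mtype k ! j) [0..<dims ! mtype k])" using h lv by simp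
    show "length (matrices ! mtype k) = dims ! mtype k" using matrix_data[OF k] by simp
    show "has_eigenvalues (mat_of_rows_list (dims ! mtype k) (matrices ! mtype k)) (eigenvalues ! mtype k)" by (rule
        has_eigenvalues[OF k])
    show "diams ! mtype k = card ((\<lambda>j. levels ! mtype k ! j) ` {..<dims ! mtype k}) - 1" using h s by simp
    show "shapes ! mtype k = map (\<lambda>i. card {j. j < dims ! mtype k \<and> levels ! mtype k ! j = mtype k + i})
        [0..<diams ! mtype k + 1]"
      using h(3) levels_length[OF t] by (simp add: length_filter_conv_card)
  qed (rule refl)
qed

lemma seeds:
  "map (\<lambda>k. map complex_of_int (snd (bases ! k ! 0))) [1..<10] =
   [[1,-1,0], [1,1,-2], [1,-1,0,0,0,0], [0,0,1,-1,0,0], [0,0,0,0,1,-1],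
    [2,-2,-2,2,2,-2,-2,2,0,0,0,0], [1,-1,1,-1,-1,1,-1,1,2,-2,0,0], [1,-1,1,-1,1,-1,1,-1,0,0,-2,2],
    [1,-1,-1,1,1,-1,1,-1,-1,1,-1,1,1,-1,-1,1,1,-1,-1,1,-1,1,-1,1]]"
proof -
  have upt: "[1..<10] = [1, 2, 3, 4, 5, 6, 7, 8, 9]" by code_simp
  show ?thesis unfolding upt list.map
    by (simp add: bases_def base_IIa_def base_IIb_def base_IIIa_def base_IIIb_def base_IIIc_def base_IVa_def
        base_IVb_def base_IVc_def base_V_def)
qed

lemma seed_II:
  assumes "k \<in> {1,2}" shows "\<exists>\<nu>. is_seed adj x ord (mf.W k) \<nu> (map of_int (snd (bases ! k ! 0)))
      \<and> adj_matrix adj *v \<nu> = EA adj x 2 1 \<nu> \<and>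
    has_module_data adj x (mf.W k) 1 2 9 5 [1,1,1,2,2,2] (basis_II adj x \<nu>) matrix_II es_II"
proof -
  have t: "mtype k = 1" and k: "k < 10" using assms by (auto simp: mtype_def)
  have a: "adj_matrix adj *v v k 0 = EA adj x (Suc (mtype k)) 1 (v k 0)" by (rule A_seed) (use assms in auto)
  show ?thesis using seed[OF k] a data[OF k]
    by (intro exI[of _ "v k 0"]) (simp add: t numeral_2_eq_2 mults_def dims_def diams_def shapes_def basis_of_def
        matrices_def eigenvalues_def)
qed

lemma seed_III:
  assumes "k \<in> {3,4,5}" shows "\<exists>\<nu>. is_seed adj x ord (mf.W k) \<nu> (map of_int (snd (bases ! k ! 0)))
      \<and> adj_matrix adj *v \<nu> = EA adj x 3 1 \<nu> \<and>
    has_module_data adj x (mf.W k) 2 3 13 5 [1,2,3,3,3,1] (basis_III adj x \<nu>) matrix_III es_III"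
proof -
  have t: "mtype k = 2" and k: "k < 10" using assms by (auto simp: mtype_def)
  have a: "adj_matrix adj *v v k 0 = EA adj x (Suc (mtype k)) 1 (v k 0)" by (rule A_seed) (use assms in auto)
  show ?thesis using seed[OF k] a data[OF k]
    by (intro exI[of _ "v k 0"]) (simp add: t mults_def dims_def diams_def shapes_def basis_of_def matrices_def eigenvalues_def)
qed

lemma seed_IV:
  assumes "k \<in> {6,7,8}" shows "\<exists>\<nu>. is_seed adj x ord (mf.W k) \<nu> (map of_int (snd (bases ! k ! 0)))
      \<and> adj_matrix adj *v \<nu> = EA adj x 4 1 \<nu> \<and>
    has_module_data adj x (mf.W k) 3 3 11 4 [1,3,3,3,1] (basis_IV adj x \<nu>) matrix_IV es_IV"
proof -
  have t: "mtype k = 3" and k: "k < 10" using assms by (auto simp: mtype_def)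
  have a: "adj_matrix adj *v v k 0 = EA adj x (Suc (mtype k)) 1 (v k 0)" by (rule A_seed) (use assms in auto)
  show ?thesis using seed[OF k] a data[OF k]
    by (intro exI[of _ "v k 0"]) (simp add: t mults_def dims_def diams_def shapes_def basis_of_def matrices_def eigenvalues_def)
qed

lemma seed_V:
  "\<exists>\<nu>. is_seed adj x ord (mf.W 9) \<nu> (map of_int (snd (bases ! 9 ! 0))) \<and>
    has_module_data adj x (mf.W 9) 4 1 4 3 [1,1,1,1] (basis_V adj x \<nu>) matrix_V es_V"
proof -
  have t: "mtype 9 = 4" by (simp add: mtype_def)
  show ?thesis using seed[of 9] data[of 9]
    by (intro exI[of _ "v 9 0"]) (simp add: t mults_def dims_def diams_def shapes_def basis_of_def matrices_def eigenvalues_def)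
qed

lemma data_I: "has_module_data adj x (mf.W 0) 0 1 8 7 [1,1,1,1,1,1,1,1] (map (estar adj x) [0..<8]) matrix_I es_I"
proof -
  have t: "mtype 0 = 0" by (simp add: mtype_def)
  have "basis_of (mtype 0) adj x (v 0 0) = map (estar adj x) [0..<8]"
    unfolding basis_of_v[of 0, simplified] by (auto simp: t dims_def v_estar)
  then show ?thesis using data[of 0]
    by (simp add: t mults_def dims_def diams_def shapes_def matrices_def eigenvalues_def)
qed

lemma modules:
  "\<forall>i<10. \<forall>j<10. T_isomorphic adj x (map mf.W [0..<10] ! i) (map mf.W [0..<10] ! j) \<longleftrightarrow>
     [1::nat, 2, 2, 3, 3, 3, 4, 4, 4, 5] ! i = [1, 2, 2, 3, 3, 3, 4, 4, 4, 5] ! j"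
proof -
  have "[1::nat, 2, 2, 3, 3, 3, 4, 4, 4, 5] ! i = Suc (mtype i)" if "i < 10" for i
    using less_10[OF that] by (elim insertE emptyE) (simp_all add: mtype_def)
  then show ?thesis by (simp add: mf.iso_iff)
qed

lemma dim_terwilliger: "cmat.dim (terwilliger_algebra adj x) = 8^2 + 9^2 + 13^2 + 11^2 + 4^2"
  unfolding mf.dim_T by (simp add: dims_def eval_nat_numeral)

end

theorem mainTheorem12:
  fixes adj :: "'n::finite \<Rightarrow> 'n \<Rightarrow> bool" and x :: 'n
  assumes "is_biggs_smith adj"
  shows
    "(\<forall>\<theta>. vec.dim {v. adj_matrix adj *v v = \<theta> *s v} =
        count (image_mset complex_of_real
          (replicate_mset 1 3 + replicate_mset 9 ((1 + sqrt 17) / 2) + replicate_mset 18 2 +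
           replicate_mset 16 theta1 + replicate_mset 17 0 + replicate_mset 16 theta2 +
           replicate_mset 9 ((1 - sqrt 17) / 2) + replicate_mset 16 theta3)) \<theta>) \<and>
     {z::complex. z ^ 3 + 3 * z ^ 2 - 3 = 0} = complex_of_real ` {theta1, theta2, theta3} \<and>
     \<bar>theta1 - 0.879\<bar> \<le> 0.0005 \<and> \<bar>theta2 - (-1.347)\<bar> \<le> 0.0005 \<and> \<bar>theta3 - (-2.532)\<bar> \<le> 0.0005 \<and>
     (\<exists>ord W0 W1a W1b W2a W2b W2c W3a W3b W3c W4.
        vertex_ordering adj x ord \<and>
        (let Ws = [W0, W1a, W1b, W2a, W2b, W2c, W3a, W3b, W3c, W4];
             types = [1::nat, 2, 2, 3, 3, 3, 4, 4, 4, 5]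
         in orthogonal_decomposition adj x Ws \<and>
            (\<forall>i<10. \<forall>j<10. T_isomorphic adj x (Ws ! i) (Ws ! j) \<longleftrightarrow> types ! i = types ! j)) \<and>
        has_module_data adj x W0 0 1 8 7 [1,1,1,1,1,1,1,1]
          (map (estar adj x) [0..<8]) matrix_I
          [3, (1 + sqrt 17) / 2, 2, theta1, 0, theta2, (1 - sqrt 17) / 2, theta3] \<and>
        (\<forall>(W, coords) \<in> {(W1a, [1,-1,0]), (W1b, [1,1,-2])}.
           \<exists>\<nu>. is_seed adj x ord W \<nu> coords \<and>
             adj_matrix adj *v \<nu> = EA adj x 2 1 \<nu> \<and>
             has_module_data adj x W 1 2 9 5 [1,1,1,2,2,2] (basis_II adj x \<nu>) matrix_II
               [(1 + sqrt 17) / 2, 2, 2, theta1, 0, 0, theta2, (1 - sqrt 17) / 2, theta3]) \<and>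
        (\<forall>(W, coords) \<in> {(W2a, [1,-1,0,0,0,0]), (W2b, [0,0,1,-1,0,0]), (W2c, [0,0,0,0,1,-1])}.
           \<exists>\<nu>. is_seed adj x ord W \<nu> coords \<and>
             adj_matrix adj *v \<nu> = EA adj x 3 1 \<nu> \<and>
             has_module_data adj x W 2 3 13 5 [1,2,3,3,3,1] (basis_III adj x \<nu>) matrix_III
               [(1 + sqrt 17) / 2, 2, 2, 2, theta1, theta1, 0, 0, theta2, theta2,
                (1 - sqrt 17) / 2, theta3, theta3]) \<and>
        (\<forall>(W, coords) \<in> {(W3a, [2,-2,-2,2,2,-2,-2,2,0,0,0,0]),
                          (W3b, [1,-1,1,-1,-1,1,-1,1,2,-2,0,0]),
                          (W3c, [1,-1,1,-1,1,-1,1,-1,0,0,-2,2])}.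
           \<exists>\<nu>. is_seed adj x ord W \<nu> coords \<and>
             adj_matrix adj *v \<nu> = EA adj x 4 1 \<nu> \<and>
             has_module_data adj x W 3 3 11 4 [1,3,3,3,1] (basis_IV adj x \<nu>) matrix_IV
               [(1 + sqrt 17) / 2, 2, theta1, theta1, 0, 0, theta2, theta2,
                (1 - sqrt 17) / 2, theta3, theta3]) \<and>
        (\<exists>\<nu>. is_seed adj x ord W4 \<nu>
               [1,-1,-1,1,1,-1,1,-1,-1,1,-1,1,1,-1,-1,1,1,-1,-1,1,-1,1,-1,1] \<and>
             has_module_data adj x W4 4 1 4 3 [1,1,1,1] (basis_V adj x \<nu>) matrix_V
               [2, theta1, theta2, theta3])) \<and>
     cmat.dim (terwilliger_algebra adj x) = 8^2 + 9^2 + 13^2 + 11^2 + 4^2 \<and>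
     8^2 + 9^2 + 13^2 + 11^2 + 4^2 = (451::nat)"
proof -
  obtain vs where "bs_vertices adj x vs" using bs_vertices_exist[OF assms] .
  then interpret bs_vertices adj x vs .
  have Ws: "[mf.W 0, mf.W 1, mf.W 2, mf.W 3, mf.W 4, mf.W 5, mf.W 6, mf.W 7, mf.W 8, mf.W 9] = map mf.W [0..<10]"
  proof -
    have "[0..<10] = [0, 1, 2, 3, 4, 5, 6, 7, 8, 9]" by code_simp
    then show ?thesis by (simp only: list.map)
  qed
  note ball = ball_simps(5,7) case_prod_conv simp_thms
  have up: "[1..<10] = [1, 2, 3, 4, 5, 6, 7, 8, 9]" by code_simp
  have coords: "map (\<lambda>k. map complex_of_int (snd (bases ! k ! 0))) [1, 2, 3, 4, 5, 6, 7, 8, 9] =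
     [[1,-1,0], [1,1,-2], [1,-1,0,0,0,0], [0,0,1,-1,0,0], [0,0,0,0,1,-1],
      [2,-2,-2,2,2,-2,-2,2,0,0,0,0], [1,-1,1,-1,-1,1,-1,1,2,-2,0,0], [1,-1,1,-1,1,-1,1,-1,0,0,-2,2],
      [1,-1,-1,1,1,-1,1,-1,-1,1,-1,1,1,-1,-1,1,1,-1,-1,1,-1,1,-1,1]]"
    using seeds unfolding up .
  have c: "map complex_of_int (snd (bases ! 1 ! 0)) = [1,-1,0]" "map complex_of_int (snd (bases ! 2 ! 0)) = [1,1,-2]"
    "map complex_of_int (snd (bases ! 3 ! 0)) = [1,-1,0,0,0,0]" "map complex_of_int (snd (bases ! 4 ! 0)) = [0,0,1,-1,0,0]"
    "map complex_of_int (snd (bases ! 5 ! 0)) = [0,0,0,0,1,-1]"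
        "map complex_of_int (snd (bases ! 6 ! 0)) = [2,-2,-2,2,2,-2,-2,2,0,0,0,0]"
    "map complex_of_int (snd (bases ! 7 ! 0)) = [1,-1,1,-1,-1,1,-1,1,2,-2,0,0]"
    "map complex_of_int (snd (bases ! 8 ! 0)) = [1,-1,1,-1,1,-1,1,-1,0,0,-2,2]"
    "map complex_of_int (snd (bases ! 9 ! 0)) = [1,-1,-1,1,1,-1,1,-1,-1,1,-1,1,1,-1,-1,1,1,-1,-1,1,-1,1,-1,1]"
    using coords unfolding list.map list.inject by blast+
  note es = es_I_def es_II_def es_III_def es_IV_def es_V_def phi1_def phi2_def
  note II = seed_II[unfolded es] and III = seed_III[unfolded es] and IV = seed_IV[unfolded es]
  show ?thesis
    apply (intro conjI)
    subgoal unfolding spectrum[OF assms] by (simp add: es_A_def phi1_def phi2_def)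
    subgoal by (rule cubic_roots)
    subgoal by (rule theta1_approx)
    subgoal by (rule theta2_approx)
    subgoal by (rule theta3_approx)
    subgoal
      apply (rule exI[of _ ord])
      apply (rule exI[of _ "mf.W 0"], rule exI[of _ "mf.W 1"], rule exI[of _ "mf.W 2"], rule exI[of _ "mf.W 3"], rule
          exI[of _ "mf.W 4"])
      apply (rule exI[of _ "mf.W 5"], rule exI[of _ "mf.W 6"], rule exI[of _ "mf.W 7"], rule exI[of _ "mf.W 8"], rule
          exI[of _ "mf.W 9"])
      apply (intro conjI)
      subgoal by (rule vertex_ordering)
      subgoal unfolding Let_def Ws using mf.decomposition_W modules by (rule conjI)
      subgoal using data_I unfolding es .
      subgoal using II[of 1] II[of 2] unfolding c by (simp only: ball insertI1 insertI2 insert_iff)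
      subgoal using III[of 3] III[of 4] III[of 5] unfolding c by (simp only: ball insert_iff)
      subgoal using IV[of 6] IV[of 7] IV[of 8] unfolding c by (simp only: ball insert_iff)
      subgoal using seed_V unfolding es c .
      done
    subgoal by (rule dim_terwilliger)
    subgoal by simp
    done
qed

end
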